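(* There exist a set of primes $\pi$ with $2\notin\pi$, a finite $\pi$-separable group $G$, a normal subgroup $M$ of $G$, a character $\eta\in\mathrm{N}_{\pi}(G)$, and an irreducible constituent $\theta\in\mathrm{Irr}(M)$ of the restriction $\eta_M$ such that $\theta\notin\mathrm{N}_{\pi}(M)$.
   Context: All groups are finite, characters are complex, $\pi'$ is the set of primes not in $\pi$, and a $\pi$-number is a positive integer all of whose prime divisors lie in $\pi$. A finite group is $\pi$-separable if it has a normal series each of whose factors is a $\pi$-group or a $\pi'$-group; subgroups of $\pi$-separable groups are $\pi$-separable. For $H \le G$, a character $\theta\in\mathrm{Irr}(H)$ lies under $\chi\in\mathrm{Irr}(G)$ (and $\chi$ lies over $\theta$) if $\theta$ is a constituent of the restriction $\chi_H$; $\mathrm{Irr}(G\mid\theta)$ is the set of irreducible characters of $G$ lying over $\theta$. Let $G$ be $\pi$-separable. $\pi$-special: $\chi\in\mathrm{Irr}(G)$ is $\pi$-special if (a) $\chi(1)$ is a $\pi$-number and (b) whenever $S$ is subnormal in $G$ and $\theta\in\mathrm{Irr}(S)$ lies under $\chi$, the order of the linear character $\det(\theta)$ of $S$ is a $\pi$-number. $\pi'$-special is defined in the same way with $\pi'$ in place of $\pi$. $\pi$-factorable: $\chi\in\mathrm{Irr}(G)$ is $\pi$-factorable if $\chi=\alpha\beta$ with $\alpha\in\mathrm{Irr}(G)$ $\pi$-special and $\beta\in\mathrm{Irr}(G)$ $\pi'$-special. Normal nucleus and $\mathrm{N}_\pi(G)$: Let $\chi\in\mathrm{Irr}(G)$.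 Consider pairs $(N,\theta)$ with $N$ normal in $G$ and $\theta\in\mathrm{Irr}(N)$ a $\pi$-factorable character lying under $\chi$, ordered by $(N,\theta)\le(N_1,\theta_1)$ if $N\le N_1$ and $\theta$ lies under $\theta_1$. It is known (Navarro) that a maximal such pair is unique up to $G$-conjugacy. If $\chi$ is $\pi$-factorable, the normal nucleus of $\chi$ is $(G,\chi)$. Otherwise take a maximal pair $(N,\theta)$ (so $N<G$) and let $T=G_\theta$ be the stabilizer of $\theta$ in $G$; it is known that $T<G$. Let $\psi\in\mathrm{Irr}(T\mid\theta)$ be the Clifford correspondent of $\chi$, so $\psi^G=\chi$; the normal nucleus of $\chi$ is defined recursively as the normal nucleus of $\psi$ (in $T$). It is a pair $(U,\epsilon)$ with $\epsilon\in\mathrm{Irr}(U)$ $\pi$-factorable and $\epsilon^G=\chi$, unique up to $G$-conjugacy. $\mathrm{N}_\pi(G)$ is the set of $\chi\in\mathrm{Irr}(G)$ whose normal nucleus $(U,\epsilon)$ has $\epsilon$ $\pi$-special. $\mathrm{N}_\pi(M)$ is defined in the same way for the $\pi$-separable group $M$. *)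

theory Defs
  imports
    "HOL-Algebra.Coset"
    "HOL-Computational_Algebra.Primes"
    "Jordan_Normal_Form.Determinant"
    "Jordan_Normal_Form.VS_Connect"
begin

text \<open>A subgroup \<open>H\<close> of \<open>G\<close>, viewed as a group in its own right, is \<open>G\<lparr>carrier := H\<rparr>\<close>.
  Characters of \<open>G\<close> are total functions that vanish outside \<open>carrier G\<close>, so that equality
  of functions is equality of characters.\<close>

subsection \<open>Complex representations and characters\<close>

definition matrix_rep :: "('a, 'b) monoid_scheme \<Rightarrow> nat \<Rightarrow> ('a \<Rightarrow> complex mat) \<Rightarrow> bool" where
  "matrix_rep G n \<rho> \<longleftrightarrow>
     (\<forall>x\<in>carrier G. \<rho> x \<in> carrier_mat n n) \<and>
     (\<forall>x\<in>carrier G. \<forall>y\<in>carrier G. \<rho> (x \<otimes>\<^bsub>G\<^esub> y) = \<rho> x * \<rho> y) \<and>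
     \<rho> \<one>\<^bsub>G\<^esub> = 1\<^sub>m n"

definition irreducible_rep :: "('a, 'b) monoid_scheme \<Rightarrow> nat \<Rightarrow> ('a \<Rightarrow> complex mat) \<Rightarrow> bool" where
  "irreducible_rep G n \<rho> \<longleftrightarrow>
     matrix_rep G n \<rho> \<and> 0 < n \<and>
     (\<forall>W. subspace class_ring W (module_vec TYPE(complex) n) \<and>
          (\<forall>x\<in>carrier G. \<forall>w\<in>W. \<rho> x *\<^sub>v w \<in> W) \<longrightarrow>
          W = {0\<^sub>v n} \<or> W = carrier_vec n)"

definition mat_trace :: "complex mat \<Rightarrow> complex" where
  "mat_trace A = (\<Sum>i<dim_row A. A $$ (i, i))"

definition rep_char :: "('a, 'b) monoid_scheme \<Rightarrow> ('a \<Rightarrow> complex mat) \<Rightarrow> 'a \<Rightarrow> complex" where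
  "rep_char G \<rho> = (\<lambda>x. if x \<in> carrier G then mat_trace (\<rho> x) else 0)"

definition Irr :: "('a, 'b) monoid_scheme \<Rightarrow> ('a \<Rightarrow> complex) set" where
  "Irr G = {rep_char G \<rho> | n \<rho>. irreducible_rep G n \<rho>}"

text \<open>The degree \<open>n\<close> of the complementary summand may be \<open>0\<close>, in which case
  \<open>\<psi> = \<theta>\<close>.\<close>

definition irr_constituent ::
  "('a, 'b) monoid_scheme \<Rightarrow> ('a \<Rightarrow> complex) \<Rightarrow> ('a \<Rightarrow> complex) \<Rightarrow> bool" where
  "irr_constituent G \<theta> \<psi> \<longleftrightarrow>
     \<theta> \<in> Irr G \<and> (\<exists>n \<rho>. matrix_rep G n \<rho> \<and> \<psi> = (\<lambda>x. \<theta> x + rep_char G \<rho> x))"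

definition restrict_char :: "'a set \<Rightarrow> ('a \<Rightarrow> complex) \<Rightarrow> 'a \<Rightarrow> complex" where
  "restrict_char H \<chi> = (\<lambda>x. if x \<in> H then \<chi> x else 0)"

definition lies_under ::
  "('a, 'b) monoid_scheme \<Rightarrow> 'a set \<Rightarrow> ('a \<Rightarrow> complex) \<Rightarrow> ('a \<Rightarrow> complex) \<Rightarrow> bool" where
  "lies_under G H \<theta> \<chi> \<longleftrightarrow> irr_constituent (G\<lparr>carrier := H\<rparr>) \<theta> (restrict_char H \<chi>)"

definition induced_char ::
  "('a, 'b) monoid_scheme \<Rightarrow> 'a set \<Rightarrow> ('a \<Rightarrow> complex) \<Rightarrow> 'a \<Rightarrow> complex" where
  "induced_char G H \<psi> = (\<lambda>g. if g \<in> carrier G then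
     (\<Sum>x\<in>carrier G.
        if x \<otimes>\<^bsub>G\<^esub> g \<otimes>\<^bsub>G\<^esub> inv\<^bsub>G\<^esub> x \<in> H then \<psi> (x \<otimes>\<^bsub>G\<^esub> g \<otimes>\<^bsub>G\<^esub> inv\<^bsub>G\<^esub> x) else 0)
       / of_nat (card H)
     else 0)"

definition char_stabilizer ::
  "('a, 'b) monoid_scheme \<Rightarrow> 'a set \<Rightarrow> ('a \<Rightarrow> complex) \<Rightarrow> 'a set" where
  "char_stabilizer G N \<theta> =
     {g \<in> carrier G. \<forall>x\<in>N. \<theta> (g \<otimes>\<^bsub>G\<^esub> x \<otimes>\<^bsub>G\<^esub> inv\<^bsub>G\<^esub> g) = \<theta> x}"

text \<open>Over the complex numbers a representation of a finite group is determined up to similarity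
  by its character, so the choice of \<open>\<rho>\<close> does not affect the determinant.\<close>

definition det_char :: "('a, 'b) monoid_scheme \<Rightarrow> ('a \<Rightarrow> complex) \<Rightarrow> 'a \<Rightarrow> complex" where
  "det_char G \<theta> =
     (let \<rho> = (SOME \<rho>. \<exists>n. matrix_rep G n \<rho> \<and> rep_char G \<rho> = \<theta>)
      in (\<lambda>x. if x \<in> carrier G then det (\<rho> x) else 0))"

definition linear_char_order :: "('a, 'b) monoid_scheme \<Rightarrow> ('a \<Rightarrow> complex) \<Rightarrow> nat" where
  "linear_char_order G \<mu> = (LEAST k. 0 < k \<and> (\<forall>x\<in>carrier G. \<mu> x ^ k = 1))"

subsection \<open>\<open>\<pi>\<close>-separable groups\<close>

definition pi_compl :: "nat set \<Rightarrow> nat set" where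
  "pi_compl \<pi> = {p. Factorial_Ring.prime p} - \<pi>"

definition pi_number :: "nat set \<Rightarrow> nat \<Rightarrow> bool" where
  "pi_number \<pi> n \<longleftrightarrow> 0 < n \<and> (\<forall>p. Factorial_Ring.prime p \<and> p dvd n \<longrightarrow> p \<in> \<pi>)"

text \<open>The order of an infinite group is \<open>0\<close>, which is not a \<open>\<pi>\<close>-number.\<close>

definition pi_group :: "nat set \<Rightarrow> ('a, 'b) monoid_scheme \<Rightarrow> bool" where
  "pi_group \<pi> G \<longleftrightarrow> group G \<and> pi_number \<pi> (Coset.order G)"

definition pi_separable :: "nat set \<Rightarrow> ('a, 'b) monoid_scheme \<Rightarrow> bool" where
  "pi_separable \<pi> G \<longleftrightarrow>
     (\<exists>(N :: nat \<Rightarrow> 'a set) k.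
        N 0 = {\<one>\<^bsub>G\<^esub>} \<and> N k = carrier G \<and>
        (\<forall>i\<le>k. N i \<lhd> G) \<and>
        (\<forall>i<k. N i \<subseteq> N (Suc i) \<and>
           (pi_group \<pi> (G\<lparr>carrier := N (Suc i)\<rparr> Mod N i) \<or>
            pi_group (pi_compl \<pi>) (G\<lparr>carrier := N (Suc i)\<rparr> Mod N i))))"

text \<open>\<open>subnormal G S\<close>: the subgroup \<open>S\<close> is subnormal in \<open>G\<close>.\<close>

inductive subnormal :: "('a, 'b) monoid_scheme \<Rightarrow> 'a set \<Rightarrow> bool" for G where
  whole: "subnormal G (carrier G)"
| step: "subnormal G S \<Longrightarrow> R \<lhd> G\<lparr>carrier := S\<rparr> \<Longrightarrow> subnormal G R"

subsection \<open>Special and factorable characters\<close>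

definition pi_special :: "nat set \<Rightarrow> ('a, 'b) monoid_scheme \<Rightarrow> ('a \<Rightarrow> complex) \<Rightarrow> bool" where
  "pi_special \<pi> G \<chi> \<longleftrightarrow>
     \<chi> \<in> Irr G \<and>
     (\<exists>d. \<chi> \<one>\<^bsub>G\<^esub> = of_nat d \<and> pi_number \<pi> d) \<and>
     (\<forall>S \<theta>. subnormal G S \<and> lies_under G S \<theta> \<chi> \<longrightarrow>
        pi_number \<pi> (linear_char_order (G\<lparr>carrier := S\<rparr>) (det_char (G\<lparr>carrier := S\<rparr>) \<theta>)))"

definition pi_factorable :: "nat set \<Rightarrow> ('a, 'b) monoid_scheme \<Rightarrow> ('a \<Rightarrow> complex) \<Rightarrow> bool" where
  "pi_factorable \<pi> G \<chi> \<longleftrightarrow>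
     \<chi> \<in> Irr G \<and>
     (\<exists>\<alpha> \<beta>. pi_special \<pi> G \<alpha> \<and> pi_special (pi_compl \<pi>) G \<beta> \<and> \<chi> = (\<lambda>x. \<alpha> x * \<beta> x))"

subsection \<open>The normal nucleus\<close>

definition factorable_pair ::
  "nat set \<Rightarrow> ('a, 'b) monoid_scheme \<Rightarrow> ('a \<Rightarrow> complex) \<Rightarrow> 'a set \<Rightarrow> ('a \<Rightarrow> complex) \<Rightarrow> bool" where
  "factorable_pair \<pi> G \<chi> N \<theta> \<longleftrightarrow>
     N \<lhd> G \<and> pi_factorable \<pi> (G\<lparr>carrier := N\<rparr>) \<theta> \<and> lies_under G N \<theta> \<chi>"

definition maximal_pair ::
  "nat set \<Rightarrow> ('a, 'b) monoid_scheme \<Rightarrow> ('a \<Rightarrow> complex) \<Rightarrow> 'a set \<Rightarrow> ('a \<Rightarrow> complex) \<Rightarrow> bool" where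
  "maximal_pair \<pi> G \<chi> N \<theta> \<longleftrightarrow>
     factorable_pair \<pi> G \<chi> N \<theta> \<and>
     (\<forall>N1 \<theta>1. factorable_pair \<pi> G \<chi> N1 \<theta>1 \<and> N \<subseteq> N1 \<and> lies_under (G\<lparr>carrier := N1\<rparr>) N \<theta> \<theta>1 \<longrightarrow>
        N1 = N \<and> \<theta>1 = \<theta>)"

text \<open>\<open>normal_nucleus \<pi> G \<chi> U \<epsilon>\<close> says that \<open>(U, \<epsilon>)\<close> is a normal nucleus of \<open>\<chi>\<close>. The pair depends
  on the choice of maximal pairs and is unique only up to \<open>G\<close>-conjugacy, hence a relation.\<close>

inductive normal_nucleus ::
  "nat set \<Rightarrow> ('a, 'b) monoid_scheme \<Rightarrow> ('a \<Rightarrow> complex) \<Rightarrow> 'a set \<Rightarrow> ('a \<Rightarrow> complex) \<Rightarrow> bool"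
  for \<pi> where
  factorable: "pi_factorable \<pi> G \<chi> \<Longrightarrow> normal_nucleus \<pi> G \<chi> (carrier G) \<chi>"
| clifford: "\<lbrakk> \<chi> \<in> Irr G; \<not> pi_factorable \<pi> G \<chi>;
     maximal_pair \<pi> G \<chi> N \<theta>; T = char_stabilizer G N \<theta>;
     \<psi> \<in> Irr (G\<lparr>carrier := T\<rparr>); lies_under (G\<lparr>carrier := T\<rparr>) N \<theta> \<psi>; induced_char G T \<psi> = \<chi>;
     normal_nucleus \<pi> (G\<lparr>carrier := T\<rparr>) \<psi> U \<epsilon> \<rbrakk>
   \<Longrightarrow> normal_nucleus \<pi> G \<chi> U \<epsilon>"

text \<open>Being \<open>\<pi>\<close>-special is invariant under conjugation, so it does not matter which normal
  nucleus of \<open>\<chi>\<close> is considered.\<close>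

definition N_pi :: "nat set \<Rightarrow> ('a, 'b) monoid_scheme \<Rightarrow> ('a \<Rightarrow> complex) set" where
  "N_pi \<pi> G = {\<chi> \<in> Irr G.
     \<exists>U \<epsilon>. normal_nucleus \<pi> G \<chi> U \<epsilon> \<and> pi_special \<pi> (G\<lparr>carrier := U\<rparr>) \<epsilon>}"

end

theory Submission
  imports Defs "Jordan_Normal_Form.Schur_Decomposition" "HOL-Algebra.Multiplicative_Group" "HOL-Library.FuncSet"
begin

text \<open>Let \<open>\<pi>\<close> be the set of odd primes. A symmetric group \<open>S\<^sub>3\<close> acting on the three cosets of a
  subgroup of order \<open>2\<close> has odd permutations, so a linear character \<open>\<mu>\<close> of odd order, induced
  along such an action, yields a character of degree \<open>3\<close> whose determinant has even order: it is
  a \<open>\<pi>\<close>-special character times the sign character, hence factorable but not \<open>\<pi>\<close>-special.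

  Take \<open>A = S\<^sub>4 wr C\<^sub>2\<close>, the subgroup \<open>S = D\<^sub>8 \<times> 1\<close> of \<open>S\<^sub>4 \<times> 1\<close>, and \<open>G = C\<^sub>3 wr A\<close>, the regular
  wreath product with base group \<open>N\<close>. The indicator function of \<open>S\<close> gives a linear character \<open>\<nu>\<close> of
  \<open>N\<close> with stabilizer \<open>T = N S\<close>; let \<open>\<mu>\<close> be its extension to \<open>T\<close> of order \<open>3\<close>. In \<open>G\<close> every normal
  subgroup properly containing \<open>N\<close> contains an involution moving \<open>\<nu>\<close> that lies in a normal
  subgroup abelian modulo \<open>N\<close>, which rules out factorable characters over \<open>\<nu>\<close>. Hence \<open>(N, \<nu>)\<close> is
  maximal for \<open>\<eta> = \<mu>\<^sup>G\<close>, whose nucleus is \<open>(T, \<mu>)\<close>. In the normal subgroup \<open>M = N (S\<^sub>4 \<times> S\<^sub>4)\<close>,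
  however, \<open>R = N (S\<^sub>4 \<times> 1)\<close> is normal, and \<open>\<mu>\<^sup>R\<close> is factorable but not \<open>\<pi>\<close>-special; its conjugates
  give the nuclei of \<open>\<theta> = \<mu>\<^sup>M\<close>.\<close>

section \<open>Complex matrices of finite order\<close>

text \<open>Why the moving involution obstructs: on the subnormal subgroup generated by
  \<open>N\<close> and \<open>e\<close> the character \<open>\<nu>\<close> of order 3 induces to
  degree 2 with determinant of even order, so no odd-special character lies over
  \<open>\<nu>\<close>; the 2-special factor is constant on \<open>N\<close> and cannot help. The
  obstruction needs a subgroup of even order as the smallest thing above \<open>N\<close>. Hence
  degree 4, where every nontrivial element has a nontrivial commutator in the Klein group; in degree
  3 one would meet the subgroup of order 3, which obstructs nothing. The asymmetry between
  \<open>G\<close> and \<open>M\<close> is this: the first Klein factor fixes \<open>\<nu>\<close>,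
  the second moves it. The swap in \<open>G\<close> forces a normal subgroup above \<open>N\<close>
  to reach the second factor, while in \<open>M\<close> a normal subgroup can stay inside the first.
  Two obstacles shape the rest. Determinants are defined through a chosen representation, so they
  are recovered from character values, usually at ninth powers: 9 is odd and removes everything of
  3-power order. And to exclude \<open>\<theta>\<close>, every choice of maximal pair has to be
  treated, so all maximal pairs of \<open>\<theta>\<close> are determined.\<close>

lemma subspace_vec_iff:
  "VectorSpace.subspace class_ring W (module_vec TYPE(complex) n) \<longleftrightarrow>
     W \<subseteq> carrier_vec n \<and> 0\<^sub>v n \<in> W \<and> (\<forall>v\<in>W. \<forall>w\<in>W. v + w \<in> W) \<and> (\<forall>c. \<forall>v\<in>W. c \<cdot>\<^sub>v v \<in> W)"
proof -
  interpret vs: vec_space "TYPE(complex)" n .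
  have md: "Module.module class_ring (module_vec TYPE(complex) n)" by unfold_locales
  have vs: "vectorspace class_ring (module_vec TYPE(complex) n)" by unfold_locales
  show ?thesis
    unfolding VectorSpace.subspace_def submodule_def
    using md vs by (auto simp: module_vec_simps class_ring_simps)
qed

lemma mat_trace_mult:
  assumes "A \<in> carrier_mat n m" "B \<in> carrier_mat m n"
  shows "mat_trace (A * B) = (\<Sum>i<n. \<Sum>j<m. A $$ (i,j) * B $$ (j,i))"
  using assms by (auto simp: mat_trace_def scalar_prod_def atLeast0LessThan intro!: sum.cong)

lemma mat_trace_comm:
  assumes "A \<in> carrier_mat n m" "B \<in> carrier_mat m n"
  shows "mat_trace (A * B) = mat_trace (B * A)"
  unfolding mat_trace_mult[OF assms] mat_trace_mult[OF assms(2,1)]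
  by (subst sum.swap) (auto intro!: sum.cong simp: mult.commute)

lemma mat_trace_one [simp]: "mat_trace (1\<^sub>m n) = of_nat n"
  by (simp add: mat_trace_def)

lemma mat_trace_conj:
  assumes "A \<in> carrier_mat n n" "P \<in> carrier_mat n n" "Q \<in> carrier_mat n n" "P * Q = 1\<^sub>m n"
  shows "mat_trace (Q * A * P) = mat_trace A"
proof -
  have "mat_trace (Q * A * P) = mat_trace (P * (Q * A))"
    using assms by (intro mat_trace_comm) auto
  also have "P * (Q * A) = A" using assms by (simp flip: assoc_mult_mat)
  finally show ?thesis .
qed

text \<open>Iterated exchange, with Cramer's rule for \<open>replace_col\<close> keeping the matrix invertible.\<close>

lemma subspace_adapted_basis:
  assumes W: "VectorSpace.subspace class_ring W (module_vec TYPE(complex) n)"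
  obtains P Q J where "P \<in> carrier_mat n n" "Q \<in> carrier_mat n n" "P * Q = 1\<^sub>m n" "Q * P = 1\<^sub>m n"
    "J \<subseteq> {..<n}" "\<And>y. y \<in> carrier_vec n \<Longrightarrow> P *\<^sub>v y \<in> W \<longleftrightarrow> (\<forall>i<n. i \<notin> J \<longrightarrow> y $ i = 0)"
proof -
  let ?ok = "\<lambda>P J. P \<in> carrier_mat n n \<and> det P \<noteq> 0 \<and> J \<subseteq> {..<n} \<and> (\<forall>j\<in>J. col P j \<in> W)"
  \<comment> \<open>The exchange is run once, from a pair with \<open>J\<close> as large as
    possible: a nonzero coordinate \<open>y $ i\<close> with \<open>i\<close> outside
    \<open>J\<close> would allow column \<open>i\<close> to be replaced by
    \<open>P *\<^sub>v y\<close>, which only multiplies the determinant by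
    \<open>y $ i\<close>.\<close>
  define S where "S = {card J | P J. ?ok P J}"
  have W': "W \<subseteq> carrier_vec n" "0\<^sub>v n \<in> W" "\<And>v w. v \<in> W \<Longrightarrow> w \<in> W \<Longrightarrow> v + w \<in> W"
    "\<And>c v. v \<in> W \<Longrightarrow> c \<cdot>\<^sub>v v \<in> W"
    using W unfolding subspace_vec_iff by auto
  have "?ok (1\<^sub>m n) {}" by simp
  hence ne: "S \<noteq> {}" unfolding S_def by blast
  have "S \<subseteq> {..n}" unfolding S_def using card_mono[of "{..<n}"] by auto
  hence fin: "finite S" using finite_subset by blast
  from Max_in[OF fin ne] obtain P J where P: "?ok P J" and max: "card J = Max S"
    unfolding S_def by auto
  have finJ: "finite J" using P finite_subset by blast
  from P obtain Q where Q: "Q \<in> carrier_mat n n" "P * Q = 1\<^sub>m n" "Q * P = 1\<^sub>m n"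
    using det_non_zero_imp_unit[of P n] by (auto simp: Units_def ring_mat_def)
  show thesis
  proof (rule that[of P Q J])
    fix y :: "complex vec" assume y: "y \<in> carrier_vec n"
    show "P *\<^sub>v y \<in> W \<longleftrightarrow> (\<forall>i<n. i \<notin> J \<longrightarrow> y $ i = 0)"
    proof
      assume w: "P *\<^sub>v y \<in> W"
      show "\<forall>i<n. i \<notin> J \<longrightarrow> y $ i = 0"
      proof (rule ccontr)
        assume "\<not> ?thesis"
        then obtain i where i: "i < n" "i \<notin> J" "y $ i \<noteq> 0" by auto
        let ?P = "replace_col P (P *\<^sub>v y) i"
        have "det ?P \<noteq> 0" using cramer_lemma_mat[of P n y i] P y i by auto
        moreover have "col ?P j \<in> W" if "j \<in> insert i J" for j
        proof (cases "j = i")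
          case True
          have "col ?P i = P *\<^sub>v y" using P i y
            by (intro eq_vecI) (auto simp: replace_col_def)
          thus ?thesis using w True by simp
        next
          case False
          hence "j \<in> J" "j < n" using that P by auto
          moreover have "col ?P j = col P j" using P i y \<open>j < n\<close> False
            by (intro eq_vecI) (auto simp: replace_col_def)
          ultimately show ?thesis using P by auto
        qed
        moreover have "?P \<in> carrier_mat n n" using P by (auto simp: replace_col_def)
        ultimately have "?ok ?P (insert i J)" using i P by auto
        hence "card (insert i J) \<in> S" unfolding S_def by blast
        hence "card (insert i J) \<le> card J" unfolding max using fin by simp
        thus False using i finJ by simp
      qed
    next
      assume z: "\<forall>i<n. i \<notin> J \<longrightarrow> y $ i = 0"
      have part: "vec n (\<lambda>i. \<Sum>j\<in>K. P $$ (i,j) * y $ j) \<in> W" if "K \<subseteq> J" for K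
        using finite_subset[OF that finJ] that
      proof (induction K rule: finite_induct)
        case empty
        have "vec n (\<lambda>i. \<Sum>j\<in>{}. P $$ (i,j) * y $ j) = 0\<^sub>v n" by auto
        thus ?case using W' by simp
      next
        case (insert k K)
        have "k < n" using insert P by auto
        have "vec n (\<lambda>i. \<Sum>j\<in>insert k K. P $$ (i,j) * y $ j)
          = y $ k \<cdot>\<^sub>v col P k + vec n (\<lambda>i. \<Sum>j\<in>K. P $$ (i,j) * y $ j)"
          using insert P \<open>k < n\<close> by (intro eq_vecI) auto
        moreover have "col P k \<in> W" using insert P by auto
        ultimately show ?case using W' insert by auto
      qed
      have "P *\<^sub>v y = vec n (\<lambda>i. \<Sum>j\<in>J. P $$ (i,j) * y $ j)"
      proof (intro eq_vecI)
        fix i assume "i < dim_vec (vec n (\<lambda>i. \<Sum>j\<in>J. P $$ (i,j) * y $ j))"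
        hence i: "i < n" by simp
        have "(P *\<^sub>v y) $ i = (\<Sum>j<n. P $$ (i,j) * y $ j)"
          using P y i by (auto simp: scalar_prod_def atLeast0LessThan intro!: sum.cong)
        also have "\<dots> = (\<Sum>j\<in>J. P $$ (i,j) * y $ j)"
          using P z by (intro sum.mono_neutral_right) auto
        finally show "(P *\<^sub>v y) $ i = vec n (\<lambda>i. \<Sum>j\<in>J. P $$ (i,j) * y $ j) $ i" using i by simp
      qed (use P in auto)
      thus "P *\<^sub>v y \<in> W" using part[of J] by simp
    qed
  qed (use P Q in auto)
qed

section \<open>Determinants of matrices of finite order from traces\<close>

lemma upper_triangular_square_diag:
  fixes B :: "complex mat"
  assumes "upper_triangular B" "B \<in> carrier_mat n n" "i < n"
  shows "(B * B) $$ (i,i) = (B $$ (i,i))\<^sup>2"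
proof -
  have "(B * B) $$ (i,i) = (\<Sum>k<n. B $$ (i,k) * B $$ (k,i))"
    using assms by (auto simp: scalar_prod_def atLeast0LessThan intro!: sum.cong)
  also have "\<dots> = (\<Sum>k\<in>{i}. B $$ (i,k) * B $$ (k,i))"
  proof (intro sum.mono_neutral_right)
    show "\<forall>k\<in>{..<n} - {i}. B $$ (i,k) * B $$ (k,i) = 0"
    proof
      fix k assume "k \<in> {..<n} - {i}"
      hence "k < i \<or> i < k" "k < n" by auto
      thus "B $$ (i,k) * B $$ (k,i) = 0"
        using upper_triangularD[OF assms(1)] assms by auto
    qed
  qed (use assms in auto)
  finally show ?thesis by (simp add: power2_eq_square)
qed

text \<open>A triangular Schur form is enough: squaring a triangular matrix squares its diagonal, so
  one list of eigenvalues serves both traces and the determinant. This is the bridge from character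
  values at \<open>x\<close> and at its square to the determinant at \<open>x\<close>.\<close>

lemma finite_order_mat_eigenvalues:
  assumes A: "(A :: complex mat) \<in> carrier_mat n n" and m: "m > 0" "A ^\<^sub>m m = 1\<^sub>m n"
  obtains d :: "nat \<Rightarrow> complex" where "\<And>i. i < n \<Longrightarrow> d i ^ m = 1"
    "mat_trace A = (\<Sum>i<n. d i)" "mat_trace (A * A) = (\<Sum>i<n. (d i)\<^sup>2)" "det A = (\<Prod>i<n. d i)"
proof -
  from char_poly_factorized[OF A] obtain es
    where es: "char_poly A = (\<Prod>a\<leftarrow>es. [:- a, 1:])" "length es = n" by auto
  obtain B P Q where "schur_decomposition A es = (B,P,Q)" by (cases "schur_decomposition A es") auto
  from schur_decomposition[OF A es(1) this]
  have sim: "similar_mat_wit A B P Q" and ut: "upper_triangular B" and dg: "diag_mat B = es" by auto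
  from sim A have car: "B \<in> carrier_mat n n" "P \<in> carrier_mat n n" "Q \<in> carrier_mat n n"
    and inv: "P * Q = 1\<^sub>m n" "Q * P = 1\<^sub>m n" and AB: "A = P * B * Q"
    unfolding similar_mat_wit_def Let_def by auto
  define d where "d = (\<lambda>i. B $$ (i,i))"
  have AA: "A * A = P * (B * B) * Q"
  proof -
    have "A * A = P * (B * ((Q * P) * (B * Q)))"
      unfolding AB using car by (simp add: assoc_mult_mat[of _ n n _ n _ n])
    also have "\<dots> = P * (B * B) * Q"
      unfolding inv using car by (simp add: assoc_mult_mat[of _ n n _ n _ n])
    finally show ?thesis .
  qed
  show thesis
  proof (rule that[of d])
    fix i assume i: "i < n"
    have "d i = es ! i" using i car dg[symmetric] unfolding d_def by (simp add: diag_mat_def)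
    hence "d i \<in> set es" using i es(2) by simp
    hence "poly (char_poly A) (d i) = 0" unfolding es(1) poly_prod_list by (auto simp: prod_list_zero_iff)
    hence "eigenvalue A (d i)" using eigenvalue_root_char_poly[OF A] by simp
    then obtain v where v: "v \<in> carrier_vec n" "v \<noteq> 0\<^sub>v n" "A *\<^sub>v v = d i \<cdot>\<^sub>v v"
      unfolding eigenvalue_def eigenvector_def using A by auto
    have "(A ^\<^sub>m k) *\<^sub>v v = d i ^ k \<cdot>\<^sub>v v" for k
    proof (induction k)
      case (Suc k)
      have "(A ^\<^sub>m Suc k) *\<^sub>v v = (A ^\<^sub>m k) *\<^sub>v (A *\<^sub>v v)" using A v by (simp add: assoc_mult_mat_vec[of _ n n])
      also have "\<dots> = d i \<cdot>\<^sub>v ((A ^\<^sub>m k) *\<^sub>v v)" using v A by (simp add: mult_mat_vec[of _ n n])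
      finally show ?case using Suc by (simp add: smult_smult_assoc)
    qed (use A v in auto)
    from this[of m] have "v = d i ^ m \<cdot>\<^sub>v v" using m v by simp
    moreover from v obtain k where k: "k < n" "v $ k \<noteq> 0" by (auto simp: vec_eq_iff)
    ultimately have "v $ k = d i ^ m * v $ k" using v by (metis carrier_vecD index_smult_vec(1))
    thus "d i ^ m = 1" using k by simp
  next
    have "mat_trace (P * B * Q) = mat_trace B" using mat_trace_conj[of B n Q P] car inv by simp
    thus "mat_trace A = (\<Sum>i<n. d i)" using AB car by (simp add: mat_trace_def d_def)
  next
    have "mat_trace (P * (B * B) * Q) = mat_trace (B * B)"
      using mat_trace_conj[of "B * B" n Q P] car inv by simp
    thus "mat_trace (A * A) = (\<Sum>i<n. (d i)\<^sup>2)" unfolding AA using car upper_triangular_square_diag[OF ut car(1)]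
      by (simp add: mat_trace_def d_def)
  next
    have "det A = det B" using det_similar[of A B] sim unfolding similar_mat_def by blast
    also have "\<dots> = prod_list (diag_mat B)" using det_upper_triangular[OF ut car(1)] .
    also have "\<dots> = (\<Prod>i<n. d i)" unfolding diag_mat_def d_def using car
      by (simp add: prod.list_conv_set_nth atLeast0LessThan)
    finally show "det A = (\<Prod>i<n. d i)" .
  qed
qed

lemma root_of_unity_norm: "(z::complex) ^ m = 1 \<Longrightarrow> m > 0 \<Longrightarrow> norm z = 1"
  by (metis norm_one norm_power power_eq_1_iff zero_less_norm_iff norm_ge_zero not_gr_zero)

text \<open>A complex number of norm 1 has real part at most 1, with equality only at 1 itself.
  Hence a representing matrix whose trace reaches the degree has all eigenvalues 1.\<close>

lemma Re_sum_roots_of_unity: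
  fixes d :: "nat \<Rightarrow> complex"
  assumes "m > 0" "\<And>i. i < n \<Longrightarrow> d i ^ m = 1"
  shows "Re (\<Sum>i<n. d i) \<le> n"
    and "Re (\<Sum>i<n. d i) = n \<Longrightarrow> i < n \<Longrightarrow> d i = 1"
proof -
  have nm: "norm (d i) = 1" if "i < n" for i using root_of_unity_norm assms that by blast
  have le: "Re (d i) \<le> 1" if "i < n" for i using complex_Re_le_cmod[of "d i"] nm[OF that] by simp
  show "Re (\<Sum>i<n. d i) \<le> n" unfolding Re_sum using sum_mono[of "{..<n}" "\<lambda>i. Re (d i)" "\<lambda>_. 1"] le by simp
  assume eq: "Re (\<Sum>i<n. d i) = n" and i: "i < n"
  have "(\<Sum>i<n. 1 - Re (d i)) = 0" using eq by (simp add: sum_subtractf)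
  hence "1 - Re (d i) = 0" using le i by (subst (asm) sum_nonneg_eq_0_iff) auto
  hence "Re (d i) = 1" by simp
  moreover have "(Re (d i))\<^sup>2 + (Im (d i))\<^sup>2 = 1" using nm[OF i] by (simp add: cmod_def)
  ultimately show "d i = 1" by (simp add: complex_eq_iff)
qed

lemma mat_trace_Re_le:
  assumes A: "A \<in> carrier_mat n n" and m: "m > 0" "A ^\<^sub>m m = 1\<^sub>m n"
  shows "Re (mat_trace A) \<le> n"
  using finite_order_mat_eigenvalues[OF A m] Re_sum_roots_of_unity(1)[OF m(1)] by metis

lemma det_eq_one_if_trace_maximal:
  assumes A: "A \<in> carrier_mat n n" and m: "m > 0" "A ^\<^sub>m m = 1\<^sub>m n" and t: "Re (mat_trace A) = n"
  shows "det A = 1"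
proof -
  obtain d where d: "\<And>i. i < n \<Longrightarrow> d i ^ m = 1"
    "mat_trace A = (\<Sum>i<n. d i)" "mat_trace (A * A) = (\<Sum>i<n. (d i)\<^sup>2)" "det A = (\<Prod>i<n. d i)"
    using finite_order_mat_eigenvalues[OF A m] by metis
  have "d i = 1" if "i < n" for i using Re_sum_roots_of_unity(2)[OF m(1) d(1)] t d(2) that by simp
  thus ?thesis using d(4) by simp
qed

text \<open>The number \<open>k\<close> counts the entries equal to \<open>- 1\<close>; the sum
  determines it, and with it the product.\<close>

lemma prod_signs:
  fixes d :: "nat \<Rightarrow> complex"
  assumes "\<And>i. i < n \<Longrightarrow> (d i)\<^sup>2 = 1"
  shows "\<exists>k\<le>n. (\<Sum>i<n. d i) = of_nat n - 2 * of_nat k \<and> (\<Prod>i<n. d i) = (- 1) ^ k"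
  using assms
proof (induction n)
  case (Suc n)
  from Suc obtain k where k: "k \<le> n" "(\<Sum>i<n. d i) = of_nat n - 2 * of_nat k" "(\<Prod>i<n. d i) = (- 1) ^ k"
    by auto
  have "d n = 1 \<or> d n = - 1" using Suc.prems[of n] by (simp add: power2_eq_1_iff)
  thus ?case
  proof
    assume "d n = 1" thus ?thesis using k by (intro exI[of _ k]) auto
  next
    assume "d n = - 1" thus ?thesis using k by (intro exI[of _ "Suc k"]) auto
  qed
qed auto

text \<open>The trace of \<open>A * A\<close> is maximal, which makes every eigenvalue a sign; the
  trace of \<open>A\<close> then counts the signs \<open>- 1\<close>. Only traces enter, so the
  lemma applies to any representation affording a given character.\<close>

lemma det_of_trace_involution:
  assumes A: "A \<in> carrier_mat n n" and m: "m > 0" "A ^\<^sub>m m = 1\<^sub>m n"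
    and t2: "mat_trace (A * A) = of_nat n" and t: "mat_trace A = of_nat n - 2 * of_nat k"
  shows "det A = (- 1) ^ k"
proof -
  obtain d where d: "\<And>i. i < n \<Longrightarrow> d i ^ m = 1"
    "mat_trace A = (\<Sum>i<n. d i)" "mat_trace (A * A) = (\<Sum>i<n. (d i)\<^sup>2)" "det A = (\<Prod>i<n. d i)"
    using finite_order_mat_eigenvalues[OF A m] by metis
  have "((d i)\<^sup>2) ^ m = 1" if "i < n" for i using d(1)[OF that] by (metis power_mult mult.commute power_one)
  moreover have "Re (\<Sum>i<n. (d i)\<^sup>2) = n" using t2 d(3) by (simp del: Re_sum)
  ultimately have "(d i)\<^sup>2 = 1" if "i < n" for i
    using Re_sum_roots_of_unity(2)[OF m(1), of n "\<lambda>i. (d i)\<^sup>2" i] that by blast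
  from prod_signs[of n d, OF this] obtain l where
    l: "(\<Sum>i<n. d i) = of_nat n - 2 * of_nat l" "(\<Prod>i<n. d i) = (- 1) ^ l" by auto
  have "(of_nat k :: complex) = of_nat l" using l(1) t d(2) by simp
  hence "k = l" by simp
  thus ?thesis using l d by simp
qed

section \<open>Characters and their irreducible constituents\<close>

definition Char :: "('a, 'b) monoid_scheme \<Rightarrow> ('a \<Rightarrow> complex) set" where
  "Char G = {rep_char G \<rho> | n \<rho>. matrix_rep G n \<rho>}"

text \<open>Conjugation is replaced by inversion of the argument, which makes the form bilinear.\<close>

definition char_ip :: "('a, 'b) monoid_scheme \<Rightarrow> ('a \<Rightarrow> complex) \<Rightarrow> ('a \<Rightarrow> complex) \<Rightarrow> complex" where
  "char_ip G \<chi> \<psi> = (\<Sum>g\<in>carrier G. \<chi> (inv\<^bsub>G\<^esub> g) * \<psi> g) / of_nat (card (carrier G))"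

text \<open>The dimensions are explicit because the sum must have a definite shape even over an
  empty index set.\<close>

definition mat_sum :: "nat \<Rightarrow> nat \<Rightarrow> ('i \<Rightarrow> complex mat) \<Rightarrow> 'i set \<Rightarrow> complex mat" where
  "mat_sum n m f S = mat n m (\<lambda>ij. \<Sum>s\<in>S. f s $$ ij)"

lemma mat_sum_carrier [simp]: "mat_sum n m f S \<in> carrier_mat n m"
  by (simp add: mat_sum_def)

lemma mat_sum_index [simp]: "i < n \<Longrightarrow> j < m \<Longrightarrow> mat_sum n m f S $$ (i,j) = (\<Sum>s\<in>S. f s $$ (i,j))"
  by (simp add: mat_sum_def)

lemma mult_mat_sum:
  assumes "A \<in> carrier_mat k n" "\<And>s. s \<in> S \<Longrightarrow> f s \<in> carrier_mat n m"
  shows "A * mat_sum n m f S = mat_sum k m (\<lambda>s. A * f s) S"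
proof (rule eq_matI)
  fix i j assume "i < dim_row (mat_sum k m (\<lambda>s. A * f s) S)" "j < dim_col (mat_sum k m (\<lambda>s. A * f s) S)"
  hence ij: "i < k" "j < m" by (auto simp: mat_sum_def)
  have "(A * mat_sum n m f S) $$ (i,j) = (\<Sum>c<n. A $$ (i,c) * (\<Sum>s\<in>S. f s $$ (c,j)))"
    using assms ij by (auto simp: scalar_prod_def atLeast0LessThan mat_sum_def intro!: sum.cong)
  also have "\<dots> = (\<Sum>s\<in>S. \<Sum>c<n. A $$ (i,c) * f s $$ (c,j))"
    unfolding sum_distrib_left by (rule sum.swap)
  also have "\<dots> = (\<Sum>s\<in>S. (A * f s) $$ (i,j))"
  proof (intro sum.cong refl)
    fix s assume "s \<in> S"
    from assms(2)[OF this] show "(\<Sum>c<n. A $$ (i,c) * f s $$ (c,j)) = (A * f s) $$ (i,j)"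
      using assms(1) ij by (auto simp: scalar_prod_def atLeast0LessThan intro!: sum.cong)
  qed
  finally show "(A * mat_sum n m f S) $$ (i,j) = mat_sum k m (\<lambda>s. A * f s) S $$ (i,j)" using ij by simp
qed (use assms in \<open>auto simp: mat_sum_def\<close>)

lemma mat_sum_mult:
  assumes "A \<in> carrier_mat m k" "\<And>s. s \<in> S \<Longrightarrow> f s \<in> carrier_mat n m"
  shows "mat_sum n m f S * A = mat_sum n k (\<lambda>s. f s * A) S"
proof (rule eq_matI)
  fix i j assume "i < dim_row (mat_sum n k (\<lambda>s. f s * A) S)" "j < dim_col (mat_sum n k (\<lambda>s. f s * A) S)"
  hence ij: "i < n" "j < k" by (auto simp: mat_sum_def)
  have "(mat_sum n m f S * A) $$ (i,j) = (\<Sum>c<m. (\<Sum>s\<in>S. f s $$ (i,c)) * A $$ (c,j))"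
    using assms ij by (auto simp: scalar_prod_def atLeast0LessThan mat_sum_def intro!: sum.cong)
  also have "\<dots> = (\<Sum>s\<in>S. \<Sum>c<m. f s $$ (i,c) * A $$ (c,j))"
    unfolding sum_distrib_right by (rule sum.swap)
  also have "\<dots> = (\<Sum>s\<in>S. (f s * A) $$ (i,j))"
  proof (intro sum.cong refl)
    fix s assume "s \<in> S"
    from assms(2)[OF this] show "(\<Sum>c<m. f s $$ (i,c) * A $$ (c,j)) = (f s * A) $$ (i,j)"
      using assms(1) ij by (auto simp: scalar_prod_def atLeast0LessThan intro!: sum.cong)
  qed
  finally show "(mat_sum n m f S * A) $$ (i,j) = mat_sum n k (\<lambda>s. f s * A) S $$ (i,j)" using ij by simp
qed (use assms in \<open>auto simp: mat_sum_def\<close>)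

lemma mat_trace_carrier: "A \<in> carrier_mat n n \<Longrightarrow> mat_trace A = (\<Sum>i<n. A $$ (i,i))"
  by (auto simp: mat_trace_def)

definition unit_mat :: "nat \<Rightarrow> nat \<Rightarrow> nat \<Rightarrow> nat \<Rightarrow> complex mat" where
  "unit_mat n m i j = mat n m (\<lambda>(a,b). if a = i \<and> b = j then 1 else 0)"

text \<open>A matrix unit between two factors isolates one coefficient of each. Averages of such
  products turn the inner product of two characters into entries of intertwiners.\<close>

lemma mult_unit_mat_mult:
  assumes "A \<in> carrier_mat k n" "B \<in> carrier_mat m l" "i < n" "j < m" "a < k" "b < l"
  shows "(A * unit_mat n m i j * B) $$ (a,b) = A $$ (a,i) * B $$ (j,b)"
proof -
  have 1: "(A * unit_mat n m i j) $$ (a,c) = (if c = j then A $$ (a,i) else 0)" if "c < m" for c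
  proof -
    have "(A * unit_mat n m i j) $$ (a,c) = (\<Sum>d<n. A $$ (a,d) * (if d = i \<and> c = j then 1 else 0))"
      using assms that by (auto simp: scalar_prod_def atLeast0LessThan unit_mat_def intro!: sum.cong)
    also have "\<dots> = (\<Sum>d<n. if d = i then (if c = j then A $$ (a,i) else 0) else 0)"
      by (intro sum.cong) auto
    also have "\<dots> = (if c = j then A $$ (a,i) else 0)" using assms by simp
    finally show ?thesis .
  qed
  have "(A * unit_mat n m i j * B) $$ (a,b) = (\<Sum>c<m. (A * unit_mat n m i j) $$ (a,c) * B $$ (c,b))"
    using assms by (auto simp: scalar_prod_def atLeast0LessThan unit_mat_def intro!: sum.cong)
  also have "\<dots> = (\<Sum>c<m. if c = j then A $$ (a,i) * B $$ (j,b) else 0)"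
    using 1 by (intro sum.cong) auto
  also have "\<dots> = A $$ (a,i) * B $$ (j,b)" using assms by simp
  finally show ?thesis .
qed

section \<open>Schur's lemma and the orthogonality relations\<close>

lemma (in group) matrix_rep_inv:
  assumes "matrix_rep G n \<rho>" "x \<in> carrier G"
  shows "\<rho> (inv x) * \<rho> x = 1\<^sub>m n" "\<rho> x * \<rho> (inv x) = 1\<^sub>m n"
  using assms unfolding matrix_rep_def by (metis inv_closed l_inv, metis inv_closed r_inv)

lemma (in group) matrix_rep_pow:
  assumes "matrix_rep G n \<rho>" "x \<in> carrier G"
  shows "\<rho> (x [^] (k::nat)) = \<rho> x ^\<^sub>m k"
  using assms by (induction k) (auto simp: matrix_rep_def)

text \<open>Schur's lemma: kernel and image of \<open>A\<close> are invariant subspaces, and since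
  \<open>A\<close> is not zero the first is trivial and the second is everything.\<close>

lemma irreducible_intertwiner_invertible:
  assumes \<rho>: "irreducible_rep G n \<rho>" and \<sigma>: "irreducible_rep G m \<sigma>" and A: "A \<in> carrier_mat n m"
    and int: "\<And>h. h \<in> carrier G \<Longrightarrow> \<rho> h * A = A * \<sigma> h" and nz: "A \<noteq> 0\<^sub>m n m"
  shows "\<exists>B\<in>carrier_mat m n. A * B = 1\<^sub>m n \<and> B * A = 1\<^sub>m m"
proof -
  have cr: "\<rho> h \<in> carrier_mat n n" "\<sigma> h \<in> carrier_mat m m" if "h \<in> carrier G" for h
    using \<rho> \<sigma> that by (auto simp: irreducible_rep_def matrix_rep_def)
  have irr\<rho>: "W = {0\<^sub>v n} \<or> W = carrier_vec n"
    if "VectorSpace.subspace class_ring W (module_vec TYPE(complex) n)"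
      "\<And>x w. x \<in> carrier G \<Longrightarrow> w \<in> W \<Longrightarrow> \<rho> x *\<^sub>v w \<in> W" for W
    using \<rho> that unfolding irreducible_rep_def by blast
  have irr\<sigma>: "W = {0\<^sub>v m} \<or> W = carrier_vec m"
    if "VectorSpace.subspace class_ring W (module_vec TYPE(complex) m)"
      "\<And>x w. x \<in> carrier G \<Longrightarrow> w \<in> W \<Longrightarrow> \<sigma> x *\<^sub>v w \<in> W" for W
    using \<sigma> that unfolding irreducible_rep_def by blast
  have nzv: "\<exists>v\<in>carrier_vec m. A *\<^sub>v v \<noteq> 0\<^sub>v n"
  proof (rule ccontr)
    assume H: "\<not> ?thesis"
    have "A = 0\<^sub>m n m"
    proof (rule eq_matI)
      fix i j assume ij: "i < dim_row (0\<^sub>m n m)" "j < dim_col (0\<^sub>m n m)"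
      have "col A j = A *\<^sub>v unit_vec m j" using A ij
        by (intro eq_vecI) (auto simp: scalar_prod_right_unit)
      hence "col A j = 0\<^sub>v n" using H by auto
      thus "A $$ (i,j) = 0\<^sub>m n m $$ (i,j)" using ij A by (auto simp: vec_eq_iff)
    qed (use A in auto)
    thus False using nz by simp
  qed
  let ?K = "{v \<in> carrier_vec m. A *\<^sub>v v = 0\<^sub>v n}"
  have "VectorSpace.subspace class_ring ?K (module_vec TYPE(complex) m)"
    unfolding subspace_vec_iff using A
    by (auto simp: mult_add_distrib_mat_vec[of _ n m] mult_mat_vec[of _ n m])
  moreover have "\<sigma> x *\<^sub>v w \<in> ?K" if "x \<in> carrier G" "w \<in> ?K" for x w
  proof -
    have w: "w \<in> carrier_vec m" using that by simp
    have "A *\<^sub>v (\<sigma> x *\<^sub>v w) = \<rho> x *\<^sub>v (A *\<^sub>v w)"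
      using assoc_mult_mat_vec[OF A cr(2)[OF that(1)] w] assoc_mult_mat_vec[OF cr(1)[OF that(1)] A w]
        int[OF that(1)] by simp
    also have "\<dots> = 0\<^sub>v n" using that cr[OF that(1)] by auto
    finally show ?thesis using that cr[OF that(1)] by auto
  qed
  ultimately have "?K = {0\<^sub>v m} \<or> ?K = carrier_vec m" by (rule irr\<sigma>)
  hence ker: "?K = {0\<^sub>v m}" using nzv by blast
  let ?I = "(\<lambda>v. A *\<^sub>v v) ` carrier_vec m"
  have "VectorSpace.subspace class_ring ?I (module_vec TYPE(complex) n)"
    unfolding subspace_vec_iff
  proof (intro conjI ballI allI)
    show "?I \<subseteq> carrier_vec n" using A by auto
    show "0\<^sub>v n \<in> ?I" using A by (intro image_eqI[of _ _ "0\<^sub>v m"]) auto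
    fix v assume v: "v \<in> ?I"
    { fix w assume w: "w \<in> ?I"
      from v w obtain v' w' where "v = A *\<^sub>v v'" "w = A *\<^sub>v w'" "v' \<in> carrier_vec m" "w' \<in> carrier_vec m" by auto
      thus "v + w \<in> ?I" using A
        by (intro image_eqI[of _ _ "v' + w'"]) (auto simp: mult_add_distrib_mat_vec[of _ n m]) }
    { fix c from v obtain v' where "v = A *\<^sub>v v'" "v' \<in> carrier_vec m" by auto
      thus "c \<cdot>\<^sub>v v \<in> ?I" using A by (intro image_eqI[of _ _ "c \<cdot>\<^sub>v v'"]) (auto simp: mult_mat_vec[of _ n m]) }
  qed
  moreover have "\<rho> x *\<^sub>v w \<in> ?I" if x: "x \<in> carrier G" and w: "w \<in> ?I" for x w
  proof -
    from w obtain v where v: "v \<in> carrier_vec m" "w = A *\<^sub>v v" by auto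
    have "\<rho> x *\<^sub>v w = A *\<^sub>v (\<sigma> x *\<^sub>v v)"
      using assoc_mult_mat_vec[OF A cr(2)[OF x] v(1)] assoc_mult_mat_vec[OF cr(1)[OF x] A v(1)]
        int[OF x] v(2) by simp
    thus ?thesis using v cr[OF x] by auto
  qed
  ultimately have "?I = {0\<^sub>v n} \<or> ?I = carrier_vec n" by (rule irr\<rho>)
  hence im: "?I = carrier_vec n" using nzv by blast
  have "\<forall>i<n. \<exists>v\<in>carrier_vec m. A *\<^sub>v v = unit_vec n i"
    using im by (metis (no_types, lifting) imageE unit_vec_carrier)
  then obtain f where f: "\<And>i. i < n \<Longrightarrow> f i \<in> carrier_vec m \<and> A *\<^sub>v f i = unit_vec n i" by metis
  \<comment> \<open>The columns of \<open>B\<close> are preimages of the unit vectors, so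
    \<open>A * B\<close> is the identity. For \<open>B * A\<close>, each column minus the unit
    vector is killed by \<open>A\<close>, and the kernel is trivial.\<close>
  define B where "B = mat_of_cols m (map f [0..<n])"
  have B: "B \<in> carrier_mat m n" unfolding B_def by (metis length_map length_upt minus_nat.diff_0 mat_of_cols_carrier(1))
  have colB: "col B i = f i" if "i < n" for i
    unfolding B_def using that f by (subst col_mat_of_cols) auto
  have AB: "A * B = 1\<^sub>m n"
  proof (rule mat_col_eqI)
    fix i assume "i < dim_col (1\<^sub>m n)" hence i: "i < n" by simp
    show "col (A * B) i = col (1\<^sub>m n) i" using i col_mult2[OF A B i] colB[OF i] f[OF i] by simp
  qed (use A B in auto)
  have "B * A = 1\<^sub>m m"
  proof (rule mat_col_eqI)
    fix j assume "j < dim_col (1\<^sub>m m)" hence j: "j < m" by simp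
    have "A *\<^sub>v (col (B * A) j - unit_vec m j) = A *\<^sub>v col (B * A) j - A *\<^sub>v unit_vec m j"
      using A B j by (intro mult_minus_distrib_mat_vec[of _ n m]) auto
    also have "A *\<^sub>v col (B * A) j = col A j"
    proof -
      have "col (A * (B * A)) j = A *\<^sub>v col (B * A) j" using A B j by (intro col_mult2[of _ n m _ m]) auto
      moreover have "A * (B * A) = A" using A B AB by (simp flip: assoc_mult_mat)
      ultimately show ?thesis by simp
    qed
    also have "A *\<^sub>v unit_vec m j = col A j" using A j
      by (intro eq_vecI) (auto simp: scalar_prod_right_unit)
    also have "col A j - col A j = 0\<^sub>v n" using A by (intro eq_vecI) auto
    finally have "col (B * A) j - unit_vec m j \<in> ?K" using A B j by auto
    hence "col (B * A) j - unit_vec m j = 0\<^sub>v m" using ker by blast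
    hence "col (B * A) j = unit_vec m j" using A B j by (auto simp: vec_eq_iff)
    thus "col (B * A) j = col (1\<^sub>m m) j" using j by simp
  qed (use A B in auto)
  thus ?thesis using AB B by blast
qed

lemma complex_mat_eigenvector_exists:
  assumes A: "(A :: complex mat) \<in> carrier_mat n n" and n: "n > 0"
  obtains c v where "v \<in> carrier_vec n" "v \<noteq> 0\<^sub>v n" "A *\<^sub>v v = c \<cdot>\<^sub>v v"
proof -
  from char_poly_factorized[OF A] obtain es
    where es: "char_poly A = (\<Prod>a\<leftarrow>es. [:- a, 1:])" "length es = n" by auto
  then obtain c where "c \<in> set es" using n by (cases es) auto
  hence "poly (char_poly A) c = 0" unfolding es(1) poly_prod_list by (auto simp: prod_list_zero_iff)
  hence "eigenvalue A c" using eigenvalue_root_char_poly[OF A] by simp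
  thus thesis using that A unfolding eigenvalue_def eigenvector_def by auto
qed

text \<open>Subtracting an eigenvalue leaves an intertwiner that kills an eigenvector, so it is not
  invertible and must vanish.\<close>

lemma irreducible_self_intertwiner_scalar:
  assumes \<rho>: "irreducible_rep G n \<rho>" and A: "A \<in> carrier_mat n n"
    and int: "\<And>h. h \<in> carrier G \<Longrightarrow> \<rho> h * A = A * \<rho> h"
  obtains c where "A = c \<cdot>\<^sub>m 1\<^sub>m n"
proof -
  have "n > 0" using \<rho> by (simp add: irreducible_rep_def)
  then obtain c v where v: "v \<in> carrier_vec n" "v \<noteq> 0\<^sub>v n" "A *\<^sub>v v = c \<cdot>\<^sub>v v"
    using complex_mat_eigenvector_exists[OF A] by blast
  let ?A = "A - c \<cdot>\<^sub>m 1\<^sub>m n"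
  have "?A = 0\<^sub>m n n"
  proof (rule ccontr)
    assume nz: "?A \<noteq> 0\<^sub>m n n"
    have "\<rho> h * ?A = ?A * \<rho> h" if h: "h \<in> carrier G" for h
    proof -
      have cr: "\<rho> h \<in> carrier_mat n n" using \<rho> h by (auto simp: irreducible_rep_def matrix_rep_def)
      have "\<rho> h * ?A = \<rho> h * A - c \<cdot>\<^sub>m \<rho> h"
        using A cr mult_smult_distrib[OF cr one_carrier_mat, of c]
        by (simp add: mult_minus_distrib_mat[of _ n n])
      moreover have "?A * \<rho> h = A * \<rho> h - c \<cdot>\<^sub>m \<rho> h"
        using A cr mult_smult_assoc_mat[OF one_carrier_mat cr, of c]
        by (simp add: minus_mult_distrib_mat[of _ n n])
      ultimately show ?thesis using int[OF h] by simp
    qed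
    from irreducible_intertwiner_invertible[OF \<rho> \<rho> _ this nz] A
    obtain B where B: "B \<in> carrier_mat n n" "B * ?A = 1\<^sub>m n" by (meson minus_carrier_mat one_carrier_mat smult_carrier_mat)
    have "?A *\<^sub>v v = A *\<^sub>v v - (c \<cdot>\<^sub>m 1\<^sub>m n) *\<^sub>v v"
      using A v by (intro minus_mult_distrib_mat_vec) auto
    also have "(c \<cdot>\<^sub>m 1\<^sub>m n) *\<^sub>v v = c \<cdot>\<^sub>v v" using v by (intro eq_vecI) (auto simp: scalar_prod_left_unit)
    finally have "?A *\<^sub>v v = 0\<^sub>v n" using v by simp
    hence "(B * ?A) *\<^sub>v v = 0\<^sub>v n" using B A v by (subst assoc_mult_mat_vec[of _ n n _ n]) auto
    thus False using B v by simp
  qed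
  hence "A = c \<cdot>\<^sub>m 1\<^sub>m n" using A
    by (auto simp: mat_eq_iff)
  thus thesis using that by blast
qed

locale finite_grp = group +
  assumes finite_carrier [simp, intro]: "finite (carrier G)"
begin

lemma card_pos: "card (carrier G) > 0"
  using card_gt_0_iff by blast

lemma sum_translate:
  assumes "h \<in> carrier G"
  shows "(\<Sum>g\<in>carrier G. f (g \<otimes> h)) = (\<Sum>g\<in>carrier G. f g)"
  by (rule sum.reindex_bij_witness[of _ "\<lambda>g. g \<otimes> inv h" "\<lambda>g. g \<otimes> h"])
     (use assms in \<open>auto simp: m_assoc\<close>)

text \<open>Replacing the summation variable \<open>g\<close> by \<open>g \<otimes> h\<close>
  cancels the left factor \<open>\<rho> h\<close> and releases \<open>\<sigma> h\<close> on the
  right.\<close>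

lemma average_intertwines:
  assumes \<rho>: "matrix_rep G n \<rho>" and \<sigma>: "matrix_rep G m \<sigma>" and Y: "Y \<in> carrier_mat n m" and h: "h \<in> carrier G"
  defines "A \<equiv> mat_sum n m (\<lambda>g. \<rho> (inv g) * Y * \<sigma> g) (carrier G)"
  shows "\<rho> h * A = A * \<sigma> h"
proof -
  have cr: "\<rho> g \<in> carrier_mat n n" "\<sigma> g \<in> carrier_mat m m" if "g \<in> carrier G" for g
    using \<rho> \<sigma> that by (auto simp: matrix_rep_def)
  have hm: "\<rho> (g \<otimes> k) = \<rho> g * \<rho> k" "\<sigma> (g \<otimes> k) = \<sigma> g * \<sigma> k" if "g \<in> carrier G" "k \<in> carrier G" for g k
    using \<rho> \<sigma> that by (auto simp: matrix_rep_def)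
  have "\<rho> h * A = mat_sum n m (\<lambda>g. \<rho> h * (\<rho> (inv g) * Y * \<sigma> g)) (carrier G)"
    unfolding A_def using cr h Y by (intro mult_mat_sum) (auto intro!: mult_carrier_mat)
  also have "\<dots> = mat_sum n m (\<lambda>g. \<rho> h * (\<rho> (inv (g \<otimes> h)) * Y * \<sigma> (g \<otimes> h))) (carrier G)"
    unfolding mat_sum_def
    by (subst sum_translate[OF h, of "\<lambda>g. (\<rho> h * (\<rho> (inv g) * Y * \<sigma> g)) $$ ij" for ij]) (rule refl)
  also have "\<dots> = mat_sum n m (\<lambda>g. (\<rho> (inv g) * Y * \<sigma> g) * \<sigma> h) (carrier G)"
  proof -
    have "\<rho> h * (\<rho> (inv (g \<otimes> h)) * Y * \<sigma> (g \<otimes> h)) = (\<rho> (inv g) * Y * \<sigma> g) * \<sigma> h" if g: "g \<in> carrier G" for g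
    proof -
      have "\<rho> h * (\<rho> (inv (g \<otimes> h)) * Y * \<sigma> (g \<otimes> h)) = (\<rho> h * \<rho> (inv h)) * (\<rho> (inv g) * Y * \<sigma> g * \<sigma> h)"
      proof -
        have c: "\<rho> h \<in> carrier_mat n n" "\<rho> (inv h) \<in> carrier_mat n n" "\<rho> (inv g) \<in> carrier_mat n n"
          "\<sigma> g \<in> carrier_mat m m" "\<sigma> h \<in> carrier_mat m m" using g h cr by auto
        have "\<rho> h * (\<rho> (inv (g \<otimes> h)) * Y * \<sigma> (g \<otimes> h)) = \<rho> h * (\<rho> (inv h) * \<rho> (inv g) * Y * (\<sigma> g * \<sigma> h))"
          using g h by (simp add: inv_mult_group hm)
        also have "\<dots> = (\<rho> h * \<rho> (inv h)) * (\<rho> (inv g) * Y * \<sigma> g * \<sigma> h)"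
          using c Y by (simp add: assoc_mult_mat[of _ n n _ n _ n] assoc_mult_mat[of _ n n _ n _ m]
            assoc_mult_mat[of _ n n _ m _ m] assoc_mult_mat[of _ n m _ m _ m])
        finally show ?thesis .
      qed
      also have "\<dots> = \<rho> (inv g) * Y * \<sigma> g * \<sigma> h"
        unfolding matrix_rep_inv[OF \<rho> h] using g h Y cr
        by (intro left_mult_one_mat) (auto intro!: mult_carrier_mat)
      finally show ?thesis .
    qed
    thus ?thesis unfolding mat_sum_def by (intro eq_matI) auto
  qed
  also have "\<dots> = A * \<sigma> h"
    unfolding A_def using cr h Y by (intro mat_sum_mult[symmetric]) (auto intro!: mult_carrier_mat)
  finally show ?thesis .
qed

text \<open>The \<open>(i,j)\<close> entry of the averaged matrix unit at position
  \<open>(i,j)\<close> is the sum over the group of products of diagonal coefficients; summing over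
  both indices gives the product of the traces. Schur's lemma can then be applied to each
  average.\<close>

lemma char_ip_as_averages:
  assumes \<rho>: "matrix_rep G n \<rho>" and \<sigma>: "matrix_rep G m \<sigma>"
  shows "char_ip G (rep_char G \<rho>) (rep_char G \<sigma>) * of_nat (card (carrier G)) =
    (\<Sum>i<n. \<Sum>j<m. mat_sum n m (\<lambda>g. \<rho> (inv g) * unit_mat n m i j * \<sigma> g) (carrier G) $$ (i,j))"
proof -
  have cr: "\<rho> g \<in> carrier_mat n n" "\<sigma> g \<in> carrier_mat m m" if "g \<in> carrier G" for g
    using \<rho> \<sigma> that by (auto simp: matrix_rep_def)
  have "(\<Sum>i<n. \<Sum>j<m. mat_sum n m (\<lambda>g. \<rho> (inv g) * unit_mat n m i j * \<sigma> g) (carrier G) $$ (i,j))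
     = (\<Sum>i<n. \<Sum>j<m. \<Sum>g\<in>carrier G. \<rho> (inv g) $$ (i,i) * \<sigma> g $$ (j,j))"
    using cr by (intro sum.cong refl) (auto intro!: sum.cong simp: mult_unit_mat_mult[of _ n n _ m m])
  also have "\<dots> = (\<Sum>i<n. \<Sum>g\<in>carrier G. \<Sum>j<m. \<rho> (inv g) $$ (i,i) * \<sigma> g $$ (j,j))"
    by (intro sum.cong refl sum.swap)
  also have "\<dots> = (\<Sum>g\<in>carrier G. \<Sum>i<n. \<Sum>j<m. \<rho> (inv g) $$ (i,i) * \<sigma> g $$ (j,j))"
    by (rule sum.swap)
  also have "\<dots> = (\<Sum>g\<in>carrier G. mat_trace (\<rho> (inv g)) * mat_trace (\<sigma> g))"
    by (intro sum.cong refl) (simp add: mat_trace_carrier[OF cr(1)] mat_trace_carrier[OF cr(2)] sum_product)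
  finally show ?thesis using card_pos by (simp add: char_ip_def rep_char_def)
qed

text \<open>A nonzero average would be an invertible intertwiner, hence the two representations
  would be similar and have equal characters.\<close>

lemma char_ip_Irr_distinct:
  assumes "\<chi> \<in> Irr G" "\<psi> \<in> Irr G" "\<chi> \<noteq> \<psi>"
  shows "char_ip G \<chi> \<psi> = 0"
proof -
  from assms obtain n \<rho> m \<sigma> where \<rho>: "irreducible_rep G n \<rho>" "\<chi> = rep_char G \<rho>"
    and \<sigma>: "irreducible_rep G m \<sigma>" "\<psi> = rep_char G \<sigma>" by (auto simp: Irr_def)
  have r: "matrix_rep G n \<rho>" "matrix_rep G m \<sigma>" using \<rho> \<sigma> by (auto simp: irreducible_rep_def)
  have cr: "\<rho> g \<in> carrier_mat n n" "\<sigma> g \<in> carrier_mat m m" if "g \<in> carrier G" for g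
    using r that by (auto simp: matrix_rep_def)
  have "mat_sum n m (\<lambda>g. \<rho> (inv g) * Y * \<sigma> g) (carrier G) = 0\<^sub>m n m" if Y: "Y \<in> carrier_mat n m" for Y
  proof (rule ccontr)
    assume nz: "mat_sum n m (\<lambda>g. \<rho> (inv g) * Y * \<sigma> g) (carrier G) \<noteq> 0\<^sub>m n m"
    let ?A = "mat_sum n m (\<lambda>g. \<rho> (inv g) * Y * \<sigma> g) (carrier G)"
    have int: "\<rho> h * ?A = ?A * \<sigma> h" if "h \<in> carrier G" for h using average_intertwines[OF r Y that] .
    from irreducible_intertwiner_invertible[OF \<rho>(1) \<sigma>(1) mat_sum_carrier int nz]
    obtain B where B: "B \<in> carrier_mat m n" "?A * B = 1\<^sub>m n" "B * ?A = 1\<^sub>m m" by auto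
    have "mat_trace (\<rho> h) = mat_trace (\<sigma> h)" if h: "h \<in> carrier G" for h
    proof -
      have "\<rho> h = \<rho> h * (?A * B)" using B cr[OF h] by simp
      also have "\<dots> = ?A * \<sigma> h * B" using B cr[OF h] int[OF h]
        by (subst assoc_mult_mat[symmetric, of _ n n _ m _ n]) auto
      finally have "mat_trace (\<rho> h) = mat_trace (?A * \<sigma> h * B)" by simp
      also have "\<dots> = mat_trace (B * (?A * \<sigma> h))" using B cr[OF h] by (intro mat_trace_comm[of _ n m] mult_carrier_mat[OF mat_sum_carrier cr(2)[OF h]]) auto
      also have "B * (?A * \<sigma> h) = \<sigma> h" using B cr[OF h]
        by (subst assoc_mult_mat[symmetric, of _ m n _ m _ m]) auto
      finally show ?thesis .
    qed
    hence "\<chi> = \<psi>" unfolding \<rho> \<sigma> rep_char_def by auto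
    thus False using assms by simp
  qed
  from this[of "unit_mat n m _ _"]
  have "char_ip G \<chi> \<psi> * of_nat (card (carrier G)) = 0"
    unfolding \<rho>(2) \<sigma>(2) char_ip_as_averages[OF r] by (simp add: unit_mat_def)
  thus ?thesis using card_pos by auto
qed

text \<open>Each average is a scalar matrix, and its trace is the group order times the trace of the
  matrix unit. So only the \<open>n\<close> diagonal positions contribute, each with the group order
  divided by \<open>n\<close>.\<close>

lemma char_ip_Irr_self:
  assumes "\<chi> \<in> Irr G"
  shows "char_ip G \<chi> \<chi> = 1"
proof -
  from assms obtain n \<rho> where \<rho>: "irreducible_rep G n \<rho>" "\<chi> = rep_char G \<rho>" by (auto simp: Irr_def)
  have r: "matrix_rep G n \<rho>" and n: "n > 0" using \<rho> by (auto simp: irreducible_rep_def)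
  have cr: "\<rho> g \<in> carrier_mat n n" if "g \<in> carrier G" for g
    using r that by (auto simp: matrix_rep_def)
  have avg: "mat_sum n n (\<lambda>g. \<rho> (inv g) * unit_mat n n i j * \<rho> g) (carrier G) $$ (i,j) =
     (if i = j then of_nat (card (carrier G)) / of_nat n else 0)" if ij: "i < n" "j < n" for i j
  proof -
    let ?Y = "unit_mat n n i j"
    let ?A = "mat_sum n n (\<lambda>g. \<rho> (inv g) * ?Y * \<rho> g) (carrier G)"
    have Y: "?Y \<in> carrier_mat n n" by (simp add: unit_mat_def)
    obtain c where c: "?A = c \<cdot>\<^sub>m 1\<^sub>m n"
      using irreducible_self_intertwiner_scalar[OF \<rho>(1) mat_sum_carrier average_intertwines[OF r r Y]] by blast
    have "of_nat n * c = mat_trace ?A" unfolding c by (simp add: mat_trace_def)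
    also have "\<dots> = (\<Sum>g\<in>carrier G. mat_trace (\<rho> (inv g) * ?Y * \<rho> g))"
    proof -
      have "mat_trace ?A = (\<Sum>i<n. \<Sum>g\<in>carrier G. (\<rho> (inv g) * ?Y * \<rho> g) $$ (i,i))"
        by (simp add: mat_trace_carrier[OF mat_sum_carrier])
      also have "\<dots> = (\<Sum>g\<in>carrier G. \<Sum>i<n. (\<rho> (inv g) * ?Y * \<rho> g) $$ (i,i))" by (rule sum.swap)
      also have "\<dots> = (\<Sum>g\<in>carrier G. mat_trace (\<rho> (inv g) * ?Y * \<rho> g))"
        using cr Y by (intro sum.cong refl mat_trace_carrier[symmetric] mult_carrier_mat[of _ n n]) auto
      finally show ?thesis .
    qed
    also have "\<dots> = (\<Sum>g\<in>carrier G. mat_trace ?Y)"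
      using cr Y matrix_rep_inv[OF r] by (intro sum.cong refl mat_trace_conj[of _ n]) auto
    also have "mat_trace ?Y = (if i = j then 1 else 0)"
    proof -
      have "mat_trace ?Y = (\<Sum>a<n. if a = i then (if i = j then 1 else 0) else 0)"
        unfolding mat_trace_def unit_mat_def by (auto intro!: sum.cong)
      thus ?thesis using ij by simp
    qed
    finally have "of_nat n * c = (if i = j then of_nat (card (carrier G)) else 0)" by simp
    hence "c = (if i = j then of_nat (card (carrier G)) / of_nat n else 0)" using n
      by (auto simp: field_simps split: if_splits)
    thus ?thesis unfolding c using ij by auto
  qed
  have "char_ip G \<chi> \<chi> * of_nat (card (carrier G)) = (\<Sum>i<n. \<Sum>j<n. if i = j then of_nat (card (carrier G)) / of_nat n else 0)"
    unfolding \<rho>(2) char_ip_as_averages[OF r r] using avg by (intro sum.cong refl) auto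
  also have "\<dots> = of_nat (card (carrier G))" using n by simp
  finally show ?thesis using card_pos by (auto simp: card_eq_0_iff)
qed

end

section \<open>Decomposition of characters into irreducible ones\<close>

lemma Char_outside: "\<chi> \<in> Char G \<Longrightarrow> x \<notin> carrier G \<Longrightarrow> \<chi> x = 0"
  by (auto simp: Char_def rep_char_def)

lemma Irr_imp_Char: "\<chi> \<in> Irr G \<Longrightarrow> \<chi> \<in> Char G"
  by (auto simp: Char_def Irr_def irreducible_rep_def)

lemma rep_char_one: "group G \<Longrightarrow> matrix_rep G n \<rho> \<Longrightarrow> rep_char G \<rho> \<one>\<^bsub>G\<^esub> = of_nat n"
  by (simp add: rep_char_def matrix_rep_def group.is_monoid monoid.one_closed)

text \<open>The hypothesis concerns products so that it covers both diagonal blocks of a block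
  triangular representation: for the invariant subspace the second factor vanishes, for the quotient
  the first.\<close>

lemma matrix_rep_diagonal_block:
  assumes \<rho>: "matrix_rep G n \<rho>" and I: "I \<subseteq> {..<n}" and grp: "group G"
    and van: "\<And>x y i j l. x \<in> carrier G \<Longrightarrow> y \<in> carrier G \<Longrightarrow> i \<in> I \<Longrightarrow> j \<in> I \<Longrightarrow> l < n \<Longrightarrow> l \<notin> I \<Longrightarrow>
       \<rho> x $$ (i,l) * \<rho> y $$ (l,j) = 0"
  obtains \<sigma> where "matrix_rep G (card I) \<sigma>" "\<And>x. x \<in> carrier G \<Longrightarrow> mat_trace (\<sigma> x) = (\<Sum>i\<in>I. \<rho> x $$ (i,i))"
proof -
  have finI: "finite I" using I finite_subset by blast
  obtain f where f: "bij_betw f {..<card I} I"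
    using ex_bij_betw_nat_finite[OF finI] by (auto simp: atLeast0LessThan)
  have fI: "f a \<in> I" if "a < card I" for a using f that by (auto simp: bij_betw_def)
  hence fn: "f a < n" if "a < card I" for a using I that by auto
  have inj: "f a = f b \<longleftrightarrow> a = b" if "a < card I" "b < card I" for a b
    using f that by (auto simp: bij_betw_def inj_on_def)
  have cr: "\<rho> x \<in> carrier_mat n n" if "x \<in> carrier G" for x using \<rho> that by (simp add: matrix_rep_def)
  define \<sigma> where "\<sigma> = (\<lambda>x. mat (card I) (card I) (\<lambda>(a,b). \<rho> x $$ (f a, f b)))"
  show thesis
  proof (rule that[of \<sigma>])
    have "\<sigma> (x \<otimes>\<^bsub>G\<^esub> y) = \<sigma> x * \<sigma> y" if x: "x \<in> carrier G" and y: "y \<in> carrier G" for x y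
    proof (rule eq_matI)
      fix a b assume "a < dim_row (\<sigma> x * \<sigma> y)" "b < dim_col (\<sigma> x * \<sigma> y)"
      hence ab: "a < card I" "b < card I" by (auto simp: \<sigma>_def)
      have "\<sigma> (x \<otimes>\<^bsub>G\<^esub> y) $$ (a,b) = (\<rho> x * \<rho> y) $$ (f a, f b)"
        using ab \<rho> x y by (simp add: \<sigma>_def matrix_rep_def)
      also have "\<dots> = (\<Sum>l<n. \<rho> x $$ (f a,l) * \<rho> y $$ (l, f b))"
        using cr[OF x] cr[OF y] fn ab by (auto simp: scalar_prod_def atLeast0LessThan intro!: sum.cong)
      also have "\<dots> = (\<Sum>l\<in>I. \<rho> x $$ (f a,l) * \<rho> y $$ (l, f b))"
        using I van[OF x y fI[OF ab(1)] fI[OF ab(2)]] by (intro sum.mono_neutral_right) auto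
      also have "\<dots> = (\<Sum>c<card I. \<rho> x $$ (f a, f c) * \<rho> y $$ (f c, f b))"
        by (rule sum.reindex_bij_betw[OF f, symmetric])
      also have "\<dots> = (\<sigma> x * \<sigma> y) $$ (a,b)" using ab
        by (auto simp: \<sigma>_def scalar_prod_def atLeast0LessThan intro!: sum.cong)
      finally show "\<sigma> (x \<otimes>\<^bsub>G\<^esub> y) $$ (a,b) = (\<sigma> x * \<sigma> y) $$ (a,b)" .
    qed (auto simp: \<sigma>_def)
    moreover have "\<sigma> \<one>\<^bsub>G\<^esub> = 1\<^sub>m (card I)" using \<rho> fn inj
      by (intro eq_matI) (auto simp: \<sigma>_def matrix_rep_def)
    ultimately show "matrix_rep G (card I) \<sigma>" by (auto simp: matrix_rep_def \<sigma>_def)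
  next
    fix x
    have "mat_trace (\<sigma> x) = (\<Sum>a<card I. \<rho> x $$ (f a, f a))" by (simp add: mat_trace_def \<sigma>_def)
    also have "\<dots> = (\<Sum>i\<in>I. \<rho> x $$ (i,i))" by (rule sum.reindex_bij_betw[OF f])
    finally show "mat_trace (\<sigma> x) = (\<Sum>i\<in>I. \<rho> x $$ (i,i))" .
  qed
qed

text \<open>In a basis adapted to an invariant subspace the matrices are block triangular, and the
  trace is the sum of the traces of the diagonal blocks, which represent subspace and
  quotient.\<close>

lemma reducible_rep_splits:
  assumes grp: "group G" and \<rho>: "matrix_rep G n \<rho>" and n: "n > 0" and red: "\<not> irreducible_rep G n \<rho>"
  obtains k l \<sigma> \<tau> where "matrix_rep G k \<sigma>" "matrix_rep G l \<tau>" "k < n" "l < n"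
    "rep_char G \<rho> = (\<lambda>x. rep_char G \<sigma> x + rep_char G \<tau> x)"
proof -
  from \<rho> n red obtain W where W: "VectorSpace.subspace class_ring W (module_vec TYPE(complex) n)"
    and inv: "\<And>x w. x \<in> carrier G \<Longrightarrow> w \<in> W \<Longrightarrow> \<rho> x *\<^sub>v w \<in> W" and ne: "W \<noteq> {0\<^sub>v n}" "W \<noteq> carrier_vec n"
    unfolding irreducible_rep_def by blast
  obtain P Q J where P: "P \<in> carrier_mat n n" "Q \<in> carrier_mat n n" "P * Q = 1\<^sub>m n" "Q * P = 1\<^sub>m n"
    and J: "J \<subseteq> {..<n}" and PW: "\<And>y. y \<in> carrier_vec n \<Longrightarrow> P *\<^sub>v y \<in> W \<longleftrightarrow> (\<forall>i<n. i \<notin> J \<longrightarrow> y $ i = 0)"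
    by (rule subspace_adapted_basis[OF W]) (rule that; assumption)
  have Wc: "W \<subseteq> carrier_vec n" "0\<^sub>v n \<in> W" using W by (auto simp: subspace_vec_iff)
  have PQ: "P *\<^sub>v (Q *\<^sub>v w) = w" if "w \<in> carrier_vec n" for w
    using that P by (subst assoc_mult_mat_vec[symmetric, of _ n n _ n]) auto
  have QP: "Q *\<^sub>v (P *\<^sub>v w) = w" if "w \<in> carrier_vec n" for w
    using that P by (subst assoc_mult_mat_vec[symmetric, of _ n n _ n]) auto
  have "J \<noteq> {}"
  proof
    assume "J = {}"
    have "w = 0\<^sub>v n" if w: "w \<in> W" for w
    proof -
      have c: "w \<in> carrier_vec n" "Q *\<^sub>v w \<in> carrier_vec n" using w Wc P by auto
      have "P *\<^sub>v (Q *\<^sub>v w) \<in> W" using PQ c w by simp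
      hence "\<forall>i<n. (Q *\<^sub>v w) $ i = 0" using PW[OF c(2)] \<open>J = {}\<close> by blast
      hence "Q *\<^sub>v w = 0\<^sub>v n" using carrier_vecD[OF c(2)] by (intro eq_vecI) (simp_all del: index_mult_mat_vec)
      hence "P *\<^sub>v (Q *\<^sub>v w) = 0\<^sub>v n" using P by auto
      thus ?thesis using PQ c by simp
    qed
    thus False using ne(1) Wc(2) by blast
  qed
  have "J \<noteq> {..<n}"
  proof
    assume "J = {..<n}"
    have "w \<in> W" if w: "w \<in> carrier_vec n" for w
      using PW[of "Q *\<^sub>v w"] PQ[OF w] w P \<open>J = {..<n}\<close> by auto
    thus False using ne(2) Wc(1) by blast
  qed
  have cr: "\<rho> x \<in> carrier_mat n n" if "x \<in> carrier G" for x using \<rho> that by (simp add: matrix_rep_def)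
  define \<rho>' where "\<rho>' = (\<lambda>x. Q * \<rho> x * P)"
  have cr': "\<rho>' x \<in> carrier_mat n n" if "x \<in> carrier G" for x using cr[OF that] P by (simp add: \<rho>'_def)
  have rep': "matrix_rep G n \<rho>'"
  proof -
    have "\<rho>' (x \<otimes>\<^bsub>G\<^esub> y) = \<rho>' x * \<rho>' y" if x: "x \<in> carrier G" and y: "y \<in> carrier G" for x y
    proof -
      have "\<rho>' x * \<rho>' y = Q * (\<rho> x * ((P * Q) * (\<rho> y * P)))"
        unfolding \<rho>'_def using P(1,2) cr[OF x] cr[OF y] by (simp add: assoc_mult_mat[of _ n n _ n _ n])
      also have "\<dots> = Q * (\<rho> x * \<rho> y) * P"
        unfolding P(3) using P(1,2) cr[OF x] cr[OF y] by (simp add: assoc_mult_mat[of _ n n _ n _ n])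
      finally show ?thesis using \<rho> x y by (simp add: \<rho>'_def matrix_rep_def)
    qed
    moreover have "\<rho>' \<one>\<^bsub>G\<^esub> = 1\<^sub>m n" using \<rho> P by (simp add: \<rho>'_def matrix_rep_def)
    ultimately show ?thesis using cr' by (auto simp: matrix_rep_def)
  qed
  \<comment> \<open>Column \<open>j\<close> of \<open>\<rho>' x\<close> holds the coordinates of the
    image of a basis vector of \<open>W\<close>, and this image stays in \<open>W\<close>.\<close>
  have van: "\<rho>' x $$ (i,j) = 0" if x: "x \<in> carrier G" and i: "i < n" "i \<notin> J" and j: "j \<in> J" for x i j
  proof -
    have jn: "j < n" using j J by auto
    have "P *\<^sub>v unit_vec n j \<in> W" using j J PW[of "unit_vec n j"] by (auto simp: unit_vec_def)
    hence "\<rho> x *\<^sub>v (P *\<^sub>v unit_vec n j) \<in> W" by (rule inv[OF x])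
    moreover have "\<rho> x *\<^sub>v (P *\<^sub>v unit_vec n j) = P *\<^sub>v (Q *\<^sub>v (\<rho> x *\<^sub>v (P *\<^sub>v unit_vec n j)))"
      using cr[OF x] P(1,2) by (subst PQ) auto
    ultimately have "(Q *\<^sub>v (\<rho> x *\<^sub>v (P *\<^sub>v unit_vec n j))) $ i = 0"
      using PW[of "Q *\<^sub>v (\<rho> x *\<^sub>v (P *\<^sub>v unit_vec n j))"] cr[OF x] P(1,2) i by auto
    also have "Q *\<^sub>v (\<rho> x *\<^sub>v (P *\<^sub>v unit_vec n j)) = \<rho>' x *\<^sub>v unit_vec n j"
      unfolding \<rho>'_def using cr[OF x] P(1,2)
      by (simp add: assoc_mult_mat_vec[of _ n n _ n])
    also have "(\<rho>' x *\<^sub>v unit_vec n j) $ i = \<rho>' x $$ (i,j)"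
      using cr'[OF x] i jn by (auto simp: scalar_prod_right_unit)
    finally show ?thesis .
  qed
  obtain \<sigma> where \<sigma>: "matrix_rep G (card J) \<sigma>" "\<And>x. x \<in> carrier G \<Longrightarrow> mat_trace (\<sigma> x) = (\<Sum>i\<in>J. \<rho>' x $$ (i,i))"
  proof (rule matrix_rep_diagonal_block[OF rep' J grp])
    fix x y i j l assume "y \<in> carrier G" "j \<in> J" "l < n" "l \<notin> J"
    thus "\<rho>' x $$ (i,l) * \<rho>' y $$ (l,j) = 0" using van by simp
  qed blast
  obtain \<tau> where \<tau>: "matrix_rep G (card ({..<n} - J)) \<tau>"
      "\<And>x. x \<in> carrier G \<Longrightarrow> mat_trace (\<tau> x) = (\<Sum>i\<in>{..<n} - J. \<rho>' x $$ (i,i))"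
  proof (rule matrix_rep_diagonal_block[OF rep' Diff_subset grp, of J])
    fix x y i j l assume "x \<in> carrier G" "i \<in> {..<n} - J" "l < n" "l \<notin> {..<n} - J"
    thus "\<rho>' x $$ (i,l) * \<rho>' y $$ (l,j) = 0" using van by simp
  qed blast
  have tr: "mat_trace (\<rho> x) = mat_trace (\<sigma> x) + mat_trace (\<tau> x)" if x: "x \<in> carrier G" for x
  proof -
    have "mat_trace (\<rho> x) = mat_trace (\<rho>' x)"
      unfolding \<rho>'_def using mat_trace_conj[OF cr[OF x] P(1,2,3)] by simp
    also have "\<dots> = (\<Sum>i<n. \<rho>' x $$ (i,i))" by (rule mat_trace_carrier[OF cr'[OF x]])
    also have "\<dots> = mat_trace (\<sigma> x) + mat_trace (\<tau> x)"
      unfolding \<sigma>(2)[OF x] \<tau>(2)[OF x]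
      using sum.subset_diff[OF J finite_lessThan, of "\<lambda>i. \<rho>' x $$ (i,i)"] by (simp only: add.commute)
    finally show ?thesis .
  qed
  have "card J < n" using \<open>J \<noteq> {..<n}\<close> J psubset_card_mono[of "{..<n}" J] by auto
  moreover have "card ({..<n} - J) < n"
    using psubset_card_mono[of "{..<n}" "{..<n} - J"] \<open>J \<noteq> {}\<close> J by auto
  moreover have "rep_char G \<rho> = (\<lambda>x. rep_char G \<sigma> x + rep_char G \<tau> x)"
    by (rule ext) (simp add: rep_char_def tr)
  ultimately show thesis by (rule that[OF \<sigma>(1) \<tau>(1)])
qed

text \<open>Strong induction on the degree. The summands are listed with repetition, so
  multiplicities become counts of indices.\<close>

lemma Char_sum_of_Irr:
  assumes "group G" "\<psi> \<in> Char G"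
  obtains k \<sigma> where "\<And>i. i < k \<Longrightarrow> \<sigma> i \<in> Irr G" "\<psi> = (\<lambda>x. \<Sum>i<(k::nat). \<sigma> i x)"
proof -
  have "\<exists>k \<sigma>. (\<forall>i<k. \<sigma> i \<in> Irr G) \<and> rep_char G \<rho> = (\<lambda>x. \<Sum>i<(k::nat). \<sigma> i x)" if "matrix_rep G n \<rho>" for n \<rho>
    using that
  proof (induction n arbitrary: \<rho> rule: less_induct)
    case (less n)
    consider "n = 0" | "irreducible_rep G n \<rho>" | "n > 0" "\<not> irreducible_rep G n \<rho>" by blast
    thus ?case
    proof cases
      case 1
      hence "rep_char G \<rho> = (\<lambda>x. 0)" using less.prems
        by (fastforce simp: rep_char_def matrix_rep_def mat_trace_def)
      thus ?thesis by (intro exI[of _ 0]) auto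
    next
      case 2
      hence "rep_char G \<rho> \<in> Irr G" by (auto simp: Irr_def)
      thus ?thesis by (intro exI[of _ 1] exI[of _ "\<lambda>_. rep_char G \<rho>"]) auto
    next
      case 3
      obtain a b \<sigma> \<tau> where s: "matrix_rep G a \<sigma>" "matrix_rep G b \<tau>" "a < n" "b < n"
        "rep_char G \<rho> = (\<lambda>x. rep_char G \<sigma> x + rep_char G \<tau> x)"
        using reducible_rep_splits[OF assms(1) less.prems 3] by metis
      from less.IH[OF s(3,1)] obtain k \<phi> where
        k: "\<forall>i<k. \<phi> i \<in> Irr G" "rep_char G \<sigma> = (\<lambda>x. \<Sum>i<(k::nat). \<phi> i x)" by blast
      from less.IH[OF s(4,2)] obtain l \<phi>' where
        l: "\<forall>i<l. \<phi>' i \<in> Irr G" "rep_char G \<tau> = (\<lambda>x. \<Sum>i<(l::nat). \<phi>' i x)" by blast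
      let ?f = "\<lambda>i. if i < k then \<phi> i else \<phi>' (i - k)"
      have "(\<Sum>i<k + l. ?f i x) = (\<Sum>i<k. \<phi> i x) + (\<Sum>i<l. \<phi>' i x)" for x
      proof -
        have "(\<Sum>i<k + l. ?f i x) = (\<Sum>i<k. ?f i x) + (\<Sum>i=k..<k+l. ?f i x)"
          using sum.atLeastLessThan_concat[of 0 k "k + l" "\<lambda>i. ?f i x"] by (simp add: atLeast0LessThan)
        also have "(\<Sum>i=k..<k+l. ?f i x) = (\<Sum>i<l. \<phi>' i x)"
          using sum.shift_bounds_nat_ivl[of "\<lambda>i. ?f i x" 0 k l] by (simp add: atLeast0LessThan add.commute)
        finally show ?thesis by simp
      qed
      thus ?thesis using k l s(5) by (intro exI[of _ "k + l"] exI[of _ ?f]) auto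
    qed
  qed
  thus thesis using assms(2) that unfolding Char_def by blast
qed

lemma Char_add:
  assumes "\<phi> \<in> Char G" "\<psi> \<in> Char G"
  shows "(\<lambda>x. \<phi> x + \<psi> x) \<in> Char G"
proof -
  from assms obtain n \<rho> m \<sigma> where r: "matrix_rep G n \<rho>" "\<phi> = rep_char G \<rho>" "matrix_rep G m \<sigma>" "\<psi> = rep_char G \<sigma>"
    by (auto simp: Char_def)
  let ?t = "\<lambda>x. four_block_mat (\<rho> x) (0\<^sub>m n m) (0\<^sub>m m n) (\<sigma> x)"
  have cr: "\<rho> x \<in> carrier_mat n n" "\<sigma> x \<in> carrier_mat m m" if "x \<in> carrier G" for x
    using r that by (auto simp: matrix_rep_def)
  have "matrix_rep G (n + m) ?t"
    unfolding matrix_rep_def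
  proof (intro conjI ballI)
    fix x assume x: "x \<in> carrier G"
    show "?t x \<in> carrier_mat (n + m) (n + m)" using cr[OF x] by auto
    fix y assume y: "y \<in> carrier G"
    show "?t (x \<otimes>\<^bsub>G\<^esub> y) = ?t x * ?t y"
    proof -
      have z: "\<rho> x * \<rho> y + 0\<^sub>m n m * 0\<^sub>m m n = \<rho> x * \<rho> y" "\<rho> x * 0\<^sub>m n m + 0\<^sub>m n m * \<sigma> y = 0\<^sub>m n m"
        "0\<^sub>m m n * \<rho> y + \<sigma> x * 0\<^sub>m m n = 0\<^sub>m m n" "0\<^sub>m m n * 0\<^sub>m n m + \<sigma> x * \<sigma> y = \<sigma> x * \<sigma> y"
        using cr[OF x] cr[OF y] by auto
      have "?t x * ?t y = four_block_mat (\<rho> x * \<rho> y + 0\<^sub>m n m * 0\<^sub>m m n) (\<rho> x * 0\<^sub>m n m + 0\<^sub>m n m * \<sigma> y)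
        (0\<^sub>m m n * \<rho> y + \<sigma> x * 0\<^sub>m m n) (0\<^sub>m m n * 0\<^sub>m n m + \<sigma> x * \<sigma> y)"
        using cr[OF x] cr[OF y] by (intro mult_four_block_mat) auto
      thus ?thesis unfolding z using r x y by (simp add: matrix_rep_def)
    qed
  next
    show "?t \<one>\<^bsub>G\<^esub> = 1\<^sub>m (n + m)" using r by (simp add: matrix_rep_def)
  qed
  moreover have "mat_trace (?t x) = mat_trace (\<rho> x) + mat_trace (\<sigma> x)" if x: "x \<in> carrier G" for x
  proof -
    have "mat_trace (?t x) = (\<Sum>i<n+m. ?t x $$ (i,i))" using cr[OF x] by (intro mat_trace_carrier) auto
    also have "\<dots> = (\<Sum>i<n. ?t x $$ (i,i)) + (\<Sum>i=n..<n+m. ?t x $$ (i,i))"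
      using sum.atLeastLessThan_concat[of 0 n "n + m" "\<lambda>i. ?t x $$ (i,i)"] by (simp add: atLeast0LessThan)
    also have "(\<Sum>i=n..<n+m. ?t x $$ (i,i)) = (\<Sum>i<m. ?t x $$ (i+n,i+n))"
      using sum.shift_bounds_nat_ivl[of "\<lambda>i. ?t x $$ (i,i)" 0 n m] by (simp add: atLeast0LessThan add.commute)
    also have "(\<Sum>i<n. ?t x $$ (i,i)) = mat_trace (\<rho> x)" unfolding mat_trace_carrier[OF cr(1)[OF x]]
      using cr[OF x] by (intro sum.cong) auto
    also have "(\<Sum>i<m. ?t x $$ (i+n,i+n)) = mat_trace (\<sigma> x)" unfolding mat_trace_carrier[OF cr(2)[OF x]]
      using cr[OF x] by (intro sum.cong) auto
    finally show ?thesis .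
  qed
  ultimately show ?thesis unfolding r Char_def by (auto simp: rep_char_def fun_eq_iff intro!: exI[of _ ?t])
qed

lemma Char_zero: "group G \<Longrightarrow> (\<lambda>x. 0) \<in> Char G"
  unfolding Char_def
  by (auto simp: matrix_rep_def rep_char_def mat_trace_def intro!: exI[of _ 0] exI[of _ "\<lambda>_. 1\<^sub>m 0"])

lemma Char_sum:
  assumes "group G" "finite S" "\<And>i. i \<in> S \<Longrightarrow> \<phi> i \<in> Char G"
  shows "(\<lambda>x. \<Sum>i\<in>S. \<phi> i x) \<in> Char G"
  using assms(2,3) by (induction S rule: finite_induct) (auto intro: Char_zero[OF assms(1)] Char_add)

section \<open>Multiplicities as inner products\<close>

lemma char_ip_sum_right:
  "char_ip G \<chi> (\<lambda>x. \<Sum>i\<in>S. \<phi> i x) = (\<Sum>i\<in>S. char_ip G \<chi> (\<phi> i))"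
  unfolding char_ip_def sum_distrib_left sum_divide_distrib by (rule sum.swap)

lemma char_ip_add_right:
  "char_ip G \<chi> (\<lambda>x. \<phi> x + \<psi> x) = char_ip G \<chi> \<phi> + char_ip G \<chi> \<psi>"
  by (simp add: char_ip_def sum.distrib distrib_left add_divide_distrib)

lemma char_ip_sum_left:
  "char_ip G (\<lambda>x. \<Sum>i\<in>S. \<phi> i x) \<chi> = (\<Sum>i\<in>S. char_ip G (\<phi> i) \<chi>)"
  unfolding char_ip_def sum_distrib_right sum_divide_distrib by (rule sum.swap)

lemma char_ip_cong_right: "(\<And>x. x \<in> carrier G \<Longrightarrow> \<phi> x = \<psi> x) \<Longrightarrow> char_ip G \<chi> \<phi> = char_ip G \<chi> \<psi>"
  by (simp add: char_ip_def)

context finite_grp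
begin

lemma char_ip_Irr: "\<chi> \<in> Irr G \<Longrightarrow> \<psi> \<in> Irr G \<Longrightarrow> char_ip G \<chi> \<psi> = (if \<chi> = \<psi> then 1 else 0)"
  using char_ip_Irr_self char_ip_Irr_distinct by auto

lemma char_ip_Irr_sum:
  assumes "\<chi> \<in> Irr G" "\<And>i. i < k \<Longrightarrow> \<sigma> i \<in> Irr G"
  shows "char_ip G \<chi> (\<lambda>x. \<Sum>i<(k::nat). \<sigma> i x) = of_nat (card {i. i < k \<and> \<sigma> i = \<chi>})"
proof -
  have "char_ip G \<chi> (\<lambda>x. \<Sum>i<(k::nat). \<sigma> i x) = (\<Sum>i<k. if \<sigma> i = \<chi> then 1 else 0)"
    unfolding char_ip_sum_right using assms by (intro sum.cong) (auto simp: char_ip_Irr)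
  also have "\<dots> = of_nat (card {i. i < k \<and> \<sigma> i = \<chi>})"
    by (simp add: sum.If_cases Int_def lessThan_def)
  finally show ?thesis .
qed

text \<open>Values of the form that are natural numbers cannot cancel each other, which lets
  constituents be followed through sums of characters.\<close>

lemma char_ip_Irr_Char_nat:
  assumes "\<chi> \<in> Irr G" "\<psi> \<in> Char G"
  obtains m :: nat where "char_ip G \<chi> \<psi> = of_nat m"
proof (rule Char_sum_of_Irr[OF is_group assms(2)])
  fix k \<sigma> assume "\<And>i. i < k \<Longrightarrow> \<sigma> i \<in> Irr G" "\<psi> = (\<lambda>x. \<Sum>i<(k::nat). \<sigma> i x)"
  thus thesis using that char_ip_Irr_sum[OF assms(1), of k \<sigma>] by simp
qed

text \<open>Links the definition by a complementary representation to a multiplicity. A nonzero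
  inner product means that some index of the decomposition carries \<open>\<chi>\<close>; the
  remaining summands form the complement.\<close>

lemma irr_constituent_iff:
  assumes "\<psi> \<in> Char G"
  shows "irr_constituent G \<chi> \<psi> \<longleftrightarrow> \<chi> \<in> Irr G \<and> char_ip G \<chi> \<psi> \<noteq> 0"
proof
  assume "irr_constituent G \<chi> \<psi>"
  then obtain n \<rho> where 1: "\<chi> \<in> Irr G" "matrix_rep G n \<rho>" "\<psi> = (\<lambda>x. \<chi> x + rep_char G \<rho> x)"
    by (auto simp: irr_constituent_def)
  hence "rep_char G \<rho> \<in> Char G" by (auto simp: Char_def)
  from char_ip_Irr_Char_nat[OF 1(1) this] obtain m where m: "char_ip G \<chi> (rep_char G \<rho>) = of_nat m" .
  have "char_ip G \<chi> \<psi> = of_nat (Suc m)" unfolding 1(3) char_ip_add_right m using char_ip_Irr_self[OF 1(1)] by simp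
  thus "\<chi> \<in> Irr G \<and> char_ip G \<chi> \<psi> \<noteq> 0" using 1(1) by (metis of_nat_eq_0_iff nat.distinct(1))
next
  assume 1: "\<chi> \<in> Irr G \<and> char_ip G \<chi> \<psi> \<noteq> 0"
  obtain k \<sigma> where \<sigma>: "\<And>i. i < k \<Longrightarrow> \<sigma> i \<in> Irr G" "\<psi> = (\<lambda>x. \<Sum>i<(k::nat). \<sigma> i x)"
    using Char_sum_of_Irr[OF is_group assms] by metis
  have "card {i. i < k \<and> \<sigma> i = \<chi>} \<noteq> 0" using 1 char_ip_Irr_sum[of \<chi> k \<sigma>] \<sigma> by auto
  then obtain i where i: "i < k" "\<sigma> i = \<chi>" by (metis (mono_tags, lifting) card.empty empty_Collect_eq)
  have "(\<lambda>x. \<Sum>j\<in>{..<k} - {i}. \<sigma> j x) \<in> Char G"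
    using \<sigma>(1) by (intro Char_sum is_group) (auto intro: Irr_imp_Char)
  then obtain n \<rho> where \<rho>: "matrix_rep G n \<rho>" "(\<lambda>x. \<Sum>j\<in>{..<k} - {i}. \<sigma> j x) = rep_char G \<rho>"
    unfolding Char_def by blast
  have "\<psi> = (\<lambda>x. \<chi> x + rep_char G \<rho> x)"
    unfolding \<sigma>(2) \<rho>(2)[symmetric] using i by (auto simp: sum.remove[of "{..<k}" i])
  thus "irr_constituent G \<chi> \<psi>" using 1 \<rho>(1) unfolding irr_constituent_def by blast
qed

lemma Char_eq_zero_or_constituent:
  assumes "\<psi> \<in> Char G" "\<psi> \<noteq> (\<lambda>x. 0)"
  obtains \<chi> where "\<chi> \<in> Irr G" "char_ip G \<chi> \<psi> \<noteq> 0"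
proof -
  obtain k \<sigma> where \<sigma>: "\<And>i. i < k \<Longrightarrow> \<sigma> i \<in> Irr G" "\<psi> = (\<lambda>x. \<Sum>i<(k::nat). \<sigma> i x)"
    using Char_sum_of_Irr[OF is_group assms(1)] by metis
  have k: "0 < k" using \<sigma>(2) assms(2) by (cases k) auto
  have "char_ip G (\<sigma> 0) \<psi> = of_nat (card {i. i < k \<and> \<sigma> i = \<sigma> 0})"
    unfolding \<sigma>(2) using \<sigma>(1) k by (intro char_ip_Irr_sum) auto
  moreover have "card {i. i < k \<and> \<sigma> i = \<sigma> 0} \<noteq> 0" using k by auto
  ultimately show thesis using that[of "\<sigma> 0"] \<sigma>(1)[OF k] by auto
qed

lemma irr_constituent_Irr_iff:
  assumes "\<psi> \<in> Irr G"
  shows "irr_constituent G \<chi> \<psi> \<longleftrightarrow> \<chi> = \<psi>"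
  using assms by (auto simp: irr_constituent_iff[OF Irr_imp_Char[OF assms]] char_ip_Irr split: if_splits)

text \<open>For \<open>k\<close> irreducible summands the norm is the number of pairs of indices
  with equal summands. The diagonal pairs alone give at least \<open>k\<close>, so norm 1 leaves a
  single summand.\<close>

lemma Irr_criterion:
  assumes "\<psi> \<in> Char G" "char_ip G \<psi> \<psi> = 1"
  shows "\<psi> \<in> Irr G"
proof -
  obtain k \<sigma> where \<sigma>: "\<And>i. i < k \<Longrightarrow> \<sigma> i \<in> Irr G" "\<psi> = (\<lambda>x. \<Sum>i<(k::nat). \<sigma> i x)"
    using Char_sum_of_Irr[OF is_group assms(1)] by metis
  have "char_ip G \<psi> \<psi> = (\<Sum>i<k. char_ip G (\<sigma> i) \<psi>)" unfolding \<sigma>(2) by (rule char_ip_sum_left)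
  also have "\<dots> = (\<Sum>i<k. of_nat (card {j. j < k \<and> \<sigma> j = \<sigma> i}))"
    unfolding \<sigma>(2) using \<sigma>(1) by (intro sum.cong refl char_ip_Irr_sum) auto
  also have "\<dots> = of_nat (\<Sum>i<k. card {j. j < k \<and> \<sigma> j = \<sigma> i})" by simp
  finally have eq: "(\<Sum>i<k. card {j. j < k \<and> \<sigma> j = \<sigma> i}) = 1" 
    using assms(2) of_nat_eq_1_iff[where 'a = complex] by metis
  have "(\<Sum>i<k. 1) \<le> (\<Sum>i<k. card {j. j < k \<and> \<sigma> j = \<sigma> i})"
  proof (intro sum_mono)
    fix i assume "i \<in> {..<k}"
    hence "card {i} \<le> card {j. j < k \<and> \<sigma> j = \<sigma> i}" by (intro card_mono) auto
    thus "1 \<le> card {j. j < k \<and> \<sigma> j = \<sigma> i}" by simp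
  qed
  hence "k \<le> 1" using eq by simp
  moreover have "k \<noteq> 0" using eq by (cases "k = 0") auto
  ultimately have "k = 1" by simp
  thus ?thesis using \<sigma> by auto
qed

lemma Char_class_function:
  assumes "\<chi> \<in> Char G" "x \<in> carrier G" "g \<in> carrier G"
  shows "\<chi> (x \<otimes> g \<otimes> inv x) = \<chi> g"
proof -
  from assms obtain n \<rho> where \<rho>: "matrix_rep G n \<rho>" "\<chi> = rep_char G \<rho>" by (auto simp: Char_def)
  have cr: "\<rho> y \<in> carrier_mat n n" if "y \<in> carrier G" for y using \<rho> that by (auto simp: matrix_rep_def)
  have "\<rho> (x \<otimes> g \<otimes> inv x) = \<rho> x * \<rho> g * \<rho> (inv x)" using \<rho> assms by (simp add: matrix_rep_def)
  moreover have "mat_trace (\<rho> x * \<rho> g * \<rho> (inv x)) = mat_trace (\<rho> g)"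
    using assms cr matrix_rep_inv[OF \<rho>(1) assms(2)] by (intro mat_trace_conj) auto
  ultimately show ?thesis using assms \<rho> by (simp add: rep_char_def)
qed

lemma matrix_rep_finite_order:
  assumes "matrix_rep G n \<rho>" "x \<in> carrier G"
  shows "\<rho> x ^\<^sub>m card (carrier G) = 1\<^sub>m n"
  using matrix_rep_pow[OF assms, of "card (carrier G)"] pow_order_eq_1[OF assms(2)] assms(1)
  by (simp add: Coset.order_def matrix_rep_def)

end

lemma matrix_rep_subgroup:
  "matrix_rep G n \<rho> \<Longrightarrow> H \<subseteq> carrier G \<Longrightarrow> matrix_rep (G\<lparr>carrier := H\<rparr>) n \<rho>"
  by (auto simp: matrix_rep_def)

lemma restrict_rep_char: "H \<subseteq> carrier G \<Longrightarrow> restrict_char H (rep_char G \<rho>) = rep_char (G\<lparr>carrier := H\<rparr>) \<rho>"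
  by (auto simp: restrict_char_def rep_char_def fun_eq_iff)

lemma restrict_Char: "\<chi> \<in> Char G \<Longrightarrow> H \<subseteq> carrier G \<Longrightarrow> restrict_char H \<chi> \<in> Char (G\<lparr>carrier := H\<rparr>)"
  unfolding Char_def using matrix_rep_subgroup[of G _ _ H] restrict_rep_char[of H G] by blast

section \<open>Linear and induced characters\<close>

definition lin_char :: "('a, 'b) monoid_scheme \<Rightarrow> ('a \<Rightarrow> complex) \<Rightarrow> bool" where
  "lin_char G \<mu> \<longleftrightarrow> \<mu> \<one>\<^bsub>G\<^esub> = 1 \<and> (\<forall>x\<in>carrier G. \<forall>y\<in>carrier G. \<mu> (x \<otimes>\<^bsub>G\<^esub> y) = \<mu> x * \<mu> y) \<and>
     (\<forall>x. x \<notin> carrier G \<longrightarrow> \<mu> x = 0)"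

lemma lin_char_one: "lin_char G \<mu> \<Longrightarrow> \<mu> \<one>\<^bsub>G\<^esub> = 1"
  by (simp add: lin_char_def)

lemma lin_char_mult:
  "lin_char G \<mu> \<Longrightarrow> x \<in> carrier G \<Longrightarrow> y \<in> carrier G \<Longrightarrow> \<mu> (x \<otimes>\<^bsub>G\<^esub> y) = \<mu> x * \<mu> y"
  by (simp add: lin_char_def)

lemma (in group) lin_char_inv:
  assumes "lin_char G \<mu>" "x \<in> carrier G"
  shows "\<mu> (inv x) * \<mu> x = 1" "\<mu> x * \<mu> (inv x) = 1" "\<mu> x \<noteq> 0"
proof -
  show *: "\<mu> (inv x) * \<mu> x = 1" using assms by (metis inv_closed l_inv lin_char_mult lin_char_one)
  thus "\<mu> x * \<mu> (inv x) = 1" by (simp add: mult.commute)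
  show "\<mu> x \<noteq> 0" using * by auto
qed

lemma (in group) lin_char_pow:
  assumes "lin_char G \<mu>" "x \<in> carrier G"
  shows "\<mu> (x [^] (k::nat)) = \<mu> x ^ k"
  using assms by (induction k) (auto simp: lin_char_def)

lemma (in group) lin_char_conj:
  assumes "lin_char G \<mu>" "x \<in> carrier G" "t \<in> carrier G"
  shows "\<mu> (t \<otimes> x \<otimes> inv t) = \<mu> x"
  using assms lin_char_inv[OF assms(1,3)] by (simp add: lin_char_mult)

lemma lin_char_restrict:
  assumes "lin_char G \<mu>" "H \<subseteq> carrier G" "subgroup H G"
  shows "lin_char (G\<lparr>carrier := H\<rparr>) (restrict_char H \<mu>)"
  unfolding lin_char_def
proof (intro conjI ballI allI impI)
  fix x y assume "x \<in> carrier (G\<lparr>carrier := H\<rparr>)" "y \<in> carrier (G\<lparr>carrier := H\<rparr>)"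
  hence xy: "x \<in> H" "y \<in> H" by auto
  hence "x \<otimes>\<^bsub>G\<^esub> y \<in> H" using assms(3) by (simp add: subgroup.m_closed)
  thus "restrict_char H \<mu> (x \<otimes>\<^bsub>G\<lparr>carrier := H\<rparr>\<^esub> y) = restrict_char H \<mu> x * restrict_char H \<mu> y"
    using xy assms(1,2) by (auto simp: restrict_char_def lin_char_mult subset_iff)
qed (use assms in \<open>auto simp: restrict_char_def lin_char_one subgroup.one_closed\<close>)

lemma lin_char_Irr:
  assumes G: "group G" and \<mu>: "lin_char G \<mu>"
  shows "\<mu> \<in> Irr G"
proof -
  let ?r = "\<lambda>x. mat 1 1 (\<lambda>_. \<mu> x)"
  have rep: "matrix_rep G 1 ?r"
    unfolding matrix_rep_def using \<mu>
    by (auto simp: lin_char_def scalar_prod_def intro!: eq_matI)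
  have irr: "W = {0\<^sub>v 1} \<or> W = carrier_vec 1"
    if W: "VectorSpace.subspace class_ring W (module_vec TYPE(complex) 1)" for W
  proof (cases "W = {0\<^sub>v 1}")
    case False
    with W obtain w where w: "w \<in> W" "w \<noteq> 0\<^sub>v 1" "w \<in> carrier_vec 1" unfolding subspace_vec_iff by blast
    hence w0: "w $ 0 \<noteq> 0" by (auto simp: vec_eq_iff)
    have "v \<in> W" if "v \<in> carrier_vec 1" for v
    proof -
      have "v = (v $ 0 / w $ 0) \<cdot>\<^sub>v w" using that w w0 by (intro eq_vecI) auto
      thus ?thesis using W w(1) unfolding subspace_vec_iff by metis
    qed
    thus ?thesis using W unfolding subspace_vec_iff by blast
  qed simp
  have "irreducible_rep G 1 ?r" unfolding irreducible_rep_def using rep irr by auto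
  moreover have "\<mu> = rep_char G ?r" using \<mu> by (auto simp: lin_char_def rep_char_def mat_trace_def fun_eq_iff)
  ultimately show ?thesis unfolding Irr_def by blast
qed

lemma irreducible_repD:
  assumes "irreducible_rep G n \<rho>" "VectorSpace.subspace class_ring W (module_vec TYPE(complex) n)"
    "\<And>x w. x \<in> carrier G \<Longrightarrow> w \<in> W \<Longrightarrow> \<rho> x *\<^sub>v w \<in> W"
  shows "W = {0\<^sub>v n} \<or> W = carrier_vec n"
  using assms unfolding irreducible_rep_def by blast

lemma (in group) subgroup_mult_left_iff:
  assumes "subgroup T G" "t \<in> T" "u \<in> carrier G"
  shows "t \<otimes> u \<in> T \<longleftrightarrow> u \<in> T"
proof
  assume "t \<otimes> u \<in> T"
  hence *: "inv t \<otimes> (t \<otimes> u) \<in> T" by (rule subgroup.m_closed[OF assms(1) subgroup.m_inv_closed[OF assms(1,2)]])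
  have "inv t \<otimes> (t \<otimes> u) = u" using assms(3) subgroup.mem_carrier[OF assms(1,2)] by (simp flip: m_assoc)
  thus "u \<in> T" using * by simp
qed (use assms in \<open>simp add: subgroup.m_closed\<close>)

lemma (in group) subgroup_conj_iff:
  assumes "subgroup T G" "t \<in> T" "u \<in> carrier G"
  shows "t \<otimes> u \<otimes> inv t \<in> T \<longleftrightarrow> u \<in> T"
proof
  have tc: "t \<in> carrier G" using subgroup.mem_carrier[OF assms(1,2)] .
  assume "t \<otimes> u \<otimes> inv t \<in> T"
  hence "t \<otimes> u \<otimes> inv t \<otimes> t \<in> T" using assms by (simp add: subgroup.m_closed)
  hence "t \<otimes> u \<in> T" using tc assms(3) by (simp add: m_assoc)
  thus "u \<in> T" using subgroup_mult_left_iff[OF assms] by simp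
qed (use assms in \<open>simp add: subgroup.m_closed subgroup.m_inv_closed\<close>)

lemma Char_times_lin_char:
  assumes "\<chi> \<in> Char G" "lin_char G \<mu>"
  shows "(\<lambda>x. \<chi> x * \<mu> x) \<in> Char G"
proof -
  from assms obtain n \<rho> where \<rho>: "matrix_rep G n \<rho>" "\<chi> = rep_char G \<rho>" by (auto simp: Char_def)
  have cr: "\<rho> x \<in> carrier_mat n n" if "x \<in> carrier G" for x using \<rho> that by (auto simp: matrix_rep_def)
  have "(\<mu> x * \<mu> y) \<cdot>\<^sub>m (\<rho> x * \<rho> y) = (\<mu> x \<cdot>\<^sub>m \<rho> x) * (\<mu> y \<cdot>\<^sub>m \<rho> y)"
    if "x \<in> carrier G" "y \<in> carrier G" for x y
    using cr[OF that(1)] cr[OF that(2)]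
    by (intro eq_matI) (auto simp: scalar_prod_def sum_distrib_left intro!: sum.cong)
  hence "matrix_rep G n (\<lambda>x. \<mu> x \<cdot>\<^sub>m \<rho> x)"
    using \<rho>(1) assms(2) cr by (auto simp: matrix_rep_def lin_char_def)
  moreover have "rep_char G (\<lambda>x. \<mu> x \<cdot>\<^sub>m \<rho> x) = (\<lambda>x. \<chi> x * \<mu> x)"
  proof (rule ext)
    fix x
    show "rep_char G (\<lambda>x. \<mu> x \<cdot>\<^sub>m \<rho> x) x = \<chi> x * \<mu> x"
    proof (cases "x \<in> carrier G")
      case True
      have "mat_trace (\<mu> x \<cdot>\<^sub>m \<rho> x) = (\<Sum>i<n. \<mu> x * \<rho> x $$ (i,i))"
        using cr[OF True] by (simp add: mat_trace_def)
      also have "\<dots> = \<mu> x * mat_trace (\<rho> x)"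
        unfolding mat_trace_carrier[OF cr[OF True]] by (simp add: sum_distrib_left)
      finally show ?thesis using True \<rho>(2) by (simp add: rep_char_def)
    qed (simp add: \<rho>(2) rep_char_def)
  qed
  ultimately show ?thesis unfolding Char_def by (metis (mono_tags, lifting) mem_Collect_eq)
qed

text \<open>The values of \<open>\<mu>\<close> at \<open>g\<close> and at its inverse cancel, so
  twisting does not change the norm.\<close>

lemma (in finite_grp) Irr_times_lin_char:
  assumes "\<chi> \<in> Irr G" "lin_char G \<mu>"
  shows "(\<lambda>x. \<chi> x * \<mu> x) \<in> Irr G"
proof (rule Irr_criterion)
  show "(\<lambda>x. \<chi> x * \<mu> x) \<in> Char G" using Char_times_lin_char Irr_imp_Char assms by blast
  have "char_ip G (\<lambda>x. \<chi> x * \<mu> x) (\<lambda>x. \<chi> x * \<mu> x) = char_ip G \<chi> \<chi>"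
    unfolding char_ip_def
  proof (intro arg_cong2[of _ _ _ _ "(/)"] sum.cong refl)
    fix g assume "g \<in> carrier G"
    from lin_char_inv(1)[OF assms(2) this]
    have "\<chi> (inv g) * \<chi> g * (\<mu> (inv g) * \<mu> g) = \<chi> (inv g) * \<chi> g" by simp
    thus "\<chi> (inv g) * \<mu> (inv g) * (\<chi> g * \<mu> g) = \<chi> (inv g) * \<chi> g" by (simp add: mult_ac)
  qed
  thus "char_ip G (\<lambda>x. \<chi> x * \<mu> x) (\<lambda>x. \<chi> x * \<mu> x) = 1" using char_ip_Irr_self[OF assms(1)] by simp
qed

text \<open>In a commutative group every representing matrix commutes with all the others and is
  scalar by Schur's lemma, so every line is invariant.\<close>

lemma (in finite_grp) Irr_comm_group_lin_char:
  assumes comm: "\<And>x y. x \<in> carrier G \<Longrightarrow> y \<in> carrier G \<Longrightarrow> x \<otimes> y = y \<otimes> x" and \<chi>: "\<chi> \<in> Irr G"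
  shows "lin_char G \<chi>"
proof -
  from \<chi> obtain n \<rho> where \<rho>: "irreducible_rep G n \<rho>" "\<chi> = rep_char G \<rho>" by (auto simp: Irr_def)
  have r: "matrix_rep G n \<rho>" and n: "n > 0" using \<rho> by (auto simp: irreducible_rep_def)
  have cr: "\<rho> g \<in> carrier_mat n n" if "g \<in> carrier G" for g using r that by (auto simp: matrix_rep_def)
  have sc: "\<exists>c. \<rho> x = c \<cdot>\<^sub>m 1\<^sub>m n" if x: "x \<in> carrier G" for x
  proof -
    have "\<rho> h * \<rho> x = \<rho> x * \<rho> h" if "h \<in> carrier G" for h
      using r x that comm[OF x that] unfolding matrix_rep_def by metis
    from irreducible_self_intertwiner_scalar[OF \<rho>(1) cr[OF x] this] show ?thesis by blast
  qed
  \<comment> \<open>The line through the first unit vector; being invariant and nonzero it is the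
    whole space, and so the degree is 1.\<close>
  let ?W = "{v :: complex vec. v \<in> carrier_vec n \<and> (\<forall>i<n. i > 0 \<longrightarrow> v $ i = 0)}"
  have "VectorSpace.subspace class_ring ?W (module_vec TYPE(complex) n)"
    unfolding subspace_vec_iff by auto
  moreover have "\<rho> x *\<^sub>v w \<in> ?W" if x: "x \<in> carrier G" and w: "w \<in> ?W" for x w
  proof -
    obtain c where "\<rho> x = c \<cdot>\<^sub>m 1\<^sub>m n" using sc[OF x] by auto
    hence "\<rho> x *\<^sub>v w = c \<cdot>\<^sub>v w" using w by (intro eq_vecI) (auto simp: scalar_prod_left_unit)
    thus ?thesis using w by auto
  qed
  ultimately have or: "?W = {0\<^sub>v n} \<or> ?W = carrier_vec n" by (rule irreducible_repD[OF \<rho>(1)])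
  have ne: "?W \<noteq> {0\<^sub>v n}"
  proof
    assume "?W = {0\<^sub>v n}"
    moreover have "unit_vec n 0 \<in> ?W" by (auto simp: unit_vec_def)
    ultimately have "unit_vec n 0 = (0\<^sub>v n :: complex vec)" by blast
    hence "(unit_vec n 0 :: complex vec) $ 0 = 0" using n by simp
    thus False using n by simp
  qed
  from or ne have W: "?W = carrier_vec n" by (simp only: simp_thms)
  have "n = 1"
  proof (rule ccontr)
    assume "n \<noteq> 1"
    hence n1: "1 < n" using n by simp
    have "unit_vec n 1 \<in> ?W" unfolding W by simp
    hence "\<forall>i<n. i > 0 \<longrightarrow> (unit_vec n 1 :: complex vec) $ i = 0" unfolding mem_Collect_eq by (rule conjunct2)
    hence "(unit_vec n 1 :: complex vec) $ 1 = 0" 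
      by (elim allE[of _ 1]) (simp only: n1 zero_less_one simp_thms)
    thus False using n1 by simp
  qed
  have val: "\<chi> x = \<rho> x $$ (0,0)" if "x \<in> carrier G" for x
    using \<rho>(2) that cr[OF that] \<open>n = 1\<close> by (simp add: rep_char_def mat_trace_def)
  have "\<chi> (x \<otimes> y) = \<chi> x * \<chi> y" if xy: "x \<in> carrier G" "y \<in> carrier G" for x y
  proof -
    have "\<chi> (x \<otimes> y) = (\<rho> x * \<rho> y) $$ (0,0)" using val[of "x \<otimes> y"] xy r by (simp add: matrix_rep_def)
    thus ?thesis using val xy cr[OF xy(1)] cr[OF xy(2)] \<open>n = 1\<close> by (simp add: scalar_prod_def)
  qed
  moreover have "\<chi> \<one> = 1" using rep_char_one[OF is_group r] \<rho>(2) \<open>n = 1\<close> by simp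
  ultimately show ?thesis using \<rho>(2) by (auto simp: lin_char_def rep_char_def)
qed

section \<open>Induction from subgroups\<close>

lemma (in finite_grp) finite_grp_subgroup: "subgroup H G \<Longrightarrow> finite_grp (G\<lparr>carrier := H\<rparr>)"
  using finite_subset[OF subgroup.subset finite_carrier]
  by (simp add: finite_grp_def finite_grp_axioms_def subgroup_imp_group)

lemma (in group) inv_subgroup: "subgroup H G \<Longrightarrow> x \<in> H \<Longrightarrow> inv\<^bsub>G\<lparr>carrier := H\<rparr>\<^esub> x = inv x"
  by (rule m_inv_consistent)

lemma induced_char_alt:
  "induced_char G T \<mu> g = (if g \<in> carrier G then
     (\<Sum>x\<in>carrier G. restrict_char T \<mu> (x \<otimes>\<^bsub>G\<^esub> g \<otimes>\<^bsub>G\<^esub> inv\<^bsub>G\<^esub> x)) / of_nat (card T) else 0)"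
  by (simp add: induced_char_def restrict_char_def)

context finite_grp
begin

lemma sum_conj:
  assumes x: "x \<in> carrier G"
  shows "(\<Sum>g\<in>carrier G. f (x \<otimes> g \<otimes> inv x)) = (\<Sum>g\<in>carrier G. f g)"
proof (rule sum.reindex_bij_witness[of _ "\<lambda>g. inv x \<otimes> g \<otimes> x" "\<lambda>g. x \<otimes> g \<otimes> inv x"])
  fix g assume g: "g \<in> carrier G"
  show "inv x \<otimes> (x \<otimes> g \<otimes> inv x) \<otimes> x = g" "x \<otimes> (inv x \<otimes> g \<otimes> x) \<otimes> inv x = g"
    using x g by (auto simp: m_assoc) (auto simp flip: m_assoc)
qed (use x in auto)

text \<open>Since \<open>\<psi>\<close> is a class function, each conjugating element
  \<open>x\<close> contributes the same sum over the group, and that sum lives on \<open>T\<close>.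
  The function \<open>\<mu>\<close> on \<open>T\<close> is arbitrary.\<close>

lemma Frobenius_reciprocity:
  assumes T: "subgroup T G" and \<psi>: "\<psi> \<in> Char G"
  shows "char_ip G (induced_char G T \<mu>) \<psi> = char_ip (G\<lparr>carrier := T\<rparr>) \<mu> (restrict_char T \<psi>)"
proof -
  have Tc: "T \<subseteq> carrier G" using T subgroup.subset by blast
  let ?m = "restrict_char T \<mu>"
  have "(\<Sum>g\<in>carrier G. induced_char G T \<mu> (inv g) * \<psi> g) =
     (\<Sum>g\<in>carrier G. \<Sum>x\<in>carrier G. ?m (x \<otimes> inv g \<otimes> inv x) * \<psi> g) / of_nat (card T)"
    unfolding induced_char_alt by (simp add: sum_divide_distrib sum_distrib_right)
  also have "(\<Sum>g\<in>carrier G. \<Sum>x\<in>carrier G. ?m (x \<otimes> inv g \<otimes> inv x) * \<psi> g) =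
     (\<Sum>x\<in>carrier G. \<Sum>g\<in>carrier G. ?m (x \<otimes> inv g \<otimes> inv x) * \<psi> g)" by (rule sum.swap)
  also have "\<dots> = (\<Sum>x\<in>carrier G. \<Sum>g\<in>carrier G. ?m (inv g) * \<psi> g)"
  proof (rule sum.cong[OF refl])
    fix x assume x: "x \<in> carrier G"
    have "(\<Sum>g\<in>carrier G. ?m (x \<otimes> inv g \<otimes> inv x) * \<psi> g) =
      (\<Sum>g\<in>carrier G. ?m (inv (x \<otimes> g \<otimes> inv x)) * \<psi> (x \<otimes> g \<otimes> inv x))"
    proof (intro sum.cong refl)
      fix g assume g: "g \<in> carrier G"
      have "x \<otimes> inv g \<otimes> inv x = inv (x \<otimes> g \<otimes> inv x)" using x g by (simp add: inv_mult_group m_assoc)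
      thus "?m (x \<otimes> inv g \<otimes> inv x) * \<psi> g = ?m (inv (x \<otimes> g \<otimes> inv x)) * \<psi> (x \<otimes> g \<otimes> inv x)"
        using Char_class_function[OF \<psi> x g] by simp
    qed
    also have "\<dots> = (\<Sum>g\<in>carrier G. ?m (inv g) * \<psi> g)" by (rule sum_conj[OF x])
    finally show "(\<Sum>g\<in>carrier G. ?m (x \<otimes> inv g \<otimes> inv x) * \<psi> g) = (\<Sum>g\<in>carrier G. ?m (inv g) * \<psi> g)" .
  qed
  also have "\<dots> = of_nat (card (carrier G)) * (\<Sum>g\<in>carrier G. ?m (inv g) * \<psi> g)" by simp
  also have "(\<Sum>g\<in>carrier G. ?m (inv g) * \<psi> g) = (\<Sum>g\<in>T. ?m (inv g) * \<psi> g)"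
  proof (rule sum.mono_neutral_right)
    show "\<forall>g\<in>carrier G - T. ?m (inv g) * \<psi> g = 0"
      using T by (auto simp: restrict_char_def) (metis inv_inv subgroup.m_inv_closed)
  qed (use Tc in auto)
  also have "\<dots> = (\<Sum>g\<in>T. \<mu> (inv g) * restrict_char T \<psi> g)"
    using T by (intro sum.cong) (auto simp: restrict_char_def subgroup.m_inv_closed)
  finally show ?thesis using card_pos T unfolding char_ip_def by (auto simp: inv_subgroup)
qed

lemma right_transversal_exists:
  assumes T: "subgroup T G"
  obtains k and x :: "nat \<Rightarrow> 'a" where "\<And>i. i < k \<Longrightarrow> x i \<in> carrier G"
    "\<And>g. g \<in> carrier G \<Longrightarrow> \<exists>!i. i < k \<and> g \<otimes> inv (x i) \<in> T"
proof -
  have fin: "finite (rcosets T)" using finite_subset[OF rcosets_subset_PowG[OF T]] by simp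
  obtain e where e: "bij_betw e {..<card (rcosets T)} (rcosets T)"
    using ex_bij_betw_nat_finite[OF fin] by (auto simp: atLeast0LessThan)
  define x where "x = (\<lambda>i. SOME y. y \<in> carrier G \<and> e i = T #> y)"
  have x: "x i \<in> carrier G \<and> e i = T #> x i" if "i < card (rcosets T)" for i
  proof -
    have "e i \<in> rcosets T" using e that by (auto simp: bij_betw_def)
    hence "\<exists>y. y \<in> carrier G \<and> e i = T #> y" by (auto simp: RCOSETS_def)
    thus ?thesis unfolding x_def by (rule someI_ex)
  qed
  have mem: "g \<otimes> inv y \<in> T \<longleftrightarrow> T #> g = T #> y" if "g \<in> carrier G" "y \<in> carrier G" for g y
    by (metis T coset_join1 coset_mult_inv2 inv_closed m_closed repr_independence rcos_self coset_join2
       coset_mult_inv1 subgroup.subset that(1) that(2))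
  show thesis
  proof (rule that[of "card (rcosets T)" x])
    fix g assume g: "g \<in> carrier G"
    have "T #> g \<in> rcosets T" using g by (auto simp: RCOSETS_def)
    hence "T #> g \<in> e ` {..<card (rcosets T)}" using e by (simp add: bij_betw_def)
    then obtain i where i: "i < card (rcosets T)" "e i = T #> g" by auto
    show "\<exists>!i. i < card (rcosets T) \<and> g \<otimes> inv (x i) \<in> T"
    proof (rule ex1I[of _ i])
      show "i < card (rcosets T) \<and> g \<otimes> inv (x i) \<in> T" using i x[OF i(1)] mem g by auto
      fix j assume j: "j < card (rcosets T) \<and> g \<otimes> inv (x j) \<in> T"
      hence "e j = T #> g" using x mem g by auto
      thus "j = i" using i j e by (auto simp: bij_betw_def inj_on_def)
    qed
  qed (use x in auto)
qed

text \<open>The representation is monomial, indexed by a right transversal: the \<open>(i,j)\<close>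
  entry is the value of \<open>\<mu>\<close>, extended by zero, at
  \<open>x i \<otimes> g \<otimes> inv (x j)\<close>. In a matrix product only the one
  \<open>j\<close> with \<open>x i \<otimes> g\<close> in the coset of \<open>x j\<close>
  survives.\<close>

lemma induced_lin_char_Char:
  assumes T: "subgroup T G" and \<mu>: "lin_char (G\<lparr>carrier := T\<rparr>) \<mu>"
  shows "induced_char G T \<mu> \<in> Char G"
proof -
  obtain k and x :: "nat \<Rightarrow> 'a" where x: "\<And>i. i < k \<Longrightarrow> x i \<in> carrier G"
    and tr: "\<And>g. g \<in> carrier G \<Longrightarrow> \<exists>!i. i < k \<and> g \<otimes> inv (x i) \<in> T"
    using right_transversal_exists[OF T] by metis
  have Tc: "T \<subseteq> carrier G" using T subgroup.subset by blast
  let ?m = "restrict_char T \<mu>"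
  have m_mult: "?m (t \<otimes> u) = ?m t * ?m u" if t: "t \<in> T" and u: "u \<in> carrier G" for t u
  proof (cases "u \<in> T")
    case True thus ?thesis using \<mu> t T by (auto simp: restrict_char_def lin_char_def subgroup.m_closed)
  next
    case False
    hence "t \<otimes> u \<notin> T"
      using subgroup_mult_left_iff[OF T t u] by simp
    thus ?thesis using False by (simp add: restrict_char_def)
  qed
  define \<rho> where "\<rho> = (\<lambda>g. mat k k (\<lambda>(i,j). ?m (x i \<otimes> g \<otimes> inv (x j))))"
  have "\<rho> (g \<otimes> h) = \<rho> g * \<rho> h" if g: "g \<in> carrier G" and h: "h \<in> carrier G" for g h
  proof (rule eq_matI)
    fix i l assume "i < dim_row (\<rho> g * \<rho> h)" "l < dim_col (\<rho> g * \<rho> h)"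
    hence il: "i < k" "l < k" by (auto simp: \<rho>_def)
    from tr[of "x i \<otimes> g"] x il g obtain j where j: "j < k" "x i \<otimes> g \<otimes> inv (x j) \<in> T"
      and ju: "\<And>j'. j' < k \<Longrightarrow> x i \<otimes> g \<otimes> inv (x j') \<in> T \<Longrightarrow> j' = j" by (metis m_closed)
    have "(\<rho> g * \<rho> h) $$ (i,l) = (\<Sum>j'<k. ?m (x i \<otimes> g \<otimes> inv (x j')) * ?m (x j' \<otimes> h \<otimes> inv (x l)))"
      using il by (auto simp: \<rho>_def scalar_prod_def atLeast0LessThan intro!: sum.cong)
    also have "\<dots> = (\<Sum>j'\<in>{j}. ?m (x i \<otimes> g \<otimes> inv (x j')) * ?m (x j' \<otimes> h \<otimes> inv (x l)))"
    proof (rule sum.mono_neutral_right)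
      show "\<forall>j'\<in>{..<k} - {j}. ?m (x i \<otimes> g \<otimes> inv (x j')) * ?m (x j' \<otimes> h \<otimes> inv (x l)) = 0"
      proof
        fix j' assume "j' \<in> {..<k} - {j}"
        hence "x i \<otimes> g \<otimes> inv (x j') \<notin> T" using ju[of j'] by blast
        thus "?m (x i \<otimes> g \<otimes> inv (x j')) * ?m (x j' \<otimes> h \<otimes> inv (x l)) = 0" by (simp add: restrict_char_def)
      qed
    qed (use j in auto)
    also have "\<dots> = ?m ((x i \<otimes> g \<otimes> inv (x j)) \<otimes> (x j \<otimes> h \<otimes> inv (x l)))"
      using m_mult[OF j(2)] x il j g h by simp
    also have "(x i \<otimes> g \<otimes> inv (x j)) \<otimes> (x j \<otimes> h \<otimes> inv (x l)) = x i \<otimes> (g \<otimes> h) \<otimes> inv (x l)"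
      using x il j g h by (simp add: m_assoc) (simp flip: m_assoc)
    also have "?m (x i \<otimes> (g \<otimes> h) \<otimes> inv (x l)) = \<rho> (g \<otimes> h) $$ (i,l)" using il by (simp add: \<rho>_def)
    finally show "\<rho> (g \<otimes> h) $$ (i,l) = (\<rho> g * \<rho> h) $$ (i,l)" by simp
  qed (auto simp: \<rho>_def)
  moreover have "\<rho> \<one> = 1\<^sub>m k"
  proof (rule eq_matI)
    fix i j assume "i < dim_row (1\<^sub>m k)" "j < dim_col (1\<^sub>m k)"
    hence ij: "i < k" "j < k" by auto
    have "x i \<otimes> inv (x j) \<in> T \<longleftrightarrow> i = j"
      using tr[OF x[OF ij(1)]] ij x T by (metis r_inv subgroup.one_closed)
    moreover have "\<mu> \<one> = 1" "\<one> \<in> T" using \<mu> T by (auto simp: lin_char_def subgroup.one_closed)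
    ultimately show "\<rho> \<one> $$ (i,j) = 1\<^sub>m k $$ (i,j)" using ij x by (auto simp: \<rho>_def restrict_char_def)
  qed (auto simp: \<rho>_def)
  ultimately have rep: "matrix_rep G k \<rho>" by (auto simp: matrix_rep_def \<rho>_def)
  have "induced_char G T \<mu> g = rep_char G \<rho> g" for g
  proof (cases "g \<in> carrier G")
    case g: True
    \<comment> \<open>Every \<open>y\<close> is uniquely \<open>t \<otimes> x i\<close>. As
      \<open>\<mu>\<close> is invariant under conjugation by \<open>T\<close>, the factor
      \<open>t\<close> drops out, which yields the \<open>card T\<close> that the definition divides
      by.\<close>
    have "(\<Sum>y\<in>carrier G. ?m (y \<otimes> g \<otimes> inv y)) = (\<Sum>(t,i)\<in>T \<times> {..<k}. ?m ((t \<otimes> x i) \<otimes> g \<otimes> inv (t \<otimes> x i)))"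
    proof (rule sum.reindex_bij_witness[of _ "\<lambda>(t,i). t \<otimes> x i"
         "\<lambda>y. (y \<otimes> inv (x (THE i. i < k \<and> y \<otimes> inv (x i) \<in> T)), THE i. i < k \<and> y \<otimes> inv (x i) \<in> T)"])
      fix y assume y: "y \<in> carrier G"
      let ?i = "THE i. i < k \<and> y \<otimes> inv (x i) \<in> T"
      have i: "?i < k \<and> y \<otimes> inv (x ?i) \<in> T" by (rule theI'[OF tr[OF y]])
      have e: "y \<otimes> inv (x ?i) \<otimes> x ?i = y" using i x y by (simp add: m_assoc)
      show "(case (y \<otimes> inv (x ?i), ?i) of (t, i) \<Rightarrow> t \<otimes> x i) = y" using e by simp
      show "(y \<otimes> inv (x ?i), ?i) \<in> T \<times> {..<k}" using i by simp
      show "(case (y \<otimes> inv (x ?i), ?i) of (t,i) \<Rightarrow> ?m ((t \<otimes> x i) \<otimes> g \<otimes> inv (t \<otimes> x i))) = ?m (y \<otimes> g \<otimes> inv y)"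
        using e by simp
    next
      fix p assume "p \<in> T \<times> {..<k}"
      then obtain t i where p: "p = (t,i)" "t \<in> T" "i < k" by auto
      have tc: "t \<in> carrier G" using p Tc by auto
      show "(case p of (t, i) \<Rightarrow> t \<otimes> x i) \<in> carrier G" using p tc x by simp
      have ti: "t \<otimes> x i \<otimes> inv (x i) = t" using tc x p by (simp add: m_assoc)
      have the: "(THE i'. i' < k \<and> t \<otimes> x i \<otimes> inv (x i') \<in> T) = i"
        using tr[of "t \<otimes> x i"] tc x p ti by (intro the1_equality) auto
      show "((case p of (t, i) \<Rightarrow> t \<otimes> x i) \<otimes> inv (x (THE i'. i' < k \<and> (case p of (t, i) \<Rightarrow> t \<otimes> x i) \<otimes> inv (x i') \<in> T)),
          THE i'. i' < k \<and> (case p of (t, i) \<Rightarrow> t \<otimes> x i) \<otimes> inv (x i') \<in> T) = p"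
        using the p ti by simp
    qed
    also have "\<dots> = (\<Sum>t\<in>T. \<Sum>i<k. ?m ((t \<otimes> x i) \<otimes> g \<otimes> inv (t \<otimes> x i)))" by (simp add: sum.cartesian_product)
    also have "\<dots> = (\<Sum>t\<in>T. \<Sum>i<k. ?m (x i \<otimes> g \<otimes> inv (x i)))"
    proof (intro sum.cong refl)
      fix t i assume t: "t \<in> T" and "i \<in> {..<k}"
      hence i: "i < k" by simp
      have tc: "t \<in> carrier G" using t Tc by auto
      let ?u = "x i \<otimes> g \<otimes> inv (x i)"
      have u: "?u \<in> carrier G" using x i g by simp
      have eq: "(t \<otimes> x i) \<otimes> g \<otimes> inv (t \<otimes> x i) = t \<otimes> ?u \<otimes> inv t"
        using tc x[OF i] g by (simp add: inv_mult_group m_assoc)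
      have tinv: "inv t \<in> T" using t T by (simp add: subgroup.m_inv_closed)
      have "?m (t \<otimes> ?u \<otimes> inv t) = ?m ?u"
      proof (cases "?u \<in> T")
        case True
        interpret TT: group "G\<lparr>carrier := T\<rparr>" using subgroup_imp_group[OF T] .
        have "?m (t \<otimes> ?u \<otimes> inv t) = \<mu> (t \<otimes> ?u \<otimes> inv t)"
          using True t tinv T by (simp add: restrict_char_def subgroup.m_closed)
        also have "\<dots> = \<mu> ?u" using TT.lin_char_conj[OF \<mu>, of ?u t] True t T by (simp add: inv_subgroup)
        finally show ?thesis using True by (simp add: restrict_char_def)
      next
        case False
        hence "t \<otimes> ?u \<otimes> inv t \<notin> T" using subgroup_conj_iff[OF T t u] by simp
        thus ?thesis using False by (simp add: restrict_char_def)
      qed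
      thus "?m ((t \<otimes> x i) \<otimes> g \<otimes> inv (t \<otimes> x i)) = ?m ?u" unfolding eq .
    qed
    also have "\<dots> = of_nat (card T) * (\<Sum>i<k. ?m (x i \<otimes> g \<otimes> inv (x i)))" by simp
    also have "(\<Sum>i<k. ?m (x i \<otimes> g \<otimes> inv (x i))) = mat_trace (\<rho> g)" by (simp add: mat_trace_def \<rho>_def)
    moreover have "card T \<noteq> 0" using T Tc finite_subset[OF Tc] by (metis card_0_eq empty_iff finite_carrier subgroup.one_closed)
    ultimately show ?thesis using g by (simp add: induced_char_alt rep_char_def)
  qed (simp add: induced_char_def rep_char_def)
  thus ?thesis using rep unfolding Char_def by (auto simp: fun_eq_iff)
qed

text \<open>The norm is an average over \<open>x\<close> of the pairing of \<open>\<mu>\<close> with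
  its conjugate by \<open>x\<close>. For \<open>x\<close> in \<open>T\<close> the pairing is full;
  for other \<open>x\<close> the two characters differ somewhere on \<open>N\<close>, and the
  pairing vanishes.\<close>

lemma induced_lin_char_Irr:
  assumes T: "subgroup T G" and \<mu>: "lin_char (G\<lparr>carrier := T\<rparr>) \<mu>" and N: "N \<subseteq> T"
    and nrm: "\<And>x n. x \<in> carrier G \<Longrightarrow> n \<in> N \<Longrightarrow> x \<otimes> n \<otimes> inv x \<in> N"
    and stab: "\<And>x. x \<in> carrier G \<Longrightarrow> x \<notin> T \<Longrightarrow> \<exists>n\<in>N. \<mu> (x \<otimes> n \<otimes> inv x) \<noteq> \<mu> n"
  shows "induced_char G T \<mu> \<in> Irr G"
proof (rule Irr_criterion)
  show Ch: "induced_char G T \<mu> \<in> Char G" by (rule induced_lin_char_Char[OF T \<mu>])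
  interpret TT: finite_grp "G\<lparr>carrier := T\<rparr>" using finite_grp_subgroup[OF T] .
  have Tc: "T \<subseteq> carrier G" using T subgroup.subset by blast
  have cT: "card T \<noteq> 0" using TT.card_pos by simp
  let ?m = "restrict_char T \<mu>"
  let ?F = "\<lambda>x t. \<mu> (inv t) * ?m (x \<otimes> t \<otimes> inv x)"
  have mm: "\<mu> (s \<otimes> t) = \<mu> s * \<mu> t" if "s \<in> T" "t \<in> T" for s t using \<mu> that by (simp add: lin_char_def)
  have mi: "\<mu> (inv t) * \<mu> t = 1" if "t \<in> T" for t
    using TT.lin_char_inv(1)[OF \<mu>, of t] that T by (simp add: inv_subgroup)
  have in_: "(\<Sum>t\<in>T. ?F x t) = of_nat (card T)" if x: "x \<in> T" for x
  proof -
    have "?F x t = 1" if t: "t \<in> T" for t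
    proof -
      have "x \<otimes> t \<otimes> inv x \<in> T" using x t T by (simp add: subgroup.m_closed subgroup.m_inv_closed)
      moreover have "\<mu> (x \<otimes> t \<otimes> inv x) = \<mu> t" using TT.lin_char_conj[OF \<mu>, of t x] x t T by (simp add: inv_subgroup)
      ultimately show ?thesis using mi[OF t] by (simp add: restrict_char_def)
    qed
    thus ?thesis by simp
  qed
  have out: "(\<Sum>t\<in>T. ?F x t) = 0" if x: "x \<in> carrier G" "x \<notin> T" for x
  proof -
    obtain n where n: "n \<in> N" "\<mu> (x \<otimes> n \<otimes> inv x) \<noteq> \<mu> n" using stab[OF x] by auto
    let ?n = "x \<otimes> n \<otimes> inv x"
    have nT: "n \<in> T" "?n \<in> T" using n nrm[OF x(1) n(1)] N by auto
    have nc: "n \<in> carrier G" using nT Tc by auto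
    \<comment> \<open>Translation by an element \<open>n\<close> on which \<open>\<mu>\<close> and
      its conjugate disagree multiplies the sum by a number other than 1, so the sum is
      zero.\<close>
    have "(\<Sum>t\<in>T. ?F x t) = (\<Sum>t\<in>T. ?F x (n \<otimes> t))"
      by (rule sum.reindex_bij_witness[of _ "\<lambda>t. n \<otimes> t" "\<lambda>t. inv n \<otimes> t"])
        (use nT nc Tc T in \<open>auto simp: subgroup.m_closed subgroup.m_inv_closed subsetD m_assoc[symmetric]\<close>)
    also have "\<dots> = (\<Sum>t\<in>T. (\<mu> (inv n) * \<mu> ?n) * ?F x t)"
    proof (intro sum.cong refl)
      fix t assume t: "t \<in> T"
      have tc: "t \<in> carrier G" using t Tc by auto
      have e: "x \<otimes> (n \<otimes> t) \<otimes> inv x = ?n \<otimes> (x \<otimes> t \<otimes> inv x)"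
        using x(1) nc tc by (simp add: m_assoc) (simp flip: m_assoc)
      have "?m (?n \<otimes> (x \<otimes> t \<otimes> inv x)) = \<mu> ?n * ?m (x \<otimes> t \<otimes> inv x)"
      proof (cases "x \<otimes> t \<otimes> inv x \<in> T")
        case True thus ?thesis using nT T mm by (simp add: restrict_char_def subgroup.m_closed)
      next
        case False
        hence "?n \<otimes> (x \<otimes> t \<otimes> inv x) \<notin> T"
          using subgroup_mult_left_iff[OF T nT(2)] x(1) tc by simp
        thus ?thesis using False by (simp add: restrict_char_def)
      qed
      moreover have "\<mu> (inv (n \<otimes> t)) = \<mu> (inv t) * \<mu> (inv n)"
        using nc tc nT t T mm by (simp add: inv_mult_group subgroup.m_inv_closed)
      ultimately show "?F x (n \<otimes> t) = (\<mu> (inv n) * \<mu> ?n) * ?F x t" unfolding e by simp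
    qed
    also have "\<dots> = (\<mu> (inv n) * \<mu> ?n) * (\<Sum>t\<in>T. ?F x t)" by (simp add: sum_distrib_left)
    finally have "(1 - \<mu> (inv n) * \<mu> ?n) * (\<Sum>t\<in>T. ?F x t) = 0" by (simp add: algebra_simps)
    moreover have "\<mu> (inv n) * \<mu> ?n \<noteq> 1"
    proof
      assume "\<mu> (inv n) * \<mu> ?n = 1"
      hence "\<mu> n * (\<mu> (inv n) * \<mu> ?n) = \<mu> n" by simp
      hence "(\<mu> (inv n) * \<mu> n) * \<mu> ?n = \<mu> n" by (simp add: mult_ac)
      thus False using mi[OF nT(1)] n(2) by simp
    qed
    ultimately show ?thesis by simp
  qed
  have "char_ip G (induced_char G T \<mu>) (induced_char G T \<mu>) =
     char_ip (G\<lparr>carrier := T\<rparr>) \<mu> (restrict_char T (induced_char G T \<mu>))"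
    by (rule Frobenius_reciprocity[OF T Ch])
  also have "\<dots> = (\<Sum>t\<in>T. \<Sum>x\<in>carrier G. ?F x t) / of_nat (card T) / of_nat (card T)"
    using T Tc unfolding char_ip_def
    by (auto simp: restrict_char_def[of T "induced_char G T \<mu>"] induced_char_alt inv_subgroup sum_distrib_left sum_divide_distrib
       subsetD intro!: sum.cong)
  also have "(\<Sum>t\<in>T. \<Sum>x\<in>carrier G. ?F x t) = (\<Sum>x\<in>carrier G. \<Sum>t\<in>T. ?F x t)" by (rule sum.swap)
  also have "\<dots> = (\<Sum>x\<in>T. \<Sum>t\<in>T. ?F x t)" using out Tc by (intro sum.mono_neutral_right) auto
  also have "\<dots> = of_nat (card T) * of_nat (card T)" using in_ by simp
  finally show "char_ip G (induced_char G T \<mu>) (induced_char G T \<mu>) = 1" using cT by simp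
qed

end

section \<open>Special characters for the set of odd primes\<close>

definition odd_primes :: "nat set" where
  "odd_primes = {p. Factorial_Ring.prime p \<and> p \<noteq> 2}"

lemma pi_number_odd_primes: "pi_number odd_primes n \<longleftrightarrow> odd n"
proof
  assume n: "pi_number odd_primes n"
  show "odd n"
  proof
    assume "even n"
    hence "2 \<in> odd_primes" using n two_is_prime_nat unfolding pi_number_def by blast
    thus False by (simp add: odd_primes_def)
  qed
next
  assume "odd n"
  moreover have "p \<noteq> 2" if "p dvd n" for p using that \<open>odd n\<close> by auto
  ultimately show "pi_number odd_primes n" by (auto simp: pi_number_def odd_primes_def odd_pos)
qed

lemma pi_compl_odd_primes: "pi_compl odd_primes = {2}"
  by (auto simp: pi_compl_def odd_primes_def)

lemma pi_number_dvd: "pi_number \<pi> n \<Longrightarrow> m dvd n \<Longrightarrow> pi_number \<pi> m"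
  unfolding pi_number_def by (auto intro: dvd_trans Nat.gr0I)

lemma pi_number_two: "pi_number (pi_compl odd_primes) 2"
proof -
  have "p = 2" if "prime p" "p dvd 2" for p :: nat
    using primes_dvd_imp_eq[OF that(1) two_is_prime_nat that(2)] .
  thus ?thesis by (simp add: pi_number_def pi_compl_odd_primes)
qed

lemma pi_number_one: "pi_number \<pi> 1"
  by (auto simp: pi_number_def)

text \<open>Any exponent \<open>k\<close> guarantees that the least one exists; division with
  remainder shows that it divides \<open>k\<close>.\<close>

lemma linear_char_order_props:
  assumes "0 < k" "\<And>x. x \<in> carrier G \<Longrightarrow> \<mu> x ^ k = 1"
  shows "0 < linear_char_order G \<mu>" "\<And>x. x \<in> carrier G \<Longrightarrow> \<mu> x ^ linear_char_order G \<mu> = 1"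
    "linear_char_order G \<mu> dvd k"
proof -
  let ?o = "linear_char_order G \<mu>"
  have "0 < ?o \<and> (\<forall>x\<in>carrier G. \<mu> x ^ ?o = 1)"
    unfolding linear_char_order_def by (rule LeastI_ex) (use assms in blast)
  thus o: "0 < ?o" "\<And>x. x \<in> carrier G \<Longrightarrow> \<mu> x ^ ?o = 1" by auto
  have "k mod ?o = 0"
  proof (rule ccontr)
    assume "k mod ?o \<noteq> 0"
    moreover have "\<mu> x ^ (k mod ?o) = 1" if x: "x \<in> carrier G" for x
    proof -
      have "\<mu> x ^ k = (\<mu> x ^ ?o) ^ (k div ?o) * \<mu> x ^ (k mod ?o)"
        by (metis mult_div_mod_eq power_add power_mult)
      thus ?thesis using assms(2)[OF x] o(2)[OF x] by simp
    qed
    ultimately have "0 < k mod ?o \<and> (\<forall>x\<in>carrier G. \<mu> x ^ (k mod ?o) = 1)" by simp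
    hence "(LEAST k. 0 < k \<and> (\<forall>x\<in>carrier G. \<mu> x ^ k = 1)) \<le> k mod ?o" by (rule Least_le)
    hence "?o \<le> k mod ?o" unfolding linear_char_order_def .
    thus False using o(1) by (metis mod_less_divisor not_less)
  qed
  thus "?o dvd k" by auto
qed

text \<open>Exposes the chosen representation only through its character. Every determinant below is
  computed from character values, so the choice has no influence.\<close>

lemma det_char_as_det:
  assumes "\<sigma> \<in> Char G"
  obtains n \<rho> where "matrix_rep G n \<rho>" "rep_char G \<rho> = \<sigma>"
    "det_char G \<sigma> = (\<lambda>x. if x \<in> carrier G then det (\<rho> x) else 0)"
proof -
  let ?P = "\<lambda>\<rho>. \<exists>n. matrix_rep G n \<rho> \<and> rep_char G \<rho> = \<sigma>"
  have "\<exists>\<rho>. ?P \<rho>" using assms unfolding Char_def by blast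
  from someI_ex[OF this] that show thesis unfolding det_char_def Let_def by blast
qed

lemma det_pow_mat: "A \<in> carrier_mat n n \<Longrightarrow> det (A ^\<^sub>m k) = det A ^ k"
  by (induction k) (auto simp: det_mult[of _ n])

lemma (in finite_grp) det_char_order:
  assumes "\<sigma> \<in> Char G"
  shows "0 < linear_char_order G (det_char G \<sigma>)"
    "\<And>x. x \<in> carrier G \<Longrightarrow> det_char G \<sigma> x ^ linear_char_order G (det_char G \<sigma>) = 1"
proof -
  obtain n \<rho> where \<rho>: "matrix_rep G n \<rho>" "rep_char G \<rho> = \<sigma>"
    "det_char G \<sigma> = (\<lambda>x. if x \<in> carrier G then det (\<rho> x) else 0)" using det_char_as_det[OF assms] .
  have "det_char G \<sigma> x ^ card (carrier G) = 1" if x: "x \<in> carrier G" for x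
  proof -
    have "\<rho> x \<in> carrier_mat n n" using \<rho>(1) x by (simp add: matrix_rep_def)
    from det_pow_mat[OF this, of "card (carrier G)"] show ?thesis
      using \<rho>(3) x matrix_rep_finite_order[OF \<rho>(1) x] by simp
  qed
  from linear_char_order_props[of "card (carrier G)" G "det_char G \<sigma>", OF card_pos this]
  show "0 < linear_char_order G (det_char G \<sigma>)"
    "\<And>x. x \<in> carrier G \<Longrightarrow> det_char G \<sigma> x ^ linear_char_order G (det_char G \<sigma>) = 1" by auto
qed

lemma det_char_lin_char:
  assumes G: "group G" and \<sigma>: "lin_char G \<sigma>"
  shows "det_char G \<sigma> = \<sigma>"
proof -
  obtain n \<rho> where \<rho>: "matrix_rep G n \<rho>" "rep_char G \<rho> = \<sigma>"
    "det_char G \<sigma> = (\<lambda>x. if x \<in> carrier G then det (\<rho> x) else 0)"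
    using det_char_as_det Irr_imp_Char lin_char_Irr[OF G \<sigma>] by blast
  have "of_nat n = (1::complex)" using rep_char_one[OF G \<rho>(1)] \<rho>(2) lin_char_one[OF \<sigma>] by simp
  hence n: "n = 1" by simp
  have "det (\<rho> x) = \<sigma> x" if x: "x \<in> carrier G" for x
  proof -
    have c: "\<rho> x \<in> carrier_mat 1 1" using \<rho>(1) x n by (simp add: matrix_rep_def)
    have "\<sigma> x = \<rho> x $$ (0,0)" using c x by (simp add: \<rho>(2)[symmetric] rep_char_def mat_trace_def)
    thus ?thesis using det_single[OF c] by simp
  qed
  thus ?thesis using \<rho>(3) \<sigma> by (auto simp: lin_char_def fun_eq_iff)
qed

lemma subnormal_subgroup:
  assumes "group G" "subnormal G S"
  shows "subgroup S G"
  using assms(2)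
proof (induction rule: subnormal.induct)
  case whole
  show ?case using assms(1) by (rule group.subgroup_self)
next
  case (step S R)
  thus ?case using group.incl_subgroup[OF assms(1)] normal_imp_subgroup by blast
qed

lemma normal_imp_subnormal: "group G \<Longrightarrow> N \<lhd> G \<Longrightarrow> subnormal G N"
  using subnormal.step[OF subnormal.whole, of N G] by simp

context finite_grp
begin

lemma lies_under_iff:
  assumes "subgroup H G" "\<chi> \<in> Char G"
  shows "lies_under G H \<theta> \<chi> \<longleftrightarrow>
    \<theta> \<in> Irr (G\<lparr>carrier := H\<rparr>) \<and> char_ip (G\<lparr>carrier := H\<rparr>) \<theta> (restrict_char H \<chi>) \<noteq> 0"
proof -
  interpret H: finite_grp "G\<lparr>carrier := H\<rparr>" using finite_grp_subgroup[OF assms(1)] .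
  show ?thesis unfolding lies_under_def
    by (rule H.irr_constituent_iff[OF restrict_Char[OF assms(2) subgroup.subset[OF assms(1)]]])
qed

lemma lies_under_lin_char:
  assumes H: "subgroup H G" and \<mu>: "lin_char G \<mu>"
  shows "lies_under G H \<sigma> \<mu> \<longleftrightarrow> \<sigma> = restrict_char H \<mu>"
proof -
  interpret H: finite_grp "G\<lparr>carrier := H\<rparr>" using finite_grp_subgroup[OF H] .
  have "lin_char (G\<lparr>carrier := H\<rparr>) (restrict_char H \<mu>)"
    using lin_char_restrict[OF \<mu> subgroup.subset[OF H] H] .
  hence "restrict_char H \<mu> \<in> Irr (G\<lparr>carrier := H\<rparr>)" using lin_char_Irr H.is_group by blast
  thus ?thesis unfolding lies_under_def by (rule H.irr_constituent_Irr_iff)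
qed

text \<open>The only character of a subgroup under a linear one is its restriction, which is its own
  determinant and inherits the exponent \<open>k\<close>.\<close>

lemma lin_char_pi_special:
  assumes \<mu>: "lin_char G \<mu>" and k: "pi_number \<pi> k" "\<And>x. x \<in> carrier G \<Longrightarrow> \<mu> x ^ k = 1"
  shows "pi_special \<pi> G \<mu>"
  unfolding pi_special_def
proof (intro conjI allI impI)
  show "\<mu> \<in> Irr G" using lin_char_Irr[OF is_group \<mu>] .
  show "\<exists>d. \<mu> \<one> = of_nat d \<and> pi_number \<pi> d" using lin_char_one[OF \<mu>] pi_number_one by (intro exI[of _ 1]) auto
  fix S \<theta> assume S: "subnormal G S \<and> lies_under G S \<theta> \<mu>"
  hence sub: "subgroup S G" using subnormal_subgroup is_group by blast
  interpret S: finite_grp "G\<lparr>carrier := S\<rparr>" using finite_grp_subgroup[OF sub] .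
  have \<theta>: "\<theta> = restrict_char S \<mu>" using S lies_under_lin_char[OF sub \<mu>] by simp
  have "lin_char (G\<lparr>carrier := S\<rparr>) \<theta>"
    unfolding \<theta> using lin_char_restrict[OF \<mu> subgroup.subset[OF sub] sub] .
  hence "det_char (G\<lparr>carrier := S\<rparr>) \<theta> = \<theta>" by (rule det_char_lin_char[OF S.is_group])
  moreover have "\<theta> x ^ k = 1" if "x \<in> S" for x
    using that k(2)[of x] subgroup.subset[OF sub] by (auto simp: \<theta> restrict_char_def)
  moreover have "k > 0" using k(1) by (simp add: pi_number_def)
  ultimately have "linear_char_order (G\<lparr>carrier := S\<rparr>) (det_char (G\<lparr>carrier := S\<rparr>) \<theta>) dvd k"
    using linear_char_order_props(3)[of k "G\<lparr>carrier := S\<rparr>" \<theta>] by simp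
  thus "pi_number \<pi> (linear_char_order (G\<lparr>carrier := S\<rparr>) (det_char (G\<lparr>carrier := S\<rparr>) \<theta>))"
    using pi_number_dvd[OF k(1)] by blast
qed

text \<open>The linear constituents of the restriction have order dividing \<open>3\<close> and a power of \<open>2\<close>.\<close>

lemma two_special_constant_on_exponent_three:
  assumes \<beta>: "pi_special (pi_compl odd_primes) G \<beta>" and N: "N \<lhd> G"
    and comm: "\<And>x y. x \<in> N \<Longrightarrow> y \<in> N \<Longrightarrow> x \<otimes> y = y \<otimes> x" and cube: "\<And>x. x \<in> N \<Longrightarrow> x [^] (3::nat) = \<one>"
    and n: "n \<in> N"
  shows "\<beta> n = \<beta> \<one>"
proof -
  have sub: "subgroup N G" using N normal_imp_subgroup by blast
  interpret N: finite_grp "G\<lparr>carrier := N\<rparr>" using finite_grp_subgroup[OF sub] .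
  have \<beta>C: "\<beta> \<in> Char G" using \<beta> Irr_imp_Char by (auto simp: pi_special_def)
  let ?b = "restrict_char N \<beta>"
  have bC: "?b \<in> Char (G\<lparr>carrier := N\<rparr>)" using restrict_Char[OF \<beta>C subgroup.subset[OF sub]] .
  obtain k \<sigma> where \<sigma>: "\<And>i. i < k \<Longrightarrow> \<sigma> i \<in> Irr (G\<lparr>carrier := N\<rparr>)" "?b = (\<lambda>x. \<Sum>i<(k::nat). \<sigma> i x)"
    using Char_sum_of_Irr[OF N.is_group bC] by metis
  have triv: "\<sigma> i x = 1" if i: "i < k" and x: "x \<in> N" for i x
  proof -
    have lin: "lin_char (G\<lparr>carrier := N\<rparr>) (\<sigma> i)"
      using N.Irr_comm_group_lin_char[OF _ \<sigma>(1)[OF i]] comm by simp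
    have "char_ip (G\<lparr>carrier := N\<rparr>) (\<sigma> i) ?b = of_nat (card {j. j < k \<and> \<sigma> j = \<sigma> i})"
      unfolding \<sigma>(2) using \<sigma>(1) i by (intro N.char_ip_Irr_sum) auto
    moreover have "card {j. j < k \<and> \<sigma> j = \<sigma> i} \<noteq> 0" using i by auto
    ultimately have "lies_under G N (\<sigma> i) \<beta>"
      using lies_under_iff[OF sub \<beta>C] \<sigma>(1)[OF i] by simp
    hence pn: "pi_number (pi_compl odd_primes) (linear_char_order (G\<lparr>carrier := N\<rparr>) (\<sigma> i))"
      using \<beta> normal_imp_subnormal[OF is_group N] det_char_lin_char[OF N.is_group lin]
      unfolding pi_special_def by metis
    have c3: "\<sigma> i y ^ 3 = 1" if y: "y \<in> N" for y
    proof -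
      have "\<sigma> i y ^ 3 = \<sigma> i (y [^]\<^bsub>G\<lparr>carrier := N\<rparr>\<^esub> (3::nat))" using N.lin_char_pow[OF lin, of y 3] y by simp
      also have "y [^]\<^bsub>G\<lparr>carrier := N\<rparr>\<^esub> (3::nat) = \<one>" using cube[OF y] nat_pow_consistent by metis
      finally show ?thesis using lin_char_one[OF lin] by simp
    qed
    have *: "\<And>y. y \<in> N \<Longrightarrow> \<sigma> i y ^ linear_char_order (G\<lparr>carrier := N\<rparr>) (\<sigma> i) = 1"
      "linear_char_order (G\<lparr>carrier := N\<rparr>) (\<sigma> i) dvd 3"
      using linear_char_order_props[of 3 "G\<lparr>carrier := N\<rparr>" "\<sigma> i"] c3 by auto
    have "prime (3::nat)" by simp
    hence "linear_char_order (G\<lparr>carrier := N\<rparr>) (\<sigma> i) = 1 \<or> linear_char_order (G\<lparr>carrier := N\<rparr>) (\<sigma> i) = 3"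
      using *(2) by (metis One_nat_def prime_nat_iff)
    moreover have "linear_char_order (G\<lparr>carrier := N\<rparr>) (\<sigma> i) \<noteq> 3"
    proof
      assume "linear_char_order (G\<lparr>carrier := N\<rparr>) (\<sigma> i) = 3"
      hence "(3::nat) \<in> {2}" using pn \<open>prime (3::nat)\<close> unfolding pi_number_def pi_compl_odd_primes by (metis dvd_refl)
      thus False by simp
    qed
    ultimately show ?thesis using *(1)[OF x] by auto
  qed
  have "?b n = of_nat k" "?b \<one> = of_nat k"
    unfolding \<sigma>(2) using triv n subgroup.one_closed[OF sub] by auto
  thus ?thesis using n subgroup.one_closed[OF sub] by (simp add: restrict_char_def)
qed

text \<open>If \<open>e\<close> moves \<open>\<nu>\<close> then \<open>\<nu>\<close> induces to an irreducible character of degree \<open>2\<close> of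
  \<open>\<langle>N, e\<rangle>\<close> vanishing at \<open>e\<close>, so its determinant takes the value \<open>-1\<close> there.\<close>

lemma odd_special_not_over_moved_lin_char:
  assumes \<alpha>: "pi_special odd_primes G \<alpha>"
    and N: "N \<lhd> G" and Y: "Y \<lhd> G" "N \<subseteq> Y"
    and commN: "\<And>x y. x \<in> N \<Longrightarrow> y \<in> N \<Longrightarrow> x \<otimes> y = y \<otimes> x"
    and commY: "\<And>x y. x \<in> Y \<Longrightarrow> y \<in> Y \<Longrightarrow> x \<otimes> y \<otimes> inv x \<otimes> inv y \<in> N"
    and e: "e \<in> Y" "e \<otimes> e = \<one>"
    and \<nu>: "lin_char (G\<lparr>carrier := N\<rparr>) \<nu>" and n0: "n0 \<in> N" "\<nu> (e \<otimes> n0 \<otimes> inv e) \<noteq> \<nu> n0"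
    and under: "char_ip (G\<lparr>carrier := N\<rparr>) \<nu> (restrict_char N \<alpha>) \<noteq> 0"
  shows False
proof -
  have subN: "subgroup N G" and subY: "subgroup Y G" using N Y normal_imp_subgroup by auto
  have Nc: "N \<subseteq> carrier G" and Yc: "Y \<subseteq> carrier G" using subN subY subgroup.subset by auto
  have nrmN: "x \<otimes> h \<otimes> inv x \<in> N" if "x \<in> carrier G" "h \<in> N" for x h
    using N that normal_inv_iff by blast
  have ec: "e \<in> carrier G" using e Yc by auto
  have ie: "inv e = e" using e ec inv_equality by blast
  have eN: "e \<notin> N"
  proof
    assume "e \<in> N"
    hence "e \<otimes> n0 \<otimes> inv e = n0" using commN[of e n0] n0 ec Nc by (auto simp: m_assoc)
    thus False using n0 by simp
  qed
  \<comment> \<open>This is the subgroup generated by \<open>N\<close> and \<open>e\<close>: as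
    \<open>e\<close> is its own inverse, \<open>x \<otimes> e \<in> N\<close> says that
    \<open>x\<close> lies in the coset \<open>N e\<close>.\<close>
  define S where "S = {x \<in> Y. x \<in> N \<or> x \<otimes> e \<in> N}"
  have NS: "N \<subseteq> S" using Y by (auto simp: S_def)
  have eS: "e \<in> S" using e subgroup.one_closed[OF subN] by (simp add: S_def)
  have mem: "x \<in> N \<or> (\<exists>n\<in>N. x = n \<otimes> e)" if "x \<in> S" for x
  proof -
    have xc: "x \<in> carrier G" using that Yc by (auto simp: S_def)
    have "x = (x \<otimes> e) \<otimes> e" using xc ec e by (simp add: m_assoc)
    thus ?thesis using that unfolding S_def by blast
  qed
  have memI: "n \<otimes> e \<in> S" if "n \<in> N" for n
  proof -
    have "n \<otimes> e \<in> Y" using that Y e subY by (auto intro: subgroup.m_closed)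
    moreover have "n \<otimes> e \<otimes> e = n" using that Nc ec e by (auto simp: m_assoc subsetD)
    ultimately show ?thesis using that by (simp add: S_def)
  qed
  have conjY: "y \<otimes> x \<otimes> inv y \<in> S" if y: "y \<in> Y" and x: "x \<in> S" for x y
  proof -
    have yc: "y \<in> carrier G" using y Yc by auto
    from mem[OF x] show ?thesis
    proof
      assume "x \<in> N" thus ?thesis using nrmN[OF yc] NS by auto
    next
      assume "\<exists>n\<in>N. x = n \<otimes> e"
      then obtain n where n: "n \<in> N" "x = n \<otimes> e" by auto
      have nc: "n \<in> carrier G" using n Nc by auto
      have "y \<otimes> x \<otimes> inv y = ((y \<otimes> n \<otimes> inv y) \<otimes> (y \<otimes> e \<otimes> inv y \<otimes> inv e)) \<otimes> e"
        unfolding n(2) using yc nc ec by (simp add: m_assoc) (simp flip: m_assoc)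
      moreover have "(y \<otimes> n \<otimes> inv y) \<otimes> (y \<otimes> e \<otimes> inv y \<otimes> inv e) \<in> N"
        using nrmN[OF yc n(1)] commY[OF y e(1)] subN by (simp add: subgroup.m_closed)
      ultimately show ?thesis using memI by simp
    qed
  qed
  have subS: "subgroup S G"
  proof (rule subgroupI)
    show "S \<subseteq> carrier G" using Yc by (auto simp: S_def)
    show "S \<noteq> {}" using eS by auto
    have ecn: "e \<otimes> n \<otimes> e \<in> N" if "n \<in> N" for n using nrmN[OF ec that] ie by simp
    fix a assume a: "a \<in> S"
    from mem[OF a] show "inv a \<in> S"
    proof
      assume "a \<in> N" thus ?thesis using subN NS by (auto simp: subgroup.m_inv_closed)
    next
      assume "\<exists>n\<in>N. a = n \<otimes> e"
      then obtain n where n: "n \<in> N" "a = n \<otimes> e" by auto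
      have nc: "n \<in> carrier G" using n Nc by auto
      have "inv a = (e \<otimes> inv n \<otimes> e) \<otimes> e" unfolding n(2) using nc ec e ie by (simp add: inv_mult_group m_assoc)
      thus ?thesis using memI ecn[of "inv n"] n subN by (simp add: subgroup.m_inv_closed)
    qed
    fix b assume b: "b \<in> S"
    have bc: "b \<in> carrier G" using b Yc by (auto simp: S_def)
    from mem[OF a] show "a \<otimes> b \<in> S"
    proof
      assume aN: "a \<in> N"
      have ac: "a \<in> carrier G" using aN Nc by auto
      from mem[OF b] show ?thesis
      proof
        assume "b \<in> N" thus ?thesis using aN subN NS by (auto simp: subgroup.m_closed)
      next
        assume "\<exists>n\<in>N. b = n \<otimes> e"
        then obtain n where n: "n \<in> N" "b = n \<otimes> e" by auto
        have "a \<otimes> b = (a \<otimes> n) \<otimes> e" using n ac Nc ec by (auto simp: m_assoc)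
        thus ?thesis using memI aN n subN by (simp add: subgroup.m_closed)
      qed
    next
      assume "\<exists>n\<in>N. a = n \<otimes> e"
      then obtain n where n: "n \<in> N" "a = n \<otimes> e" by auto
      have nc: "n \<in> carrier G" using n Nc by auto
      from mem[OF b] show ?thesis
      proof
        assume bN: "b \<in> N"
        have "a \<otimes> b = (n \<otimes> (e \<otimes> b \<otimes> e)) \<otimes> e" using n bc nc ec e by (simp add: m_assoc)
        thus ?thesis using memI n ecn[OF bN] subN by (simp add: subgroup.m_closed)
      next
        assume "\<exists>n\<in>N. b = n \<otimes> e"
        then obtain m where m: "m \<in> N" "b = m \<otimes> e" by auto
        have "a \<otimes> b = n \<otimes> (e \<otimes> m \<otimes> e)" using n m nc Nc ec e by (auto simp: m_assoc)
        thus ?thesis using n ecn[OF m(1)] subN NS by (auto simp: subgroup.m_closed)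
      qed
    qed
  qed
  have Sc: "S \<subseteq> carrier G" using subS subgroup.subset by blast
  \<comment> \<open>\<open>S\<close> is normal in \<open>Y\<close> because commutators of
    \<open>Y\<close> fall into \<open>N\<close>, and \<open>Y\<close> is normal in \<open>G\<close>;
    \<open>S\<close> itself need not be normal in \<open>G\<close>.\<close>
  have "subnormal G S"
  proof (rule subnormal.step[OF normal_imp_subnormal[OF is_group Y(1)]])
    interpret Y: group "G\<lparr>carrier := Y\<rparr>" using subgroup_imp_group[OF subY] .
    have "subgroup S (G\<lparr>carrier := Y\<rparr>)"
      using subgroup_incl[OF subS subY] by (auto simp: S_def)
    thus "S \<lhd> G\<lparr>carrier := Y\<rparr>" unfolding Y.normal_inv_iff using conjY by (auto simp: inv_subgroup[OF subY])
  qed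
  interpret S: finite_grp "G\<lparr>carrier := S\<rparr>" using finite_grp_subgroup[OF subS] .
  have subNS: "subgroup N (G\<lparr>carrier := S\<rparr>)" using subgroup_incl[OF subN subS NS] .
  have \<alpha>C: "\<alpha> \<in> Char G" using \<alpha> Irr_imp_Char by (auto simp: pi_special_def)
  define \<sigma> where "\<sigma> = induced_char (G\<lparr>carrier := S\<rparr>) N \<nu>"
  have \<nu>': "lin_char (G\<lparr>carrier := S, carrier := N\<rparr>) \<nu>" using \<nu> by simp
  have conjN: "\<nu> (m \<otimes> x \<otimes> inv m) = \<nu> x" if "m \<in> N" "x \<in> N" for m x
    using commN[OF that] that Nc by (auto simp: m_assoc subsetD)
  have \<sigma>I: "\<sigma> \<in> Irr (G\<lparr>carrier := S\<rparr>)"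
    unfolding \<sigma>_def
  proof (rule S.induced_lin_char_Irr[OF subNS])
    show "lin_char (G\<lparr>carrier := S, carrier := N\<rparr>) \<nu>" by (rule \<nu>')
    show "x \<otimes>\<^bsub>G\<lparr>carrier := S\<rparr>\<^esub> n \<otimes>\<^bsub>G\<lparr>carrier := S\<rparr>\<^esub> inv\<^bsub>G\<lparr>carrier := S\<rparr>\<^esub> x \<in> N"
      if "x \<in> carrier (G\<lparr>carrier := S\<rparr>)" "n \<in> N" for x n
      using nrmN[of x n] that Sc by (auto simp: inv_subgroup[OF subS])
    show "\<exists>n\<in>N. \<nu> (x \<otimes>\<^bsub>G\<lparr>carrier := S\<rparr>\<^esub> n \<otimes>\<^bsub>G\<lparr>carrier := S\<rparr>\<^esub> inv\<^bsub>G\<lparr>carrier := S\<rparr>\<^esub> x) \<noteq> \<nu> n"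
      if x: "x \<in> carrier (G\<lparr>carrier := S\<rparr>)" "x \<notin> N" for x
    proof -
      from mem[of x] x obtain m where m: "m \<in> N" "x = m \<otimes> e" by auto
      have "x \<otimes> n0 \<otimes> inv x = m \<otimes> (e \<otimes> n0 \<otimes> inv e) \<otimes> inv m"
        unfolding m(2) using m n0 Nc ec by (auto simp: inv_mult_group m_assoc subsetD)
      hence "\<nu> (x \<otimes> n0 \<otimes> inv x) = \<nu> (e \<otimes> n0 \<otimes> inv e)" using conjN[OF m(1) nrmN[OF ec n0(1)]] by simp
      thus ?thesis using n0 x by (intro bexI[of _ n0]) (auto simp: inv_subgroup[OF subS])
    qed
  qed simp
  \<comment> \<open>By Frobenius reciprocity \<open>\<sigma>\<close> lies under
    \<open>\<alpha>\<close> exactly because \<open>\<nu>\<close> does, so specialness of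
    \<open>\<alpha>\<close> restricts the determinant of \<open>\<sigma>\<close>.\<close>
  have "char_ip (G\<lparr>carrier := S\<rparr>) \<sigma> (restrict_char S \<alpha>) =
     char_ip (G\<lparr>carrier := N\<rparr>) \<nu> (restrict_char N (restrict_char S \<alpha>))"
    unfolding \<sigma>_def using S.Frobenius_reciprocity[OF subNS restrict_Char[OF \<alpha>C Sc], of \<nu>] by simp
  also have "restrict_char N (restrict_char S \<alpha>) = restrict_char N \<alpha>" using NS by (auto simp: restrict_char_def fun_eq_iff)
  finally have "lies_under G S \<sigma> \<alpha>" using lies_under_iff[OF subS \<alpha>C] \<sigma>I under by simp
  hence od: "odd (linear_char_order (G\<lparr>carrier := S\<rparr>) (det_char (G\<lparr>carrier := S\<rparr>) \<sigma>))"
    using \<alpha> \<open>subnormal G S\<close> unfolding pi_special_def pi_number_odd_primes by blast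
  obtain n \<rho> where \<rho>: "matrix_rep (G\<lparr>carrier := S\<rparr>) n \<rho>" "rep_char (G\<lparr>carrier := S\<rparr>) \<rho> = \<sigma>"
    "det_char (G\<lparr>carrier := S\<rparr>) \<sigma> = (\<lambda>x. if x \<in> carrier (G\<lparr>carrier := S\<rparr>) then det (\<rho> x) else 0)"
    using det_char_as_det[OF Irr_imp_Char[OF \<sigma>I]] .
  have finN: "finite N" using Nc finite_subset by blast
  have cardS: "card S = 2 * card N"
  proof -
    have "S = N \<union> (\<lambda>n. n \<otimes> e) ` N" using mem memI NS by auto
    moreover have "N \<inter> (\<lambda>n. n \<otimes> e) ` N = {}"
    proof (rule ccontr)
      assume "N \<inter> (\<lambda>n. n \<otimes> e) ` N \<noteq> {}"
      then obtain n where n: "n \<in> N" "n \<otimes> e \<in> N" by auto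
      have "inv n \<otimes> (n \<otimes> e) \<in> N" using n subN by (simp add: subgroup.m_closed subgroup.m_inv_closed)
      moreover have "inv n \<otimes> (n \<otimes> e) = e" using n Nc ec by (auto simp: m_assoc[symmetric] subsetD)
      ultimately show False using eN by simp
    qed
    moreover have "card ((\<lambda>n. n \<otimes> e) ` N) = card N"
      using ec Nc by (intro card_image) (auto simp: inj_on_def subsetD)
    ultimately show ?thesis using finN by (simp add: card_Un_disjoint)
  qed
  have cN: "card N \<noteq> 0" using finN subgroup.one_closed[OF subN] by auto
  have oneN: "\<one> \<in> N" using subgroup.one_closed[OF subN] .
  have "\<sigma> \<one> = (\<Sum>x\<in>S. 1) / of_nat (card N)"
    unfolding \<sigma>_def induced_char_def using subgroup.one_closed[OF subS] oneN Sc lin_char_one[OF \<nu>]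
    by (auto simp: inv_subgroup[OF subS] subsetD intro!: sum.cong)
  hence s2: "\<sigma> \<one> = of_nat 2" using cardS cN by (simp add: field_simps)
  have "\<sigma> \<one> = of_nat n" using rep_char_one[OF S.is_group \<rho>(1)] \<rho>(2) by simp
  with s2 have n2: "n = 2" by (simp only: of_nat_eq_iff)
  have "\<sigma> e = 0"
  proof -
    have "x \<otimes> e \<otimes> inv x \<notin> N" if "x \<in> S" for x
    proof
      assume a: "x \<otimes> e \<otimes> inv x \<in> N"
      have xc: "x \<in> carrier G" using that Sc by auto
      have "inv x \<otimes> (x \<otimes> e \<otimes> inv x) \<otimes> inv (inv x) \<in> N" using nrmN[OF inv_closed[OF xc] a] .
      moreover have "inv x \<otimes> (x \<otimes> e \<otimes> inv x) \<otimes> inv (inv x) = e"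
        using xc ec by (simp add: m_assoc) (simp flip: m_assoc)
      ultimately show False using eN by simp
    qed
    thus ?thesis unfolding \<sigma>_def induced_char_def by (auto simp: inv_subgroup[OF subS])
  qed
  have car: "\<rho> e \<in> carrier_mat 2 2" using \<rho>(1) eS n2 by (auto simp: matrix_rep_def)
  have tr: "mat_trace (\<rho> e) = 0" using \<open>\<sigma> e = 0\<close> \<rho>(2) eS by (auto simp: rep_char_def)
  have sq: "\<rho> e * \<rho> e = 1\<^sub>m 2" using \<rho>(1) eS e n2 by (auto simp: matrix_rep_def) metis
  \<comment> \<open>Degree 2, trace \<open>0 = 2 - 2 * 1\<close> and
    \<open>\<rho> e * \<rho> e = 1\<close>: the eigenvalues are 1 and \<open>- 1\<close>.\<close>
  have "det (\<rho> e) = (- 1) ^ 1"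
    by (rule det_of_trace_involution[OF car, of "card S"])
       (use S.matrix_rep_finite_order[OF \<rho>(1), of e] eS n2 S.card_pos tr sq in auto)
  hence "det_char (G\<lparr>carrier := S\<rparr>) \<sigma> e = - 1" using \<rho>(3) eS by simp
  hence "(- 1 :: complex) ^ linear_char_order (G\<lparr>carrier := S\<rparr>) (det_char (G\<lparr>carrier := S\<rparr>) \<sigma>) = 1"
    using S.det_char_order(2)[OF Irr_imp_Char[OF \<sigma>I], of e] eS by simp
  thus False using od by simp
qed

text \<open>On \<open>N\<close> the 2-special factor is the constant \<open>\<beta> \<one>\<close>,
  so the multiplicity of \<open>\<nu>\<close> in the product is that constant times its multiplicity
  in \<open>\<alpha>\<close>, and the odd-special factor would have to lie over
  \<open>\<nu>\<close>.\<close>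

lemma factorable_not_over_moved_lin_char:
  assumes \<chi>: "pi_factorable odd_primes G \<chi>"
    and N: "N \<lhd> G" and Y: "Y \<lhd> G" "N \<subseteq> Y"
    and commN: "\<And>x y. x \<in> N \<Longrightarrow> y \<in> N \<Longrightarrow> x \<otimes> y = y \<otimes> x"
    and cube: "\<And>x. x \<in> N \<Longrightarrow> x [^] (3::nat) = \<one>"
    and commY: "\<And>x y. x \<in> Y \<Longrightarrow> y \<in> Y \<Longrightarrow> x \<otimes> y \<otimes> inv x \<otimes> inv y \<in> N"
    and e: "e \<in> Y" "e \<otimes> e = \<one>"
    and \<nu>: "lin_char (G\<lparr>carrier := N\<rparr>) \<nu>" and n0: "n0 \<in> N" "\<nu> (e \<otimes> n0 \<otimes> inv e) \<noteq> \<nu> n0"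
  shows "\<not> lies_under G N \<nu> \<chi>"
proof
  assume under: "lies_under G N \<nu> \<chi>"
  from \<chi> obtain \<alpha> \<beta> where ab: "pi_special odd_primes G \<alpha>" "pi_special (pi_compl odd_primes) G \<beta>"
    "\<chi> = (\<lambda>x. \<alpha> x * \<beta> x)" and \<chi>I: "\<chi> \<in> Irr G" unfolding pi_factorable_def by blast
  have subN: "subgroup N G" using N normal_imp_subgroup by auto
  have \<beta>: "\<beta> n = \<beta> \<one>" if "n \<in> N" for n
    using two_special_constant_on_exponent_three[OF ab(2) N commN cube that] .
  have "char_ip (G\<lparr>carrier := N\<rparr>) \<nu> (restrict_char N \<chi>) = \<beta> \<one> * char_ip (G\<lparr>carrier := N\<rparr>) \<nu> (restrict_char N \<alpha>)"
    unfolding char_ip_def ab(3) by (auto simp: restrict_char_def sum_distrib_left \<beta> mult_ac intro!: sum.cong)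
  moreover have "char_ip (G\<lparr>carrier := N\<rparr>) \<nu> (restrict_char N \<chi>) \<noteq> 0"
    using under lies_under_iff[OF subN Irr_imp_Char[OF \<chi>I]] by blast
  ultimately have "char_ip (G\<lparr>carrier := N\<rparr>) \<nu> (restrict_char N \<alpha>) \<noteq> 0" by auto
  thus False using odd_special_not_over_moved_lin_char[OF ab(1) N Y commN commY e \<nu> n0] by blast
qed

end

section \<open>Groups mapping onto the symmetric group of degree three\<close>

text \<open>Mackey's formula when \<open>G\<close> is the single double coset \<open>T S\<close>:
  the summand at \<open>t \<otimes> s\<close> depends only on \<open>s\<close>, and each element
  factors in as many ways as \<open>T \<inter> S\<close> has elements.\<close>

lemma (in finite_grp) restrict_induced_transitive:
  assumes T: "subgroup T G" and \<mu>: "lin_char (G\<lparr>carrier := T\<rparr>) \<mu>" and S: "subgroup S G"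
    and trans: "\<And>x. x \<in> carrier G \<Longrightarrow> \<exists>t\<in>T. \<exists>s\<in>S. x = t \<otimes> s"
  shows "restrict_char S (induced_char G T \<mu>) =
    induced_char (G\<lparr>carrier := S\<rparr>) (T \<inter> S) (restrict_char (T \<inter> S) \<mu>)"
proof (rule ext)
  fix g
  have Tc: "T \<subseteq> carrier G" and Sc: "S \<subseteq> carrier G" using T S subgroup.subset by auto
  interpret TT: group "G\<lparr>carrier := T\<rparr>" using subgroup_imp_group[OF T] .
  have finT: "finite T" and finS: "finite S" using finite_subset[OF _ finite_carrier] Tc Sc by auto
  show "restrict_char S (induced_char G T \<mu>) g =
    induced_char (G\<lparr>carrier := S\<rparr>) (T \<inter> S) (restrict_char (T \<inter> S) \<mu>) g"
  proof (cases "g \<in> S")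
    case g: True
    have gc: "g \<in> carrier G" using g Sc by auto
    define F where "F = (\<lambda>x. restrict_char T \<mu> (x \<otimes> g \<otimes> inv x))"
    have FT: "F (t \<otimes> x) = F x" if t: "t \<in> T" and x: "x \<in> carrier G" for t x
    proof -
      have tc: "t \<in> carrier G" using t Tc by auto
      let ?u = "x \<otimes> g \<otimes> inv x"
      have u: "?u \<in> carrier G" using x gc by simp
      have eq: "(t \<otimes> x) \<otimes> g \<otimes> inv (t \<otimes> x) = t \<otimes> ?u \<otimes> inv t"
        using tc x gc by (simp add: inv_mult_group m_assoc)
      show ?thesis
      proof (cases "?u \<in> T")
        case True
        hence "t \<otimes> ?u \<otimes> inv t \<in> T" using subgroup_conj_iff[OF T t u] by simp
        moreover have "\<mu> (t \<otimes> ?u \<otimes> inv t) = \<mu> ?u"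
          using TT.lin_char_conj[OF \<mu>, of ?u t] True t T by (simp add: inv_subgroup)
        ultimately show ?thesis using True unfolding F_def eq by (simp add: restrict_char_def)
      next
        case False
        hence "t \<otimes> ?u \<otimes> inv t \<notin> T" using subgroup_conj_iff[OF T t u] by simp
        thus ?thesis using False unfolding F_def eq by (simp add: restrict_char_def)
      qed
    qed
    \<comment> \<open>All factorizations arise from one, \<open>x = t0 \<otimes> s0\<close>, by
      moving some \<open>u\<close> in \<open>T \<inter> S\<close> from one factor to the
      other.\<close>
    have fib: "card {p \<in> T \<times> S. fst p \<otimes> snd p = x} = card (T \<inter> S)" if x: "x \<in> carrier G" for x
    proof -
      obtain t0 s0 where ts: "t0 \<in> T" "s0 \<in> S" "x = t0 \<otimes> s0" using trans[OF x] by blast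
      have c0: "t0 \<in> carrier G" "s0 \<in> carrier G" using ts Tc Sc by auto
      have "bij_betw (\<lambda>u. (t0 \<otimes> u, inv u \<otimes> s0)) (T \<inter> S) {p \<in> T \<times> S. fst p \<otimes> snd p = x}"
      proof (rule bij_betw_byWitness[where f' = "\<lambda>p. inv t0 \<otimes> fst p"])
        show "\<forall>u\<in>T \<inter> S. inv t0 \<otimes> fst (t0 \<otimes> u, inv u \<otimes> s0) = u"
          using c0 Tc by (auto simp: m_assoc[symmetric] subsetD)
        show "\<forall>p\<in>{p \<in> T \<times> S. fst p \<otimes> snd p = x}. (t0 \<otimes> (inv t0 \<otimes> fst p), inv (inv t0 \<otimes> fst p) \<otimes> s0) = p"
        proof
          fix p assume "p \<in> {p \<in> T \<times> S. fst p \<otimes> snd p = x}"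
          then obtain t s where p: "p = (t, s)" "t \<in> T" "s \<in> S" "t \<otimes> s = t0 \<otimes> s0" using ts by auto
          have c: "t \<in> carrier G" "s \<in> carrier G" using p Tc Sc by auto
          have "inv t \<otimes> (t0 \<otimes> s0) = s" using c by (simp flip: p(4) m_assoc)
          thus "(t0 \<otimes> (inv t0 \<otimes> fst p), inv (inv t0 \<otimes> fst p) \<otimes> s0) = p"
            using c c0 p(1) by (simp add: inv_mult_group m_assoc) (simp flip: m_assoc)
        qed
        show "(\<lambda>u. (t0 \<otimes> u, inv u \<otimes> s0)) ` (T \<inter> S) \<subseteq> {p \<in> T \<times> S. fst p \<otimes> snd p = x}"
        proof
          fix p assume "p \<in> (\<lambda>u. (t0 \<otimes> u, inv u \<otimes> s0)) ` (T \<inter> S)"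
          then obtain u where u: "u \<in> T" "u \<in> S" "p = (t0 \<otimes> u, inv u \<otimes> s0)" by auto
          have uc: "u \<in> carrier G" using u Tc by auto
          have "t0 \<otimes> u \<otimes> (inv u \<otimes> s0) = t0 \<otimes> (u \<otimes> (inv u \<otimes> s0))" using uc c0 by (simp add: m_assoc)
          also have "u \<otimes> (inv u \<otimes> s0) = s0" using uc c0 by (simp flip: m_assoc)
          finally have "t0 \<otimes> u \<otimes> (inv u \<otimes> s0) = x" using ts by simp
          thus "p \<in> {p \<in> T \<times> S. fst p \<otimes> snd p = x}"
            using u ts T S by (simp add: subgroup.m_closed subgroup.m_inv_closed)
        qed
        show "(\<lambda>p. inv t0 \<otimes> fst p) ` {p \<in> T \<times> S. fst p \<otimes> snd p = x} \<subseteq> T \<inter> S"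
        proof
          fix u assume "u \<in> (\<lambda>p. inv t0 \<otimes> fst p) ` {p \<in> T \<times> S. fst p \<otimes> snd p = x}"
          then obtain t s where p: "u = inv t0 \<otimes> t" "t \<in> T" "s \<in> S" "t \<otimes> s = t0 \<otimes> s0" using ts by auto
          have c: "t \<in> carrier G" "s \<in> carrier G" using p Tc Sc by auto
          have "inv t0 \<otimes> (t \<otimes> s) = s0" using c0 c by (simp add: p(4)) (simp flip: m_assoc)
          hence "inv t0 \<otimes> t \<otimes> s = s0" using c0 c by (simp add: m_assoc)
          hence "inv t0 \<otimes> t = s0 \<otimes> inv s" using c0 c inv_solve_right[of "inv t0 \<otimes> t" s0 s] by simp
          moreover have "inv t0 \<otimes> t \<in> T" "s0 \<otimes> inv s \<in> S"
            using p ts T S by (simp_all add: subgroup.m_closed subgroup.m_inv_closed)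
          ultimately show "u \<in> T \<inter> S" using p(1) by simp
        qed
      qed
      from bij_betw_same_card[OF this] show ?thesis by simp
    qed
    have "(\<Sum>x\<in>carrier G. of_nat (card (T \<inter> S)) * F x) =
       (\<Sum>x\<in>carrier G. \<Sum>p\<in>{p \<in> T \<times> S. fst p \<otimes> snd p = x}. F (fst p \<otimes> snd p))"
      using fib by (intro sum.cong refl) simp
    also have "\<dots> = (\<Sum>p\<in>T \<times> S. F (fst p \<otimes> snd p))"
      using finT finS Tc Sc by (intro sum.group) (auto simp: subsetD)
    also have "\<dots> = (\<Sum>p\<in>T \<times> S. F (snd p))"
      using FT Sc by (intro sum.cong refl) auto
    also have "\<dots> = (\<Sum>t\<in>T. \<Sum>s\<in>S. F s)"
      using sum.cartesian_product[of "\<lambda>_ s. F s" S T] by (simp add: split_def)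
    also have "\<dots> = of_nat (card T) * (\<Sum>s\<in>S. F s)" by simp
    finally have eq: "of_nat (card (T \<inter> S)) * (\<Sum>x\<in>carrier G. F x) = of_nat (card T) * (\<Sum>s\<in>S. F s)"
      by (simp add: sum_distrib_left)
    have nz: "card T \<noteq> 0" "card (T \<inter> S) \<noteq> 0"
      using finT subgroup.one_closed[OF T] subgroup.one_closed[OF S] by auto
    have "F s = restrict_char (T \<inter> S) (restrict_char (T \<inter> S) \<mu>) (s \<otimes> g \<otimes> inv s)" if "s \<in> S" for s
      using that g S by (simp add: F_def restrict_char_def subgroup.m_closed subgroup.m_inv_closed)
    hence "induced_char (G\<lparr>carrier := S\<rparr>) (T \<inter> S) (restrict_char (T \<inter> S) \<mu>) g = (\<Sum>s\<in>S. F s) / of_nat (card (T \<inter> S))"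
      using g by (simp add: induced_char_alt inv_subgroup[OF S])
    moreover have "restrict_char S (induced_char G T \<mu>) g = (\<Sum>x\<in>carrier G. F x) / of_nat (card T)"
      using g gc by (simp add: induced_char_alt restrict_char_def[of S] F_def)
    moreover have "(\<Sum>x\<in>carrier G. F x) / of_nat (card T) = (\<Sum>s\<in>S. F s) / of_nat (card (T \<inter> S))"
      using eq nz by (simp add: frac_eq_eq mult_ac)
    ultimately show ?thesis by simp
  qed (simp add: restrict_char_def induced_char_def)
qed

text \<open>The map \<open>x \<mapsto> (\<delta> x, b x)\<close> is a homomorphism onto the group of affine maps
  \<open>y \<mapsto> \<delta> x * y + b x\<close> of \<open>\<int>/3\<close>, and \<open>pt_stab\<close> is the stabilizer of the point \<open>0\<close>.\<close>

locale sym3_cover = finite_grp +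
  fixes N :: "'a set" and \<delta> b :: "'a \<Rightarrow> int" and \<mu> :: "'a \<Rightarrow> complex"
  assumes N_sub: "subgroup N G"
    and N_conj: "\<And>x n. x \<in> carrier G \<Longrightarrow> n \<in> N \<Longrightarrow> x \<otimes> n \<otimes> inv x \<in> N"
    and \<delta>_range: "\<And>x. x \<in> carrier G \<Longrightarrow> \<delta> x = 1 \<or> \<delta> x = - 1"
    and \<delta>_mult: "\<And>x y. x \<in> carrier G \<Longrightarrow> y \<in> carrier G \<Longrightarrow> \<delta> (x \<otimes> y) = \<delta> x * \<delta> y"
    and b_range: "\<And>x. x \<in> carrier G \<Longrightarrow> 0 \<le> b x \<and> b x < 3"
    and b_mult: "\<And>x y. x \<in> carrier G \<Longrightarrow> y \<in> carrier G \<Longrightarrow> b (x \<otimes> y) = (b x + \<delta> x * b y) mod 3"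
    and \<delta>_N: "\<And>n. n \<in> N \<Longrightarrow> \<delta> n = 1" and b_N: "\<And>n. n \<in> N \<Longrightarrow> b n = 0"
    and onto: "\<And>i. 0 \<le> i \<Longrightarrow> i < 3 \<Longrightarrow> \<exists>x\<in>carrier G. \<delta> x = - 1 \<and> b x = i"
    and \<mu>_lin: "lin_char (G\<lparr>carrier := {x \<in> carrier G. b x = 0}\<rparr>) \<mu>"
    and \<mu>_cube: "\<And>x. x \<in> carrier G \<Longrightarrow> b x = 0 \<Longrightarrow> \<mu> x ^ 3 = 1"
    and stab: "\<And>x. x \<in> carrier G \<Longrightarrow> b x \<noteq> 0 \<Longrightarrow> \<exists>n\<in>N. \<mu> (x \<otimes> n \<otimes> inv x) \<noteq> \<mu> n"
begin

section \<open>The action on three points and the induced character at ninth powers\<close>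

definition pt_stab :: "'a set" where "pt_stab = {x \<in> carrier G. b x = 0}"

definition sgn_char :: "'a \<Rightarrow> complex" where
  "sgn_char x = (if x \<in> carrier G then of_int (\<delta> x) else 0)"

abbreviation (input) ind :: "'a \<Rightarrow> complex" where "ind \<equiv> induced_char G pt_stab \<mu>"

lemma \<delta>_one: "\<delta> \<one> = 1"
  using \<delta>_mult[of \<one> \<one>] \<delta>_range[of \<one>] by auto

lemma b_one: "b \<one> = 0"
  using b_mult[of \<one> \<one>] b_range[of \<one>] \<delta>_one by (simp; presburger)

lemma \<delta>_inv: "x \<in> carrier G \<Longrightarrow> \<delta> (inv x) = \<delta> x"
  using \<delta>_mult[of x "inv x"] \<delta>_range[of x] \<delta>_one by auto

lemma b_inv: "x \<in> carrier G \<Longrightarrow> b (inv x) = (- \<delta> x * b x) mod 3"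
  using b_mult[of x "inv x"] b_range[of "inv x"] \<delta>_range[of x] b_one by (auto; presburger)

lemma \<delta>_conj: "x \<in> carrier G \<Longrightarrow> y \<in> carrier G \<Longrightarrow> \<delta> (x \<otimes> y \<otimes> inv x) = \<delta> y"
  using \<delta>_range[of x] by (auto simp: \<delta>_mult \<delta>_inv)

lemma b_conj:
  assumes "x \<in> carrier G" "y \<in> carrier G"
  shows "b (x \<otimes> y \<otimes> inv x) = (b x + \<delta> x * b y - \<delta> y * b x) mod 3"
  using \<delta>_range[OF assms(1)] \<delta>_range[OF assms(2)] assms
  by (elim disjE) (simp add: b_mult b_inv \<delta>_mult, presburger)+

lemma pt_stab_subgroup: "subgroup pt_stab G"
proof (rule subgroupI)
  show "pt_stab \<noteq> {}" using b_one by (auto simp: pt_stab_def)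
qed (auto simp: pt_stab_def b_inv b_mult)

lemma N_pt_stab: "N \<subseteq> pt_stab"
  using subgroup.subset[OF N_sub] b_N by (auto simp: pt_stab_def)

lemma \<mu>_lin': "lin_char (G\<lparr>carrier := pt_stab\<rparr>) \<mu>"
  using \<mu>_lin by (simp add: pt_stab_def)

lemma sgn_char_lin: "lin_char G sgn_char"
  by (auto simp: lin_char_def sgn_char_def \<delta>_one \<delta>_mult)

lemma ind_Irr: "ind \<in> Irr G"
  using stab by (intro induced_lin_char_Irr[OF pt_stab_subgroup \<mu>_lin' N_pt_stab] N_conj) (auto simp: pt_stab_def)

lemma \<delta>_pow: "x \<in> carrier G \<Longrightarrow> \<delta> (x [^] (k::nat)) = \<delta> x ^ k"
  by (induction k) (auto simp: \<delta>_one \<delta>_mult)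

lemma b_pow_even: "x \<in> carrier G \<Longrightarrow> \<delta> x = 1 \<Longrightarrow> b (x [^] (k::nat)) = (of_nat k * b x) mod 3"
  by (induction k) (auto simp: b_one b_mult \<delta>_pow mod_simps algebra_simps)

lemma b_square_odd: "x \<in> carrier G \<Longrightarrow> \<delta> x = - 1 \<Longrightarrow> b (x [^] (2::nat)) = 0"
  by (simp add: numeral_2_eq_2 b_mult b_one \<delta>_one mod_simps)

text \<open>The number \<open>b x\<close> is the image of the point 0, so the fibre is a left coset
  of the point stabilizer.\<close>

lemma card_fibre: "0 \<le> i \<Longrightarrow> i < 3 \<Longrightarrow> card {x \<in> carrier G. b x = i} = card pt_stab"
proof -
  assume "0 \<le> i" "i < 3"
  then obtain y where y: "y \<in> carrier G" "\<delta> y = - 1" "b y = i" using onto by blast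
  have "bij_betw (\<lambda>t. y \<otimes> t) pt_stab {x \<in> carrier G. b x = i}"
  proof (rule bij_betw_byWitness[where f' = "\<lambda>x. inv y \<otimes> x"])
    show "\<forall>t\<in>pt_stab. inv y \<otimes> (y \<otimes> t) = t" using y by (auto simp: pt_stab_def m_assoc[symmetric])
    show "\<forall>x\<in>{x \<in> carrier G. b x = i}. y \<otimes> (inv y \<otimes> x) = x" using y by (auto simp: m_assoc[symmetric])
    show "(\<lambda>t. y \<otimes> t) ` pt_stab \<subseteq> {x \<in> carrier G. b x = i}"
      using y b_range[of y] by (auto simp: pt_stab_def b_mult)
    show "(\<lambda>x. inv y \<otimes> x) ` {x \<in> carrier G. b x = i} \<subseteq> pt_stab"
      using y by (auto simp: pt_stab_def b_mult b_inv \<delta>_inv mod_simps)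
  qed
  thus ?thesis using bij_betw_same_card by fastforce
qed

lemma card_pt_stab_pos: "card pt_stab \<noteq> 0"
  using subgroup.one_closed[OF pt_stab_subgroup] finite_subset[OF subgroup.subset[OF pt_stab_subgroup]] by auto

lemma card_carrier_eq: "card (carrier G) = 3 * card pt_stab"
proof -
  have eq: "carrier G = {x \<in> carrier G. b x = 0} \<union> ({x \<in> carrier G. b x = 1} \<union> {x \<in> carrier G. b x = 2})"
    using b_range by force
  have "card (carrier G) = card {x \<in> carrier G. b x = 0} + (card {x \<in> carrier G. b x = 1} + card {x \<in> carrier G. b x = 2})"
    by (subst eq) (subst card_Un_disjoint; auto)+
  thus ?thesis using card_fibre[of 0] card_fibre[of 1] card_fibre[of 2] by simp
qed

lemma ind_one: "ind \<one> = 3"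
proof -
  have "ind \<one> = (\<Sum>x\<in>carrier G. 1) / of_nat (card pt_stab)"
    unfolding induced_char_def using b_one lin_char_one[OF \<mu>_lin] by (auto simp: pt_stab_def intro!: sum.cong)
  thus ?thesis using card_carrier_eq card_pt_stab_pos by (simp add: field_simps)
qed

lemma \<mu>_pow9:
  assumes x: "x \<in> carrier G" and b: "b x = 0"
  shows "\<mu> (x [^] (9::nat)) = 1"
proof -
  interpret T: group "G\<lparr>carrier := pt_stab\<rparr>" using subgroup_imp_group[OF pt_stab_subgroup] .
  have "x \<in> pt_stab" using assms by (simp add: pt_stab_def)
  hence "\<mu> (x [^] (9::nat)) = \<mu> x ^ 9"
    using T.lin_char_pow[OF \<mu>_lin', of x 9] nat_pow_consistent[of x 9 pt_stab] by simp
  also have "\<dots> = (\<mu> x ^ 3) ^ 3" by (simp flip: power_mult)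
  finally show ?thesis using \<mu>_cube[OF assms] by simp
qed

lemma conj_pow: "x \<in> carrier G \<Longrightarrow> y \<in> carrier G \<Longrightarrow> x \<otimes> y [^] (k::nat) \<otimes> inv x = (x \<otimes> y \<otimes> inv x) [^] k"
proof (induction k)
  case (Suc k)
  have "x \<otimes> y [^] Suc k \<otimes> inv x = (x \<otimes> y [^] k \<otimes> inv x) \<otimes> (x \<otimes> y \<otimes> inv x)"
    using Suc.prems by (simp add: m_assoc) (simp flip: m_assoc)
  thus ?case using Suc by simp
qed simp

text \<open>Two cubings: an element with \<open>\<delta> s = 1\<close> acts as a rotation, so its
  cube fixes all three points; \<open>\<mu>\<close> has cube roots of unity as values, so the second
  cube makes all three conjugate values 1.\<close>

lemma ind_pow9_even:
  assumes s: "s \<in> carrier G" "\<delta> s = 1"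
  shows "ind (s [^] (9::nat)) = 3"
proof -
  have b3: "b (s [^] (3::nat)) = 0" "\<delta> (s [^] (3::nat)) = 1" using s by (auto simp: b_pow_even \<delta>_pow)
  have "x \<otimes> s [^] (9::nat) \<otimes> inv x \<in> pt_stab \<and> \<mu> (x \<otimes> s [^] (9::nat) \<otimes> inv x) = 1" if x: "x \<in> carrier G" for x
  proof -
    let ?y = "x \<otimes> s [^] (3::nat) \<otimes> inv x"
    have y: "?y \<in> carrier G" "b ?y = 0" using x s b3 by (auto simp: b_conj)
    have e: "x \<otimes> s [^] (9::nat) \<otimes> inv x = ?y [^] (3::nat)"
      using conj_pow[OF x, of "s [^] (3::nat)" 3] s by (simp add: nat_pow_pow)
    interpret T: group "G\<lparr>carrier := pt_stab\<rparr>" using subgroup_imp_group[OF pt_stab_subgroup] .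
    have yT: "?y \<in> pt_stab" using y by (simp add: pt_stab_def)
    have "\<mu> (?y [^] (3::nat)) = \<mu> ?y ^ 3"
      using T.lin_char_pow[OF \<mu>_lin', of ?y 3] nat_pow_consistent[of ?y 3 pt_stab] yT by simp
    moreover have "?y [^] (3::nat) \<in> pt_stab" using T.nat_pow_closed[of ?y 3] nat_pow_consistent[of ?y 3 pt_stab] yT by simp
    ultimately show ?thesis using \<mu>_cube[OF y] unfolding e by simp
  qed
  hence "ind (s [^] (9::nat)) = (\<Sum>x\<in>carrier G. 1) / of_nat (card pt_stab)"
    unfolding induced_char_def using s by (auto intro!: sum.cong)
  thus ?thesis using card_carrier_eq card_pt_stab_pos by (simp add: field_simps)
qed

text \<open>Since \<open>9 = 2 * 4 + 1\<close> and the square of a reflection acts trivially, the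
  ninth power acts as \<open>s\<close> does.\<close>

lemma odd_pow9:
  assumes s: "s \<in> carrier G" "\<delta> s = - 1"
  shows "\<delta> (s [^] (9::nat)) = - 1" "b (s [^] (9::nat)) = b s"
proof -
  show "\<delta> (s [^] (9::nat)) = - 1" using s by (simp add: \<delta>_pow)
  have e: "s [^] (9::nat) = (s [^] (2::nat)) [^] (4::nat) \<otimes> s" using s by (simp add: nat_pow_pow) (simp flip: nat_pow_Suc)
  have "b ((s [^] (2::nat)) [^] (4::nat)) = 0"
    using s b_square_odd[OF s] by (subst b_pow_even) (auto simp: \<delta>_pow)
  thus "b (s [^] (9::nat)) = b s" unfolding e using s b_range[OF s(1)] by (simp add: b_mult \<delta>_pow)
qed

text \<open>A reflection fixes exactly one of the three points, so one fibre of conjugating elements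
  contributes. There the conjugate of \<open>s\<close> already lies in the point stabilizer, and
  \<open>\<mu>\<close> of its ninth power is 1.\<close>

lemma ind_pow9_odd:
  assumes s: "s \<in> carrier G" "\<delta> s = - 1"
  shows "ind (s [^] (9::nat)) = 1"
proof -
  let ?t = "s [^] (9::nat)"
  have t: "?t \<in> carrier G" "\<delta> ?t = - 1" "b ?t = b s" using s odd_pow9 by auto
  have mem: "x \<otimes> ?t \<otimes> inv x \<in> pt_stab \<longleftrightarrow> b (inv x) = (- b s) mod 3" if x: "x \<in> carrier G" for x
  proof -
    have "x \<otimes> ?t \<otimes> inv x \<in> pt_stab \<longleftrightarrow> (b x + \<delta> x * b s + b x) mod 3 = 0"
      using x t by (simp add: pt_stab_def b_conj)
    also have "\<dots> \<longleftrightarrow> (- \<delta> x * b x) mod 3 = (- b s) mod 3"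
      using \<delta>_range[OF x] by (auto; presburger)
    finally show ?thesis using x by (simp add: b_inv)
  qed
  have val: "\<mu> (x \<otimes> ?t \<otimes> inv x) = 1" if x: "x \<in> carrier G" and m: "x \<otimes> ?t \<otimes> inv x \<in> pt_stab" for x
  proof -
    have "b (x \<otimes> s \<otimes> inv x) = 0" using m x s t by (simp add: pt_stab_def b_conj)
    thus ?thesis using \<mu>_pow9[of "x \<otimes> s \<otimes> inv x"] conj_pow[OF x s(1)] x s by simp
  qed
  have "card {x \<in> carrier G. b (inv x) = (- b s) mod 3} = card {x \<in> carrier G. b x = (- b s) mod 3}"
    by (rule bij_betw_same_card[of "\<lambda>x. inv x"], rule bij_betw_byWitness[where f' = "\<lambda>x. inv x"]) auto
  also have "\<dots> = card pt_stab" by (rule card_fibre) auto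
  finally have c: "card {x \<in> carrier G. b (inv x) = (- b s) mod 3} = card pt_stab" .
  have "(\<Sum>x\<in>carrier G. if x \<otimes> ?t \<otimes> inv x \<in> pt_stab then \<mu> (x \<otimes> ?t \<otimes> inv x) else 0)
     = (\<Sum>x\<in>carrier G. if b (inv x) = (- b s) mod 3 then 1 else 0)"
    using mem val by (intro sum.cong refl) auto
  also have "\<dots> = of_nat (card {x \<in> carrier G. b (inv x) = (- b s) mod 3})"
    by (simp add: sum.If_cases Int_def)
  finally show ?thesis using t c card_pt_stab_pos by (simp add: induced_char_def)
qed

text \<open>Descends the subnormal chain. If \<open>t\<close> moves \<open>\<mu>\<close> on
  \<open>z\<close>, replace \<open>z\<close> by the commutator of \<open>t\<close> and
  \<open>z\<close>, on which \<open>\<mu>\<close> is a cube root of unity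
  \<open>u \<noteq> 1\<close>. The square of the reflection \<open>t\<close> fixes the point 0, so
  \<open>t\<close> turns \<open>u\<close> into its inverse, which is different from
  \<open>u\<close>.\<close>

lemma subnormal_moves:
  assumes "subnormal G S"
  shows "t \<in> S \<Longrightarrow> b t \<noteq> 0 \<Longrightarrow> \<delta> t = - 1 \<Longrightarrow> \<exists>z\<in>N \<inter> S. \<mu> (t \<otimes> z \<otimes> inv t) \<noteq> \<mu> z"
  using assms
proof (induction arbitrary: t rule: subnormal.induct)
  case whole
  thus ?case using stab[of t] subgroup.subset[OF N_sub] by auto
next
  case (step S R)
  have subS: "subgroup S G" using subnormal_subgroup[OF is_group step.hyps(1)] .
  interpret S: group "G\<lparr>carrier := S\<rparr>" using subgroup_imp_group[OF subS] .
  have RS: "R \<subseteq> S" using normal_imp_subgroup[OF step.hyps(2)] subgroup.subset by fastforce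
  have subR: "subgroup R G" using incl_subgroup[OF subS normal_imp_subgroup[OF step.hyps(2)]] .
  obtain z where z: "z \<in> N" "z \<in> S" "\<mu> (t \<otimes> z \<otimes> inv t) \<noteq> \<mu> z" using step RS by blast
  have tc: "t \<in> carrier G" and zc: "z \<in> carrier G" using step.prems(1) RS z subS subgroup.mem_carrier by fastforce+
  define y where "y = t \<otimes> z \<otimes> inv t"
  have yN: "y \<in> N" using N_conj[OF tc z(1)] by (simp add: y_def)
  interpret T: group "G\<lparr>carrier := pt_stab\<rparr>" using subgroup_imp_group[OF pt_stab_subgroup] .
  have NT: "n \<in> N \<Longrightarrow> n \<in> pt_stab" for n using N_pt_stab by auto
  have mm: "\<mu> (p \<otimes> inv q) = \<mu> p * \<mu> (inv q)" "\<mu> q * \<mu> (inv q) = 1" if "p \<in> N" "q \<in> N" for p q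
    using lin_char_mult[OF \<mu>_lin', of p "inv q"] T.lin_char_inv(2)[OF \<mu>_lin', of q] NT that N_sub pt_stab_subgroup
    by (auto simp: inv_subgroup subgroup.m_inv_closed)
  let ?w = "y \<otimes> inv z"
  have wN: "?w \<in> N" using yN z N_sub by (simp add: subgroup.m_closed subgroup.m_inv_closed)
  have yc: "y \<in> carrier G" using tc zc by (simp add: y_def)
  \<comment> \<open>Normality of \<open>R\<close> in \<open>S\<close> with \<open>z\<close> in
    \<open>S\<close> and \<open>t\<close> in \<open>R\<close> puts the commutator into
    \<open>R\<close>, although \<open>z\<close> need not belong to it.\<close>
  have "z \<otimes> inv t \<otimes> inv z \<in> R"
    using step.hyps(2) step.prems(1) z subR unfolding S.normal_inv_iff
    by (simp add: inv_subgroup[OF subS] subgroup.m_inv_closed)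
  hence "t \<otimes> (z \<otimes> inv t \<otimes> inv z) \<in> R" using step.prems(1) subR by (simp add: subgroup.m_closed)
  hence wR: "?w \<in> R" using tc zc by (simp add: y_def m_assoc)
  define u where "u = \<mu> y * \<mu> (inv z)"
  have u: "\<mu> ?w = u" using mm(1)[OF yN z(1)] by (simp add: u_def)
  have "u \<noteq> 1"
  proof
    assume "u = 1"
    hence "\<mu> y * (\<mu> z * \<mu> (inv z)) = \<mu> z" by (simp add: u_def mult_ac)
    thus False using mm(2)[OF z(1) z(1)] z(3) by (simp add: y_def)
  qed
  have u3: "u ^ 3 = 1" using \<mu>_cube[of ?w] wN b_N yc zc u by simp
  have tyt: "\<mu> (t \<otimes> y \<otimes> inv t) = \<mu> z"
  proof -
    have "t \<otimes> t \<in> pt_stab" using step.prems(3) tc by (simp add: pt_stab_def b_mult)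
    hence "\<mu> ((t \<otimes> t) \<otimes> z \<otimes> inv (t \<otimes> t)) = \<mu> z"
      using T.lin_char_conj[OF \<mu>_lin', of z "t \<otimes> t"] NT[OF z(1)] by (simp add: inv_subgroup[OF pt_stab_subgroup])
    thus ?thesis using tc zc by (simp add: y_def inv_mult_group m_assoc)
  qed
  have "t \<otimes> ?w \<otimes> inv t = (t \<otimes> y \<otimes> inv t) \<otimes> inv y"
    using tc zc yc by (simp add: y_def inv_mult_group m_assoc) (simp flip: m_assoc)
  hence "\<mu> (t \<otimes> ?w \<otimes> inv t) = \<mu> z * \<mu> (inv y)" using mm(1)[OF N_conj[OF tc yN] yN] tyt by simp
  moreover have "u * (\<mu> z * \<mu> (inv y)) = 1"
  proof -
    have "u * (\<mu> z * \<mu> (inv y)) = (\<mu> y * \<mu> (inv y)) * (\<mu> z * \<mu> (inv z))" by (simp add: u_def mult_ac)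
    thus ?thesis using mm(2)[OF yN yN] mm(2)[OF z(1) z(1)] by simp
  qed
  moreover have "u * u \<noteq> 1" using u3 \<open>u \<noteq> 1\<close> by (auto simp: power3_eq_cube)
  ultimately have "\<mu> (t \<otimes> ?w \<otimes> inv t) \<noteq> \<mu> ?w" unfolding u by auto
  thus ?case using wN wR by blast
qed

text \<open>A subnormal subgroup of the symmetric group of degree 3 containing a transposition is
  the whole group. Concretely, the conjugate of \<open>t\<close> by a reflection \<open>x\<close>
  has \<open>b\<close>-value \<open>2 * b x - b t\<close> modulo 3, and \<open>x\<close> is chosen
  to make this \<open>j\<close>.\<close>

lemma subnormal_onto:
  assumes "subnormal G S"
  shows "t \<in> S \<Longrightarrow> \<delta> t = - 1 \<Longrightarrow> 0 \<le> j \<Longrightarrow> j < 3 \<Longrightarrow> \<exists>x\<in>S. \<delta> x = - 1 \<and> b x = j"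
  using assms
proof (induction arbitrary: t j rule: subnormal.induct)
  case whole thus ?case using onto by auto
next
  case (step S R)
  have subS: "subgroup S G" using subnormal_subgroup[OF is_group step.hyps(1)] .
  interpret S: group "G\<lparr>carrier := S\<rparr>" using subgroup_imp_group[OF subS] .
  have RS: "R \<subseteq> S" using normal_imp_subgroup[OF step.hyps(2)] subgroup.subset by fastforce
  have tS: "t \<in> S" using step.prems RS by auto
  obtain x where x: "x \<in> S" "\<delta> x = - 1" "b x = (- (b t + j)) mod 3"
    using step.IH[OF tS step.prems(2), of "(- (b t + j)) mod 3"] by auto
  have c: "x \<in> carrier G" "t \<in> carrier G" using x tS subgroup.mem_carrier[OF subS] by auto
  have "x \<otimes> t \<otimes> inv x \<in> R"
    using step.hyps(2) step.prems(1) x unfolding S.normal_inv_iff by (auto simp: inv_subgroup[OF subS])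
  moreover have "\<delta> (x \<otimes> t \<otimes> inv x) = - 1" using c step.prems by (simp add: \<delta>_conj)
  moreover have "b (x \<otimes> t \<otimes> inv x) = j"
    using c step.prems x by (simp add: b_conj) presburger
  ultimately show ?case by blast
qed

abbreviation (input) ind_sgn :: "'a \<Rightarrow> complex" where "ind_sgn \<equiv> (\<lambda>x. ind x * sgn_char x)"

lemma ind_sgn_Irr: "ind_sgn \<in> Irr G"
  by (rule Irr_times_lin_char[OF ind_Irr sgn_char_lin])

text \<open>The sign is a class function, so it may be moved under the induction; the Mackey formula
  then applies to the twisted character.\<close>

lemma ind_sgn_as_induced:
  "ind_sgn = induced_char G pt_stab (\<lambda>x. \<mu> x * sgn_char x)"
proof (rule ext)
  fix g
  show "ind g * sgn_char g = induced_char G pt_stab (\<lambda>x. \<mu> x * sgn_char x) g"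
  proof (cases "g \<in> carrier G")
    case True
    have "sgn_char (x \<otimes> g \<otimes> inv x) = sgn_char g" if "x \<in> carrier G" for x
      using that True by (simp add: sgn_char_def \<delta>_conj)
    thus ?thesis using True
      by (auto simp: induced_char_def sum_distrib_right intro!: sum.cong arg_cong2[of _ _ _ _ "(/)"])
  qed (simp add: induced_char_def)
qed

text \<open>An odd element makes \<open>S\<close> transitive on the three points, so the restriction
  is again induced from a point stabilizer, and enough of \<open>N\<close> remains in
  \<open>S\<close> to keep it irreducible.\<close>

lemma restrict_ind_sgn_Irr:
  assumes sn: "subnormal G S" and t: "t \<in> S" "\<delta> t = - 1"
  shows "restrict_char S ind_sgn \<in> Irr (G\<lparr>carrier := S\<rparr>)"
proof -
  have subS: "subgroup S G" using subnormal_subgroup[OF is_group sn] .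
  have Sc: "S \<subseteq> carrier G" using subS subgroup.subset by blast
  interpret S: finite_grp "G\<lparr>carrier := S\<rparr>" using finite_grp_subgroup[OF subS] .
  interpret T: finite_grp "G\<lparr>carrier := pt_stab\<rparr>" using finite_grp_subgroup[OF pt_stab_subgroup] .
  let ?l = "\<lambda>x. \<mu> x * sgn_char x"
  have lin: "lin_char (G\<lparr>carrier := pt_stab\<rparr>) ?l"
    using \<mu>_lin' sgn_char_lin subgroup.subset[OF pt_stab_subgroup] by (auto simp: lin_char_def subset_iff)
  have trans: "\<exists>a\<in>pt_stab. \<exists>s\<in>S. x = a \<otimes> s" if x: "x \<in> carrier G" for x
  proof -
    \<comment> \<open>The value of \<open>b s\<close> is the one for which
      \<open>x \<otimes> inv s\<close> fixes the point 0.\<close>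
    obtain s where s: "s \<in> S" "\<delta> s = - 1" "b s = (- \<delta> x * b x) mod 3"
      using subnormal_onto[OF sn t, of "(- \<delta> x * b x) mod 3"] by auto
    have sc: "s \<in> carrier G" using s Sc by auto
    have "x \<otimes> inv s \<in> pt_stab"
      using x sc s \<delta>_range[OF x] by (auto simp: pt_stab_def b_mult b_inv mod_simps)
    moreover have "x = (x \<otimes> inv s) \<otimes> s" using x sc by (simp add: m_assoc)
    ultimately show ?thesis using s by blast
  qed
  let ?I = "pt_stab \<inter> S"
  have subI: "subgroup ?I (G\<lparr>carrier := S\<rparr>)"
    using subgroup_incl[OF subgroups_Inter_pair[OF pt_stab_subgroup subS] subS] by simp
  have subI': "subgroup ?I (G\<lparr>carrier := pt_stab\<rparr>)"
    using subgroup_incl[OF subgroups_Inter_pair[OF pt_stab_subgroup subS] pt_stab_subgroup] by simp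
  have linI: "lin_char (G\<lparr>carrier := S, carrier := ?I\<rparr>) (restrict_char ?I ?l)"
    using lin_char_restrict[OF lin _ subI'] by simp
  have "restrict_char S ind_sgn = induced_char (G\<lparr>carrier := S\<rparr>) ?I (restrict_char ?I ?l)"
    unfolding ind_sgn_as_induced by (rule restrict_induced_transitive[OF pt_stab_subgroup lin subS trans])
  also have "\<dots> \<in> Irr (G\<lparr>carrier := S\<rparr>)"
  proof (rule S.induced_lin_char_Irr[OF subI linI, of "N \<inter> S"])
    show "N \<inter> S \<subseteq> ?I" using N_pt_stab by auto
    fix x assume x: "x \<in> carrier (G\<lparr>carrier := S\<rparr>)"
    hence xS: "x \<in> S" and xc: "x \<in> carrier G" using Sc by auto
    { fix n assume n: "n \<in> N \<inter> S"
      show "x \<otimes>\<^bsub>G\<lparr>carrier := S\<rparr>\<^esub> n \<otimes>\<^bsub>G\<lparr>carrier := S\<rparr>\<^esub> inv\<^bsub>G\<lparr>carrier := S\<rparr>\<^esub> x \<in> N \<inter> S"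
        using N_conj[OF xc] n xS subS by (simp add: inv_subgroup subgroup.m_closed subgroup.m_inv_closed) }
    note cl = this
    assume "x \<notin> ?I"
    hence bx: "b x \<noteq> 0" using xS xc by (simp add: pt_stab_def)
    \<comment> \<open>Again \<open>x = a \<otimes> s\<close> with \<open>a\<close> in the point
      stabilizer. Conjugation by \<open>a\<close> does not change \<open>\<mu>\<close>, so it
      suffices that the reflection \<open>s\<close>, which also moves the point 0, moves
      \<open>\<mu>\<close>.\<close>
    obtain s where s: "s \<in> S" "\<delta> s = - 1" "b s = (- \<delta> x * b x) mod 3"
      using subnormal_onto[OF sn t, of "(- \<delta> x * b x) mod 3"] by auto
    have sc: "s \<in> carrier G" using s Sc by auto
    have "b s \<noteq> 0" using s(3) bx b_range[OF xc] \<delta>_range[OF xc] by (auto; presburger)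
    then obtain z where z: "z \<in> N" "z \<in> S" "\<mu> (s \<otimes> z \<otimes> inv s) \<noteq> \<mu> z"
      using subnormal_moves[OF sn s(1) _ s(2)] by blast
    have zc: "z \<in> carrier G" using z Sc by auto
    let ?a = "x \<otimes> inv s"
    have a: "?a \<in> pt_stab" using xc sc s \<delta>_range[OF xc] by (auto simp: pt_stab_def b_mult b_inv mod_simps)
    have "x \<otimes> z \<otimes> inv x = ?a \<otimes> (s \<otimes> z \<otimes> inv s) \<otimes> inv ?a"
      using xc sc zc by (simp add: inv_mult_group m_assoc) (simp flip: m_assoc)
    moreover have "\<mu> (?a \<otimes> (s \<otimes> z \<otimes> inv s) \<otimes> inv ?a) = \<mu> (s \<otimes> z \<otimes> inv s)"
      using T.lin_char_conj[OF \<mu>_lin', of "s \<otimes> z \<otimes> inv s" ?a] a N_conj[OF sc z(1)] N_pt_stab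
      by (auto simp: inv_subgroup[OF pt_stab_subgroup] subsetD)
    ultimately have ne: "\<mu> (x \<otimes> z \<otimes> inv x) \<noteq> \<mu> z" using z(3) by simp
    have sg: "sgn_char n = 1" if "n \<in> N" for n
      using that \<delta>_N subgroup.mem_carrier[OF N_sub] by (simp add: sgn_char_def)
    have xz: "x \<otimes> z \<otimes> inv x \<in> N" "x \<otimes> z \<otimes> inv x \<in> S"
      using cl[of z] z by (auto simp: inv_subgroup[OF subS] xS)
    have "restrict_char ?I ?l (x \<otimes> z \<otimes> inv x) = \<mu> (x \<otimes> z \<otimes> inv x)" "restrict_char ?I ?l z = \<mu> z"
      using xz z N_pt_stab sg by (auto simp: restrict_char_def)
    hence "restrict_char ?I ?l (x \<otimes> z \<otimes> inv x) \<noteq> restrict_char ?I ?l z" using ne by simp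
    thus "\<exists>n\<in>N \<inter> S. restrict_char ?I ?l (x \<otimes>\<^bsub>G\<lparr>carrier := S\<rparr>\<^esub> n \<otimes>\<^bsub>G\<lparr>carrier := S\<rparr>\<^esub> inv\<^bsub>G\<lparr>carrier := S\<rparr>\<^esub> x) \<noteq> restrict_char ?I ?l n"
      using z xS by (intro bexI[of _ z]) (auto simp: inv_subgroup[OF subS])
  qed
  finally show ?thesis .
qed

lemma det_pow9:
  assumes subS: "subgroup S G" and \<rho>: "matrix_rep (G\<lparr>carrier := S\<rparr>) n \<rho>" and s: "s \<in> S"
    and "det (\<rho> (s [^] (9::nat))) = 1"
  shows "det (\<rho> s) ^ 9 = 1"
proof -
  interpret S: finite_grp "G\<lparr>carrier := S\<rparr>" using finite_grp_subgroup[OF subS] .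
  have "\<rho> s \<in> carrier_mat n n" using \<rho> s by (simp add: matrix_rep_def)
  from det_pow_mat[OF this, of 9] show ?thesis
    using S.matrix_rep_pow[OF \<rho>, of s 9] s assms(4) nat_pow_consistent[of s 9 S] by simp
qed

text \<open>For every constituent on a subnormal subgroup the determinant at ninth powers is 1,
  hence its order divides 9. The sign twist is what repairs the reflections: their eigenvalues 1, 1,
  \<open>- 1\<close> become \<open>- 1\<close>, \<open>- 1\<close>, 1.\<close>

lemma ind_sgn_special: "pi_special odd_primes G ind_sgn"
  unfolding pi_special_def
proof (intro conjI allI impI)
  show "ind_sgn \<in> Irr G" by (rule ind_sgn_Irr)
  have one: "ind_sgn \<one> = 3" using ind_one \<delta>_one by (simp add: sgn_char_def)
  thus "\<exists>d. ind_sgn \<one> = of_nat d \<and> pi_number odd_primes d"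
    by (intro exI[of _ 3]) (simp add: pi_number_odd_primes)
  fix S \<sigma> assume "subnormal G S \<and> lies_under G S \<sigma> ind_sgn"
  hence sn: "subnormal G S" and under: "lies_under G S \<sigma> ind_sgn" by auto
  have subS: "subgroup S G" using subnormal_subgroup[OF is_group sn] .
  have Sc: "S \<subseteq> carrier G" using subS subgroup.subset by blast
  let ?S = "G\<lparr>carrier := S\<rparr>"
  interpret S: finite_grp "?S" using finite_grp_subgroup[OF subS] .
  have \<sigma>: "\<sigma> \<in> Irr ?S" using under by (simp add: lies_under_def irr_constituent_def)
  obtain n \<rho> where \<rho>: "matrix_rep ?S n \<rho>" "rep_char ?S \<rho> = \<sigma>"
    "det_char ?S \<sigma> = (\<lambda>x. if x \<in> carrier ?S then det (\<rho> x) else 0)"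
    using det_char_as_det[OF Irr_imp_Char[OF \<sigma>]] .
  have cr: "\<rho> x \<in> carrier_mat n n" if "x \<in> S" for x using \<rho>(1) that by (simp add: matrix_rep_def)
  have fo: "\<rho> x ^\<^sub>m card S = 1\<^sub>m n" if "x \<in> S" for x using S.matrix_rep_finite_order[OF \<rho>(1), of x] that by simp
  have cS: "card S > 0" using S.card_pos by simp
  have tr: "mat_trace (\<rho> x) = \<sigma> x" if "x \<in> S" for x using \<rho>(2) that by (auto simp: rep_char_def)
  have deg: "\<sigma> \<one> = of_nat n" using rep_char_one[OF S.is_group \<rho>(1)] \<rho>(2) by simp
  have pw: "s [^] (9::nat) \<in> S" if "s \<in> S" for s
    using S.nat_pow_closed[of s 9] that nat_pow_consistent[of s 9 S] by simp
  have even9: "ind_sgn (s [^] (9::nat)) = 3" if "s \<in> S" "\<delta> s = 1" for s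
    using that ind_pow9_even[of s] Sc by (auto simp: sgn_char_def \<delta>_pow subsetD)
  have key: "det (\<rho> s) ^ 9 = 1" if s: "s \<in> S" for s
  \<comment> \<open>Without odd elements the restriction takes its largest value 3 at ninth powers,
    so both the constituent and its complement must reach their degrees there.\<close>
  proof (cases "\<exists>t\<in>S. \<delta> t = - 1")
    case False
    have sc: "s \<in> carrier G" using s Sc by auto
    have ds: "\<delta> s = 1" using False s \<delta>_range[OF sc] by auto
    obtain m \<tau> where \<tau>: "matrix_rep ?S m \<tau>" "restrict_char S ind_sgn = (\<lambda>x. \<sigma> x + rep_char ?S \<tau> x)"
      using under by (auto simp: lies_under_def irr_constituent_def)
    let ?y = "s [^] (9::nat)"
    have y: "?y \<in> S" using pw[OF s] .
    have v: "ind_sgn x = \<sigma> x + mat_trace (\<tau> x)" if "x \<in> S" for x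
      using fun_cong[OF \<tau>(2), of x] that by (simp add: restrict_char_def rep_char_def)
    have "\<one> \<in> S" using subgroup.one_closed[OF subS] .
    hence "(3::complex) = of_nat n + of_nat m" using v[of \<one>] one deg \<tau>(1) by (simp add: matrix_rep_def)
    hence nm: "n + m = 3" by (metis of_nat_add of_nat_eq_iff of_nat_numeral)
    have "Re (mat_trace (\<rho> ?y)) \<le> n" using mat_trace_Re_le[OF cr[OF y] cS fo[OF y]] .
    moreover have "Re (mat_trace (\<tau> ?y)) \<le> m"
      using mat_trace_Re_le[of "\<tau> ?y" m "card S"] \<tau>(1) y cS S.matrix_rep_finite_order[OF \<tau>(1), of ?y]
      by (simp add: matrix_rep_def)
    moreover have "Re (mat_trace (\<rho> ?y)) + Re (mat_trace (\<tau> ?y)) = 3"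
      using v[OF y] even9[OF s ds] tr[OF y] by (metis complex_Re_numeral plus_complex.simps(1))
    ultimately have "Re (mat_trace (\<rho> ?y)) = n" using nm by linarith
    thus ?thesis using det_pow9[OF subS \<rho>(1) s] det_eq_one_if_trace_maximal[OF cr[OF y] cS fo[OF y]] by blast
  next
    case True
    then obtain t where "t \<in> S" "\<delta> t = - 1" by blast
    from restrict_ind_sgn_Irr[OF sn this] have "\<sigma> = restrict_char S ind_sgn"
      using under S.irr_constituent_Irr_iff unfolding lies_under_def by blast
    hence v: "\<sigma> x = ind_sgn x" if "x \<in> S" for x using that by (simp add: restrict_char_def)
    have "(of_nat n :: complex) = of_nat 3" using deg v[of \<one>] one subgroup.one_closed[OF subS] by simp
    hence n: "n = 3" by (simp only: of_nat_eq_iff)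
    have sc: "s \<in> carrier G" using s Sc by auto
    let ?y = "s [^] (9::nat)"
    have y: "?y \<in> S" using pw[OF s] .
    show ?thesis
    proof (cases "\<delta> s = 1")
      case ds: True
      have "Re (mat_trace (\<rho> ?y)) = n" using tr[OF y] v[OF y] even9[OF s ds] n by simp
      thus ?thesis using det_pow9[OF subS \<rho>(1) s] det_eq_one_if_trace_maximal[OF cr[OF y] cS fo[OF y]] by blast
    next
      case False
      hence ds: "\<delta> s = - 1" using \<delta>_range[OF sc] by auto
      \<comment> \<open>The trace is \<open>- 1 = 3 - 2 * 2\<close>, so two eigenvalues are
        \<open>- 1\<close> and the determinant is 1.\<close>
      have "mat_trace (\<rho> ?y) = of_nat n - 2 * of_nat 2"
        using tr[OF y] v[OF y] ind_pow9_odd[OF sc ds] odd_pow9[OF sc ds] sc n by (simp add: sgn_char_def)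
      moreover have "mat_trace (\<rho> ?y * \<rho> ?y) = of_nat n"
      proof -
        have "s \<otimes> s \<in> S" "\<delta> (s \<otimes> s) = 1" using s subS sc ds by (auto simp: subgroup.m_closed \<delta>_mult)
        hence "ind_sgn ((s \<otimes> s) [^] (9::nat)) = 3" by (rule even9)
        moreover have "(s \<otimes> s) [^] (9::nat) = ?y \<otimes> ?y" using sc by (simp add: pow_mult_distrib)
        moreover have "?y \<otimes> ?y \<in> S" using y subS by (simp add: subgroup.m_closed)
        moreover have "\<rho> ?y * \<rho> ?y = \<rho> (?y \<otimes> ?y)" using \<rho>(1) y by (simp add: matrix_rep_def)
        ultimately show ?thesis using tr[of "?y \<otimes> ?y"] v[of "?y \<otimes> ?y"] n by simp
      qed
      ultimately have "det (\<rho> ?y) = (- 1) ^ 2"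
        by (intro det_of_trace_involution[OF cr[OF y] cS fo[OF y]])
      thus ?thesis using det_pow9[OF subS \<rho>(1) s] by simp
    qed
  qed
  have "linear_char_order ?S (det_char ?S \<sigma>) dvd 9"
    by (rule linear_char_order_props(3)) (use key \<rho>(3) in auto)
  thus "pi_number odd_primes (linear_char_order ?S (det_char ?S \<sigma>))"
    unfolding pi_number_odd_primes by (metis dvd_trans odd_numeral numeral_BitM odd_one even_Suc_Suc_iff dvd_def even_mult_iff)
qed

lemma ind_factorable: "pi_factorable odd_primes G ind"
  unfolding pi_factorable_def
proof (intro conjI exI)
  show "ind \<in> Irr G" by (rule ind_Irr)
  show "pi_special odd_primes G ind_sgn" by (rule ind_sgn_special)
  have sq: "sgn_char x * sgn_char x = 1" if "x \<in> carrier G" for x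
    using \<delta>_range[OF that] that by (auto simp: sgn_char_def)
  show "pi_special (pi_compl odd_primes) G sgn_char"
    using sq by (intro lin_char_pi_special[OF sgn_char_lin pi_number_two]) (auto simp: power2_eq_square)
  show "ind = (\<lambda>x. ind_sgn x * sgn_char x)"
  proof
    fix x show "ind x = ind_sgn x * sgn_char x"
      using sq[of x] by (cases "x \<in> carrier G") (auto simp: mult.assoc induced_char_def)
  qed
qed

text \<open>Without the twist the trace at the ninth power of a reflection is
  \<open>1 = 3 - 2 * 1\<close>, so the determinant is \<open>- 1\<close> there and has even
  order.\<close>

lemma ind_not_special: "\<not> pi_special odd_primes G ind"
proof
  assume sp: "pi_special odd_primes G ind"
  have G: "G\<lparr>carrier := carrier G\<rparr> = G" by simp
  have "restrict_char (carrier G) ind = ind" by (auto simp: restrict_char_def induced_char_def fun_eq_iff)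
  hence "lies_under G (carrier G) ind ind" using irr_constituent_Irr_iff[OF ind_Irr] by (simp add: lies_under_def)
  hence od: "odd (linear_char_order G (det_char G ind))"
    using sp subnormal.whole[of G] unfolding pi_special_def pi_number_odd_primes by (metis G)
  obtain n \<rho> where \<rho>: "matrix_rep G n \<rho>" "rep_char G \<rho> = ind"
    "det_char G ind = (\<lambda>x. if x \<in> carrier G then det (\<rho> x) else 0)"
    using det_char_as_det[OF Irr_imp_Char[OF ind_Irr]] .
  have "(of_nat n :: complex) = of_nat 3" using rep_char_one[OF is_group \<rho>(1)] \<rho>(2) ind_one by simp
  hence n: "n = 3" by (simp only: of_nat_eq_iff)
  obtain s where s: "s \<in> carrier G" "\<delta> s = - 1" using onto[of 0] by auto
  let ?y = "s [^] (9::nat)"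
  have y: "?y \<in> carrier G" using s by simp
  have cr: "\<rho> ?y \<in> carrier_mat n n" using \<rho>(1) y by (simp add: matrix_rep_def)
  have tr: "mat_trace (\<rho> x) = ind x" if "x \<in> carrier G" for x using fun_cong[OF \<rho>(2), of x] that by (simp add: rep_char_def)
  have "mat_trace (\<rho> ?y) = of_nat n - 2 * of_nat 1" using tr[OF y] ind_pow9_odd[OF s] n by simp
  moreover have "mat_trace (\<rho> ?y * \<rho> ?y) = of_nat n"
  proof -
    have "ind ((s \<otimes> s) [^] (9::nat)) = 3" using s by (intro ind_pow9_even) (auto simp: \<delta>_mult)
    moreover have "(s \<otimes> s) [^] (9::nat) = ?y \<otimes> ?y" using s by (simp add: pow_mult_distrib)
    moreover have "\<rho> ?y * \<rho> ?y = \<rho> (?y \<otimes> ?y)" using \<rho>(1) y by (simp add: matrix_rep_def)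
    ultimately show ?thesis using tr[of "?y \<otimes> ?y"] y n by simp
  qed
  ultimately have "det (\<rho> ?y) = (- 1) ^ 1"
    by (intro det_of_trace_involution[OF cr card_pos matrix_rep_finite_order[OF \<rho>(1) y]])
  hence "(- 1 :: complex) ^ linear_char_order G (det_char G ind) = 1"
    using det_char_order(2)[OF Irr_imp_Char[OF ind_Irr] y] \<rho>(3) y by simp
  thus False using od by simp
qed

end

section \<open>Nuclei over the wreath configuration\<close>

lemma (in finite_grp) Irr_degree_nonzero:
  assumes "\<chi> \<in> Irr G"
  shows "\<chi> \<one> \<noteq> 0"
proof -
  from assms obtain n \<rho> where \<rho>: "irreducible_rep G n \<rho>" "\<chi> = rep_char G \<rho>" by (auto simp: Irr_def)
  hence "matrix_rep G n \<rho>" "n > 0" by (auto simp: irreducible_rep_def)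
  thus ?thesis using rep_char_one[OF is_group] \<rho>(2) by simp
qed

lemma restrict_char_twice: "H \<subseteq> K \<Longrightarrow> restrict_char H (restrict_char K \<chi>) = restrict_char H \<chi>"
  by (auto simp: restrict_char_def fun_eq_iff)

lemma restrict_char_self: "\<chi> \<in> Char G \<Longrightarrow> restrict_char (carrier G) \<chi> = \<chi>"
  using Char_outside by (fastforce simp: restrict_char_def)

context finite_grp
begin

text \<open>Multiplicities are natural numbers, so that of \<open>\<kappa>\<close> in
  \<open>\<phi>\<close> cannot be cancelled by the complement of \<open>\<phi>\<close>.\<close>

lemma lies_under_trans:
  assumes K: "subgroup K G" and H: "subgroup H G" "H \<subseteq> K" and \<chi>: "\<chi> \<in> Char G"
    and \<phi>: "lies_under G K \<phi> \<chi>" and \<kappa>: "lies_under (G\<lparr>carrier := K\<rparr>) H \<kappa> \<phi>"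
  shows "lies_under G H \<kappa> \<chi>"
proof -
  interpret K: finite_grp "G\<lparr>carrier := K\<rparr>" using finite_grp_subgroup[OF K] .
  interpret H: finite_grp "G\<lparr>carrier := H\<rparr>" using finite_grp_subgroup[OF H(1)] .
  have HK: "subgroup H (G\<lparr>carrier := K\<rparr>)" using subgroup_incl[OF H(1) K H(2)] .
  obtain n \<rho> where \<rho>: "matrix_rep (G\<lparr>carrier := K\<rparr>) n \<rho>"
    "restrict_char K \<chi> = (\<lambda>x. \<phi> x + rep_char (G\<lparr>carrier := K\<rparr>) \<rho> x)" and \<phi>I: "\<phi> \<in> Irr (G\<lparr>carrier := K\<rparr>)"
    using \<phi> by (auto simp: lies_under_def irr_constituent_def)
  let ?r = "rep_char (G\<lparr>carrier := K\<rparr>) \<rho>"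
  have rC: "?r \<in> Char (G\<lparr>carrier := K\<rparr>)" using \<rho>(1) unfolding Char_def by blast
  have \<kappa>I: "\<kappa> \<in> Irr (G\<lparr>carrier := H\<rparr>)" and nz: "char_ip (G\<lparr>carrier := H\<rparr>) \<kappa> (restrict_char H \<phi>) \<noteq> 0"
    using \<kappa> K.lies_under_iff[OF HK Irr_imp_Char[OF \<phi>I]] by auto
  have Hc: "H \<subseteq> carrier (G\<lparr>carrier := K\<rparr>)" using H by simp
  have c1: "restrict_char H \<phi> \<in> Char (G\<lparr>carrier := H\<rparr>)"
    using restrict_Char[OF Irr_imp_Char[OF \<phi>I] Hc] by simp
  have c2: "restrict_char H ?r \<in> Char (G\<lparr>carrier := H\<rparr>)"
    using restrict_Char[OF rC Hc] by simp
  obtain p where p: "char_ip (G\<lparr>carrier := H\<rparr>) \<kappa> (restrict_char H \<phi>) = of_nat p"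
    by (rule H.char_ip_Irr_Char_nat[OF \<kappa>I c1])
  obtain q where q: "char_ip (G\<lparr>carrier := H\<rparr>) \<kappa> (restrict_char H ?r) = of_nat q"
    by (rule H.char_ip_Irr_Char_nat[OF \<kappa>I c2])
  have "restrict_char H \<chi> = (\<lambda>x. restrict_char H \<phi> x + restrict_char H ?r x)"
    unfolding restrict_char_twice[OF H(2), symmetric, of \<chi>] \<rho>(2) by (auto simp: restrict_char_def)
  hence "char_ip (G\<lparr>carrier := H\<rparr>) \<kappa> (restrict_char H \<chi>) = of_nat (p + q)"
    by (simp add: char_ip_add_right p q)
  moreover have "p \<noteq> 0" using nz p by auto
  ultimately have "char_ip (G\<lparr>carrier := H\<rparr>) \<kappa> (restrict_char H \<chi>) \<noteq> 0"
    by (metis add_is_0 of_nat_eq_0_iff)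
  thus ?thesis using lies_under_iff[OF H(1) \<chi>] \<kappa>I by simp
qed

lemma conj_lin_char:
  assumes N: "N \<lhd> G" and T: "subgroup T G" "N \<subseteq> T" and \<mu>: "lin_char (G\<lparr>carrier := T\<rparr>) \<mu>" and x: "x \<in> carrier G"
  shows "lin_char (G\<lparr>carrier := N\<rparr>) (restrict_char N (\<lambda>n. \<mu> (x \<otimes> n \<otimes> inv x)))"
proof -
  have sub: "subgroup N G" using N normal_imp_subgroup by blast
  have cl: "x \<otimes> n \<otimes> inv x \<in> T" if "n \<in> N" for n using N x that normal_inv_iff T(2) by blast
  have "\<mu> (x \<otimes> (n \<otimes> m) \<otimes> inv x) = \<mu> (x \<otimes> n \<otimes> inv x) * \<mu> (x \<otimes> m \<otimes> inv x)" if "n \<in> N" "m \<in> N" for n m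
  proof -
    have c: "n \<in> carrier G" "m \<in> carrier G" using that subgroup.mem_carrier[OF sub] by auto
    have "x \<otimes> (n \<otimes> m) \<otimes> inv x = (x \<otimes> n \<otimes> inv x) \<otimes> (x \<otimes> m \<otimes> inv x)"
      using c x by (simp add: m_assoc) (simp flip: m_assoc)
    thus ?thesis using lin_char_mult[OF \<mu>, of "x \<otimes> n \<otimes> inv x" "x \<otimes> m \<otimes> inv x"] cl that by simp
  qed
  thus ?thesis using sub x lin_char_one[OF \<mu>]
    by (auto simp: lin_char_def restrict_char_def subgroup.m_closed subgroup.one_closed)
qed

text \<open>On a normal subgroup inside \<open>T\<close> the induced character, multiplied by the
  order of \<open>T\<close>, is the sum of all conjugates of \<open>\<mu>\<close>. Summing over the
  whole group instead of a transversal only rescales the multiplicities.\<close>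

lemma lies_under_induced_lin_char_iff:
  assumes N: "N \<lhd> G" and T: "subgroup T G" "N \<subseteq> T" and \<mu>: "lin_char (G\<lparr>carrier := T\<rparr>) \<mu>"
  shows "lies_under G N \<kappa> (induced_char G T \<mu>) \<longleftrightarrow>
    (\<exists>x\<in>carrier G. \<kappa> = restrict_char N (\<lambda>n. \<mu> (x \<otimes> n \<otimes> inv x)))" (is "_ \<longleftrightarrow> ?R")
proof -
  have sub: "subgroup N G" using N normal_imp_subgroup by blast
  have Nc: "N \<subseteq> carrier G" using sub subgroup.subset by blast
  interpret N: finite_grp "G\<lparr>carrier := N\<rparr>" using finite_grp_subgroup[OF sub] .
  let ?n = "\<lambda>x. restrict_char N (\<lambda>n. \<mu> (x \<otimes> n \<otimes> inv x))"
  have cl: "x \<otimes> n \<otimes> inv x \<in> T" if "n \<in> N" "x \<in> carrier G" for n x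
    using N that normal_inv_iff T(2) by blast
  have nI: "?n x \<in> Irr (G\<lparr>carrier := N\<rparr>)" if "x \<in> carrier G" for x
    using lin_char_Irr[OF N.is_group conj_lin_char[OF N T \<mu> that]] .
  have cT: "card T \<noteq> 0" using subgroup.one_closed[OF T(1)] finite_subset[OF subgroup.subset[OF T(1)]] by auto
  have Ch: "induced_char G T \<mu> \<in> Char G" by (rule induced_lin_char_Char[OF T(1) \<mu>])
  have key: "char_ip (G\<lparr>carrier := N\<rparr>) \<kappa> (restrict_char N (induced_char G T \<mu>)) * of_nat (card T) =
     of_nat (card {x \<in> carrier G. \<kappa> = ?n x})" if \<kappa>: "\<kappa> \<in> Irr (G\<lparr>carrier := N\<rparr>)"
  proof -
    have "restrict_char N (induced_char G T \<mu>) n * of_nat (card T) = (\<Sum>x\<in>carrier G. ?n x n)" if "n \<in> N" for n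
    proof -
      have "restrict_char N (induced_char G T \<mu>) n = (\<Sum>x\<in>carrier G. \<mu> (x \<otimes> n \<otimes> inv x)) / of_nat (card T)"
        using that cl[OF that] Nc by (auto simp: restrict_char_def induced_char_def intro!: sum.cong)
      thus ?thesis using cT that by (simp add: restrict_char_def)
    qed
    hence "char_ip (G\<lparr>carrier := N\<rparr>) \<kappa> (\<lambda>n. restrict_char N (induced_char G T \<mu>) n * of_nat (card T)) =
       char_ip (G\<lparr>carrier := N\<rparr>) \<kappa> (\<lambda>n. \<Sum>x\<in>carrier G. ?n x n)"
      by (intro char_ip_cong_right) simp
    also have "\<dots> = (\<Sum>x\<in>carrier G. char_ip (G\<lparr>carrier := N\<rparr>) \<kappa> (?n x))" by (rule char_ip_sum_right)
    also have "\<dots> = (\<Sum>x\<in>carrier G. if \<kappa> = ?n x then 1 else 0)"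
      using N.char_ip_Irr[OF \<kappa> nI] by (intro sum.cong refl) auto
    also have "\<dots> = of_nat (card {x \<in> carrier G. \<kappa> = ?n x})" by (simp add: sum.If_cases Int_def)
    finally show ?thesis by (simp add: char_ip_def sum_distrib_right mult.assoc)
  qed
  show ?thesis
  proof
    assume L: "lies_under G N \<kappa> (induced_char G T \<mu>)"
    hence \<kappa>: "\<kappa> \<in> Irr (G\<lparr>carrier := N\<rparr>)" and "char_ip (G\<lparr>carrier := N\<rparr>) \<kappa> (restrict_char N (induced_char G T \<mu>)) \<noteq> 0"
      using lies_under_iff[OF sub Ch] by auto
    hence "card {x \<in> carrier G. \<kappa> = ?n x} \<noteq> 0" using key[OF \<kappa>] cT by (metis mult_eq_0_iff of_nat_eq_0_iff)
    hence "{x \<in> carrier G. \<kappa> = ?n x} \<noteq> {}" by (metis card.empty)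
    thus ?R by blast
  next
    assume R: ?R
    hence \<kappa>: "\<kappa> \<in> Irr (G\<lparr>carrier := N\<rparr>)" using nI by blast
    have "card {x \<in> carrier G. \<kappa> = ?n x} \<noteq> 0" using R by auto
    hence "char_ip (G\<lparr>carrier := N\<rparr>) \<kappa> (restrict_char N (induced_char G T \<mu>)) \<noteq> 0"
      using key[OF \<kappa>] by auto
    thus "lies_under G N \<kappa> (induced_char G T \<mu>)" using lies_under_iff[OF sub Ch] \<kappa> by blast
  qed
qed

lemma lin_char_cube_factorable:
  assumes \<mu>: "lin_char G \<mu>" "\<And>x. x \<in> carrier G \<Longrightarrow> \<mu> x ^ 3 = 1"
  shows "pi_special odd_primes G \<mu>" "pi_factorable odd_primes G \<mu>"
proof -
  show sp: "pi_special odd_primes G \<mu>"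
    by (rule lin_char_pi_special[of _ _ 3]) (use \<mu> in \<open>auto simp: pi_number_odd_primes\<close>)
  let ?t = "\<lambda>x. if x \<in> carrier G then 1 else (0::complex)"
  have "pi_special (pi_compl odd_primes) G ?t"
    by (rule lin_char_pi_special[of _ _ 1]) (auto simp: lin_char_def pi_number_def)
  moreover have "\<mu> = (\<lambda>x. \<mu> x * ?t x)" using \<mu> by (auto simp: lin_char_def)
  moreover have "\<mu> \<in> Irr G" using lin_char_Irr[OF is_group \<mu>(1)] .
  ultimately show "pi_factorable odd_primes G \<mu>" using sp unfolding pi_factorable_def by blast
qed

end

lemma (in group) induced_char_subgroup:
  assumes "subgroup H G" "g \<in> H"
  shows "induced_char (G\<lparr>carrier := H\<rparr>) T \<mu> g =
    (\<Sum>x\<in>H. if x \<otimes> g \<otimes> inv x \<in> T then \<mu> (x \<otimes> g \<otimes> inv x) else 0) / of_nat (card T)"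
  using assms by (simp add: induced_char_def inv_subgroup cong: if_cong sum.cong)

text \<open>Modulo \<open>N\<close> the subgroup \<open>F\<close> is an elementary abelian 2-group,
  and its elements outside \<open>R\<close> are the source of the moving involutions. The asymmetry
  of the example sits in the last two assumptions: in \<open>G\<close> every normal subgroup
  strictly above \<open>N\<close> contains such an element, in \<open>M\<close> only those not
  contained in \<open>R\<close>, and \<open>R\<close> is itself normal in \<open>M\<close>.\<close>

locale nucleus_setting = finite_grp +
  fixes N F M R :: "'a set" and \<delta> b :: "'a \<Rightarrow> int" and \<mu> :: "'a \<Rightarrow> complex"
  assumes N_normal: "N \<lhd> G" and F_normal: "F \<lhd> G" and M_normal: "M \<lhd> G"
    and R_sub: "subgroup R G" and R_M: "R \<subseteq> M" and R_conj: "\<And>m r. m \<in> M \<Longrightarrow> r \<in> R \<Longrightarrow> m \<otimes> r \<otimes> inv m \<in> R"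
    and M_not_R: "\<not> M \<subseteq> R"
    and N_R: "N \<subseteq> R" and N_F: "N \<subseteq> F"
    and N_comm: "\<And>x y. x \<in> N \<Longrightarrow> y \<in> N \<Longrightarrow> x \<otimes> y = y \<otimes> x"
    and N_cube: "\<And>x. x \<in> N \<Longrightarrow> x [^] (3::nat) = \<one>"
    and F_square: "\<And>x. x \<in> F \<Longrightarrow> x \<otimes> x \<in> N"
    and F_comm: "\<And>x y. x \<in> F \<Longrightarrow> y \<in> F \<Longrightarrow> x \<otimes> y \<otimes> inv x \<otimes> inv y \<in> N"
    and R_sym3: "sym3_cover (G\<lparr>carrier := R\<rparr>) N \<delta> b \<mu>"
    and stab_R: "\<And>x. x \<in> carrier G \<Longrightarrow> x \<notin> R \<Longrightarrow> \<exists>n\<in>N. \<mu> (x \<otimes> n \<otimes> inv x) \<noteq> \<mu> n"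
    and normal_G_meets: "\<And>C. C \<lhd> G \<Longrightarrow> N \<subset> C \<Longrightarrow> \<exists>e\<in>C \<inter> F. e \<notin> R"
    and normal_M_meets: "\<And>C. C \<lhd> G\<lparr>carrier := M\<rparr> \<Longrightarrow> \<not> C \<subseteq> R \<Longrightarrow> \<exists>e\<in>C \<inter> F. e \<notin> R"
begin

sublocale S: sym3_cover "G\<lparr>carrier := R\<rparr>" N \<delta> b \<mu> by (rule R_sym3)

definition T where "T = {x \<in> R. b x = 0}"

lemma T_eq: "S.pt_stab = T"
  by (simp add: S.pt_stab_def T_def)

lemma R_carrier: "R \<subseteq> carrier G" and M_sub: "subgroup M G" and N_sub_G: "subgroup N G" and F_sub: "subgroup F G"
  using R_sub subgroup.subset M_normal N_normal F_normal normal_imp_subgroup by blast+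

lemma T_sub_R: "subgroup T (G\<lparr>carrier := R\<rparr>)"
  using S.pt_stab_subgroup T_eq by simp

lemma T_sub: "subgroup T G"
  using incl_subgroup[OF R_sub T_sub_R] .

lemma T_R: "T \<subseteq> R" by (auto simp: T_def)

lemma N_T: "N \<subseteq> T" using S.N_pt_stab T_eq by simp

lemma \<mu>_T: "lin_char (G\<lparr>carrier := T\<rparr>) \<mu>"
  using S.\<mu>_lin' T_eq by simp

lemma \<mu>_T_cube: "x \<in> T \<Longrightarrow> \<mu> x ^ 3 = 1"
  using S.\<mu>_cube by (auto simp: T_def)

lemma N_conj_closed: "x \<in> carrier G \<Longrightarrow> n \<in> N \<Longrightarrow> x \<otimes> n \<otimes> inv x \<in> N"
  using N_normal normal_inv_iff by blast

lemma stab_T: "x \<in> carrier G \<Longrightarrow> x \<notin> T \<Longrightarrow> \<exists>n\<in>N. \<mu> (x \<otimes> n \<otimes> inv x) \<noteq> \<mu> n"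
  using stab_R[of x] S.stab[of x] by (cases "x \<in> R") (auto simp: T_def inv_subgroup[OF R_sub])

definition \<eta> where "\<eta> = induced_char G T \<mu>"
definition \<theta> where "\<theta> = induced_char (G\<lparr>carrier := M\<rparr>) T \<mu>"

lemma \<eta>_Irr: "\<eta> \<in> Irr G"
  unfolding \<eta>_def by (rule induced_lin_char_Irr[OF T_sub \<mu>_T N_T N_conj_closed stab_T])

lemma M_grp: "finite_grp (G\<lparr>carrier := M\<rparr>)"
  by (rule finite_grp_subgroup[OF M_sub])

lemma T_sub_M: "subgroup T (G\<lparr>carrier := M\<rparr>)"
  using subgroup_incl[OF T_sub M_sub] T_R R_M by auto

lemma M_carrier: "M \<subseteq> carrier G"
  using M_sub subgroup.subset by blast

lemma \<theta>_Irr: "\<theta> \<in> Irr (G\<lparr>carrier := M\<rparr>)"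
proof -
  interpret M: finite_grp "G\<lparr>carrier := M\<rparr>" by (rule M_grp)
  show ?thesis unfolding \<theta>_def
    using \<mu>_T M_carrier stab_T N_conj_closed
    by (intro M.induced_lin_char_Irr[OF T_sub_M _ N_T]) (auto simp: inv_subgroup[OF M_sub] subsetD)
qed

text \<open>Frobenius reciprocity twice: the multiplicity of \<open>\<theta>\<close> in
  \<open>\<eta>\<close> equals that of \<open>\<mu>\<close> in \<open>\<eta>\<close>, which is the
  norm of \<open>\<eta>\<close>.\<close>

lemma \<theta>_under_\<eta>: "irr_constituent (G\<lparr>carrier := M\<rparr>) \<theta> (restrict_char M \<eta>)"
proof -
  interpret M: finite_grp "G\<lparr>carrier := M\<rparr>" by (rule M_grp)
  have C: "restrict_char M \<eta> \<in> Char (G\<lparr>carrier := M\<rparr>)"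
    using restrict_Char[OF Irr_imp_Char[OF \<eta>_Irr] M_carrier] .
  have "char_ip (G\<lparr>carrier := M\<rparr>) \<theta> (restrict_char M \<eta>) =
     char_ip (G\<lparr>carrier := T\<rparr>) \<mu> (restrict_char T (restrict_char M \<eta>))"
    unfolding \<theta>_def using M.Frobenius_reciprocity[OF T_sub_M C, of \<mu>] by simp
  also have "\<dots> = char_ip G \<eta> \<eta>"
    using Frobenius_reciprocity[OF T_sub Irr_imp_Char[OF \<eta>_Irr], of \<mu>] restrict_char_twice[of T M \<eta>] T_R R_M
    by (auto simp: \<eta>_def)
  finally have "char_ip (G\<lparr>carrier := M\<rparr>) \<theta> (restrict_char M \<eta>) = 1" using char_ip_Irr_self[OF \<eta>_Irr] by simp
  thus ?thesis using M.irr_constituent_iff[OF C] \<theta>_Irr by simp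
qed

text \<open>The cube of an element of \<open>F\<close> is trivial or an involution, since \<open>F/N\<close> has exponent \<open>2\<close>
  and \<open>N\<close> has exponent \<open>3\<close>.\<close>

lemma no_factorable_over:
  assumes C: "subgroup C G" and norm: "\<And>n c. n \<in> N \<Longrightarrow> c \<in> C \<Longrightarrow> n \<otimes> c \<otimes> inv n \<in> C"
    and e0: "e0 \<in> C" "e0 \<in> F" "e0 \<notin> R" and m: "m \<in> M" and \<chi>: "pi_factorable odd_primes (G\<lparr>carrier := C\<rparr>) \<chi>"
  shows "\<not> lies_under (G\<lparr>carrier := C\<rparr>) (N \<inter> C) (restrict_char (N \<inter> C) (\<lambda>n. \<mu> (m \<otimes> n \<otimes> inv m))) \<chi>"
proof -
  interpret C: finite_grp "G\<lparr>carrier := C\<rparr>" using finite_grp_subgroup[OF C] .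
  interpret T: group "G\<lparr>carrier := T\<rparr>" using subgroup_imp_group[OF T_sub] .
  have Cc: "C \<subseteq> carrier G" using C subgroup.subset by blast
  have mc: "m \<in> carrier G" using m M_carrier by auto
  have e0c: "e0 \<in> carrier G" using e0 Cc by auto
  define e where "e = e0 \<otimes> e0 \<otimes> e0"
  have ee0: "e0 \<otimes> e0 \<in> N" using F_square e0 by blast
  have eC: "e \<in> C" and eF: "e \<in> F" using e0 C F_sub by (auto simp: e_def subgroup.m_closed)
  have ec: "e \<in> carrier G" using eC Cc by auto
  have e2: "e \<otimes> e = \<one>"
    using N_cube[OF ee0] e0c by (simp add: e_def m_assoc numeral_3_eq_3)
  have ie: "inv e = e" using e2 ec inv_equality by blast
  have eR: "e \<notin> R"
    using subgroup_mult_left_iff[OF R_sub, of "e0 \<otimes> e0" e0] ee0 N_R e0 e0c by (auto simp: e_def)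
  \<comment> \<open>How \<open>e\<close> acts on the conjugate of \<open>\<mu>\<close> by
    \<open>m\<close> is how \<open>f\<close> acts on \<open>\<mu>\<close>. As \<open>M\<close>
    normalizes \<open>R\<close>, \<open>f\<close> is outside \<open>R\<close> and moves
    \<open>\<mu>\<close> on some \<open>n\<close>.\<close>
  define f where "f = m \<otimes> e \<otimes> inv m"
  have fc: "f \<in> carrier G" using mc ec by (simp add: f_def)
  have imM: "inv m \<in> M" using m M_sub by (simp add: subgroup.m_inv_closed)
  have "f \<notin> R"
  proof
    assume "f \<in> R"
    hence "inv m \<otimes> f \<otimes> inv (inv m) \<in> R" using R_conj[OF imM] by blast
    moreover have "inv m \<otimes> f \<otimes> inv (inv m) = e" using mc ec by (simp add: f_def m_assoc) (simp flip: m_assoc)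
    ultimately show False using eR by simp
  qed
  then obtain n where n: "n \<in> N" "\<mu> (f \<otimes> n \<otimes> inv f) \<noteq> \<mu> n" using stab_R[OF fc] by auto
  have nc: "n \<in> carrier G" using n subgroup.mem_carrier[OF N_sub_G] by auto
  let ?\<nu> = "\<lambda>n. \<mu> (m \<otimes> n \<otimes> inv m)"
  have lin: "lin_char (G\<lparr>carrier := N\<rparr>) (restrict_char N ?\<nu>)"
    by (rule conj_lin_char[OF N_normal T_sub N_T \<mu>_T mc])
  define n1 where "n1 = inv m \<otimes> n \<otimes> m"
  have n1: "n1 \<in> N" using N_conj_closed[OF inv_closed[OF mc] n(1)] mc by (simp add: n1_def)
  have n1c: "n1 \<in> carrier G" using mc nc by (simp add: n1_def)
  define y where "y = e \<otimes> n1 \<otimes> inv e"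
  have yN: "y \<in> N" using N_conj_closed[OF ec n1] by (simp add: y_def)
  have yc: "y \<in> carrier G" using ec n1c by (simp add: y_def)
  have v1: "?\<nu> n1 = \<mu> n" using mc nc by (simp add: n1_def m_assoc) (simp flip: m_assoc)
  have v2: "?\<nu> y = \<mu> (f \<otimes> n \<otimes> inv f)"
    using mc nc ec by (simp add: n1_def y_def f_def m_assoc inv_mult_group)
  interpret N: group "G\<lparr>carrier := N\<rparr>" using subgroup_imp_group[OF N_sub_G] .
  have mult: "?\<nu> (p \<otimes> inv q) = ?\<nu> p * ?\<nu> (inv q)" "?\<nu> q * ?\<nu> (inv q) = 1" if "p \<in> N" "q \<in> N" for p q
    using lin_char_mult[OF lin, of p "inv q"] N.lin_char_inv(2)[OF lin, of q] that N_sub_G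
    by (auto simp: restrict_char_def inv_subgroup subgroup.m_inv_closed subgroup.m_closed)
  \<comment> \<open>\<open>n1\<close> need not lie in \<open>C\<close>, but the commutator of
    \<open>e\<close> and \<open>n1\<close> does, because \<open>N\<close> normalizes
    \<open>C\<close>. The character has a value \<open>u \<noteq> 1\<close> there, the involution
    \<open>e\<close> inverts the commutator, and a cube root of unity other than 1 differs from its
    inverse; so \<open>e\<close> moves the character already on \<open>N \<inter> C\<close>.\<close>
  define n0 where "n0 = y \<otimes> inv n1"
  have n0N: "n0 \<in> N" using yN n1 N_sub_G by (simp add: n0_def subgroup.m_closed subgroup.m_inv_closed)
  have "e \<otimes> (n1 \<otimes> inv e \<otimes> inv n1) \<in> C" using eC norm[OF n1, of "inv e"] C by (simp add: subgroup.m_closed subgroup.m_inv_closed)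
  hence n0C: "n0 \<in> C" using ec n1c by (simp add: n0_def y_def m_assoc)
  define u where "u = ?\<nu> n0"
  have u: "u = ?\<nu> y * ?\<nu> (inv n1)" using mult(1)[OF yN n1] by (simp add: u_def n0_def)
  have "u \<noteq> 1"
  proof
    assume "u = 1"
    hence eq: "?\<nu> y * ?\<nu> (inv n1) = ?\<nu> n1 * ?\<nu> (inv n1)" using u mult(2)[OF n1 n1] by simp
    have "?\<nu> (inv n1) \<noteq> 0" using mult(2)[OF n1 n1] by auto
    with eq have "?\<nu> y = ?\<nu> n1" by (simp only: mult_cancel_right simp_thms)
    thus False using v1 v2 n(2) by simp
  qed
  have u3: "u ^ 3 = 1"
    using \<mu>_T_cube[of "m \<otimes> n0 \<otimes> inv m"] N_conj_closed[OF mc n0N] N_T by (auto simp: u_def)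
  have "e \<otimes> n0 \<otimes> inv e = n1 \<otimes> inv y"
    using ec n1c e2 by (simp add: n0_def y_def m_assoc inv_mult_group ie) (simp flip: m_assoc)
  hence "?\<nu> (e \<otimes> n0 \<otimes> inv e) = ?\<nu> n1 * ?\<nu> (inv y)" using mult(1)[OF n1 yN] by simp
  moreover have "u * (?\<nu> n1 * ?\<nu> (inv y)) = 1"
  proof -
    have "u * (?\<nu> n1 * ?\<nu> (inv y)) = (?\<nu> y * ?\<nu> (inv y)) * (?\<nu> n1 * ?\<nu> (inv n1))" unfolding u by (simp only: mult_ac)
    thus ?thesis using mult(2)[OF yN yN] mult(2)[OF n1 n1] by simp
  qed
  moreover have "u * u \<noteq> 1" using u3 \<open>u \<noteq> 1\<close> by (auto simp: power3_eq_cube)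
  ultimately have moved: "?\<nu> (e \<otimes> n0 \<otimes> inv e) \<noteq> ?\<nu> n0" by (auto simp: u_def)
  have subNC: "subgroup (N \<inter> C) G" using subgroups_Inter_pair[OF N_sub_G C] .
  have subFC: "subgroup (F \<inter> C) G" using subgroups_Inter_pair[OF F_sub C] .
  have conjC: "x \<otimes> y \<otimes> inv x \<in> C" if "x \<in> C" "y \<in> C" for x y
    using that C by (simp add: subgroup.m_closed subgroup.m_inv_closed)
  have nN: "N \<inter> C \<lhd> G\<lparr>carrier := C\<rparr>"
    unfolding C.normal_inv_iff using subgroup_incl[OF subNC C] N_conj_closed conjC Cc
    by (auto simp: inv_subgroup[OF C] subsetD)
  have nF: "F \<inter> C \<lhd> G\<lparr>carrier := C\<rparr>"
    unfolding C.normal_inv_iff using subgroup_incl[OF subFC C] F_normal normal_inv_iff conjC Cc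
    by (auto simp: inv_subgroup[OF C] subsetD)
  have linC: "lin_char (G\<lparr>carrier := C, carrier := N \<inter> C\<rparr>) (restrict_char (N \<inter> C) ?\<nu>)"
    using lin_char_restrict[OF lin, of "N \<inter> C"] subgroup_incl[OF subNC N_sub_G] restrict_char_twice[of "N \<inter> C" N ?\<nu>] by simp
  have eN: "e \<otimes> n0 \<otimes> inv e \<in> N \<inter> C" using N_conj_closed[OF ec n0N] conjC[OF eC n0C] by simp
  show ?thesis
  proof (rule C.factorable_not_over_moved_lin_char[OF \<chi> nN nF, of e _ n0])
    show "lin_char (G\<lparr>carrier := C, carrier := N \<inter> C\<rparr>) (restrict_char (N \<inter> C) ?\<nu>)" by (rule linC)
    show "restrict_char (N \<inter> C) ?\<nu> (e \<otimes>\<^bsub>G\<lparr>carrier := C\<rparr>\<^esub> n0 \<otimes>\<^bsub>G\<lparr>carrier := C\<rparr>\<^esub> inv\<^bsub>G\<lparr>carrier := C\<rparr>\<^esub> e) \<noteq> restrict_char (N \<inter> C) ?\<nu> n0"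
      using moved eN n0N n0C eC by (simp add: inv_subgroup[OF C] restrict_char_def)
    show "x [^]\<^bsub>G\<lparr>carrier := C\<rparr>\<^esub> (3::nat) = \<one>\<^bsub>G\<lparr>carrier := C\<rparr>\<^esub>" if "x \<in> N \<inter> C" for x
      using N_cube[of x] that nat_pow_consistent[of x 3 C] by simp
    show "x \<otimes>\<^bsub>G\<lparr>carrier := C\<rparr>\<^esub> y \<otimes>\<^bsub>G\<lparr>carrier := C\<rparr>\<^esub> inv\<^bsub>G\<lparr>carrier := C\<rparr>\<^esub> x \<otimes>\<^bsub>G\<lparr>carrier := C\<rparr>\<^esub> inv\<^bsub>G\<lparr>carrier := C\<rparr>\<^esub> y \<in> N \<inter> C"
      if "x \<in> F \<inter> C" "y \<in> F \<inter> C" for x y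
      using F_comm[of x y] that conjC[of x y] C by (simp add: inv_subgroup subgroup.m_closed subgroup.m_inv_closed)
  qed (use N_F N_comm eF eC e2 n0N n0C in auto)
qed

lemma \<nu>_under_induced:
  assumes K: "subgroup K G" "T \<subseteq> K"
  shows "lies_under (G\<lparr>carrier := K\<rparr>) N (restrict_char N \<mu>) (induced_char (G\<lparr>carrier := K\<rparr>) T \<mu>)"
proof -
  interpret K: finite_grp "G\<lparr>carrier := K\<rparr>" using finite_grp_subgroup[OF K(1)] .
  have TK: "subgroup T (G\<lparr>carrier := K\<rparr>)" using subgroup_incl[OF T_sub K] .
  have NK: "N \<lhd> G\<lparr>carrier := K\<rparr>"
    using normal_Int_subgroup[OF K(1) N_normal] N_T K(2) by (metis Int_absorb1 Int_commute order_trans)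
  have \<mu>': "lin_char (G\<lparr>carrier := K, carrier := T\<rparr>) \<mu>" using \<mu>_T by simp
  have one: "\<one> \<in> K" using subgroup.one_closed[OF K(1)] .
  have "restrict_char N \<mu> = restrict_char N (\<lambda>n. \<mu> (\<one> \<otimes> n \<otimes> inv \<one>))"
    using subgroup.mem_carrier[OF N_sub_G] by (auto simp: restrict_char_def fun_eq_iff)
  thus ?thesis
    unfolding K.lies_under_induced_lin_char_iff[OF NK TK N_T \<mu>'] using one
    by (intro bexI[of _ \<one>]) (simp_all add: inv_subgroup[OF K(1)])
qed

lemma N_conj_C: "C \<lhd> G\<lparr>carrier := M\<rparr> \<Longrightarrow> n \<in> N \<Longrightarrow> c \<in> C \<Longrightarrow> n \<otimes> c \<otimes> inv n \<in> C"
proof -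
  interpret M: group "G\<lparr>carrier := M\<rparr>" using subgroup_imp_group[OF M_sub] .
  assume "C \<lhd> G\<lparr>carrier := M\<rparr>" "n \<in> N" "c \<in> C"
  moreover have "n \<in> M" using \<open>n \<in> N\<close> N_R R_M by auto
  ultimately show "n \<otimes> c \<otimes> inv n \<in> C" unfolding M.normal_inv_iff by (auto simp: inv_subgroup[OF M_sub])
qed

lemma \<mu>_at_one_conj: "restrict_char (N \<inter> C) (\<lambda>n. \<mu> (\<one> \<otimes> n \<otimes> inv \<one>)) = restrict_char (N \<inter> C) \<mu>"
  using subgroup.mem_carrier[OF N_sub_G] by (auto simp: restrict_char_def fun_eq_iff)

text \<open>The case of trivial conjugation and \<open>N\<close> contained in \<open>C\<close>, as
  used for \<open>G\<close>, for \<open>M\<close> and for the candidates above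
  \<open>(N, \<nu>)\<close>.\<close>

lemma not_factorable_over_\<nu>:
  assumes C: "subgroup C G" "N \<subseteq> C" and norm: "\<And>n c. n \<in> N \<Longrightarrow> c \<in> C \<Longrightarrow> n \<otimes> c \<otimes> inv n \<in> C"
    and e: "e \<in> C" "e \<in> F" "e \<notin> R" and \<chi>: "lies_under (G\<lparr>carrier := C\<rparr>) N (restrict_char N \<mu>) \<chi>"
  shows "\<not> pi_factorable odd_primes (G\<lparr>carrier := C\<rparr>) \<chi>"
  using no_factorable_over[OF C(1) norm e subgroup.one_closed[OF M_sub], of \<chi>] \<chi> C(2) \<mu>_at_one_conj[of C]
  by (auto simp: Int_absorb2)

lemma meets_F: "\<exists>e\<in>M \<inter> F. e \<notin> R"
proof -
  interpret M: group "G\<lparr>carrier := M\<rparr>" using subgroup_imp_group[OF M_sub] .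
  have "M \<lhd> G\<lparr>carrier := M\<rparr>" using M.normal_self by simp
  thus ?thesis using normal_M_meets M_not_R by blast
qed

lemma \<eta>_not_factorable: "\<not> pi_factorable odd_primes G \<eta>"
proof -
  obtain e where "e \<in> M \<inter> F" "e \<notin> R" using meets_F by blast
  moreover have "subgroup (carrier G) G" by (rule subgroup_self)
  moreover have "lies_under (G\<lparr>carrier := carrier G\<rparr>) N (restrict_char N \<mu>) \<eta>"
    using \<nu>_under_induced[OF subgroup_self subgroup.subset[OF T_sub]] by (simp add: \<eta>_def)
  ultimately show ?thesis
    using not_factorable_over_\<nu>[of "carrier G" e \<eta>] subgroup.subset[OF N_sub_G] M_carrier by auto
qed

lemma \<theta>_not_factorable: "\<not> pi_factorable odd_primes (G\<lparr>carrier := M\<rparr>) \<theta>"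
proof -
  obtain e where e: "e \<in> M" "e \<in> F" "e \<notin> R" using meets_F by blast
  have "lies_under (G\<lparr>carrier := M\<rparr>) N (restrict_char N \<mu>) \<theta>"
    using \<nu>_under_induced[OF M_sub] T_R R_M by (auto simp: \<theta>_def)
  moreover have "n \<otimes> c \<otimes> inv n \<in> M" if "n \<in> N" "c \<in> M" for n c
    using that N_R R_M M_sub by (auto simp: subgroup.m_closed subgroup.m_inv_closed subsetD)
  moreover have "N \<subseteq> M" using N_R R_M by auto
  ultimately show ?thesis using not_factorable_over_\<nu>[OF M_sub _ _ e] by blast
qed

lemma \<nu>_lin: "lin_char (G\<lparr>carrier := N\<rparr>) (restrict_char N \<mu>)"
  using lin_char_restrict[OF \<mu>_T, of N] subgroup_incl[OF N_sub_G T_sub N_T] N_T by simp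

lemma T_stabilizer: "T = char_stabilizer G N (restrict_char N \<mu>)"
proof -
  interpret T: group "G\<lparr>carrier := T\<rparr>" using subgroup_imp_group[OF T_sub] .
  have "\<mu> (x \<otimes> n \<otimes> inv x) = \<mu> n" if "x \<in> T" "n \<in> N" for x n
    using T.lin_char_conj[OF \<mu>_T, of n x] that N_T by (auto simp: inv_subgroup[OF T_sub] subsetD)
  moreover have "x \<in> T" if x: "x \<in> carrier G" and "\<forall>n\<in>N. restrict_char N \<mu> (x \<otimes> n \<otimes> inv x) = restrict_char N \<mu> n" for x
    using stab_T[OF x] that(2) N_conj_closed[OF x] by (auto simp: restrict_char_def)
  ultimately show ?thesis
    using subgroup.mem_carrier[OF T_sub] N_conj_closed
    by (auto simp: char_stabilizer_def restrict_char_def)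
qed

text \<open>A pair strictly above \<open>(N, \<nu>)\<close> would be factorable over
  \<open>\<nu>\<close> on a normal subgroup meeting \<open>F\<close> outside \<open>R\<close>. So
  the recursion stops after one step: the Clifford correspondent \<open>\<mu>\<close> is linear of
  order dividing 3, hence special.\<close>

theorem \<eta>_in_N_pi: "\<eta> \<in> N_pi odd_primes G"
proof -
  interpret N: finite_grp "G\<lparr>carrier := N\<rparr>" using finite_grp_subgroup[OF N_sub_G] .
  interpret T: finite_grp "G\<lparr>carrier := T\<rparr>" using finite_grp_subgroup[OF T_sub] .
  let ?\<nu> = "restrict_char N \<mu>"
  have under: "lies_under G N ?\<nu> \<eta>"
    using \<nu>_under_induced[OF subgroup_self subgroup.subset[OF T_sub]] by (simp add: \<eta>_def)
  have \<nu>f: "pi_factorable odd_primes (G\<lparr>carrier := N\<rparr>) ?\<nu>"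
    using \<mu>_T_cube N_T by (intro N.lin_char_cube_factorable(2)[OF \<nu>_lin]) (auto simp: restrict_char_def)
  have \<mu>f: "pi_special odd_primes (G\<lparr>carrier := T\<rparr>) \<mu>" "pi_factorable odd_primes (G\<lparr>carrier := T\<rparr>) \<mu>"
    using \<mu>_T_cube T.lin_char_cube_factorable[OF \<mu>_T] by auto
  have max: "maximal_pair odd_primes G \<eta> N ?\<nu>"
    unfolding maximal_pair_def factorable_pair_def
  proof (intro conjI allI impI N_normal \<nu>f under)
    fix N1 \<theta>1
    assume A: "(N1 \<lhd> G \<and> pi_factorable odd_primes (G\<lparr>carrier := N1\<rparr>) \<theta>1 \<and> lies_under G N1 \<theta>1 \<eta>) \<and>
       N \<subseteq> N1 \<and> lies_under (G\<lparr>carrier := N1\<rparr>) N ?\<nu> \<theta>1"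
    show eq: "N1 = N"
    proof (rule ccontr)
      assume "N1 \<noteq> N"
      then obtain e where e: "e \<in> N1" "e \<in> F" "e \<notin> R" using normal_G_meets[of N1] A by blast
      have "n \<otimes> c \<otimes> inv n \<in> N1" if "n \<in> N" "c \<in> N1" for n c
        using A that normal_inv_iff subgroup.mem_carrier[OF N_sub_G] by blast
      from not_factorable_over_\<nu>[OF normal_imp_subgroup _ this e, of \<theta>1] A show False by blast
    qed
    have "\<theta>1 \<in> Irr (G\<lparr>carrier := N\<rparr>)" using A eq by (simp add: pi_factorable_def)
    thus "\<theta>1 = ?\<nu>"
      using A eq N.irr_constituent_Irr_iff[of \<theta>1 ?\<nu>] restrict_char_self[OF Irr_imp_Char, of \<theta>1 "G\<lparr>carrier := N\<rparr>"]
      by (simp add: lies_under_def)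
  qed
  have "lies_under (G\<lparr>carrier := T\<rparr>) N ?\<nu> \<mu>"
    using T.lies_under_lin_char[OF _ \<mu>_T, of N] subgroup_incl[OF N_sub_G T_sub N_T] by simp
  moreover have "\<mu> \<in> Irr (G\<lparr>carrier := T\<rparr>)" using lin_char_Irr[OF T.is_group \<mu>_T] .
  moreover have "normal_nucleus odd_primes (G\<lparr>carrier := T\<rparr>) \<mu> T \<mu>"
    using normal_nucleus.factorable[OF \<mu>f(2)] by simp
  ultimately have "normal_nucleus odd_primes G \<eta> T \<mu>"
    using normal_nucleus.clifford[OF \<eta>_Irr \<eta>_not_factorable max T_stabilizer, of \<mu> T \<mu>] by (simp add: \<eta>_def)
  thus ?thesis using \<mu>f \<eta>_Irr unfolding N_pi_def by blast
qed

section \<open>Maximal pairs and nuclei of the constituent on \<open>M\<close>\<close>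

definition \<chi>_conj where "\<chi>_conj m = (\<lambda>x. if x \<in> R then induced_char (G\<lparr>carrier := R\<rparr>) T \<mu> (m \<otimes> x \<otimes> inv m) else 0)"

text \<open>Conjugating \<open>\<delta>\<close>, \<open>b\<close> and \<open>\<mu>\<close> by
  \<open>m\<close> gives another degree 3 cover on the same \<open>R\<close> and \<open>N\<close>,
  whose induced character is the conjugate one. Everything known about the induced character thereby
  holds for all its conjugates.\<close>

lemma sym3_conj:
  assumes m: "m \<in> M"
  defines "c \<equiv> \<lambda>x. m \<otimes> x \<otimes> inv m"
  defines "\<mu>' \<equiv> \<lambda>x. if x \<in> R \<and> b (c x) = 0 then \<mu> (c x) else 0"
  shows "sym3_cover (G\<lparr>carrier := R\<rparr>) N (\<lambda>x. \<delta> (c x)) (\<lambda>x. b (c x)) \<mu>'"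
    and "\<chi>_conj m = induced_char (G\<lparr>carrier := R\<rparr>) {x \<in> R. b (c x) = 0} \<mu>'"
proof -
  have mc: "m \<in> carrier G" using m M_carrier by auto
  have imM: "inv m \<in> M" using m M_sub by (simp add: subgroup.m_inv_closed)
  have cR: "c x \<in> R" if "x \<in> R" for x using R_conj[OF m that] by (simp add: c_def)
  have cN: "c x \<in> N" if "x \<in> N" for x using N_conj_closed[OF mc that] by (simp add: c_def)
  define d where "d = (\<lambda>x. inv m \<otimes> x \<otimes> m)"
  have dR: "d x \<in> R" if "x \<in> R" for x using R_conj[OF imM that] mc by (simp add: d_def)
  have dN: "d x \<in> N" if "x \<in> N" for x using N_conj_closed[OF inv_closed[OF mc] that] mc by (simp add: d_def)
  have cd: "c (d x) = x" "d (c x) = x" if "x \<in> carrier G" for x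
    using that mc by (simp_all add: c_def d_def m_assoc) (simp_all flip: m_assoc)
  have Rc: "x \<in> carrier G" if "x \<in> R" for x using that R_carrier by auto
  have hom: "c (x \<otimes> y) = c x \<otimes> c y" if "x \<in> carrier G" "y \<in> carrier G" for x y
    using that mc by (simp add: c_def m_assoc) (simp flip: m_assoc)
  have cinv: "c (inv x) = inv (c x)" if "x \<in> carrier G" for x
    using that mc by (simp add: c_def m_assoc inv_mult_group)
  have cone: "c \<one> = \<one>" using mc by (simp add: c_def)
  have RR: "x \<otimes> y \<in> R" "inv x \<in> R" if "x \<in> R" "y \<in> R" for x y
    using that R_sub by (auto simp: subgroup.m_closed subgroup.m_inv_closed)
  have iR: "inv\<^bsub>G\<lparr>carrier := R\<rparr>\<^esub> x = inv x" if "x \<in> R" for x using inv_subgroup[OF R_sub that] .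
  let ?T = "{x \<in> R. b (c x) = 0}"
  show "sym3_cover (G\<lparr>carrier := R\<rparr>) N (\<lambda>x. \<delta> (c x)) (\<lambda>x. b (c x)) \<mu>'"
  proof (rule sym3_cover.intro[OF finite_grp_subgroup[OF R_sub] sym3_cover_axioms.intro], goal_cases)
    case 1 show ?case by (rule S.N_sub)
  next
    case (2 x n) thus ?case by (rule S.N_conj)
  next
    case (3 x) thus ?case using S.\<delta>_range[of "c x"] cR by simp
  next
    case (4 x y) thus ?case using S.\<delta>_mult[of "c x" "c y"] cR hom Rc by simp
  next
    case (5 x) thus ?case using S.b_range[of "c x"] cR by simp
  next
    case (6 x y) thus ?case using S.b_mult[of "c x" "c y"] cR hom Rc by simp
  next
    case (7 n) thus ?case using S.\<delta>_N[of "c n"] cN by simp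
  next
    case (8 n) thus ?case using S.b_N[of "c n"] cN by simp
  next
    case (9 i)
    then obtain x where "x \<in> R" "\<delta> x = - 1" "b x = i" using S.onto[of i] by auto
    thus ?case using dR[of x] cd(1)[of x] Rc by (intro bexI[of _ "d x"]) auto
  next
    case 10
    have "\<mu>' (x \<otimes> y) = \<mu>' x * \<mu>' y" if "x \<in> R" "y \<in> R" "b (c x) = 0" "b (c y) = 0" for x y
    proof -
      have T: "c x \<in> T" "c y \<in> T" using that cR by (auto simp: T_def)
      hence "c x \<otimes> c y \<in> T" using T_sub by (simp add: subgroup.m_closed)
      hence "b (c (x \<otimes> y)) = 0" using hom[of x y] that Rc by (simp add: T_def)
      thus ?thesis using lin_char_mult[OF \<mu>_T, of "c x" "c y"] T hom[of x y] that Rc RR by (simp add: \<mu>'_def)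
    qed
    moreover have "\<mu>' \<one> = 1" using lin_char_one[OF \<mu>_T] S.b_one subgroup.one_closed[OF R_sub] by (simp add: \<mu>'_def cone)
    moreover have "\<mu>' x = 0" if "\<not> (x \<in> R \<and> b (c x) = 0)" for x using that by (auto simp: \<mu>'_def)
    ultimately show ?case unfolding lin_char_def by auto
  next
    case (11 x) thus ?case using S.\<mu>_cube[of "c x"] cR by (simp add: \<mu>'_def)
  next
    case (12 x)
    hence x: "x \<in> R" "b (c x) \<noteq> 0" by auto
    obtain n where n: "n \<in> N" "\<mu> (c x \<otimes> n \<otimes> inv (c x)) \<noteq> \<mu> n"
      using S.stab[of "c x"] x cR iR by auto
    have nc: "n \<in> carrier G" using n subgroup.mem_carrier[OF N_sub_G] by auto
    have xc: "x \<in> carrier G" using x Rc by auto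
    have dc: "d n \<in> carrier G" using nc mc by (simp add: d_def)
    have e: "c (x \<otimes> d n \<otimes> inv x) = c x \<otimes> n \<otimes> inv (c x)" using xc dc nc by (simp add: hom cinv cd)
    have v: "\<mu>' y = \<mu> (c y)" if "y \<in> N" for y
      using that cN[OF that] S.b_N N_R by (auto simp: \<mu>'_def)
    have "\<mu>' (x \<otimes> d n \<otimes> inv x) \<noteq> \<mu>' (d n)"
      using v[OF dN[OF n(1)]] v[OF N_conj_closed[OF xc dN[OF n(1)]]] e n cd(1)[OF nc] by simp
    thus ?case using dN[OF n(1)] x iR by (intro bexI[of _ "d n"]) auto
  qed
  have cardT: "card ?T = card T"
  proof (rule bij_betw_same_card[of c], rule bij_betw_byWitness[where f' = d])
    show "c ` ?T \<subseteq> T" using cR by (auto simp: T_def)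
    show "d ` T \<subseteq> ?T" using dR cd(1) Rc by (auto simp: T_def)
  qed (use cd Rc T_R in auto)
  show "\<chi>_conj m = induced_char (G\<lparr>carrier := R\<rparr>) ?T \<mu>'"
  proof
    fix g
    show "\<chi>_conj m g = induced_char (G\<lparr>carrier := R\<rparr>) ?T \<mu>' g"
    proof (cases "g \<in> R")
      case True
      have "(\<Sum>y\<in>R. if y \<otimes> c g \<otimes> inv y \<in> T then \<mu> (y \<otimes> c g \<otimes> inv y) else 0)
         = (\<Sum>x\<in>R. if x \<otimes> g \<otimes> inv x \<in> ?T then \<mu>' (x \<otimes> g \<otimes> inv x) else 0)"
      proof (rule sum.reindex_bij_witness[of _ c d])
        fix y assume y: "y \<in> R"
        have "c (d y \<otimes> g \<otimes> inv (d y)) = y \<otimes> c g \<otimes> inv y"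
          using y dR[OF y] True Rc by (simp add: hom cinv cd)
        moreover have "d y \<otimes> g \<otimes> inv (d y) \<in> R" using RR dR[OF y] True by simp
        moreover have "y \<otimes> c g \<otimes> inv y \<in> R" using RR y cR[OF True] by simp
        ultimately show "(if d y \<otimes> g \<otimes> inv (d y) \<in> ?T then \<mu>' (d y \<otimes> g \<otimes> inv (d y)) else 0) =
          (if y \<otimes> c g \<otimes> inv y \<in> T then \<mu> (y \<otimes> c g \<otimes> inv y) else 0)"
          by (simp add: T_def \<mu>'_def)
      qed (use cd cR dR Rc in auto)
      thus ?thesis unfolding induced_char_subgroup[OF R_sub True] \<chi>_conj_def cardT
        using True induced_char_subgroup[OF R_sub cR[OF True], of T \<mu>] by (simp add: c_def)
    qed (simp add: \<chi>_conj_def induced_char_def)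
  qed
qed

lemma \<chi>_conj_props:
  assumes m: "m \<in> M"
  shows "\<chi>_conj m \<in> Irr (G\<lparr>carrier := R\<rparr>)" "pi_factorable odd_primes (G\<lparr>carrier := R\<rparr>) (\<chi>_conj m)"
    "\<not> pi_special odd_primes (G\<lparr>carrier := R\<rparr>) (\<chi>_conj m)"
proof -
  interpret C: sym3_cover "G\<lparr>carrier := R\<rparr>" N "\<lambda>x. \<delta> (m \<otimes> x \<otimes> inv m)" "\<lambda>x. b (m \<otimes> x \<otimes> inv m)"
    "\<lambda>x. if x \<in> R \<and> b (m \<otimes> x \<otimes> inv m) = 0 then \<mu> (m \<otimes> x \<otimes> inv m) else 0"
    by (rule sym3_conj(1)[OF m])
  have e: "\<chi>_conj m = induced_char (G\<lparr>carrier := R\<rparr>) C.pt_stab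
     (\<lambda>x. if x \<in> R \<and> b (m \<otimes> x \<otimes> inv m) = 0 then \<mu> (m \<otimes> x \<otimes> inv m) else 0)"
    unfolding sym3_conj(2)[OF m] C.pt_stab_def by simp
  show "\<chi>_conj m \<in> Irr (G\<lparr>carrier := R\<rparr>)" "pi_factorable odd_primes (G\<lparr>carrier := R\<rparr>) (\<chi>_conj m)"
    "\<not> pi_special odd_primes (G\<lparr>carrier := R\<rparr>) (\<chi>_conj m)"
    unfolding e using C.ind_Irr C.ind_factorable C.ind_not_special by auto
qed

text \<open>The double sum over \<open>r\<close> in \<open>R\<close> and \<open>m\<close> in
  \<open>M\<close> depends only on \<open>r \<otimes> m\<close>, so each \<open>r\<close> repeats
  the sum defining \<open>\<theta>\<close>. The factor \<open>card R\<close> replaces a transversal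
  of \<open>R\<close> in \<open>M\<close>.\<close>

lemma restrict_\<theta>_R: "restrict_char R \<theta> x * of_nat (card R) = (\<Sum>m\<in>M. \<chi>_conj m x)"
proof (cases "x \<in> R")
  case x: True
  have xM: "x \<in> M" and xc: "x \<in> carrier G" using x R_M M_carrier by auto
  let ?f = "\<lambda>y. if y \<otimes> x \<otimes> inv y \<in> T then \<mu> (y \<otimes> x \<otimes> inv y) else 0"
  have RM: "r \<in> M" if "r \<in> R" for r using that R_M by auto
  have Mc: "r \<in> carrier G" if "r \<in> M" for r using that M_carrier by auto
  interpret M: finite_grp "G\<lparr>carrier := M\<rparr>" by (rule M_grp)
  have in_: "(\<Sum>m\<in>M. ?f (r \<otimes> m)) = (\<Sum>m\<in>M. ?f m)" if r: "r \<in> R" for r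
    by (rule sum.reindex_bij_witness[of _ "\<lambda>m. inv r \<otimes> m" "\<lambda>m. r \<otimes> m"])
      (use RM[OF r] Mc M_sub in \<open>auto simp: subgroup.m_closed subgroup.m_inv_closed m_assoc[symmetric]\<close>)
  have "(\<Sum>m\<in>M. \<chi>_conj m x) * of_nat (card T) = (\<Sum>m\<in>M. \<Sum>r\<in>R. ?f (r \<otimes> m))"
  proof -
    have cT: "card T \<noteq> 0" using subgroup.one_closed[OF T_sub] finite_subset[OF subgroup.subset[OF T_sub]] by auto
    have "\<chi>_conj m x * of_nat (card T) = (\<Sum>r\<in>R. ?f (r \<otimes> m))" if m: "m \<in> M" for m
    proof -
      have "r \<otimes> (m \<otimes> x \<otimes> inv m) \<otimes> inv r = (r \<otimes> m) \<otimes> x \<otimes> inv (r \<otimes> m)" if "r \<in> R" for r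
        using Mc[OF m] Mc[OF RM[OF that]] xc by (simp add: m_assoc inv_mult_group)
      hence "(\<Sum>r\<in>R. if r \<otimes> (m \<otimes> x \<otimes> inv m) \<otimes> inv r \<in> T then \<mu> (r \<otimes> (m \<otimes> x \<otimes> inv m) \<otimes> inv r) else 0)
        = (\<Sum>r\<in>R. ?f (r \<otimes> m))" by (intro sum.cong refl) auto
      thus ?thesis using x R_conj[OF m x] cT
        by (simp add: \<chi>_conj_def induced_char_subgroup[OF R_sub])
    qed
    thus ?thesis by (simp add: sum_distrib_right)
  qed
  also have "\<dots> = (\<Sum>r\<in>R. \<Sum>m\<in>M. ?f (r \<otimes> m))" by (rule sum.swap)
  also have "\<dots> = of_nat (card R) * (\<Sum>m\<in>M. ?f m)" using in_ by simp
  also have "(\<Sum>m\<in>M. ?f m) = \<theta> x * of_nat (card T)"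
  proof -
    have cT: "card T \<noteq> 0" using subgroup.one_closed[OF T_sub] finite_subset[OF subgroup.subset[OF T_sub]] by auto
    thus ?thesis using xM by (simp add: \<theta>_def induced_char_subgroup[OF M_sub])
  qed
  finally show ?thesis
    using x subgroup.one_closed[OF T_sub] finite_subset[OF subgroup.subset[OF T_sub]]
    by (auto simp: restrict_char_def mult_ac)
qed (simp add: restrict_char_def \<chi>_conj_def)

lemma R_normal_M: "R \<lhd> G\<lparr>carrier := M\<rparr>"
proof -
  interpret M: finite_grp "G\<lparr>carrier := M\<rparr>" by (rule M_grp)
  show ?thesis unfolding M.normal_inv_iff
    using subgroup_incl[OF R_sub M_sub R_M] R_conj by (auto simp: inv_subgroup[OF M_sub])
qed

lemma \<chi>_conj_under_\<theta>:
  assumes m: "m \<in> M"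
  shows "lies_under (G\<lparr>carrier := M\<rparr>) R (\<chi>_conj m) \<theta>"
proof -
  interpret M: finite_grp "G\<lparr>carrier := M\<rparr>" by (rule M_grp)
  have finM: "finite M" using M_carrier finite_subset by blast
  have "char_ip (G\<lparr>carrier := R\<rparr>) (\<chi>_conj m) (\<lambda>x. restrict_char R \<theta> x * of_nat (card R)) =
     (\<Sum>k\<in>M. char_ip (G\<lparr>carrier := R\<rparr>) (\<chi>_conj m) (\<chi>_conj k))"
    unfolding restrict_\<theta>_R char_ip_sum_right ..
  also have "\<dots> = (\<Sum>k\<in>M. if \<chi>_conj m = \<chi>_conj k then 1 else 0)"
    using S.char_ip_Irr \<chi>_conj_props(1) m by (intro sum.cong refl) auto
  also have "\<dots> = of_nat (card {k \<in> M. \<chi>_conj m = \<chi>_conj k})" using finM by (simp add: sum.If_cases Int_def)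
  also have "\<dots> \<noteq> 0" using m finM by auto
  finally have "char_ip (G\<lparr>carrier := R\<rparr>) (\<chi>_conj m) (restrict_char R \<theta>) * of_nat (card R) \<noteq> 0"
    by (simp add: char_ip_def sum_distrib_right mult.assoc)
  thus ?thesis
    using M.lies_under_iff[OF normal_imp_subgroup[OF R_normal_M] Irr_imp_Char[OF \<theta>_Irr], of "\<chi>_conj m"]
      \<chi>_conj_props(1)[OF m] by auto
qed

text \<open>After conjugation by \<open>m\<close> one has \<open>f\<close> fixing the character
  induced to \<open>R\<close>. Then the conjugate of \<open>\<nu>\<close> by \<open>f\<close> still
  lies under it and so equals the conjugate by some \<open>x\<close> in \<open>R\<close>; the
  quotient of \<open>f\<close> by \<open>x\<close> fixes \<open>\<nu>\<close> and belongs to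
  \<open>R\<close>.\<close>

lemma \<chi>_conj_stabilizer:
  assumes m: "m \<in> M"
  shows "char_stabilizer (G\<lparr>carrier := M\<rparr>) R (\<chi>_conj m) = R"
proof
  show "R \<subseteq> char_stabilizer (G\<lparr>carrier := M\<rparr>) R (\<chi>_conj m)"
    using R_M S.Char_class_function[OF Irr_imp_Char[OF \<chi>_conj_props(1)[OF m]]]
    by (auto simp: char_stabilizer_def inv_subgroup[OF M_sub] inv_subgroup[OF R_sub] subsetD)
  have mc: "m \<in> carrier G" using m M_carrier by auto
  have imM: "inv m \<in> M" using m M_sub by (simp add: subgroup.m_inv_closed)
  let ?\<chi> = "induced_char (G\<lparr>carrier := R\<rparr>) T \<mu>"
  show "char_stabilizer (G\<lparr>carrier := M\<rparr>) R (\<chi>_conj m) \<subseteq> R"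
  proof
    fix g assume "g \<in> char_stabilizer (G\<lparr>carrier := M\<rparr>) R (\<chi>_conj m)"
    hence g: "g \<in> M" and st: "\<And>x. x \<in> R \<Longrightarrow> \<chi>_conj m (g \<otimes> x \<otimes> inv g) = \<chi>_conj m x"
      by (auto simp: char_stabilizer_def inv_subgroup[OF M_sub])
    have gc: "g \<in> carrier G" using g M_carrier by auto
    define f where "f = m \<otimes> g \<otimes> inv m"
    have fM: "f \<in> M" using m g imM M_sub by (simp add: f_def subgroup.m_closed)
    have fc: "f \<in> carrier G" using fM M_carrier by auto
    have st': "?\<chi> (f \<otimes> n \<otimes> inv f) = ?\<chi> n" if n: "n \<in> N" for n
    proof -
      have nc: "n \<in> carrier G" using n subgroup.mem_carrier[OF N_sub_G] by auto
      let ?x = "inv m \<otimes> n \<otimes> m"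
      have xR: "?x \<in> R" using N_conj_closed[OF inv_closed[OF mc] n] N_R mc by auto
      have "m \<otimes> (g \<otimes> ?x \<otimes> inv g) \<otimes> inv m = f \<otimes> n \<otimes> inv f"
        using mc gc nc by (simp add: f_def m_assoc inv_mult_group)
      moreover have "m \<otimes> ?x \<otimes> inv m = n" using mc nc by (simp add: m_assoc) (simp flip: m_assoc)
      ultimately show ?thesis using st[OF xR] R_conj[OF g xR] xR by (simp add: \<chi>_conj_def)
    qed
    have NR: "N \<lhd> G\<lparr>carrier := R\<rparr>"
      using S.N_sub S.N_conj S.normal_inv_iff by blast
    have \<mu>': "lin_char (G\<lparr>carrier := R, carrier := T\<rparr>) \<mu>" using \<mu>_T by simp
    have \<chi>C: "?\<chi> \<in> Char (G\<lparr>carrier := R\<rparr>)" using S.induced_lin_char_Char[OF T_sub_R \<mu>'] .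
    have NRs: "subgroup N (G\<lparr>carrier := R\<rparr>)" by (rule S.N_sub)
    let ?\<nu> = "restrict_char N \<mu>" and ?\<nu>f = "restrict_char N (\<lambda>n. \<mu> (f \<otimes> n \<otimes> inv f))"
    \<comment> \<open>Conjugation by \<open>f\<close> permutes \<open>N\<close> and preserves
      \<open>?\<chi>\<close> on it, so both conjugates occur with the same multiplicity.\<close>
    have "char_ip (G\<lparr>carrier := N\<rparr>) ?\<nu>f (restrict_char N ?\<chi>) = char_ip (G\<lparr>carrier := N\<rparr>) ?\<nu> (restrict_char N ?\<chi>)"
    proof -
      have "(\<Sum>n\<in>N. ?\<nu>f (inv n) * ?\<chi> n) = (\<Sum>n\<in>N. ?\<nu> (inv n) * ?\<chi> n)"
      proof (rule sum.reindex_bij_witness[of _ "\<lambda>n. inv f \<otimes> n \<otimes> f" "\<lambda>n. f \<otimes> n \<otimes> inv f"])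
        fix n assume n: "n \<in> N"
        have nc: "n \<in> carrier G" using n subgroup.mem_carrier[OF N_sub_G] by auto
        show "inv f \<otimes> (f \<otimes> n \<otimes> inv f) \<otimes> f = n" using fc nc by (simp add: m_assoc) (simp flip: m_assoc)
        show "f \<otimes> (inv f \<otimes> n \<otimes> f) \<otimes> inv f = n" using fc nc by (simp add: m_assoc) (simp flip: m_assoc)
        show fn: "f \<otimes> n \<otimes> inv f \<in> N" using N_conj_closed[OF fc n] .
        show "inv f \<otimes> n \<otimes> f \<in> N" using N_conj_closed[OF inv_closed[OF fc] n] fc by simp
        have "inv (f \<otimes> n \<otimes> inv f) = f \<otimes> inv n \<otimes> inv f" using fc nc by (simp add: inv_mult_group m_assoc)
        moreover have "inv n \<in> N" using n N_sub_G by (simp add: subgroup.m_inv_closed)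
        moreover have "inv (f \<otimes> n \<otimes> inv f) \<in> N" using fn N_sub_G by (simp add: subgroup.m_inv_closed)
        ultimately show "?\<nu> (inv (f \<otimes> n \<otimes> inv f)) * ?\<chi> (f \<otimes> n \<otimes> inv f) = ?\<nu>f (inv n) * ?\<chi> n"
          using st'[OF n] by (simp add: restrict_char_def)
      qed
      thus ?thesis by (simp add: char_ip_def inv_subgroup[OF N_sub_G] restrict_char_def[of N ?\<chi>] cong: sum.cong)
    qed
    moreover have "char_ip (G\<lparr>carrier := N\<rparr>) ?\<nu> (restrict_char N ?\<chi>) \<noteq> 0"
      using \<nu>_under_induced[OF R_sub T_R] S.lies_under_iff[OF NRs \<chi>C] by simp
    moreover have "?\<nu>f \<in> Irr (G\<lparr>carrier := N\<rparr>)"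
      using lin_char_Irr[OF subgroup_imp_group[OF N_sub_G] conj_lin_char[OF N_normal T_sub N_T \<mu>_T fc]] .
    ultimately have "lies_under (G\<lparr>carrier := R\<rparr>) N ?\<nu>f ?\<chi>"
      using S.lies_under_iff[OF NRs \<chi>C] by simp
    then obtain x where x: "x \<in> R" "?\<nu>f = restrict_char N (\<lambda>n. \<mu> (x \<otimes> n \<otimes> inv x))"
      using S.lies_under_induced_lin_char_iff[OF NR T_sub_R N_T \<mu>'] by (auto simp: inv_subgroup[OF R_sub])
    have xc: "x \<in> carrier G" using x R_carrier by auto
    let ?g = "f \<otimes> inv x"
    have "?g \<in> R"
    proof (rule ccontr)
      assume "?g \<notin> R"
      then obtain n where n: "n \<in> N" "\<mu> (?g \<otimes> n \<otimes> inv ?g) \<noteq> \<mu> n" using stab_R[of ?g] fc xc by auto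
      have nc: "n \<in> carrier G" using n subgroup.mem_carrier[OF N_sub_G] by auto
      let ?k = "inv x \<otimes> n \<otimes> x"
      have k: "?k \<in> N" using N_conj_closed[OF inv_closed[OF xc] n(1)] xc by simp
      have "\<mu> (f \<otimes> ?k \<otimes> inv f) = \<mu> (x \<otimes> ?k \<otimes> inv x)" using fun_cong[OF x(2), of ?k] k by (simp add: restrict_char_def)
      moreover have "f \<otimes> ?k \<otimes> inv f = ?g \<otimes> n \<otimes> inv ?g" using fc xc nc by (simp add: m_assoc inv_mult_group)
      moreover have "x \<otimes> ?k \<otimes> inv x = n" using xc nc by (simp add: m_assoc) (simp flip: m_assoc)
      ultimately show False using n(2) by simp
    qed
    hence "?g \<otimes> x \<in> R" using x(1) R_sub by (simp add: subgroup.m_closed)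
    hence "f \<in> R" using fc xc by (simp add: m_assoc)
    hence "inv m \<otimes> f \<otimes> inv (inv m) \<in> R" by (rule R_conj[OF imM])
    moreover have "inv m \<otimes> f \<otimes> inv (inv m) = g" using mc gc by (simp add: f_def m_assoc) (simp flip: m_assoc)
    ultimately show "g \<in> R" by simp
  qed
qed

text \<open>A factorable pair cannot leave \<open>R\<close>, since outside it there would be a
  moving involution. Inside \<open>R\<close> it lies below a conjugate of the induced character,
  which itself forms a factorable pair, and maximality makes them equal.\<close>

lemma \<theta>_maximal_pair:
  assumes max: "maximal_pair odd_primes (G\<lparr>carrier := M\<rparr>) \<theta> N0 \<phi>"
  obtains m where "m \<in> M" "N0 = R" "\<phi> = \<chi>_conj m"
proof -
  interpret M: finite_grp "G\<lparr>carrier := M\<rparr>" by (rule M_grp)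
  have n0: "N0 \<lhd> G\<lparr>carrier := M\<rparr>" and fac: "pi_factorable odd_primes (G\<lparr>carrier := N0\<rparr>) \<phi>"
    and un: "lies_under (G\<lparr>carrier := M\<rparr>) N0 \<phi> \<theta>"
    using max by (auto simp: maximal_pair_def factorable_pair_def)
  have subM: "subgroup N0 (G\<lparr>carrier := M\<rparr>)" using n0 normal_imp_subgroup by blast
  have sub: "subgroup N0 G" using incl_subgroup[OF M_sub subM] .
  have N0M: "N0 \<subseteq> M" using subgroup.subset[OF subM] by simp
  interpret N0: finite_grp "G\<lparr>carrier := N0\<rparr>" using finite_grp_subgroup[OF sub] .
  have \<phi>I: "\<phi> \<in> Irr (G\<lparr>carrier := N0\<rparr>)" using fac by (simp add: pi_factorable_def)
  have \<theta>C: "\<theta> \<in> Char (G\<lparr>carrier := M\<rparr>)" by (rule Irr_imp_Char[OF \<theta>_Irr])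
  have N0R: "N0 \<subseteq> R"
  proof (rule ccontr)
    assume "\<not> N0 \<subseteq> R"
    then obtain e where e: "e \<in> N0" "e \<in> F" "e \<notin> R" using normal_M_meets[OF n0] by blast
    \<comment> \<open>\<open>N0\<close> is not known to contain \<open>N\<close>, so a constituent
      is taken on the intersection; it is a restricted conjugate of \<open>\<nu>\<close>.\<close>
    let ?I = "N \<inter> N0"
    have subI: "subgroup ?I G" using subgroups_Inter_pair[OF N_sub_G sub] .
    have subI0: "subgroup ?I (G\<lparr>carrier := N0\<rparr>)" using subgroup_incl[OF subI sub] by simp
    have subIM: "subgroup ?I (G\<lparr>carrier := M\<rparr>)" using subgroup_incl[OF subI M_sub] N0M by auto
    interpret I: finite_grp "G\<lparr>carrier := ?I\<rparr>" using finite_grp_subgroup[OF subI] .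
    have rC: "restrict_char ?I \<phi> \<in> Char (G\<lparr>carrier := ?I\<rparr>)"
      using restrict_Char[OF Irr_imp_Char[OF \<phi>I], of ?I] by simp
    have "\<one> \<in> ?I" using subgroup.one_closed[OF subI] .
    hence "restrict_char ?I \<phi> \<one> \<noteq> 0" using N0.Irr_degree_nonzero[OF \<phi>I] by (simp add: restrict_char_def)
    hence "restrict_char ?I \<phi> \<noteq> (\<lambda>x. 0)" by auto
    then obtain \<kappa> where \<kappa>: "\<kappa> \<in> Irr (G\<lparr>carrier := ?I\<rparr>)" "char_ip (G\<lparr>carrier := ?I\<rparr>) \<kappa> (restrict_char ?I \<phi>) \<noteq> 0"
      by (rule I.Char_eq_zero_or_constituent[OF rC])
    have u0: "lies_under (G\<lparr>carrier := N0\<rparr>) ?I \<kappa> \<phi>"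
      using N0.lies_under_iff[OF subI0 Irr_imp_Char[OF \<phi>I]] \<kappa> by simp
    have "lies_under (G\<lparr>carrier := M\<rparr>) ?I \<kappa> \<theta>"
      using M.lies_under_trans[OF subM subIM _ \<theta>C un, of \<kappa>] u0 by simp
    moreover have "?I \<lhd> G\<lparr>carrier := M\<rparr>"
    proof -
      have "x \<otimes> h \<otimes> inv x \<in> ?I" if "x \<in> M" "h \<in> ?I" for x h
        using N_conj_closed[of x h] M_carrier n0 that unfolding M.normal_inv_iff
        by (auto simp: inv_subgroup[OF M_sub])
      thus ?thesis unfolding M.normal_inv_iff using subIM by (auto simp: inv_subgroup[OF M_sub])
    qed
    moreover have "?I \<subseteq> T" using N_T by auto
    moreover have "lin_char (G\<lparr>carrier := M, carrier := T\<rparr>) \<mu>" using \<mu>_T by simp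
    ultimately obtain m where m: "m \<in> M" "\<kappa> = restrict_char ?I (\<lambda>n. \<mu> (m \<otimes> n \<otimes> inv m))"
      using M.lies_under_induced_lin_char_iff[OF _ T_sub_M, of ?I \<mu> \<kappa>]
      by (auto simp: \<theta>_def inv_subgroup[OF M_sub])
    show False
      using no_factorable_over[OF sub N_conj_C[OF n0] e m(1) fac] u0 m(2) by simp
  qed
  have N0Rs: "subgroup N0 (G\<lparr>carrier := R\<rparr>)" using subgroup_incl[OF sub R_sub N0R] .
  \<comment> \<open>These multiplicities add up to \<open>card R\<close> times the nonzero
    multiplicity of \<open>\<phi>\<close> in \<open>\<theta>\<close>.\<close>
  have "\<exists>m\<in>M. char_ip (G\<lparr>carrier := N0\<rparr>) \<phi> (restrict_char N0 (\<chi>_conj m)) \<noteq> 0"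
  proof (rule ccontr)
    assume "\<not> ?thesis"
    hence "(\<Sum>m\<in>M. char_ip (G\<lparr>carrier := N0\<rparr>) \<phi> (restrict_char N0 (\<chi>_conj m))) = 0" by simp
    hence "char_ip (G\<lparr>carrier := N0\<rparr>) \<phi> (\<lambda>x. \<Sum>m\<in>M. restrict_char N0 (\<chi>_conj m) x) = 0"
      by (simp add: char_ip_sum_right)
    moreover have "(\<Sum>m\<in>M. restrict_char N0 (\<chi>_conj m) x) = restrict_char N0 \<theta> x * of_nat (card R)" for x
      using restrict_\<theta>_R[of x] N0R by (auto simp: restrict_char_def)
    ultimately have "char_ip (G\<lparr>carrier := N0\<rparr>) \<phi> (\<lambda>x. restrict_char N0 \<theta> x * of_nat (card R)) = 0" by simp
    hence "char_ip (G\<lparr>carrier := N0\<rparr>) \<phi> (restrict_char N0 \<theta>) * of_nat (card R) = 0"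
      by (simp add: char_ip_def sum_distrib_right mult.assoc)
    moreover have "card R \<noteq> 0" using S.card_pos by simp
    ultimately show False using un M.lies_under_iff[OF subM \<theta>C] by simp
  qed
  then obtain m where m: "m \<in> M" "char_ip (G\<lparr>carrier := N0\<rparr>) \<phi> (restrict_char N0 (\<chi>_conj m)) \<noteq> 0" by blast
  have "lies_under (G\<lparr>carrier := R\<rparr>) N0 \<phi> (\<chi>_conj m)"
    using S.lies_under_iff[OF N0Rs Irr_imp_Char[OF \<chi>_conj_props(1)[OF m(1)]]] m(2) \<phi>I by simp
  moreover have "factorable_pair odd_primes (G\<lparr>carrier := M\<rparr>) \<theta> R (\<chi>_conj m)"
    unfolding factorable_pair_def
    using R_normal_M \<chi>_conj_props(2)[OF m(1)] \<chi>_conj_under_\<theta>[OF m(1)] by simp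
  ultimately have "R = N0 \<and> \<chi>_conj m = \<phi>"
    using max N0R unfolding maximal_pair_def by simp
  thus thesis using that m(1) by auto
qed

text \<open>Whatever maximal pair is chosen, the stabilizer is \<open>R\<close> and the Clifford
  correspondent is the chosen conjugate. That conjugate is factorable, so it is its own nucleus, and
  it is not special.\<close>

theorem \<theta>_notin_N_pi: "\<theta> \<notin> N_pi odd_primes (G\<lparr>carrier := M\<rparr>)"
proof
  assume "\<theta> \<in> N_pi odd_primes (G\<lparr>carrier := M\<rparr>)"
  then obtain U \<epsilon> where U: "normal_nucleus odd_primes (G\<lparr>carrier := M\<rparr>) \<theta> U \<epsilon>"
    and sp: "pi_special odd_primes (G\<lparr>carrier := U\<rparr>) \<epsilon>" by (auto simp: N_pi_def)
  from U show False
  proof cases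
    case factorable
    thus False using \<theta>_not_factorable by simp
  next
    case (clifford N0 \<phi> T0 \<psi>)
    obtain m where m: "m \<in> M" "N0 = R" "\<phi> = \<chi>_conj m" using \<theta>_maximal_pair[OF clifford(3)] .
    have T0: "T0 = R" using clifford(4) m \<chi>_conj_stabilizer[OF m(1)] by simp
    have \<psi>: "\<psi> \<in> Irr (G\<lparr>carrier := R\<rparr>)" using clifford(5) T0 by simp
    have "\<psi> = \<chi>_conj m"
      using clifford(6) T0 m S.irr_constituent_Irr_iff[OF \<psi>] restrict_char_self[OF Irr_imp_Char[OF \<psi>]]
      by (simp add: lies_under_def)
    hence nuc: "normal_nucleus odd_primes (G\<lparr>carrier := R\<rparr>) (\<chi>_conj m) U \<epsilon>" using clifford(8) T0 by simp
    from nuc show False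
    proof cases
      case factorable
      thus False using sp \<chi>_conj_props(3)[OF m(1)] by simp
    next
      case clifford
      thus False using \<chi>_conj_props(2)[OF m(1)] by simp
    qed
  qed
qed

end

section \<open>Semidirect products\<close>

definition semidirect :: "('k, 'c) monoid_scheme \<Rightarrow> ('q, 'd) monoid_scheme \<Rightarrow> ('q \<Rightarrow> 'k \<Rightarrow> 'k) \<Rightarrow> ('k \<times> 'q) monoid" where
  "semidirect K Q act = \<lparr>carrier = carrier K \<times> carrier Q,
     monoid.mult = (\<lambda>(k, q) (l, r). (k \<otimes>\<^bsub>K\<^esub> act q l, q \<otimes>\<^bsub>Q\<^esub> r)), one = (\<one>\<^bsub>K\<^esub>, \<one>\<^bsub>Q\<^esub>)\<rparr>"

lemma semidirect_simps [simp]: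
  "carrier (semidirect K Q act) = carrier K \<times> carrier Q"
  "(k, q) \<otimes>\<^bsub>semidirect K Q act\<^esub> (l, r) = (k \<otimes>\<^bsub>K\<^esub> act q l, q \<otimes>\<^bsub>Q\<^esub> r)"
  "\<one>\<^bsub>semidirect K Q act\<^esub> = (\<one>\<^bsub>K\<^esub>, \<one>\<^bsub>Q\<^esub>)"
  by (simp_all add: semidirect_def)

lemma semidirect_group:
  assumes K: "group K" and Q: "group Q"
    and cl: "\<And>q k. q \<in> carrier Q \<Longrightarrow> k \<in> carrier K \<Longrightarrow> act q k \<in> carrier K"
    and hom: "\<And>q k l. q \<in> carrier Q \<Longrightarrow> k \<in> carrier K \<Longrightarrow> l \<in> carrier K \<Longrightarrow> act q (k \<otimes>\<^bsub>K\<^esub> l) = act q k \<otimes>\<^bsub>K\<^esub> act q l"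
    and one: "\<And>k. k \<in> carrier K \<Longrightarrow> act \<one>\<^bsub>Q\<^esub> k = k"
    and mul: "\<And>q r k. q \<in> carrier Q \<Longrightarrow> r \<in> carrier Q \<Longrightarrow> k \<in> carrier K \<Longrightarrow> act (q \<otimes>\<^bsub>Q\<^esub> r) k = act q (act r k)"
  shows "group (semidirect K Q act)"
proof (rule groupI)
  interpret K: group K by (rule K)
  interpret Q: group Q by (rule Q)
  show "\<one>\<^bsub>semidirect K Q act\<^esub> \<in> carrier (semidirect K Q act)" by simp
  fix x assume "x \<in> carrier (semidirect K Q act)"
  then obtain k q where x: "x = (k, q)" "k \<in> carrier K" "q \<in> carrier Q" by auto
  show "\<one>\<^bsub>semidirect K Q act\<^esub> \<otimes>\<^bsub>semidirect K Q act\<^esub> x = x" using x one by simp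
  show "\<exists>y\<in>carrier (semidirect K Q act). y \<otimes>\<^bsub>semidirect K Q act\<^esub> x = \<one>\<^bsub>semidirect K Q act\<^esub>"
  proof (rule bexI[of _ "(act (inv\<^bsub>Q\<^esub> q) (inv\<^bsub>K\<^esub> k), inv\<^bsub>Q\<^esub> q)"])
    have "act (inv\<^bsub>Q\<^esub> q) (inv\<^bsub>K\<^esub> k \<otimes>\<^bsub>K\<^esub> k) = act (inv\<^bsub>Q\<^esub> q) \<one>\<^bsub>K\<^esub>" using x by simp
    also have "act (inv\<^bsub>Q\<^esub> q) \<one>\<^bsub>K\<^esub> = \<one>\<^bsub>K\<^esub>"
      using hom[of "inv\<^bsub>Q\<^esub> q" "\<one>\<^bsub>K\<^esub>" "\<one>\<^bsub>K\<^esub>"] cl[of "inv\<^bsub>Q\<^esub> q" "\<one>\<^bsub>K\<^esub>"] x by simp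
    finally show "(act (inv\<^bsub>Q\<^esub> q) (inv\<^bsub>K\<^esub> k), inv\<^bsub>Q\<^esub> q) \<otimes>\<^bsub>semidirect K Q act\<^esub> x = \<one>\<^bsub>semidirect K Q act\<^esub>"
      using x hom[of "inv\<^bsub>Q\<^esub> q" "inv\<^bsub>K\<^esub> k" k] by simp
  qed (use x cl in simp)
  fix y assume "y \<in> carrier (semidirect K Q act)"
  then obtain l r where y: "y = (l, r)" "l \<in> carrier K" "r \<in> carrier Q" by auto
  show "x \<otimes>\<^bsub>semidirect K Q act\<^esub> y \<in> carrier (semidirect K Q act)" using x y cl by simp
  fix z assume "z \<in> carrier (semidirect K Q act)"
  then obtain m s where z: "z = (m, s)" "m \<in> carrier K" "s \<in> carrier Q" by auto
  show "x \<otimes>\<^bsub>semidirect K Q act\<^esub> y \<otimes>\<^bsub>semidirect K Q act\<^esub> z = x \<otimes>\<^bsub>semidirect K Q act\<^esub> (y \<otimes>\<^bsub>semidirect K Q act\<^esub> z)"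
    using x y z cl hom mul by (simp add: K.m_assoc Q.m_assoc)
qed

section \<open>The symmetric group of degree four\<close>

text \<open>\<open>klein4\<close> consists of the even subsets of \<open>\<int>/3\<close> under symmetric difference, and the pair \<open>(d, c)\<close>
  in \<open>affine3\<close> stands for the map \<open>y \<mapsto> d * y + c\<close>, so that \<open>affine3\<close> is the symmetric group on \<open>\<int>/3\<close>.\<close>

definition affine3 :: "(int \<times> int) monoid" where
  "affine3 = \<lparr>carrier = {1, - 1} \<times> {0, 1, 2},
     monoid.mult = (\<lambda>(d, c) (d', c'). (d * d', (c + d * c') mod 3)), one = (1, 0)\<rparr>"

definition klein4 :: "int set monoid" where
  "klein4 = \<lparr>carrier = {{}, {0, 1}, {0, 2}, {1, 2}}, monoid.mult = (\<lambda>v w. (v - w) \<union> (w - v)), one = {}\<rparr>"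

definition affine3_act :: "int \<times> int \<Rightarrow> int set \<Rightarrow> int set" where
  "affine3_act = (\<lambda>(d, c) v. (\<lambda>x. (d * x + c) mod 3) ` v)"

definition sym4 :: "(int set \<times> (int \<times> int)) monoid" where
  "sym4 = semidirect klein4 affine3 affine3_act"

lemma affine3_simps [simp]:
  "carrier affine3 = {1, - 1} \<times> {0, 1, 2}"
  "(d, c) \<otimes>\<^bsub>affine3\<^esub> (d', c') = (d * d', (c + d * c') mod 3)"
  "\<one>\<^bsub>affine3\<^esub> = (1, 0)"
  by (simp_all add: affine3_def)

lemma klein4_simps [simp]:
  "carrier klein4 = {{}, {0, 1}, {0, 2}, {1, 2}}"
  "v \<otimes>\<^bsub>klein4\<^esub> w = (v - w) \<union> (w - v)"
  "\<one>\<^bsub>klein4\<^esub> = {}"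
  by (simp_all add: klein4_def)

lemma mod_3_affine: "(c + d * (t mod 3)) mod 3 = (c + d * t) mod (3::int)"
  by (metis mod_add_right_eq mod_mult_right_eq)

lemma affine3_group: "group affine3"
proof (rule groupI)
  fix x assume "x \<in> carrier affine3"
  thus "\<exists>y\<in>carrier affine3. y \<otimes>\<^bsub>affine3\<^esub> x = \<one>\<^bsub>affine3\<^esub>"
    by (intro bexI[of _ "(fst x, (- fst x * snd x) mod 3)"]) auto
  fix y assume "y \<in> carrier affine3"
  { fix z assume "z \<in> carrier affine3"
    show "x \<otimes>\<^bsub>affine3\<^esub> y \<otimes>\<^bsub>affine3\<^esub> z = x \<otimes>\<^bsub>affine3\<^esub> (y \<otimes>\<^bsub>affine3\<^esub> z)"
      by (cases x; cases y; cases z) (simp add: mod_3_affine mod_add_left_eq mod_add_right_eq algebra_simps) }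
qed auto

lemma klein4_closed: "v \<in> carrier klein4 \<Longrightarrow> w \<in> carrier klein4 \<Longrightarrow> v \<otimes>\<^bsub>klein4\<^esub> w \<in> carrier klein4"
  by (simp, elim disjE) (simp_all add: insert_Diff_if insert_commute)

lemma klein4_group: "group klein4"
proof (rule groupI)
  fix x y assume "x \<in> carrier klein4" "y \<in> carrier klein4"
  thus "x \<otimes>\<^bsub>klein4\<^esub> y \<in> carrier klein4" by (rule klein4_closed)
next
  fix x assume "x \<in> carrier klein4"
  thus "\<exists>y\<in>carrier klein4. y \<otimes>\<^bsub>klein4\<^esub> x = \<one>\<^bsub>klein4\<^esub>" by (intro bexI[of _ x]) simp_all
qed auto

lemma affine3_act_closed: "q \<in> carrier affine3 \<Longrightarrow> v \<in> carrier klein4 \<Longrightarrow> affine3_act q v \<in> carrier klein4"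
  by (cases q, simp, elim disjE conjE) (simp_all add: affine3_act_def insert_commute)

lemma affine3_act_mult:
  assumes q: "q \<in> carrier affine3" and v: "v \<in> carrier klein4" and w: "w \<in> carrier klein4"
  shows "affine3_act q (v \<otimes>\<^bsub>klein4\<^esub> w) = affine3_act q v \<otimes>\<^bsub>klein4\<^esub> affine3_act q w"
proof -
  obtain d c where dc: "q = (d, c)" "d \<in> {1, - 1}" using q by auto
  let ?f = "\<lambda>x. (d * x + c) mod 3"
  have inj: "inj_on ?f {0, 1, 2}" using dc(2) by (auto simp: inj_on_def; presburger)
  have sub: "v \<subseteq> {0, 1, 2}" "w \<subseteq> {0, 1, 2}" using v w by auto
  have "?f ` (v - w) = ?f ` v - ?f ` w" "?f ` (w - v) = ?f ` w - ?f ` v"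
    using inj_on_image_set_diff[OF inj] sub by (meson Diff_subset order_trans)+
  thus ?thesis unfolding dc(1) affine3_act_def by (simp add: image_Un)
qed

lemma affine3_act_one: "v \<in> carrier klein4 \<Longrightarrow> affine3_act \<one>\<^bsub>affine3\<^esub> v = v"
  by (auto simp: affine3_act_def)

lemma affine3_act_comp: "affine3_act (q \<otimes>\<^bsub>affine3\<^esub> r) v = affine3_act q (affine3_act r v)"
  by (cases q; cases r) (simp add: affine3_act_def image_image mod_3_affine mod_add_right_eq algebra_simps)

lemma sym4_group: "group sym4"
  unfolding sym4_def
  by (rule semidirect_group[OF klein4_group affine3_group affine3_act_closed affine3_act_mult affine3_act_one affine3_act_comp])

lemma sym4_simps [simp]:
  "carrier sym4 = carrier klein4 \<times> carrier affine3"
  "(v, p) \<otimes>\<^bsub>sym4\<^esub> (w, q) = (v \<otimes>\<^bsub>klein4\<^esub> affine3_act p w, p \<otimes>\<^bsub>affine3\<^esub> q)"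
  "\<one>\<^bsub>sym4\<^esub> = ({}, (1, 0))"
  by (simp_all add: sym4_def)

lemma sym4_hom_affine3: "snd \<in> hom sym4 affine3"
  by (auto simp: hom_def)

text \<open>The Klein subgroup is its own centralizer, so a nontrivial \<open>c\<close> has a
  nontrivial commutator in it. The equation is written without inverses, which spares inverting in a
  semidirect product.\<close>

lemma sym4_commutator:
  assumes c: "c \<in> carrier sym4" "c \<noteq> \<one>\<^bsub>sym4\<^esub>"
  obtains x u where "x \<in> carrier sym4" "u \<in> carrier klein4" "u \<noteq> {}"
    "c \<otimes>\<^bsub>sym4\<^esub> x = (u, (1, 0)) \<otimes>\<^bsub>sym4\<^esub> (x \<otimes>\<^bsub>sym4\<^esub> c)"
proof -
  obtain v s where vs: "c = (v, s)" "v \<in> carrier klein4" "s \<in> carrier affine3" using c by auto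
  have id: "affine3_act (1, 0) w = w" if "w \<in> carrier klein4" for w using affine3_act_one[OF that] by simp
  have sd: "s \<otimes>\<^bsub>affine3\<^esub> (1, 0) = s" "(1, 0) \<otimes>\<^bsub>affine3\<^esub> s = s" using vs(3) by auto
  show thesis
  proof (cases "s = (1, 0)")
    case False
    \<comment> \<open>The action of \<open>affine3\<close> on \<open>klein4\<close> is
      faithful.\<close>
    have "\<exists>w\<in>carrier klein4. affine3_act s w \<noteq> w"
      using vs(3) False
      by (cases s) (auto simp: affine3_act_def doubleton_eq_iff)
    then obtain w where w: "w \<in> carrier klein4" "affine3_act s w \<noteq> w" by blast
    have wc: "affine3_act s w \<in> carrier klein4" by (rule affine3_act_closed[OF vs(3) w(1)])
    let ?u = "affine3_act s w \<otimes>\<^bsub>klein4\<^esub> w"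
    have u: "?u \<in> carrier klein4" by (rule klein4_closed[OF wc w(1)])
    have "?u \<noteq> {}" using w(2) by auto
    moreover have "c \<otimes>\<^bsub>sym4\<^esub> (w, (1, 0)) = (?u, (1, 0)) \<otimes>\<^bsub>sym4\<^esub> ((w, (1, 0)) \<otimes>\<^bsub>sym4\<^esub> c)"
    proof -
      have e1: "c \<otimes>\<^bsub>sym4\<^esub> (w, (1, 0)) = (v \<otimes>\<^bsub>klein4\<^esub> affine3_act s w, s)"
        unfolding vs(1) sym4_simps sd ..
      have wv: "w \<otimes>\<^bsub>klein4\<^esub> v \<in> carrier klein4" by (rule klein4_closed[OF w(1) vs(2)])
      have e2: "(?u, (1, 0)) \<otimes>\<^bsub>sym4\<^esub> ((w, (1, 0)) \<otimes>\<^bsub>sym4\<^esub> c) = (?u \<otimes>\<^bsub>klein4\<^esub> (w \<otimes>\<^bsub>klein4\<^esub> v), s)"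
        unfolding vs(1) sym4_simps sd id[OF vs(2)] id[OF wv] ..
      have "v \<otimes>\<^bsub>klein4\<^esub> affine3_act s w = ?u \<otimes>\<^bsub>klein4\<^esub> (w \<otimes>\<^bsub>klein4\<^esub> v)" by auto
      thus ?thesis unfolding e1 e2 by simp
    qed
    ultimately show thesis using that[of "(w, (1, 0))" ?u] w(1) u by simp
  next
    case True
    have v: "v \<noteq> {}" using c vs True by auto
    \<comment> \<open>For \<open>c\<close> inside the Klein group the partner is the rotation by 1,
      which fixes no nonempty even subset.\<close>
    have r: "(1, 1) \<in> carrier affine3" by simp
    have vc: "affine3_act (1, 1) v \<in> carrier klein4" by (rule affine3_act_closed[OF r vs(2)])
    let ?u = "v \<otimes>\<^bsub>klein4\<^esub> affine3_act (1, 1) v"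
    have u: "?u \<in> carrier klein4" by (rule klein4_closed[OF vs(2) vc])
    have "affine3_act (1, 1) v \<noteq> v"
      using vs(2) v by (auto simp: affine3_act_def doubleton_eq_iff)
    hence "?u \<noteq> {}" by auto
    moreover have "c \<otimes>\<^bsub>sym4\<^esub> ({}, (1, 1)) = (?u, (1, 0)) \<otimes>\<^bsub>sym4\<^esub> (({}, (1, 1)) \<otimes>\<^bsub>sym4\<^esub> c)"
    proof -
      have e: "affine3_act p {} = {}" for p by (cases p) (simp add: affine3_act_def)
      have "{} \<otimes>\<^bsub>klein4\<^esub> affine3_act (1, 1) v = affine3_act (1, 1) v" by simp
      thus ?thesis unfolding vs(1) True sym4_simps e using id[OF vc] by auto
    qed
    ultimately show thesis using that[of "({}, (1, 1))" ?u] u by simp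
  qed
qed

section \<open>Wreath products\<close>

definition swap_group :: "bool monoid" where
  "swap_group = \<lparr>carrier = UNIV, monoid.mult = (\<noteq>), one = False\<rparr>"

definition wreath2 :: "'x monoid \<Rightarrow> (('x \<times> 'x) \<times> bool) monoid" where
  "wreath2 X = semidirect (X \<times>\<times> X) swap_group (\<lambda>s (x, y). if s then (y, x) else (x, y))"

lemma swap_group_group: "group swap_group"
  by (rule groupI) (auto simp: swap_group_def)

lemma wreath2_simps [simp]:
  "carrier (wreath2 X) = (carrier X \<times> carrier X) \<times> UNIV"
  "((x, y), s) \<otimes>\<^bsub>wreath2 X\<^esub> ((x', y'), s') =
     (if s then ((x \<otimes>\<^bsub>X\<^esub> y', y \<otimes>\<^bsub>X\<^esub> x'), \<not> s') else ((x \<otimes>\<^bsub>X\<^esub> x', y \<otimes>\<^bsub>X\<^esub> y'), s'))"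
  "\<one>\<^bsub>wreath2 X\<^esub> = ((\<one>\<^bsub>X\<^esub>, \<one>\<^bsub>X\<^esub>), False)"
  by (auto simp: wreath2_def swap_group_def)

lemma wreath2_group:
  assumes "group X"
  shows "group (wreath2 X)"
  unfolding wreath2_def
proof (rule semidirect_group)
  interpret X: group X by (rule assms)
  show "group (X \<times>\<times> X)" by (rule DirProd_group[OF assms assms])
  show "group swap_group" by (rule swap_group_group)
qed (auto simp: swap_group_def)

lemma wreath2_map_hom:
  assumes "f \<in> hom X Y"
  shows "(\<lambda>((x, y), s). ((f x, f y), s)) \<in> hom (wreath2 X) (wreath2 Y)"
  using assms by (auto simp: hom_def split: prod.splits)

text \<open>The group of order 3 is realized by the complex cube roots of unity, so that products of
  values are already character values. Extensional functions keep the group finite.\<close>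

definition base3 :: "('a, 'b) monoid_scheme \<Rightarrow> ('a \<Rightarrow> complex) monoid" where
  "base3 A = \<lparr>carrier = carrier A \<rightarrow>\<^sub>E {z. z ^ 3 = 1}, monoid.mult = (\<lambda>f g. \<lambda>a\<in>carrier A. f a * g a),
     one = (\<lambda>a\<in>carrier A. 1)\<rparr>"

definition base3_act :: "('a, 'b) monoid_scheme \<Rightarrow> 'a \<Rightarrow> ('a \<Rightarrow> complex) \<Rightarrow> 'a \<Rightarrow> complex" where
  "base3_act A a f = (\<lambda>z\<in>carrier A. f (inv\<^bsub>A\<^esub> a \<otimes>\<^bsub>A\<^esub> z))"

definition wreath3 :: "('a, 'b) monoid_scheme \<Rightarrow> (('a \<Rightarrow> complex) \<times> 'a) monoid" where
  "wreath3 A = semidirect (base3 A) A (base3_act A)"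

text \<open>The character of the base group belonging to the indicator function of \<open>S\<close>,
  extended trivially over \<open>S\<close>: translation by \<open>S\<close> permutes the factors of
  the product.\<close>

definition wreath3_char :: "('a, 'b) monoid_scheme \<Rightarrow> 'a set \<Rightarrow> ('a \<Rightarrow> complex) \<times> 'a \<Rightarrow> complex" where
  "wreath3_char A S = (\<lambda>(f, a). if f \<in> carrier (base3 A) \<and> a \<in> S then \<Prod>s\<in>S. f s else 0)"

lemma base3_simps [simp]:
  "carrier (base3 A) = carrier A \<rightarrow>\<^sub>E {z. z ^ 3 = 1}"
  "f \<otimes>\<^bsub>base3 A\<^esub> g = (\<lambda>a\<in>carrier A. f a * g a)"
  "\<one>\<^bsub>base3 A\<^esub> = (\<lambda>a\<in>carrier A. 1)"
  by (simp_all add: base3_def)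

lemma base3_group: "group (base3 A)"
proof (rule groupI)
  fix f assume f: "f \<in> carrier (base3 A)"
  have f3: "f a ^ 3 = 1" if "a \<in> carrier A" for a using f that by auto
  have nz: "f a \<noteq> 0" if "a \<in> carrier A" for a using f3[OF that] by auto
  show "\<exists>g\<in>carrier (base3 A). g \<otimes>\<^bsub>base3 A\<^esub> f = \<one>\<^bsub>base3 A\<^esub>"
    by (intro bexI[of _ "\<lambda>a\<in>carrier A. inverse (f a)"])
      (simp_all add: restrict_PiE_iff f3 power_inverse nz cong: restrict_cong)
  have "restrict f (carrier A) = f" using f by (simp add: PiE_restrict)
  thus "\<one>\<^bsub>base3 A\<^esub> \<otimes>\<^bsub>base3 A\<^esub> f = f" by (simp cong: restrict_cong)
  fix g assume g: "g \<in> carrier (base3 A)"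
  have "g a ^ 3 = 1" if "a \<in> carrier A" for a using g that by auto
  thus "f \<otimes>\<^bsub>base3 A\<^esub> g \<in> carrier (base3 A)"
    using f3 by (simp add: restrict_PiE_iff power_mult_distrib)
qed (simp_all add: restrict_PiE_iff mult.assoc cong: restrict_cong)

lemma base3_comm: "f \<otimes>\<^bsub>base3 A\<^esub> g = g \<otimes>\<^bsub>base3 A\<^esub> f"
  by (auto simp: restrict_def mult.commute)

lemma cube_roots_unity:
  shows "finite {z :: complex. z ^ 3 = 1}" "card {z :: complex. z ^ 3 = 1} = 3"
  using finite_roots_unity[of 3, where 'a = complex] card_roots_unity_eq[of 3] by auto

context group
begin

lemma wreath3_group: "group (wreath3 G)"
  unfolding wreath3_def
proof (rule semidirect_group[OF base3_group is_group])
  fix a f assume "a \<in> carrier G" "f \<in> carrier (base3 G)"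
  thus "base3_act G a f \<in> carrier (base3 G)" by (auto simp: base3_act_def)
next
  fix a f g assume "a \<in> carrier G"
  thus "base3_act G a (f \<otimes>\<^bsub>base3 G\<^esub> g) = base3_act G a f \<otimes>\<^bsub>base3 G\<^esub> base3_act G a g"
    by (auto simp: base3_act_def restrict_def)
next
  fix f assume "f \<in> carrier (base3 G)"
  thus "base3_act G \<one> f = f" by (auto simp: base3_act_def restrict_def PiE_def extensional_def)
next
  fix a c f assume "a \<in> carrier G" "c \<in> carrier G"
  thus "base3_act G (a \<otimes> c) f = base3_act G a (base3_act G c f)"
    by (auto simp: base3_act_def restrict_def inv_mult_group m_assoc)
qed

lemma wreath3_simps:
  "carrier (wreath3 G) = carrier (base3 G) \<times> carrier G"
  "(f, a) \<otimes>\<^bsub>wreath3 G\<^esub> (g, c) = (f \<otimes>\<^bsub>base3 G\<^esub> base3_act G a g, a \<otimes> c)"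
  "\<one>\<^bsub>wreath3 G\<^esub> = (\<one>\<^bsub>base3 G\<^esub>, \<one>)"
  by (simp_all add: wreath3_def)

lemma wreath3_snd_hom: "snd \<in> hom (wreath3 G) G"
  by (auto simp: hom_def wreath3_def)

lemma base3_act_one: "f \<in> carrier (base3 G) \<Longrightarrow> base3_act G \<one> f = f"
  by (auto simp: base3_act_def restrict_def PiE_def extensional_def)

lemma base3_act_closed: "a \<in> carrier G \<Longrightarrow> f \<in> carrier (base3 G) \<Longrightarrow> base3_act G a f \<in> carrier (base3 G)"
  by (auto simp: base3_act_def)

lemma wreath3_char_lin:
  assumes S: "subgroup S G"
  shows "lin_char ((wreath3 G)\<lparr>carrier := carrier (base3 G) \<times> S\<rparr>) (wreath3_char G S)"
proof -
  have Sc: "s \<in> carrier G" if "s \<in> S" for s using that S subgroup.mem_carrier by metis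
  have "wreath3_char G S ((f, a) \<otimes>\<^bsub>wreath3 G\<^esub> (g, c)) = wreath3_char G S (f, a) * wreath3_char G S (g, c)"
    if f: "f \<in> carrier (base3 G)" and a: "a \<in> S" and g: "g \<in> carrier (base3 G)" and c: "c \<in> S" for f a g c
  proof -
    have ag: "base3_act G a g \<in> carrier (base3 G)" using base3_act_closed[OF Sc[OF a] g] .
    have fg: "f \<otimes>\<^bsub>base3 G\<^esub> base3_act G a g \<in> carrier (base3 G)"
      using group.is_monoid[OF base3_group] monoid.m_closed f ag by metis
    have ac: "a \<otimes> c \<in> S" using S a c by (rule subgroup.m_closed)
    have "(\<Prod>s\<in>S. (f \<otimes>\<^bsub>base3 G\<^esub> base3_act G a g) s) = (\<Prod>s\<in>S. f s) * (\<Prod>s\<in>S. g (inv a \<otimes> s))"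
      using Sc by (simp add: base3_act_def prod.distrib)
    also have "(\<Prod>s\<in>S. g (inv a \<otimes> s)) = (\<Prod>s\<in>S. g s)"
      by (rule prod.reindex_bij_witness[of _ "\<lambda>s. a \<otimes> s" "\<lambda>s. inv a \<otimes> s"])
        (use S a Sc in \<open>auto simp: subgroup.m_closed subgroup.m_inv_closed m_assoc[symmetric]\<close>)
    finally show ?thesis using f g fg a c ac by (simp only: wreath3_simps wreath3_char_def prod.case simp_thms if_True)
  qed
  moreover have "wreath3_char G S (\<one>\<^bsub>base3 G\<^esub>, \<one>) = 1"
  proof -
    have "(\<Prod>s\<in>S. \<one>\<^bsub>base3 G\<^esub> s) = 1" using Sc by simp
    moreover have "\<one>\<^bsub>base3 G\<^esub> \<in> carrier (base3 G)" using group.is_monoid[OF base3_group] monoid.one_closed by metis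
    ultimately show ?thesis using subgroup.one_closed[OF S] by (simp only: wreath3_char_def prod.case simp_thms if_True)
  qed
  ultimately show ?thesis
    unfolding lin_char_def by (auto simp: wreath3_simps wreath3_char_def simp del: base3_simps)
qed

lemma wreath3_char_cube:
  assumes S: "subgroup S G" and f: "f \<in> carrier (base3 G)" and a: "a \<in> S"
  shows "wreath3_char G S (f, a) ^ 3 = 1"
proof -
  have "f s ^ 3 = 1" if "s \<in> S" for s using f subgroup.mem_carrier[OF S that] by auto
  hence "(\<Prod>s\<in>S. f s) ^ 3 = 1" unfolding prod_power_distrib by (rule prod.neutral[OF ballI])
  thus ?thesis using f a by (simp add: wreath3_char_def del: base3_simps)
qed

text \<open>A function supported at \<open>inv a\<close> tells the translate \<open>inv a \<otimes> S\<close> from \<open>S\<close>.\<close>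

lemma wreath3_char_stab:
  assumes fin: "finite (carrier G)" and S: "subgroup S G" and x: "x \<in> carrier (wreath3 G)" "snd x \<notin> S"
  shows "\<exists>n\<in>carrier (base3 G) \<times> {\<one>}.
    wreath3_char G S (x \<otimes>\<^bsub>wreath3 G\<^esub> n \<otimes>\<^bsub>wreath3 G\<^esub> inv\<^bsub>wreath3 G\<^esub> x) \<noteq> wreath3_char G S n"
proof -
  interpret W: group "wreath3 G" by (rule wreath3_group)
  interpret B: group "base3 G" by (rule base3_group)
  obtain h a where h: "x = (h, a)" "h \<in> carrier (base3 G)" "a \<in> carrier G" "a \<notin> S" using x by (auto simp: wreath3_simps)
  have "card {z :: complex. z ^ 3 = 1} \<noteq> card {1 :: complex}" using cube_roots_unity by simp
  hence "{z :: complex. z ^ 3 = 1} \<noteq> {1}" by metis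
  then obtain w :: complex where w: "w ^ 3 = 1" "w \<noteq> 1" by auto
  define f where "f = (\<lambda>z\<in>carrier G. if z = inv a then w else 1)"
  have f: "f \<in> carrier (base3 G)" using w by (auto simp: f_def)
  have Sc: "s \<in> carrier G" if "s \<in> S" for s using that S subgroup.mem_carrier by metis
  have finS: "finite S" using Sc finite_subset[OF _ fin] by blast
  let ?f' = "base3_act G a f"
  have f': "?f' \<in> carrier (base3 G)" using base3_act_closed[OF h(3) f] .
  have n: "(f, \<one>) \<in> carrier (wreath3 G)" and n': "(?f', \<one>) \<in> carrier (wreath3 G)"
    using f f' by (simp_all add: wreath3_simps del: base3_simps)
  \<comment> \<open>The base component \<open>h\<close> drops out because the base group is
    commutative; conjugation only translates \<open>f\<close> by \<open>a\<close>.\<close>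
  have "x \<otimes>\<^bsub>wreath3 G\<^esub> (f, \<one>) = (?f', \<one>) \<otimes>\<^bsub>wreath3 G\<^esub> x"
    unfolding h(1) wreath3_simps base3_act_one[OF h(2)] using h(3) by (simp add: base3_comm del: base3_simps)
  hence e: "x \<otimes>\<^bsub>wreath3 G\<^esub> (f, \<one>) \<otimes>\<^bsub>wreath3 G\<^esub> inv\<^bsub>wreath3 G\<^esub> x = (?f', \<one>)"
    using x(1) n n' by (simp add: W.m_assoc)
  have "(\<Prod>s\<in>S. ?f' s) = (\<Prod>s\<in>S. if s = \<one> then w else 1)"
  proof (intro prod.cong refl)
    fix s assume s: "s \<in> S"
    have "inv a \<otimes> s = inv a \<longleftrightarrow> s = \<one>" using h(3) Sc[OF s] by simp
    thus "?f' s = (if s = \<one> then w else 1)" using h(3) Sc[OF s] by (simp add: base3_act_def f_def)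
  qed
  also have "\<dots> = w" using finS subgroup.one_closed[OF S] by simp
  finally have v1: "wreath3_char G S (?f', \<one>) = w"
    using f' subgroup.one_closed[OF S] by (simp add: wreath3_char_def del: base3_simps)
  \<comment> \<open>The only point where \<open>f\<close> differs from 1 lies outside
    \<open>S\<close>, while its translate has its exceptional point at the identity, inside
    \<open>S\<close>.\<close>
  have "inv a \<notin> S" using h(3,4) S subgroup.m_inv_closed[of S G "inv a"] by auto
  hence "(\<Prod>s\<in>S. f s) = 1" using Sc by (intro prod.neutral) (auto simp: f_def)
  hence v2: "wreath3_char G S (f, \<one>) = 1"
    using f subgroup.one_closed[OF S] by (simp add: wreath3_char_def del: base3_simps)
  show ?thesis using v1 v2 e w f by (intro bexI[of _ "(f, \<one>)"]) (auto simp del: base3_simps)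
qed

lemma base3_cube:
  assumes "f \<in> carrier (base3 G)"
  shows "(f, \<one>) [^]\<^bsub>wreath3 G\<^esub> (3::nat) = \<one>\<^bsub>wreath3 G\<^esub>"
proof -
  interpret W: group "wreath3 G" by (rule wreath3_group)
  interpret B: group "base3 G" by (rule base3_group)
  have pw: "(f, \<one>) [^]\<^bsub>wreath3 G\<^esub> (k::nat) = ((\<lambda>a\<in>carrier G. f a ^ k), \<one>)" for k
  proof (induction k)
    case (Suc k)
    have "(f, \<one>) [^]\<^bsub>wreath3 G\<^esub> Suc k = ((\<lambda>a\<in>carrier G. f a ^ k) \<otimes>\<^bsub>base3 G\<^esub> f, \<one>)"
      by (simp only: W.nat_pow_Suc Suc wreath3_simps base3_act_one[OF assms] r_one one_closed)
    thus ?case by (auto simp: restrict_def mult.commute)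
  qed (simp add: wreath3_simps restrict_def)
  have "f a ^ 3 = 1" if "a \<in> carrier G" for a using assms that by auto
  thus ?thesis unfolding pw by (auto simp: wreath3_simps restrict_def)
qed

lemma base3_commute:
  assumes "f \<in> carrier (base3 G)" "g \<in> carrier (base3 G)"
  shows "(f, \<one>) \<otimes>\<^bsub>wreath3 G\<^esub> (g, \<one>) = (g, \<one>) \<otimes>\<^bsub>wreath3 G\<^esub> (f, \<one>)"
  unfolding wreath3_simps base3_act_one[OF assms(1)] base3_act_one[OF assms(2)] base3_comm[of G f g] ..

end

section \<open>The configuration\<close>

lemma kernel_normal:
  assumes "group G" "group H" "h \<in> hom G H"
  shows "{x \<in> carrier G. h x = \<one>\<^bsub>H\<^esub>} \<lhd> G"
proof -
  interpret group_hom G H h using assms by (simp add: group_hom_def group_hom_axioms_def)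
  show ?thesis using normal_kernel by (simp add: kernel_def)
qed

text \<open>Elements of \<open>cex_group\<close> have the form \<open>(f, ((x, y), s))\<close>: a
  base function, two elements of \<open>sym4\<close> and a flag for the swap.\<close>

abbreviation (input) "sw g \<equiv> snd (snd g)"
abbreviation (input) "p1 g \<equiv> fst (fst (snd g))"
abbreviation (input) "p2 g \<equiv> snd (fst (snd g))"

definition ambient :: "(((int set \<times> (int \<times> int)) \<times> (int set \<times> (int \<times> int))) \<times> bool) monoid" where
  "ambient = wreath2 sym4"

definition cex_group where "cex_group = wreath3 ambient"

text \<open>Modulo the base group \<open>N0\<close> of the wreath product, \<open>F0\<close>, \<open>J0\<close>, \<open>M0\<close>, \<open>R0\<close> are
  \<open>V\<^sub>4 \<times> V\<^sub>4\<close>, \<open>A\<^sub>4 \<times> A\<^sub>4\<close>, \<open>S\<^sub>4 \<times> S\<^sub>4\<close>, \<open>S\<^sub>4 \<times> 1\<close>, and \<open>S0\<close> is \<open>D\<^sub>8 \<times> 1\<close>.\<close>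

definition N0 where "N0 = {g \<in> carrier cex_group. snd g = \<one>\<^bsub>ambient\<^esub>}"
definition F0 where "F0 = {g \<in> carrier cex_group. \<not> sw g \<and> snd (p1 g) = (1, 0) \<and> snd (p2 g) = (1, 0)}"
definition J0 where "J0 = {g \<in> carrier cex_group. \<not> sw g \<and> fst (snd (p1 g)) = 1 \<and> fst (snd (p2 g)) = 1}"
definition M0 where "M0 = {g \<in> carrier cex_group. \<not> sw g}"
definition R0 where "R0 = {g \<in> carrier cex_group. \<not> sw g \<and> p2 g = \<one>\<^bsub>sym4\<^esub>}"
definition S0 where "S0 = {a \<in> carrier ambient. \<not> snd a \<and> snd (fst a) = \<one>\<^bsub>sym4\<^esub> \<and> snd (snd (fst (fst a))) = 0}"

interpretation sym4: group sym4 by (rule sym4_group)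

interpretation ambient: group ambient unfolding ambient_def by (rule wreath2_group[OF sym4_group])

interpretation cex_group: group cex_group unfolding cex_group_def by (rule ambient.wreath3_group)

lemma carrier_ambient: "carrier ambient = (carrier sym4 \<times> carrier sym4) \<times> UNIV"
  by (simp only: ambient_def wreath2_simps)

lemma carrier_cex: "carrier cex_group = carrier (base3 ambient) \<times> carrier ambient"
  by (simp only: cex_group_def ambient.wreath3_simps)

lemma finite_ambient: "finite (carrier ambient)"
  by (simp add: carrier_ambient)

lemma finite_cex: "finite (carrier cex_group)"
  unfolding carrier_cex using finite_ambient cube_roots_unity(1) by (simp add: finite_PiE)

lemma one_ambient: "\<one>\<^bsub>ambient\<^esub> = ((\<one>\<^bsub>sym4\<^esub>, \<one>\<^bsub>sym4\<^esub>), False)"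
  by (simp only: ambient_def wreath2_simps)

lemma ambient_mult:
  "((x, y), s) \<otimes>\<^bsub>ambient\<^esub> ((x', y'), s') =
     (if s then ((x \<otimes>\<^bsub>sym4\<^esub> y', y \<otimes>\<^bsub>sym4\<^esub> x'), \<not> s') else ((x \<otimes>\<^bsub>sym4\<^esub> x', y \<otimes>\<^bsub>sym4\<^esub> y'), s'))"
  by (simp only: ambient_def wreath2_simps)

lemma cex_snd_hom: "snd \<in> hom cex_group ambient"
  unfolding cex_group_def by (rule ambient.wreath3_snd_hom)

lemma cex_snd_mult: "g \<in> carrier cex_group \<Longrightarrow> h \<in> carrier cex_group \<Longrightarrow> snd (g \<otimes>\<^bsub>cex_group\<^esub> h) = snd g \<otimes>\<^bsub>ambient\<^esub> snd h"
  using cex_snd_hom by (simp add: hom_def)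

lemma cex_snd_closed: "g \<in> carrier cex_group \<Longrightarrow> snd g \<in> carrier ambient"
  by (auto simp: carrier_cex)

lemma lift_ambient: "a \<in> carrier ambient \<Longrightarrow> (\<one>\<^bsub>base3 ambient\<^esub>, a) \<in> carrier cex_group"
  using group.is_monoid[OF base3_group] monoid.one_closed[of "base3 ambient"] by (auto simp: carrier_cex simp del: base3_simps)

lemma cex_components:
  assumes "g \<in> carrier cex_group" "h \<in> carrier cex_group"
  shows "sw (g \<otimes>\<^bsub>cex_group\<^esub> h) \<longleftrightarrow> sw g \<noteq> sw h"
    "\<not> sw g \<Longrightarrow> p1 (g \<otimes>\<^bsub>cex_group\<^esub> h) = p1 g \<otimes>\<^bsub>sym4\<^esub> p1 h"
    "\<not> sw g \<Longrightarrow> p2 (g \<otimes>\<^bsub>cex_group\<^esub> h) = p2 g \<otimes>\<^bsub>sym4\<^esub> p2 h"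
    "sw g \<Longrightarrow> p1 (g \<otimes>\<^bsub>cex_group\<^esub> h) = p1 g \<otimes>\<^bsub>sym4\<^esub> p2 h"
    "sw g \<Longrightarrow> p2 (g \<otimes>\<^bsub>cex_group\<^esub> h) = p2 g \<otimes>\<^bsub>sym4\<^esub> p1 h"
  unfolding cex_snd_mult[OF assms]
  by (cases "snd g"; cases "snd h"; cases "fst (snd g)"; cases "fst (snd h)"; simp add: ambient_mult del: sym4_simps)+

lemma p_closed: "g \<in> carrier cex_group \<Longrightarrow> p1 g \<in> carrier sym4" "g \<in> carrier cex_group \<Longrightarrow> p2 g \<in> carrier sym4"
  by (auto simp: carrier_cex carrier_ambient simp del: base3_simps sym4_simps)

lemma sym4_affine_part:
  "fst (snd (x \<otimes>\<^bsub>sym4\<^esub> y)) = fst (snd x) * fst (snd y)"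
  "snd (snd (x \<otimes>\<^bsub>sym4\<^esub> y)) = (snd (snd x) + fst (snd x) * snd (snd y)) mod 3"
  by (cases x; cases y; cases "snd x"; cases "snd y"; simp)+

lemma N0_normal: "N0 \<lhd> cex_group"
  unfolding N0_def by (rule kernel_normal[OF cex_group.is_group ambient.is_group cex_snd_hom])

lemma M0_normal: "M0 \<lhd> cex_group"
proof -
  have "sw \<in> hom cex_group swap_group"
    using cex_components(1) by (auto simp: hom_def swap_group_def)
  from kernel_normal[OF cex_group.is_group swap_group_group this] show ?thesis by (simp add: M0_def swap_group_def)
qed

text \<open>A homomorphism on \<open>sym4\<close> extends to the wreath product with the swap, and
  this is its kernel. The affine part gives \<open>F0\<close>, the sign gives
  \<open>J0\<close>.\<close>

lemma wreath2_kernel_normal: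
  fixes Y :: "'y monoid"
  assumes Y: "group Y" and f: "f \<in> hom sym4 Y"
  shows "{g \<in> carrier cex_group. \<not> sw g \<and> f (p1 g) = \<one>\<^bsub>Y\<^esub> \<and> f (p2 g) = \<one>\<^bsub>Y\<^esub>} \<lhd> cex_group"
proof -
  let ?h = "\<lambda>((x, y), s). ((f x, f y), s)"
  have "?h \<in> hom ambient (wreath2 Y)" unfolding ambient_def by (rule wreath2_map_hom[OF f])
  hence "?h \<circ> snd \<in> hom cex_group (wreath2 Y)" using hom_compose[OF cex_snd_hom] by blast
  from kernel_normal[OF cex_group.is_group wreath2_group[OF Y] this]
  have "{g \<in> carrier cex_group. (?h \<circ> snd) g = \<one>\<^bsub>wreath2 Y\<^esub>} \<lhd> cex_group" .
  moreover have "{g \<in> carrier cex_group. (?h \<circ> snd) g = \<one>\<^bsub>wreath2 Y\<^esub>} =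
    {g \<in> carrier cex_group. \<not> sw g \<and> f (p1 g) = \<one>\<^bsub>Y\<^esub> \<and> f (p2 g) = \<one>\<^bsub>Y\<^esub>}"
    by (auto split: prod.splits)
  ultimately show ?thesis by simp
qed

lemma F0_normal: "F0 \<lhd> cex_group"
  using wreath2_kernel_normal[OF affine3_group sym4_hom_affine3] by (simp add: F0_def)

definition sign_group :: "int monoid" where
  "sign_group = \<lparr>carrier = {1, - 1}, monoid.mult = (*), one = 1\<rparr>"

lemma sign_group_group: "group sign_group"
  by (rule groupI) (auto simp: sign_group_def)

lemma J0_normal: "J0 \<lhd> cex_group"
proof -
  have "(\<lambda>x. fst (snd x)) \<in> hom sym4 sign_group"
    by (auto simp: hom_def sign_group_def)
  from wreath2_kernel_normal[OF sign_group_group this] show ?thesis by (simp add: J0_def sign_group_def)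
qed

lemma M0_subgroup: "subgroup M0 cex_group"
  using M0_normal normal_imp_subgroup by blast

lemma R0_normal_M0: "R0 \<lhd> cex_group\<lparr>carrier := M0\<rparr>"
proof -
  have "p2 \<in> hom (cex_group\<lparr>carrier := M0\<rparr>) sym4"
    using cex_components(3) p_closed by (auto simp: hom_def M0_def simp del: sym4_simps)
  from kernel_normal[OF cex_group.subgroup_imp_group[OF M0_subgroup] sym4_group this]
  show ?thesis by (simp add: M0_def R0_def conj_ac del: sym4_simps)
qed

lemma R0_subgroup: "subgroup R0 cex_group"
  using cex_group.incl_subgroup[OF M0_subgroup normal_imp_subgroup[OF R0_normal_M0]] .

lemma R0_conj: "m \<in> M0 \<Longrightarrow> r \<in> R0 \<Longrightarrow> m \<otimes>\<^bsub>cex_group\<^esub> r \<otimes>\<^bsub>cex_group\<^esub> inv\<^bsub>cex_group\<^esub> m \<in> R0"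
proof -
  interpret M: group "cex_group\<lparr>carrier := M0\<rparr>" by (rule cex_group.subgroup_imp_group[OF M0_subgroup])
  show "m \<in> M0 \<Longrightarrow> r \<in> R0 \<Longrightarrow> m \<otimes>\<^bsub>cex_group\<^esub> r \<otimes>\<^bsub>cex_group\<^esub> inv\<^bsub>cex_group\<^esub> m \<in> R0"
    using R0_normal_M0 unfolding M.normal_inv_iff by (simp add: cex_group.inv_subgroup[OF M0_subgroup])
qed

lemma S0_subgroup: "subgroup S0 ambient"
proof (rule ambient.subgroupI)
  show "S0 \<noteq> {}" using ambient.one_closed by (auto simp: S0_def one_ambient)
  fix a assume a: "a \<in> S0"
  then obtain v d where v: "a = (((v, (d, 0)), \<one>\<^bsub>sym4\<^esub>), False)" "v \<in> carrier klein4" "d \<in> {1, - 1}"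
    by (auto simp: S0_def carrier_ambient simp del: klein4_simps)
  have q: "(d, 0) \<in> carrier affine3" using v by auto
  \<comment> \<open>With translation part 0 the affine map is its own inverse, so the inverse of
    \<open>(v, (d, 0))\<close> is \<open>(?w, (d, 0))\<close>.\<close>
  let ?w = "affine3_act (d, 0) v"
  let ?a' = "(((?w, (d, 0)), \<one>\<^bsub>sym4\<^esub>), False)"
  have w: "?w \<in> carrier klein4" by (rule affine3_act_closed[OF q v(2)])
  have "{} \<in> carrier klein4" by simp
  hence a': "?a' \<in> S0" using w q by (simp add: S0_def carrier_ambient del: klein4_simps)
  have "(?w, (d, 0)) \<otimes>\<^bsub>sym4\<^esub> (v, (d, 0)) = \<one>\<^bsub>sym4\<^esub>" using v(3) by auto
  hence "?a' \<otimes>\<^bsub>ambient\<^esub> a = \<one>\<^bsub>ambient\<^esub>"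
    unfolding v(1) ambient_mult one_ambient by (simp del: sym4_simps)
  hence "inv\<^bsub>ambient\<^esub> a = ?a'" using a a' by (intro ambient.inv_equality) (auto simp: S0_def simp del: sym4_simps)
  thus "inv\<^bsub>ambient\<^esub> a \<in> S0" using a' by simp
  fix c assume c: "c \<in> S0"
  then obtain u e where u: "c = (((u, (e, 0)), \<one>\<^bsub>sym4\<^esub>), False)" "u \<in> carrier klein4"
    by (auto simp: S0_def carrier_ambient simp del: klein4_simps)
  have ac: "a \<otimes>\<^bsub>ambient\<^esub> c \<in> carrier ambient" using a c by (auto simp: S0_def)
  have "a \<otimes>\<^bsub>ambient\<^esub> c = (((v, (d, 0)) \<otimes>\<^bsub>sym4\<^esub> (u, (e, 0)), \<one>\<^bsub>sym4\<^esub>), False)"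
    unfolding v(1) u(1) ambient_mult by (simp del: sym4_simps)
  thus "a \<otimes>\<^bsub>ambient\<^esub> c \<in> S0" using ac by (simp add: S0_def)
qed (auto simp: S0_def)

lemma N0_eq: "N0 = carrier (base3 ambient) \<times> {\<one>\<^bsub>ambient\<^esub>}"
  by (auto simp: N0_def carrier_cex simp del: base3_simps)

definition delta0 where "delta0 g = fst (snd (p1 g))"
definition b0 where "b0 g = snd (snd (p1 g))"

lemma R0_T: "{x \<in> R0. b0 x = 0} = carrier (base3 ambient) \<times> S0"
  by (auto simp: R0_def b0_def S0_def carrier_cex simp del: base3_simps sym4_simps)

lemma mu_stab:
  assumes "x \<in> carrier cex_group" "snd x \<notin> S0"
  shows "\<exists>n\<in>N0. wreath3_char ambient S0 (x \<otimes>\<^bsub>cex_group\<^esub> n \<otimes>\<^bsub>cex_group\<^esub> inv\<^bsub>cex_group\<^esub> x) \<noteq> wreath3_char ambient S0 n"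
  using ambient.wreath3_char_stab[OF finite_ambient S0_subgroup, of x] assms
  unfolding N0_eq cex_group_def by blast

lemma finite_grp_cex: "finite_grp cex_group"
  by (simp add: finite_grp_def finite_grp_axioms_def finite_cex cex_group.is_group)

lemma N0_R0: "N0 \<subseteq> R0" and N0_F0: "N0 \<subseteq> F0" and R0_M0: "R0 \<subseteq> M0"
  by (auto simp: N0_def R0_def F0_def M0_def one_ambient)

lemma sym3_cover_cex: "sym3_cover (cex_group\<lparr>carrier := R0\<rparr>) N0 delta0 b0 (wreath3_char ambient S0)"
proof (rule sym3_cover.intro[OF finite_grp.finite_grp_subgroup[OF finite_grp_cex R0_subgroup] sym3_cover_axioms.intro], goal_cases)
  case 1 show ?case using cex_group.subgroup_incl[OF normal_imp_subgroup[OF N0_normal] R0_subgroup N0_R0] .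
next
  case (2 x n)
  thus ?case using N0_normal R0_subgroup subgroup.mem_carrier[OF R0_subgroup]
    by (auto simp: cex_group.normal_inv_iff cex_group.inv_subgroup)
next
  case (3 x) thus ?case using p_closed(1)[of x] by (auto simp: R0_def delta0_def)
next
  case (4 x y)
  hence "x \<in> carrier cex_group" "y \<in> carrier cex_group" "\<not> sw x" by (auto simp: R0_def)
  thus ?case by (simp add: delta0_def cex_components(2) sym4_affine_part)
next
  case (5 x) thus ?case using p_closed(1)[of x] by (auto simp: R0_def b0_def)
next
  case (6 x y)
  hence "x \<in> carrier cex_group" "y \<in> carrier cex_group" "\<not> sw x" by (auto simp: R0_def)
  thus ?case by (simp add: delta0_def b0_def cex_components(2) sym4_affine_part)
next
  case (7 n) thus ?case by (auto simp: N0_def delta0_def one_ambient)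
next
  case (8 n) thus ?case by (auto simp: N0_def b0_def one_ambient)
next
  case (9 i)
  let ?a = "((({}, (- 1, i)), \<one>\<^bsub>sym4\<^esub>), False)"
  have "i = 0 \<or> i = 1 \<or> i = 2" using 9 by auto
  hence "?a \<in> carrier ambient" by (auto simp: carrier_ambient)
  from lift_ambient[OF this] show ?case
    by (intro bexI[of _ "(\<one>\<^bsub>base3 ambient\<^esub>, ?a)"]) (auto simp: R0_def delta0_def b0_def simp del: base3_simps)
next
  case 10
  show ?case using ambient.wreath3_char_lin[OF S0_subgroup] R0_T by (simp add: cex_group_def)
next
  case (11 x)
  hence "x \<in> carrier (base3 ambient) \<times> S0" using R0_T by auto
  thus ?case using ambient.wreath3_char_cube[OF S0_subgroup] by (auto simp del: base3_simps)
next
  case (12 x)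
  hence x: "x \<in> carrier cex_group" "snd x \<notin> S0" "x \<in> R0" by (auto simp: R0_def S0_def b0_def)
  show ?case using mu_stab[OF x(1,2)] x(3) by (simp add: cex_group.inv_subgroup[OF R0_subgroup])
qed

text \<open>An element \<open>c\<close> outside \<open>R0\<close> has a nontrivial second component.
  Its commutator with a suitable \<open>g\<close> supported in the second component is trivial in
  the first and a nontrivial Klein element in the second.\<close>

lemma normal_M0_meets:
  assumes C: "C \<lhd> cex_group\<lparr>carrier := M0\<rparr>" and nR: "\<not> C \<subseteq> R0"
  shows "\<exists>e\<in>C \<inter> F0. e \<notin> R0"
proof -
  interpret M: group "cex_group\<lparr>carrier := M0\<rparr>" by (rule cex_group.subgroup_imp_group[OF M0_subgroup])
  have subM: "subgroup C (cex_group\<lparr>carrier := M0\<rparr>)" using C normal_imp_subgroup by blast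
  have sub: "subgroup C cex_group" using cex_group.incl_subgroup[OF M0_subgroup subM] .
  have CM: "C \<subseteq> M0" using subgroup.subset[OF subM] by simp
  obtain c where c: "c \<in> C" "c \<notin> R0" using nR by blast
  have cc: "c \<in> carrier cex_group" "\<not> sw c" "p2 c \<noteq> \<one>\<^bsub>sym4\<^esub>" using c CM by (auto simp: M0_def R0_def simp del: sym4_simps)
  obtain x u where x: "x \<in> carrier sym4" and u: "u \<in> carrier klein4" "u \<noteq> {}"
    and eq: "p2 c \<otimes>\<^bsub>sym4\<^esub> x = (u, (1, 0)) \<otimes>\<^bsub>sym4\<^esub> (x \<otimes>\<^bsub>sym4\<^esub> p2 c)"
    by (rule sym4_commutator[OF p_closed(2)[OF cc(1)] cc(3)])
  let ?a = "((\<one>\<^bsub>sym4\<^esub>, x), False)"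
  define g where "g = (\<one>\<^bsub>base3 ambient\<^esub>, ?a)"
  have gc: "g \<in> carrier cex_group" unfolding g_def using x by (intro lift_ambient) (simp add: carrier_ambient del: sym4_simps)
  have g: "\<not> sw g" "p1 g = \<one>\<^bsub>sym4\<^esub>" "p2 g = x" by (simp_all add: g_def del: sym4_simps)
  have gM: "g \<in> M0" using gc g by (simp add: M0_def)
  define e where "e = c \<otimes>\<^bsub>cex_group\<^esub> (g \<otimes>\<^bsub>cex_group\<^esub> inv\<^bsub>cex_group\<^esub> c \<otimes>\<^bsub>cex_group\<^esub> inv\<^bsub>cex_group\<^esub> g)"
  have "inv\<^bsub>cex_group\<^esub> c \<in> C" using c sub by (simp add: subgroup.m_inv_closed)
  hence "g \<otimes>\<^bsub>cex_group\<^esub> inv\<^bsub>cex_group\<^esub> c \<otimes>\<^bsub>cex_group\<^esub> inv\<^bsub>cex_group\<^esub> g \<in> C"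
    using C gM unfolding M.normal_inv_iff by (simp add: cex_group.inv_subgroup[OF M0_subgroup])
  hence eC: "e \<in> C" using c sub by (simp add: e_def subgroup.m_closed)
  have ec: "e \<in> carrier cex_group" "\<not> sw e" using eC CM by (auto simp: M0_def)
  \<comment> \<open>The commutator is characterized without inverses, so the components of
    \<open>e\<close> can be read off by cancellation.\<close>
  have rel: "e \<otimes>\<^bsub>cex_group\<^esub> (g \<otimes>\<^bsub>cex_group\<^esub> c) = c \<otimes>\<^bsub>cex_group\<^esub> g"
    using cc gc by (simp add: e_def cex_group.m_assoc) (simp flip: cex_group.m_assoc)
  have "p1 e \<otimes>\<^bsub>sym4\<^esub> p1 c = p1 c"
    using arg_cong[OF rel, of p1] cc gc ec g p_closed(1)[OF cc(1)]
    by (simp add: cex_components del: sym4_simps)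
  hence p1e: "p1 e = \<one>\<^bsub>sym4\<^esub>" using p_closed(1)[OF cc(1)] p_closed(1)[OF ec(1)] by (simp del: sym4_simps)
  have uc: "(u, (1, 0)) \<in> carrier sym4" using u by simp
  have xc: "x \<otimes>\<^bsub>sym4\<^esub> p2 c \<in> carrier sym4" using x p_closed(2)[OF cc(1)] by (rule sym4.m_closed)
  have "p2 e \<otimes>\<^bsub>sym4\<^esub> (x \<otimes>\<^bsub>sym4\<^esub> p2 c) = (u, (1, 0)) \<otimes>\<^bsub>sym4\<^esub> (x \<otimes>\<^bsub>sym4\<^esub> p2 c)"
    using arg_cong[OF rel, of p2] cc gc ec g eq by (simp add: cex_components del: sym4_simps)
  hence p2e: "p2 e = (u, (1, 0))"
    using sym4.right_cancel[OF xc p_closed(2)[OF ec(1)] uc] by blast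
  have "e \<in> F0" using ec p1e p2e by (simp add: F0_def)
  moreover have "e \<notin> R0" using p2e u by (simp add: R0_def)
  ultimately show ?thesis using eC by blast
qed

text \<open>It is enough to find an element without swap whose second component is nontrivial; the
  intersection with \<open>M0\<close> then falls under the previous case. The swap is what makes
  this possible for a normal subgroup that begins in the first component.\<close>

lemma normal_cex_meets:
  assumes C: "C \<lhd> cex_group" and NC: "N0 \<subset> C"
  shows "\<exists>e\<in>C \<inter> F0. e \<notin> R0"
proof -
  interpret M: group "cex_group\<lparr>carrier := M0\<rparr>" by (rule cex_group.subgroup_imp_group[OF M0_subgroup])
  have sub: "subgroup C cex_group" using C normal_imp_subgroup by blast
  have Cc: "x \<in> carrier cex_group" if "x \<in> C" for x using that subgroup.mem_carrier[OF sub] by blast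
  obtain c where c: "c \<in> C" "c \<notin> N0" using NC by blast
  have cc: "c \<in> carrier cex_group" using Cc c by blast
  have "\<exists>e\<in>C. \<not> sw e \<and> p2 e \<noteq> \<one>\<^bsub>sym4\<^esub>"
  proof (cases "sw c")
    case sc: True
    \<comment> \<open>Any nontrivial element would do: if \<open>c\<close> swaps, its commutator
      with \<open>(?z, 1)\<close> has a conjugate of \<open>?z\<close> as second component.\<close>
    let ?z = "({}, (1, 1)) :: int set \<times> (int \<times> int)"
    have z: "?z \<in> carrier sym4" "?z \<noteq> \<one>\<^bsub>sym4\<^esub>" by auto
    define g where "g = (\<one>\<^bsub>base3 ambient\<^esub>, ((?z, \<one>\<^bsub>sym4\<^esub>), False))"
    have gc: "g \<in> carrier cex_group" unfolding g_def
      by (intro lift_ambient) (use z(1) sym4.one_closed in \<open>simp only: carrier_ambient mem_Times_iff fst_conv snd_conv UNIV_I simp_thms\<close>)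
    have g: "\<not> sw g" "p1 g = ?z" "p2 g = \<one>\<^bsub>sym4\<^esub>" by (simp_all add: g_def del: sym4_simps)
    define e where "e = c \<otimes>\<^bsub>cex_group\<^esub> (g \<otimes>\<^bsub>cex_group\<^esub> inv\<^bsub>cex_group\<^esub> c \<otimes>\<^bsub>cex_group\<^esub> inv\<^bsub>cex_group\<^esub> g)"
    have "inv\<^bsub>cex_group\<^esub> c \<in> C" using c sub by (simp add: subgroup.m_inv_closed)
    hence "g \<otimes>\<^bsub>cex_group\<^esub> inv\<^bsub>cex_group\<^esub> c \<otimes>\<^bsub>cex_group\<^esub> inv\<^bsub>cex_group\<^esub> g \<in> C"
      using C gc unfolding cex_group.normal_inv_iff by simp
    hence eC: "e \<in> C" using c sub by (simp add: e_def subgroup.m_closed)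
    have ec: "e \<in> carrier cex_group" using Cc eC by blast
    have rel: "e \<otimes>\<^bsub>cex_group\<^esub> (g \<otimes>\<^bsub>cex_group\<^esub> c) = c \<otimes>\<^bsub>cex_group\<^esub> g"
      using cc gc by (simp add: e_def cex_group.m_assoc) (simp flip: cex_group.m_assoc)
    have se: "\<not> sw e" using arg_cong[OF rel, of sw] cc gc ec g sc by (simp add: cex_components)
    have "p2 e \<otimes>\<^bsub>sym4\<^esub> p2 c = p2 c \<otimes>\<^bsub>sym4\<^esub> ?z"
      using arg_cong[OF rel, of p2] cc gc ec g sc se p_closed(2)[OF cc]
      by (simp add: cex_components del: sym4_simps)
    moreover have "p2 c \<otimes>\<^bsub>sym4\<^esub> ?z \<noteq> p2 c"
      using p_closed(2)[OF cc] z by (simp del: sym4_simps)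
    ultimately have "p2 e \<noteq> \<one>\<^bsub>sym4\<^esub>" using p_closed(2)[OF cc] by (auto simp del: sym4_simps)
    thus ?thesis using eC se by blast
  next
    case sc: False
    show ?thesis
    proof (cases "p2 c = \<one>\<^bsub>sym4\<^esub>")
      case True
      have "p1 c \<noteq> \<one>\<^bsub>sym4\<^esub>"
      proof
        assume "p1 c = \<one>\<^bsub>sym4\<^esub>"
        hence "snd c = \<one>\<^bsub>ambient\<^esub>" using True sc unfolding one_ambient by (intro prod_eqI) (auto simp del: sym4_simps)
        thus False using c cc by (simp add: N0_def)
      qed
      \<comment> \<open>The pure swap; conjugation by it carries the nontrivial first component of
        \<open>c\<close> to the second place.\<close>
      define t where "t = (\<one>\<^bsub>base3 ambient\<^esub>, ((\<one>\<^bsub>sym4\<^esub>, \<one>\<^bsub>sym4\<^esub>), True))"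
      have tc: "t \<in> carrier cex_group" unfolding t_def
        by (intro lift_ambient) (simp add: carrier_ambient del: sym4_simps)
      have t: "sw t" "p1 t = \<one>\<^bsub>sym4\<^esub>" "p2 t = \<one>\<^bsub>sym4\<^esub>" by (simp_all add: t_def del: sym4_simps)
      define e where "e = t \<otimes>\<^bsub>cex_group\<^esub> c \<otimes>\<^bsub>cex_group\<^esub> inv\<^bsub>cex_group\<^esub> t"
      have eC: "e \<in> C" using C c tc unfolding cex_group.normal_inv_iff by (simp add: e_def)
      have ec: "e \<in> carrier cex_group" using Cc eC by blast
      have rel: "e \<otimes>\<^bsub>cex_group\<^esub> t = t \<otimes>\<^bsub>cex_group\<^esub> c" using cc tc by (simp add: e_def cex_group.m_assoc)
      have se: "\<not> sw e" using arg_cong[OF rel, of sw] cc tc ec t sc by (simp add: cex_components)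
      have "p2 e = p1 c"
        using arg_cong[OF rel, of p2] cc tc ec t se p_closed[OF cc] p_closed[OF ec]
        by (simp add: cex_components del: sym4_simps)
      thus ?thesis using eC se \<open>p1 c \<noteq> \<one>\<^bsub>sym4\<^esub>\<close> by auto
    qed (use c sc in blast)
  qed
  then obtain e where e: "e \<in> C" "\<not> sw e" "p2 e \<noteq> \<one>\<^bsub>sym4\<^esub>" by blast
  have "C \<inter> M0 \<lhd> cex_group\<lparr>carrier := M0\<rparr>"
  proof -
    have "subgroup (C \<inter> M0) (cex_group\<lparr>carrier := M0\<rparr>)"
      using cex_group.subgroup_incl[OF cex_group.subgroups_Inter_pair[OF sub M0_subgroup] M0_subgroup] by simp
    moreover have "x \<otimes>\<^bsub>cex_group\<^esub> h \<otimes>\<^bsub>cex_group\<^esub> inv\<^bsub>cex_group\<^esub> x \<in> C \<inter> M0" if "x \<in> M0" "h \<in> C \<inter> M0" for x h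
      using that C M0_normal subgroup.mem_carrier[OF M0_subgroup that(1)] unfolding cex_group.normal_inv_iff by blast
    ultimately show ?thesis unfolding M.normal_inv_iff by (simp add: cex_group.inv_subgroup[OF M0_subgroup])
  qed
  moreover have "e \<in> C \<inter> M0" "e \<notin> R0" using e Cc[OF e(1)] by (simp_all add: M0_def R0_def del: sym4_simps)
  hence "\<not> C \<inter> M0 \<subseteq> R0" by blast
  ultimately show ?thesis using normal_M0_meets by blast
qed

lemma F0_snd:
  assumes "x \<in> F0"
  obtains v w where "snd x = (((v, (1, 0)), (w, (1, 0))), False)" "v \<in> carrier klein4" "w \<in> carrier klein4"
  using assms that by (cases "snd x") (auto simp: F0_def carrier_cex carrier_ambient simp del: klein4_simps base3_simps)

lemma F0_mult:
  assumes "x \<in> F0" "y \<in> F0"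
  shows "x \<otimes>\<^bsub>cex_group\<^esub> x \<in> N0" "snd (x \<otimes>\<^bsub>cex_group\<^esub> y) = snd (y \<otimes>\<^bsub>cex_group\<^esub> x)"
proof -
  have c: "x \<in> carrier cex_group" "y \<in> carrier cex_group" using assms by (auto simp: F0_def)
  obtain v w where v: "snd x = (((v, (1, 0)), (w, (1, 0))), False)" "v \<in> carrier klein4" "w \<in> carrier klein4"
    by (rule F0_snd[OF assms(1)])
  obtain v' w' where v': "snd y = (((v', (1, 0)), (w', (1, 0))), False)" "v' \<in> carrier klein4" "w' \<in> carrier klein4"
    by (rule F0_snd[OF assms(2)])
  have id: "affine3_act (1, 0) z = z" if "z \<in> carrier klein4" for z using affine3_act_one[OF that] by simp
  have "snd (x \<otimes>\<^bsub>cex_group\<^esub> x) = \<one>\<^bsub>ambient\<^esub>"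
    unfolding cex_snd_mult[OF c(1) c(1)] v(1) ambient_mult one_ambient using id v by simp
  thus "x \<otimes>\<^bsub>cex_group\<^esub> x \<in> N0" using c by (simp add: N0_def)
  show "snd (x \<otimes>\<^bsub>cex_group\<^esub> y) = snd (y \<otimes>\<^bsub>cex_group\<^esub> x)"
    unfolding cex_snd_mult[OF c] cex_snd_mult[OF c(2,1)] v(1) v'(1) ambient_mult using id[OF v(2)] id[OF v(3)] id[OF v'(2)] id[OF v'(3)]
    by (simp add: Un_commute)
qed

theorem nucleus_setting_cex:
  "nucleus_setting cex_group N0 F0 M0 R0 delta0 b0 (wreath3_char ambient S0)"
proof (rule nucleus_setting.intro[OF finite_grp_cex nucleus_setting_axioms.intro], goal_cases)
  case 1 show ?case by (rule N0_normal)
next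
  case 2 show ?case by (rule F0_normal)
next
  case 3 show ?case by (rule M0_normal)
next
  case 4 show ?case by (rule R0_subgroup)
next
  case 5 show ?case by (rule R0_M0)
next
  case (6 m r) thus ?case by (rule R0_conj)
next
  case 7
  let ?a = "((\<one>\<^bsub>sym4\<^esub>, ({}, (1, 1))), False)"
  have "?a \<in> carrier ambient" by (simp add: carrier_ambient)
  from lift_ambient[OF this] have "(\<one>\<^bsub>base3 ambient\<^esub>, ?a) \<in> M0" "(\<one>\<^bsub>base3 ambient\<^esub>, ?a) \<notin> R0"
    by (auto simp: M0_def R0_def simp del: base3_simps)
  thus ?case by blast
next
  case 8 show ?case by (rule N0_R0)
next
  case 9 show ?case by (rule N0_F0)
next
  case (10 x y) thus ?case using ambient.base3_commute by (auto simp: N0_eq cex_group_def simp del: base3_simps)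
next
  case (11 x) thus ?case using ambient.base3_cube by (auto simp: N0_eq cex_group_def simp del: base3_simps)
next
  case (12 x) thus ?case using F0_mult(1)[OF 12 12] by simp
next
  case (13 x y)
  have c: "x \<in> carrier cex_group" "y \<in> carrier cex_group" using 13 by (auto simp: F0_def)
  let ?e = "x \<otimes>\<^bsub>cex_group\<^esub> y \<otimes>\<^bsub>cex_group\<^esub> inv\<^bsub>cex_group\<^esub> x \<otimes>\<^bsub>cex_group\<^esub> inv\<^bsub>cex_group\<^esub> y"
  have e: "?e \<in> carrier cex_group" using c by simp
  have "?e \<otimes>\<^bsub>cex_group\<^esub> (y \<otimes>\<^bsub>cex_group\<^esub> x) = x \<otimes>\<^bsub>cex_group\<^esub> y" using c by (simp add: cex_group.m_assoc) (simp flip: cex_group.m_assoc)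
  hence "snd ?e \<otimes>\<^bsub>ambient\<^esub> snd (y \<otimes>\<^bsub>cex_group\<^esub> x) = snd (y \<otimes>\<^bsub>cex_group\<^esub> x)"
    using cex_snd_mult[OF e, of "y \<otimes>\<^bsub>cex_group\<^esub> x"] c F0_mult(2)[OF 13] by simp
  hence "snd ?e = \<one>\<^bsub>ambient\<^esub>" using cex_snd_closed e c by simp
  thus ?case using e by (simp add: N0_def)
next
  case 14 show ?case by (rule sym3_cover_cex)
next
  case (15 x)
  hence "snd x \<notin> S0" by (auto simp: R0_def S0_def)
  thus ?case using mu_stab[OF 15(1)] by blast
next
  case (16 C) thus ?case by (rule normal_cex_meets)
next
  case (17 C) thus ?case by (rule normal_M0_meets)
qed

section \<open>Separability and transfer to the natural numbers\<close>

lemma (in group) pi_group_quotient: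
  assumes fin: "finite (carrier G)" and K: "subgroup K G" and L: "L \<lhd> G" "L \<subseteq> K"
    and c: "card K = c * card L" "pi_number \<pi> c"
  shows "pi_group \<pi> (G\<lparr>carrier := K\<rparr> Mod L)"
proof -
  interpret K: group "G\<lparr>carrier := K\<rparr>" using subgroup_imp_group[OF K] .
  have LK: "L \<lhd> G\<lparr>carrier := K\<rparr>"
    using normal_Int_subgroup[OF K L(1)] L(2) by (metis Int_absorb1 Int_commute)
  have subL: "subgroup L (G\<lparr>carrier := K\<rparr>)" using LK normal_imp_subgroup by blast
  have finL: "finite L" using fin finite_subset subgroup.subset[OF normal_imp_subgroup[OF L(1)]] by blast
  have "card L \<noteq> 0" using finL subgroup.one_closed[OF subL] by auto
  moreover have "card (rcosets\<^bsub>G\<lparr>carrier := K\<rparr>\<^esub> L) * card L = c * card L"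
    using K.lagrange[OF subL] c(1) by (simp add: Coset.order_def)
  ultimately have "card (rcosets\<^bsub>G\<lparr>carrier := K\<rparr>\<^esub> L) = c" by simp
  hence "Coset.order (G\<lparr>carrier := K\<rparr> Mod L) = c" by (simp add: Coset.order_def FactGroup_def)
  moreover have "group (G\<lparr>carrier := K\<rparr> Mod L)" using normal.factorgroup_is_group[OF LK] .
  ultimately show ?thesis using c(2) by (simp add: pi_group_def)
qed

lemma pi_number_power_two: "pi_number (pi_compl odd_primes) (2 ^ k)"
proof -
  have "p = 2" if "Factorial_Ring.prime p" "p dvd 2 ^ k" for p :: nat
    using primes_dvd_imp_eq[OF that(1) two_is_prime_nat] prime_dvd_power[OF that] by blast
  thus ?thesis by (auto simp: pi_number_def pi_compl_odd_primes)
qed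

text \<open>Meant for the base group, then the extensions by the two Klein groups and by the two
  alternating groups, then the whole group: factors of odd order and of 2-power order
  alternate.\<close>

lemma (in group) pi_separable_chain:
  assumes fin: "finite (carrier G)" and n: "N1 \<lhd> G" "N2 \<lhd> G" "N3 \<lhd> G" and sub: "N1 \<subseteq> N2" "N2 \<subseteq> N3"
    and c: "odd (card N1)" "card N2 = 2 ^ a * card N1" "card N3 = m * card N2" "odd m" "card (carrier G) = 2 ^ d * card N3"
  shows "pi_separable odd_primes G"
proof -
  let ?N = "\<lambda>i. [{\<one>}, N1, N2, N3, carrier G] ! i"
  have s: "subgroup N1 G" "subgroup N2 G" "subgroup N3 G" "subgroup (carrier G) G"
    using n normal_imp_subgroup subgroup_self by auto
  have t: "{\<one>} \<lhd> G" "carrier G \<lhd> G" using one_is_normal normal_self by auto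
  have le: "{\<one>} \<subseteq> N1" "N3 \<subseteq> carrier G" using subgroup.one_closed[OF s(1)] subgroup.subset[OF s(3)] by auto
  have "pi_group odd_primes (G\<lparr>carrier := N1\<rparr> Mod {\<one>})"
    by (rule pi_group_quotient[OF fin s(1) t(1) le(1), of "card N1"]) (use c in \<open>auto simp: pi_number_odd_primes\<close>)
  moreover have "pi_group (pi_compl odd_primes) (G\<lparr>carrier := N2\<rparr> Mod N1)"
    by (rule pi_group_quotient[OF fin s(2) n(1) sub(1) c(2) pi_number_power_two])
  moreover have "pi_group odd_primes (G\<lparr>carrier := N3\<rparr> Mod N2)"
    by (rule pi_group_quotient[OF fin s(3) n(2) sub(2) c(3)]) (use c in \<open>simp add: pi_number_odd_primes\<close>)
  moreover have "pi_group (pi_compl odd_primes) (G\<lparr>carrier := carrier G\<rparr> Mod N3)"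
    by (rule pi_group_quotient[OF fin s(4) n(3) le(2) c(5) pi_number_power_two])
  moreover have "i = 0 \<or> i = 1 \<or> i = 2 \<or> i = 3" if "i < 4" for i :: nat using that by auto
  moreover have "i = 0 \<or> i = 1 \<or> i = 2 \<or> i = 3 \<or> i = 4" if "i \<le> 4" for i :: nat using that by auto
  ultimately have "(\<forall>i\<le>4. ?N i \<lhd> G) \<and> (\<forall>i<4. ?N i \<subseteq> ?N (Suc i) \<and>
     (pi_group odd_primes (G\<lparr>carrier := ?N (Suc i)\<rparr> Mod ?N i) \<or>
      pi_group (pi_compl odd_primes) (G\<lparr>carrier := ?N (Suc i)\<rparr> Mod ?N i)))"
    using n t le sub by (fastforce simp: numeral_2_eq_2 numeral_3_eq_3)
  moreover have "?N 0 = {\<one>}" "?N 4 = carrier G" by auto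
  ultimately show ?thesis unfolding pi_separable_def by blast
qed

lemma card_cex:
  "odd (card N0)" "card F0 = 2 ^ 4 * card N0" "card J0 = 9 * card F0" "card (carrier cex_group) = 2 ^ 3 * card J0"
proof -
  let ?B = "carrier (base3 ambient)"
  let ?k = "carrier klein4"
  have k: "card ?k = 4" by (simp add: doubleton_eq_iff)
  have N: "card N0 = card ?B" by (simp only: N0_eq card_cartesian_product) simp
  have "card ?B = 3 ^ card (carrier ambient)"
    using finite_ambient cube_roots_unity(2) by (simp add: card_PiE)
  thus "odd (card N0)" unfolding N by simp
  \<comment> \<open>The numbers below are \<open>16 = 4 * 4\<close>, \<open>144 = 12 * 12\<close>
    and \<open>1152 = 2 * 24 * 24\<close>, from the orders of the Klein, alternating and symmetric
    groups and the swap.\<close>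
  have F: "F0 = ?B \<times> (((?k \<times> {(1, 0)}) \<times> (?k \<times> {(1, 0)})) \<times> {False})"
    by (auto simp: F0_def carrier_cex carrier_ambient simp del: klein4_simps base3_simps)
  have F': "card F0 = card ?B * 16" unfolding F by (simp only: card_cartesian_product k) simp
  thus "card F0 = 2 ^ 4 * card N0" unfolding N by simp
  let ?r = "{1 :: int} \<times> {0 :: int, 1, 2}"
  have Jeq: "J0 = ?B \<times> (((?k \<times> ?r) \<times> (?k \<times> ?r)) \<times> {False})"
    by (auto simp: J0_def carrier_cex carrier_ambient simp del: klein4_simps base3_simps)
  have J: "card J0 = card ?B * 144" unfolding Jeq by (simp only: card_cartesian_product k) simp
  thus "card J0 = 9 * card F0" unfolding F' by simp
  have "carrier cex_group = ?B \<times> (((?k \<times> carrier affine3) \<times> (?k \<times> carrier affine3)) \<times> UNIV)"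
    by (simp only: carrier_cex carrier_ambient sym4_simps)
  moreover have "card (carrier affine3) = 6" by (simp add: card_cartesian_product)
  ultimately have "card (carrier cex_group) = card ?B * 1152" by (simp only: card_cartesian_product k) simp
  thus "card (carrier cex_group) = 2 ^ 3 * card J0" unfolding J by simp
qed

text \<open>The theorem asks for a group on natural numbers, so the structure is carried over along
  an injection of the finite carrier.\<close>

lemma nat_copy_exists:
  fixes H :: "('a, 'b) monoid_scheme"
  assumes H: "group H" and fin: "finite (carrier H)"
  obtains G :: "nat monoid" and \<phi> where "group G" "\<phi> \<in> hom G H" "bij_betw \<phi> (carrier G) (carrier H)"
proof -
  interpret H: group H by (rule H)
  obtain f :: "'a \<Rightarrow> nat" where f: "inj_on f (carrier H)"
    using finite_imp_inj_to_nat_seg[OF fin] by blast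
  let ?d = "inv_into (carrier H) f"
  define G where "G = \<lparr>carrier = f ` carrier H, monoid.mult = (\<lambda>x y. f (?d x \<otimes>\<^bsub>H\<^esub> ?d y)), one = f \<one>\<^bsub>H\<^esub>\<rparr>"
  have df: "?d (f x) = x" if "x \<in> carrier H" for x using f that by simp
  have G: "group G"
  proof (rule groupI)
    fix x assume "x \<in> carrier G"
    then obtain a where a: "a \<in> carrier H" "x = f a" by (auto simp: G_def)
    show "\<exists>y\<in>carrier G. y \<otimes>\<^bsub>G\<^esub> x = \<one>\<^bsub>G\<^esub>"
      using a df by (intro bexI[of _ "f (inv\<^bsub>H\<^esub> a)"]) (auto simp: G_def)
  qed (auto simp: G_def df H.m_assoc)
  have "?d \<in> hom G H" by (auto simp: hom_def G_def df)
  moreover have "bij_betw ?d (carrier G) (carrier H)"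
    using bij_betw_inv_into[OF inj_on_imp_bij_betw[OF f]] by (simp add: G_def)
  ultimately show thesis using that G by blast
qed

locale group_iso_map = G: group G + H: group H for G (structure) and H +
  fixes \<phi>
  assumes \<phi>_hom: "\<phi> \<in> hom G H" and \<phi>_bij: "bij_betw \<phi> (carrier G) (carrier H)"
begin

definition pre where "pre D = {x \<in> carrier G. \<phi> x \<in> D}"

lemma \<phi>_mult: "x \<in> carrier G \<Longrightarrow> y \<in> carrier G \<Longrightarrow> \<phi> (x \<otimes> y) = \<phi> x \<otimes>\<^bsub>H\<^esub> \<phi> y"
  using \<phi>_hom by (simp add: hom_def)

lemma \<phi>_closed: "x \<in> carrier G \<Longrightarrow> \<phi> x \<in> carrier H"
  using \<phi>_bij by (auto simp: bij_betw_def)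

lemma \<phi>_inj: "x \<in> carrier G \<Longrightarrow> y \<in> carrier G \<Longrightarrow> \<phi> x = \<phi> y \<longleftrightarrow> x = y"
  using \<phi>_bij by (auto simp: bij_betw_def inj_on_def)

lemma \<phi>_surj:
  assumes "z \<in> carrier H"
  shows "\<exists>x\<in>carrier G. \<phi> x = z"
proof -
  have "z \<in> \<phi> ` carrier G" using assms by (simp add: bij_betw_imp_surj_on[OF \<phi>_bij])
  thus ?thesis by auto
qed

lemma is_group_hom: "group_hom G H \<phi>"
  using \<phi>_hom G.is_group H.is_group by (simp add: group_hom_def group_hom_axioms_def)

lemma \<phi>_one: "\<phi> \<one> = \<one>\<^bsub>H\<^esub>"
  using group_hom.hom_one[OF is_group_hom] .

lemma \<phi>_inv: "x \<in> carrier G \<Longrightarrow> \<phi> (inv x) = inv\<^bsub>H\<^esub> \<phi> x"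
  using group_hom.hom_inv[OF is_group_hom] .

lemma \<phi>_conj: "x \<in> carrier G \<Longrightarrow> y \<in> carrier G \<Longrightarrow> \<phi> (x \<otimes> y \<otimes> inv x) = \<phi> x \<otimes>\<^bsub>H\<^esub> \<phi> y \<otimes>\<^bsub>H\<^esub> inv\<^bsub>H\<^esub> \<phi> x"
  by (simp add: \<phi>_mult \<phi>_inv)

lemma pre_subgroup:
  assumes "subgroup D H"
  shows "subgroup (pre D) G"
proof (rule G.subgroupI)
  have "\<one> \<in> pre D" using subgroup.one_closed[OF assms] by (simp add: pre_def \<phi>_one)
  thus "pre D \<noteq> {}" by blast
qed (use assms in \<open>auto simp: pre_def \<phi>_mult \<phi>_inv subgroup.m_closed subgroup.m_inv_closed\<close>)

lemma pre_normal: "D \<lhd> H \<Longrightarrow> pre D \<lhd> G"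
  unfolding G.normal_inv_iff H.normal_inv_iff using pre_subgroup[of D]
  by (auto simp: pre_def \<phi>_conj \<phi>_closed)

lemma image_pre: "D \<subseteq> carrier H \<Longrightarrow> \<phi> ` pre D = D"
  using \<phi>_surj by (auto simp: pre_def)

lemma card_pre: "D \<subseteq> carrier H \<Longrightarrow> card (pre D) = card D"
  using image_pre[of D] card_image[of \<phi> "pre D"] \<phi>_inj by (auto simp: inj_on_def pre_def)

lemma image_normal:
  assumes "C \<lhd> G"
  shows "\<phi> ` C \<lhd> H"
proof -
  have sub: "subgroup C G" using assms normal_imp_subgroup by blast
  have "subgroup (\<phi> ` C) H" using group_hom.subgroup_img_is_subgroup[OF is_group_hom sub] .
  moreover have "x \<otimes>\<^bsub>H\<^esub> h \<otimes>\<^bsub>H\<^esub> inv\<^bsub>H\<^esub> x \<in> \<phi> ` C" if x: "x \<in> carrier H" and h: "h \<in> \<phi> ` C" for x h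
  proof -
    obtain y c where y: "y \<in> carrier G" "\<phi> y = x" and c: "c \<in> C" "\<phi> c = h" using \<phi>_surj[OF x] h by blast
    have "y \<otimes> c \<otimes> inv y \<in> C" using assms y c unfolding G.normal_inv_iff by blast
    moreover have "\<phi> (y \<otimes> c \<otimes> inv y) = x \<otimes>\<^bsub>H\<^esub> h \<otimes>\<^bsub>H\<^esub> inv\<^bsub>H\<^esub> x"
      using \<phi>_conj[OF y(1)] y c subgroup.mem_carrier[OF sub] by simp
    ultimately show ?thesis by (metis imageI)
  qed
  ultimately show ?thesis unfolding H.normal_inv_iff by blast
qed

text \<open>Needed for \<open>M\<close>: its normal subgroups are not normal in \<open>G\<close>, so
  they are transported along the restricted isomorphism.\<close>

lemma restricted: "subgroup D H \<Longrightarrow> group_iso_map (G\<lparr>carrier := pre D\<rparr>) (H\<lparr>carrier := D\<rparr>) \<phi>"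
proof -
  assume D: "subgroup D H"
  have "bij_betw \<phi> (pre D) D"
    using image_pre[OF subgroup.subset[OF D]] \<phi>_inj by (auto simp: bij_betw_def inj_on_def pre_def)
  thus ?thesis
    using G.subgroup_imp_group[OF pre_subgroup[OF D]] H.subgroup_imp_group[OF D]
    by (auto simp: group_iso_map_def group_iso_map_axioms_def hom_def \<phi>_mult pre_def)
qed

lemma \<phi>_pow: "x \<in> carrier G \<Longrightarrow> \<phi> (x [^] (k::nat)) = \<phi> x [^]\<^bsub>H\<^esub> k"
  by (induction k) (simp_all add: \<phi>_one \<phi>_mult)

text \<open>The character is cut off outside \<open>carrier G\<close>, where \<open>\<phi>\<close>
  is unspecified and could hit the support of \<open>\<mu>\<close>.\<close>

lemma sym3_cover_pre:
  assumes R: "subgroup R H" and S: "sym3_cover (H\<lparr>carrier := R\<rparr>) N \<delta> b \<mu>" and N: "subgroup N H" and fin: "finite (carrier G)"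
  shows "sym3_cover (G\<lparr>carrier := pre R\<rparr>) (pre N) (\<lambda>x. \<delta> (\<phi> x)) (\<lambda>x. b (\<phi> x)) (\<lambda>x. if x \<in> carrier G then \<mu> (\<phi> x) else 0)"
proof -
  interpret S: sym3_cover "H\<lparr>carrier := R\<rparr>" N \<delta> b \<mu> by (rule S)
  have fg: "finite_grp (G\<lparr>carrier := pre R\<rparr>)"
    using G.subgroup_imp_group[OF pre_subgroup[OF R]] fin
    by (simp add: finite_grp_def finite_grp_axioms_def pre_def)
  have NR: "N \<subseteq> R" using subgroup.subset[OF S.N_sub] by simp
  have iR: "inv\<^bsub>G\<lparr>carrier := pre R\<rparr>\<^esub> x = inv x" if "x \<in> pre R" for x
    using G.inv_subgroup[OF pre_subgroup[OF R] that] .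
  have iH: "inv\<^bsub>H\<lparr>carrier := R\<rparr>\<^esub> x = inv\<^bsub>H\<^esub> x" if "x \<in> R" for x
    using H.inv_subgroup[OF R that] .
  show ?thesis
  proof (rule sym3_cover.intro[OF fg sym3_cover_axioms.intro], goal_cases)
    case 1
    show ?case using G.subgroup_incl[OF pre_subgroup[OF N] pre_subgroup[OF R]] NR by (auto simp: pre_def)
  next
    case (2 x n)
    hence x: "x \<in> carrier G" "\<phi> x \<in> R" "n \<in> carrier G" "\<phi> n \<in> N" by (auto simp: pre_def)
    have "\<phi> x \<otimes>\<^bsub>H\<^esub> \<phi> n \<otimes>\<^bsub>H\<^esub> inv\<^bsub>H\<^esub> \<phi> x \<in> N" using S.N_conj[of "\<phi> x" "\<phi> n"] x iH by simp
    thus ?case using x 2 iR by (simp add: pre_def \<phi>_conj)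
  next
    case (3 x) thus ?case using S.\<delta>_range[of "\<phi> x"] by (auto simp: pre_def)
  next
    case (4 x y) thus ?case using S.\<delta>_mult[of "\<phi> x" "\<phi> y"] by (auto simp: pre_def \<phi>_mult)
  next
    case (5 x) thus ?case using S.b_range[of "\<phi> x"] by (auto simp: pre_def)
  next
    case (6 x y) thus ?case using S.b_mult[of "\<phi> x" "\<phi> y"] by (auto simp: pre_def \<phi>_mult)
  next
    case (7 n) thus ?case using S.\<delta>_N by (auto simp: pre_def)
  next
    case (8 n) thus ?case using S.b_N by (auto simp: pre_def)
  next
    case (9 i)
    then obtain z where z: "z \<in> R" "\<delta> z = - 1" "b z = i" using S.onto[of i] by auto
    then obtain x where "x \<in> carrier G" "\<phi> x = z" using \<phi>_surj[of z] subgroup.mem_carrier[OF R] by blast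
    thus ?case using z by (intro bexI[of _ x]) (auto simp: pre_def)
  next
    case 10
    have m: "\<mu> (\<phi> x \<otimes>\<^bsub>H\<^esub> \<phi> y) = \<mu> (\<phi> x) * \<mu> (\<phi> y)" if "\<phi> x \<in> R" "b (\<phi> x) = 0" "\<phi> y \<in> R" "b (\<phi> y) = 0" for x y
      using lin_char_mult[OF S.\<mu>_lin, of "\<phi> x" "\<phi> y"] that by simp
    have o: "\<mu> \<one>\<^bsub>H\<^esub> = 1" using lin_char_one[OF S.\<mu>_lin] by simp
    have z: "\<mu> w = 0" if "\<not> (w \<in> R \<and> b w = 0)" for w using S.\<mu>_lin that by (auto simp: lin_char_def)
    show ?case unfolding lin_char_def using m o z by (auto simp: pre_def \<phi>_mult \<phi>_one)
  next
    case (11 x) thus ?case using S.\<mu>_cube[of "\<phi> x"] by (auto simp: pre_def)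
  next
    case (12 x)
    hence x: "x \<in> carrier G" "\<phi> x \<in> R" by (auto simp: pre_def)
    then obtain z where z: "z \<in> N" "\<mu> (\<phi> x \<otimes>\<^bsub>H\<^esub> z \<otimes>\<^bsub>H\<^esub> inv\<^bsub>H\<^esub> \<phi> x) \<noteq> \<mu> z"
      using S.stab[of "\<phi> x"] 12 iH by auto
    obtain n where "n \<in> carrier G" "\<phi> n = z" using \<phi>_surj[of z] subgroup.mem_carrier[OF N z(1)] by blast
    thus ?case using z x 12 iR by (intro bexI[of _ n]) (auto simp: pre_def \<phi>_conj)
  qed
qed

text \<open>The configuration is transported, and the characters and nuclei are then formed directly
  in the copy; no statement about representations has to be carried across the isomorphism.\<close>

lemma nucleus_setting_pre:
  assumes S: "nucleus_setting H N F M R \<delta> b \<mu>"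
  shows "nucleus_setting G (pre N) (pre F) (pre M) (pre R) (\<lambda>x. \<delta> (\<phi> x)) (\<lambda>x. b (\<phi> x)) (\<lambda>x. if x \<in> carrier G then \<mu> (\<phi> x) else 0)"
proof -
  interpret N: nucleus_setting H N F M R \<delta> b \<mu> by (rule S)
  have fin: "finite (carrier G)" using bij_betw_finite[OF \<phi>_bij] N.finite_carrier by simp
  have fg: "finite_grp G" using fin G.is_group by (simp add: finite_grp_def finite_grp_axioms_def)
  interpret M: group_iso_map "G\<lparr>carrier := pre M\<rparr>" "H\<lparr>carrier := M\<rparr>" \<phi> by (rule restricted[OF N.M_sub])
  have meets: "\<exists>e\<in>C \<inter> pre F. e \<notin> pre R" if "C \<subseteq> carrier G" "\<exists>e\<in>\<phi> ` C \<inter> F. e \<notin> R" for C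
    using that by (auto simp: pre_def)
  show ?thesis
  proof (rule nucleus_setting.intro[OF fg nucleus_setting_axioms.intro], goal_cases)
    case 1 show ?case by (rule pre_normal[OF N.N_normal])
  next
    case 2 show ?case by (rule pre_normal[OF N.F_normal])
  next
    case 3 show ?case by (rule pre_normal[OF N.M_normal])
  next
    case 4 show ?case by (rule pre_subgroup[OF N.R_sub])
  next
    case 5 show ?case using N.R_M by (auto simp: pre_def)
  next
    case (6 m r) thus ?case using N.R_conj[of "\<phi> m" "\<phi> r"] by (auto simp: pre_def \<phi>_conj)
  next
    case 7
    obtain z where "z \<in> M" "z \<notin> R" using N.M_not_R by blast
    moreover then obtain x where "x \<in> carrier G" "\<phi> x = z" using \<phi>_surj[of z] N.M_carrier by blast
    ultimately show ?case by (auto simp: pre_def)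
  next
    case 8 show ?case using N.N_R by (auto simp: pre_def)
  next
    case 9 show ?case using N.N_F by (auto simp: pre_def)
  next
    case (10 x y)
    hence c: "x \<in> carrier G" "y \<in> carrier G" "\<phi> x \<in> N" "\<phi> y \<in> N" by (auto simp: pre_def)
    have "\<phi> (x \<otimes> y) = \<phi> (y \<otimes> x)" using N.N_comm[OF c(3,4)] c by (simp add: \<phi>_mult)
    thus ?case using \<phi>_inj[of "x \<otimes> y" "y \<otimes> x"] c by simp
  next
    case (11 x)
    hence c: "x \<in> carrier G" "\<phi> x \<in> N" by (auto simp: pre_def)
    have "\<phi> (x [^] (3::nat)) = \<phi> \<one>" using N.N_cube[OF c(2)] c by (simp add: \<phi>_pow \<phi>_one)
    thus ?case using \<phi>_inj[of "x [^] (3::nat)" "\<one>"] c by simp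
  next
    case (12 x) thus ?case using N.F_square[of "\<phi> x"] by (auto simp: pre_def \<phi>_mult)
  next
    case (13 x y) thus ?case using N.F_comm[of "\<phi> x" "\<phi> y"] by (auto simp: pre_def \<phi>_mult \<phi>_inv)
  next
    case 14 show ?case by (rule sym3_cover_pre[OF N.R_sub N.R_sym3 N.N_sub_G fin])
  next
    case (15 x)
    hence x: "x \<in> carrier G" "\<phi> x \<notin> R" by (auto simp: pre_def)
    then obtain z where z: "z \<in> N" "\<mu> (\<phi> x \<otimes>\<^bsub>H\<^esub> z \<otimes>\<^bsub>H\<^esub> inv\<^bsub>H\<^esub> \<phi> x) \<noteq> \<mu> z"
      using N.stab_R[of "\<phi> x"] \<phi>_closed by auto
    obtain n where "n \<in> carrier G" "\<phi> n = z" using \<phi>_surj[of z] subgroup.mem_carrier[OF N.N_sub_G z(1)] by blast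
    thus ?case using z x by (intro bexI[of _ n]) (auto simp: pre_def \<phi>_conj)
  next
    case (16 C)
    have sC: "C \<subseteq> carrier G" using subgroup.subset[OF normal_imp_subgroup[OF 16(1)]] .
    have "N \<subset> \<phi> ` C"
    proof
      show "N \<subseteq> \<phi> ` C"
        using image_pre[OF subgroup.subset[OF N.N_sub_G]] 16(2) by (metis image_mono psubset_imp_subset)
      obtain c where "c \<in> C" "c \<notin> pre N" using 16(2) by blast
      thus "N \<noteq> \<phi> ` C" using sC by (auto simp: pre_def)
    qed
    thus ?case using meets[OF sC] N.normal_G_meets[OF image_normal[OF 16(1)]] by blast
  next
    case (17 C)
    have sM: "C \<subseteq> pre M" using subgroup.subset[OF normal_imp_subgroup[OF 17(1)]] by simp
    hence sC: "C \<subseteq> carrier G" by (auto simp: pre_def)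
    have "\<not> \<phi> ` C \<subseteq> R" using 17(2) sC by (auto simp: pre_def)
    thus ?case using meets[OF sC] N.normal_M_meets[OF M.image_normal[OF 17(1)]] by blast
  qed
qed

end

theorem mainTheorem3:
  shows "\<exists>(\<pi> :: nat set) (G :: nat monoid) (M :: nat set) (\<eta> :: nat \<Rightarrow> complex) (\<theta> :: nat \<Rightarrow> complex).
    (\<forall>p\<in>\<pi>. Factorial_Ring.prime p) \<and> 2 \<notin> \<pi> \<and>
    group G \<and> finite (carrier G) \<and> pi_separable \<pi> G \<and>
    M \<lhd> G \<and>
    \<eta> \<in> N_pi \<pi> G \<and>
    irr_constituent (G\<lparr>carrier := M\<rparr>) \<theta> (restrict_char M \<eta>) \<and>
    \<theta> \<notin> N_pi \<pi> (G\<lparr>carrier := M\<rparr>)"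
proof -
  obtain G :: "nat monoid" and \<phi> where G: "group G" and \<phi>: "\<phi> \<in> hom G cex_group" "bij_betw \<phi> (carrier G) (carrier cex_group)"
    by (rule nat_copy_exists[OF cex_group.is_group finite_cex])
  interpret I: group_iso_map G cex_group \<phi>
    using G \<phi> cex_group.is_group by (simp add: group_iso_map_def group_iso_map_axioms_def)
  \<comment> \<open>From here \<open>S.\<eta>\<close> and \<open>S.\<theta>\<close> are the required
    characters; separability alone remains, and it only needs the orders of the preimages.\<close>
  interpret S: nucleus_setting G "I.pre N0" "I.pre F0" "I.pre M0" "I.pre R0" "\<lambda>x. delta0 (\<phi> x)" "\<lambda>x. b0 (\<phi> x)"
    "\<lambda>x. if x \<in> carrier G then wreath3_char ambient S0 (\<phi> x) else 0"
    by (rule I.nucleus_setting_pre[OF nucleus_setting_cex])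
  have sub: "N0 \<subseteq> carrier cex_group" "F0 \<subseteq> carrier cex_group" "J0 \<subseteq> carrier cex_group"
    by (auto simp: N0_def F0_def J0_def)
  have chain: "I.pre N0 \<subseteq> I.pre F0" "I.pre F0 \<subseteq> I.pre J0"
    using N0_F0 by (auto simp: I.pre_def F0_def J0_def)
  have "pi_separable odd_primes G"
  proof (rule I.G.pi_separable_chain[OF S.finite_carrier I.pre_normal[OF N0_normal] I.pre_normal[OF F0_normal]
        I.pre_normal[OF J0_normal] chain])
    show "odd (card (I.pre N0))" using card_cex(1) I.card_pre[OF sub(1)] by simp
    show "card (I.pre F0) = 2 ^ 4 * card (I.pre N0)" using card_cex(2) I.card_pre sub by simp
    show "card (I.pre J0) = 9 * card (I.pre F0)" using card_cex(3) I.card_pre sub by simp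
    show "card (carrier G) = 2 ^ 3 * card (I.pre J0)"
      using card_cex(4) I.card_pre[OF sub(3)] bij_betw_same_card[OF \<phi>(2)] by simp
  qed simp
  moreover have "\<forall>p\<in>odd_primes. Factorial_Ring.prime p" "2 \<notin> odd_primes" by (auto simp: odd_primes_def)
  ultimately show ?thesis
    using G S.finite_carrier S.M_normal S.\<eta>_in_N_pi S.\<theta>_under_\<eta> S.\<theta>_notin_N_pi
    by (intro exI[of _ odd_primes] exI[of _ G] exI[of _ "I.pre M0"] exI[of _ S.\<eta>] exI[of _ S.\<theta>]) simp
qed

end
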